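(* (a) Let $\boldsymbol{K}=(K_{n,m})$ be a compact rectangular matrix convex set in a topological vector space. Then the canonical rectangular matrix affine mapping $\boldsymbol{\theta}$ from $\boldsymbol{K}$ to $\mathrm{CBall}(A_\rho(\boldsymbol{K})')$ given by point evaluations is a rectangular matrix affine homeomorphism from $\boldsymbol{K}$ onto $\mathrm{CBall}(A_\rho(\boldsymbol{K})')$. (b) The assignment $X\mapsto\mathrm{CBall}(X')$ is a one-to-one correspondence between operator spaces and compact rectangular matrix convex sets. Moreover, this correspondence is an equivalence of categories, where morphisms between operator spaces are completely contractive linear maps, and morphisms between compact rectangular matrix convex sets are continuous rectangular matrix affine mappings.
   Context: A rectangular matrix convex set in a complex vector space $V$ is a collection $\boldsymbol{K}=(K_{n,m})_{n,m\in\mathbb{N}}$ of subsets $K_{n,m}\subset M_{n,m}(V)$ with the property that for any $\alpha_i\in M_{n_i,n}(\mathbb{C})$, $\beta_i\in M_{m_i,m}(\mathbb{C})$ and $v_i\in K_{n_i,m_i}$ for $1\le i\le\ell$ such that $\|\sum_i\alpha_i^*\alpha_i\|\,\|\sum_i\beta_i^*\beta_i\|\le1$ one has $\sum_i\alpha_i^*v_i\beta_i\in K_{n,m}$. When $V$ is a topological vector space, $\boldsymbol{K}$ is compact if each $K_{n,m}$ is compact. A rectangular matrix convex combination in $\boldsymbol{K}$ is an expression $\alpha_1^*v_1\beta_1+\cdots+\alpha_\ell^*v_\ell\beta_\ell$ with $v_i\in K_{n_i,m_i}$, $\alpha_i\in M_{n_i,n}(\mathbb{C})$, $\beta_i\in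 M_{m_i,m}(\mathbb{C})$, $\sum_i\alpha_i^*\alpha_i=1$ and $\sum_i\beta_i^*\beta_i=1$. A rectangular matrix affine mapping from $\boldsymbol{K}$ to a rectangular matrix convex set $\boldsymbol{T}$ is a sequence $\boldsymbol{\theta}$ of maps $\theta_{n,m}:K_{n,m}\to T_{n,m}$ that preserves rectangular matrix convex combinations; between compact sets it is continuous (a homeomorphism) when every $\theta_{n,m}$ is. For an operator space $X$ with dual operator space $X'$, $\mathrm{CBall}(X')$ is the compact rectangular matrix convex set in $X'$ (with the weak* topology) whose $(n,m)$ level is the set of completely contractive linear maps from $X$ to $M_{n,m}(\mathbb{C})$. $\mathrm{CBall}(\mathbb{C})$ is the compact rectangular matrix convex set whose $(n,m)$ level is the set of completely contractive maps from $\mathbb{C}$, with its canonical operator space structure, to $M_{n,m}(\mathbb{C})$. For $\boldsymbol{K}$ compact, $A_\rho(\boldsymbol{K})$ is the complex vector space of continuous rectangular matrix affine mappings from $\boldsymbol{K}$ to $\mathrm{CBall}(\mathbb{C})$. It has a natural operator space structure where $M_{n,m}(A_\rho(\boldsymbol{K}))$ is identified isometrically with a subspace of $C(K_{n,m},M_{n,m}(\mathbb{C}))$ endowed with the supremum norm. $A_\rho(\boldsymbol{K})'$ is the dual operator space of $A_\rho(\boldsymbol{K})$.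
   Formalization: Topological vector spaces are taken Hausdorff and locally convex (else Roberts' compact convex sets refute (a)), operator spaces complete (a space and its completion have the same CBall), and the family with all levels empty is excluded (it is not a dual ball). *)

theory Defs
  imports "HOL-Analysis.Analysis" "HOL-Library.Function_Algebras"
begin

section \<open>Complex vector spaces and locally convex spaces\<close>

class complex_vector = ab_group_add +
  fixes scaleC :: "complex \<Rightarrow> 'a \<Rightarrow> 'a" (infixr "*\<^sub>C" 75)
  assumes scaleC_add_right: "c *\<^sub>C (x + y) = c *\<^sub>C x + c *\<^sub>C y"
    and scaleC_add_left: "(c + d) *\<^sub>C x = c *\<^sub>C x + d *\<^sub>C x"
    and scaleC_scaleC: "c *\<^sub>C d *\<^sub>C x = (c * d) *\<^sub>C x"
    and scaleC_one: "1 *\<^sub>C x = x"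

interpretation complex_vector: vector_space "scaleC :: complex \<Rightarrow> 'a \<Rightarrow> 'a::complex_vector"
  by unfold_locales
    (simp_all add: scaleC_add_right scaleC_add_left scaleC_scaleC scaleC_one)

text \<open>Hausdorff locally convex complex topological vector spaces. The Hausdorff property and
  local convexity are part of the standing conventions on topological vector spaces.\<close>

class complex_lctvs = complex_vector + topological_ab_group_add + t2_space +
  assumes tendsto_scaleC_Pair:
      "LIM p (nhds c \<times>\<^sub>F nhds x). fst p *\<^sub>C snd p :> nhds (c *\<^sub>C x)"
    and locally_convex: "open U \<Longrightarrow> 0 \<in> U \<Longrightarrow>
      \<exists>W. open W \<and> 0 \<in> W \<and> W \<subseteq> U \<and>
        (\<forall>x\<in>W. \<forall>y\<in>W. \<forall>t\<in>{0..1}. complex_of_real t *\<^sub>C x + complex_of_real (1 - t) *\<^sub>C y \<in> W)"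

instantiation complex :: complex_vector
begin
definition scaleC_complex :: "complex \<Rightarrow> complex \<Rightarrow> complex" where "scaleC_complex c x = c * x"
instance by standard (simp_all add: scaleC_complex_def algebra_simps)
end

instantiation "fun" :: (type, complex_vector) complex_vector
begin
definition scaleC_fun :: "complex \<Rightarrow> ('a \<Rightarrow> 'b) \<Rightarrow> 'a \<Rightarrow> 'b"
  where "scaleC_fun c f = (\<lambda>x. c *\<^sub>C f x)"
instance
  by standard
    (simp_all add: scaleC_fun_def plus_fun_def fun_eq_iff scaleC_add_right scaleC_add_left
      scaleC_scaleC scaleC_one)
end

instance complex :: complex_lctvs
proof
  fix c x :: complex
  show "LIM p (nhds c \<times>\<^sub>F nhds x). fst p *\<^sub>C snd p :> nhds (c *\<^sub>C x)"
    unfolding scaleC_complex_def by (rule tendsto_mult_Pair)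
next
  fix U :: "complex set"
  assume "open U" "0 \<in> U"
  then obtain e where e: "e > 0" "ball 0 e \<subseteq> U"
    using openE by blast
  have "complex_of_real t *\<^sub>C x + complex_of_real (1 - t) *\<^sub>C y \<in> ball 0 e"
    if "x \<in> ball 0 e" "y \<in> ball 0 e" "t \<in> {0..1}" for x y :: complex and t :: real
    using convexD[OF convex_ball that(1,2), of t "1 - t"] that(3)
    by (simp add: scaleC_complex_def scaleR_conv_of_real)
  then show "\<exists>W. open W \<and> 0 \<in> W \<and> W \<subseteq> U \<and>
      (\<forall>x\<in>W. \<forall>y\<in>W. \<forall>t\<in>{0..1}. complex_of_real t *\<^sub>C x + complex_of_real (1 - t) *\<^sub>C y \<in> W)"
    using e by (intro exI[of _ "ball 0 e"]) auto
qed

lemma tendsto_fun_iff: "(f \<longlongrightarrow> l) F \<longleftrightarrow> (\<forall>i. ((\<lambda>x. f x i) \<longlongrightarrow> l i) F)"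
  for f :: "'c \<Rightarrow> 'a \<Rightarrow> 'b::topological_space"
  using limitin_componentwise[of "\<lambda>_. euclidean" UNIV f l F]
  by (simp add: euclidean_product_topology)

lemma open_eval_vimage: "open ((\<lambda>f. f a) -` W)" if "open W" for W :: "'b::topological_space set"
  by (rule open_vimage[OF that continuous_on_product_coordinates])

instance "fun" :: (type, t0_space) t0_space
proof
  fix f g :: "'a \<Rightarrow> 'b"
  assume "f \<noteq> g"
  then obtain a where "f a \<noteq> g a" by auto
  obtain U where "open U" "\<not> (f a \<in> U \<longleftrightarrow> g a \<in> U)"
    using t0_space_class.t0_space[OF \<open>f a \<noteq> g a\<close>] by auto
  then show "\<exists>U. open U \<and> \<not> (f \<in> U \<longleftrightarrow> g \<in> U)"
    by (intro exI[of _ "(\<lambda>h. h a) -` U"]) (simp add: open_eval_vimage)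
qed

instance "fun" :: (type, t1_space) t1_space
proof
  fix f g :: "'a \<Rightarrow> 'b"
  assume "f \<noteq> g"
  then obtain a where "f a \<noteq> g a" by auto
  obtain U where "open U" "f a \<in> U" "g a \<notin> U"
    using t1_space_class.t1_space[OF \<open>f a \<noteq> g a\<close>] by auto
  then show "\<exists>U. open U \<and> f \<in> U \<and> g \<notin> U"
    by (intro exI[of _ "(\<lambda>h. h a) -` U"]) (simp add: open_eval_vimage)
qed

instance "fun" :: (type, t2_space) t2_space
proof
  fix f g :: "'a \<Rightarrow> 'b"
  assume "f \<noteq> g"
  then obtain a where "f a \<noteq> g a" by auto
  obtain U V where "open U" "open V" "f a \<in> U" "g a \<in> V" "U \<inter> V = {}"
    using hausdorff[OF \<open>f a \<noteq> g a\<close>] by auto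
  then show "\<exists>U V. open U \<and> open V \<and> f \<in> U \<and> g \<in> V \<and> U \<inter> V = {}"
    by (intro exI[of _ "(\<lambda>h. h a) -` U"] exI[of _ "(\<lambda>h. h a) -` V"])
      (simp add: open_eval_vimage flip: vimage_Int)
qed

instance "fun" :: (type, topological_ab_group_add) topological_ab_group_add
proof
  fix f g :: "'a \<Rightarrow> 'b"
  have 1: "((\<lambda>p. fst p a) \<longlongrightarrow> f a) (nhds f \<times>\<^sub>F nhds g)" for a
    using filterlim_fst[of "nhds f" "nhds g"] unfolding tendsto_fun_iff by blast
  have 2: "((\<lambda>p. snd p a) \<longlongrightarrow> g a) (nhds f \<times>\<^sub>F nhds g)" for a
    using filterlim_snd[of "nhds g" "nhds f"] unfolding tendsto_fun_iff by blast
  show "LIM p (nhds f \<times>\<^sub>F nhds g). fst p + snd p :> nhds (f + g)"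
    unfolding tendsto_fun_iff plus_fun_def using 1 2 by (auto intro!: tendsto_add)
  have "((\<lambda>h. h a) \<longlongrightarrow> f a) (nhds f)" for a
    using filterlim_ident[of "nhds f"] unfolding tendsto_fun_iff by blast
  then show "(uminus \<longlongrightarrow> - f) (nhds f)"
    unfolding tendsto_fun_iff fun_Compl_def by (auto intro!: tendsto_minus)
qed

instance "fun" :: (type, complex_lctvs) complex_lctvs
proof
  fix c :: complex and f :: "'a \<Rightarrow> 'b"
  have "((\<lambda>p. snd p a) \<longlongrightarrow> f a) (nhds c \<times>\<^sub>F nhds f)" for a
    using filterlim_snd[of "nhds f" "nhds c"] unfolding tendsto_fun_iff by blast
  from filterlim_compose[OF tendsto_scaleC_Pair filterlim_Pair[OF filterlim_fst this]]
  have "((\<lambda>p. fst p *\<^sub>C snd p a) \<longlongrightarrow> c *\<^sub>C f a) (nhds c \<times>\<^sub>F nhds f)" for a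
    by simp
  then show "LIM p (nhds c \<times>\<^sub>F nhds f). fst p *\<^sub>C snd p :> nhds (c *\<^sub>C f)"
    unfolding tendsto_fun_iff scaleC_fun_def by auto
next
  fix U :: "('a \<Rightarrow> 'b) set"
  assume "open U" "0 \<in> U"
  then obtain B where B: "finite {a. B a \<noteq> UNIV}" "\<And>a. open (B a)" "0 \<in> Pi\<^sub>E UNIV B"
      "Pi\<^sub>E UNIV B \<subseteq> U"
    using product_topology_open_contains_basis[of "\<lambda>_. euclidean" UNIV U 0]
    unfolding open_fun_def by auto
  define C where "C = (\<lambda>W :: 'b set. \<forall>x\<in>W. \<forall>y\<in>W. \<forall>t\<in>{0..1}.
      complex_of_real t *\<^sub>C x + complex_of_real (1 - t) *\<^sub>C y \<in> W)"
  have "\<exists>W. open W \<and> 0 \<in> W \<and> W \<subseteq> B a \<and> C W \<and> (B a = UNIV \<longrightarrow> W = UNIV)" for a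
  proof (cases "B a = UNIV")
    case True
    then show ?thesis by (intro exI[of _ UNIV]) (simp add: C_def)
  next
    case False
    have "0 \<in> B a" using B(3) by (auto simp: PiE_iff)
    with False locally_convex[OF B(2) this] show ?thesis unfolding C_def by blast
  qed
  then have "\<exists>W. \<forall>a. open (W a) \<and> 0 \<in> W a \<and> W a \<subseteq> B a \<and> C (W a) \<and> (B a = UNIV \<longrightarrow> W a = UNIV)"
    by (rule choice[OF allI])
  then obtain W where W: "\<And>a. open (W a)" "\<And>a. 0 \<in> W a" "\<And>a. W a \<subseteq> B a" "\<And>a. C (W a)"
      "\<And>a. B a = UNIV \<Longrightarrow> W a = UNIV"
    by blast
  have "{a. W a \<noteq> UNIV} \<subseteq> {a. B a \<noteq> UNIV}" using W(5) by auto
  then have "open (Pi\<^sub>E UNIV W)"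
    using B(1) finite_subset W(1) by (intro open_PiE) auto
  moreover have "Pi\<^sub>E UNIV W \<subseteq> U"
    using W(3) B(4) by (auto simp: PiE_iff subset_eq)
  ultimately show "\<exists>W. open W \<and> 0 \<in> W \<and> W \<subseteq> U \<and>
      (\<forall>x\<in>W. \<forall>y\<in>W. \<forall>t\<in>{0..1}. complex_of_real t *\<^sub>C x + complex_of_real (1 - t) *\<^sub>C y \<in> W)"
    using W(2) W(4)[unfolded C_def]
    by (intro exI[of _ "Pi\<^sub>E UNIV W"]) (simp add: PiE_iff scaleC_fun_def)
qed


section \<open>Matrices\<close>

text \<open>An \<open>n \<times> m\<close> matrix is a function that vanishes outside \<open>{..<n} \<times> {..<m}\<close>; the product
  topology on functions then induces on the set of these matrices the topology of \<open>M\<^sub>n\<^sub>,\<^sub>m(V)\<close>.\<close>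

type_synonym 'a matrix = "nat \<Rightarrow> nat \<Rightarrow> 'a"

definition mats :: "nat \<Rightarrow> nat \<Rightarrow> 'a::zero set \<Rightarrow> 'a matrix set" where
  "mats n m S = {A. (\<forall>i<n. \<forall>j<m. A i j \<in> S) \<and> (\<forall>i j. n \<le> i \<or> m \<le> j \<longrightarrow> A i j = 0)}"

abbreviation cmats :: "nat \<Rightarrow> nat \<Rightarrow> complex matrix set" where
  "cmats n m \<equiv> mats n m UNIV"

definition id_mat :: "nat \<Rightarrow> complex matrix" where
  "id_mat n = (\<lambda>i j. if i = j \<and> i < n then 1 else 0)"

definition adj :: "complex matrix \<Rightarrow> complex matrix" where
  "adj \<alpha> = (\<lambda>i j. cnj (\<alpha> j i))"

text \<open>\<open>gram k \<alpha>\<close> is \<open>\<alpha>\<^sup>* \<alpha>\<close> for \<open>\<alpha>\<close> with \<open>k\<close> rows, and \<open>sandwich n m \<alpha> x \<beta>\<close> is \<open>\<alpha> x \<beta>\<close> for an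
  \<open>n \<times> m\<close> matrix \<open>x\<close>.\<close>

definition gram :: "nat \<Rightarrow> complex matrix \<Rightarrow> complex matrix" where
  "gram k \<alpha> = (\<lambda>i j. \<Sum>a<k. adj \<alpha> i a * \<alpha> a j)"

definition sandwich ::
  "nat \<Rightarrow> nat \<Rightarrow> complex matrix \<Rightarrow> 'a::complex_vector matrix \<Rightarrow> complex matrix \<Rightarrow> 'a matrix" where
  "sandwich n m \<alpha> x \<beta> = (\<lambda>i j. \<Sum>a<n. \<Sum>b<m. (\<alpha> i a * \<beta> b j) *\<^sub>C x a b)"

definition dsum :: "nat \<Rightarrow> nat \<Rightarrow> 'a::zero matrix \<Rightarrow> 'a matrix \<Rightarrow> 'a matrix" where
  "dsum n m x y = (\<lambda>i j. if i < n \<and> j < m then x i j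
     else if n \<le> i \<and> m \<le> j then y (i - n) (j - m) else 0)"

text \<open>The norm of an \<open>n \<times> m\<close> matrix as an operator from \<open>\<complex>\<^sup>m\<close> to \<open>\<complex>\<^sup>n\<close> (Euclidean norms).\<close>

definition opnorm :: "nat \<Rightarrow> nat \<Rightarrow> complex matrix \<Rightarrow> real" where
  "opnorm n m A = (SUP y \<in> {y. L2_set (\<lambda>j. cmod (y j)) {..<m} \<le> 1}.
     L2_set (\<lambda>i. cmod (\<Sum>j<m. A i j * y j)) {..<n})"

text \<open>The canonical identification of \<open>M\<^sub>p\<^sub>,\<^sub>q(M\<^sub>n\<^sub>,\<^sub>m(\<complex>))\<close> with \<open>M\<^sub>p\<^sub>n\<^sub>,\<^sub>q\<^sub>m(\<complex>)\<close>.\<close>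

definition flatten :: "nat \<Rightarrow> nat \<Rightarrow> complex matrix matrix \<Rightarrow> complex matrix" where
  "flatten n m X = (\<lambda>r s. X (r div n) (s div m) (r mod n) (s mod m))"


section \<open>Operator spaces\<close>

text \<open>\<open>mnorm X n m\<close> is the norm on \<open>M\<^sub>n\<^sub>,\<^sub>m(X)\<close>; only its values on \<open>mats n m (carrier X)\<close> with
  \<open>n, m > 0\<close> matter.\<close>

record 'a opspace =
  carrier :: "'a set"
  mnorm :: "nat \<Rightarrow> nat \<Rightarrow> 'a matrix \<Rightarrow> real"

text \<open>Complete \<open>L\<^sup>\<infinity>\<close>-matrix-normed spaces (Ruan's axioms). Completeness of the first level
  implies that of all levels.\<close>

definition elem_norm :: "'a::zero opspace \<Rightarrow> 'a \<Rightarrow> real" where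
  "elem_norm X x = mnorm X 1 1 (\<lambda>i j. if i = 0 \<and> j = 0 then x else 0)"

definition operator_space :: "'a::complex_vector opspace \<Rightarrow> bool" where
  "operator_space X \<longleftrightarrow>
     complex_vector.subspace (carrier X) \<and>
     (\<forall>n>0. \<forall>m>0. \<forall>x\<in>mats n m (carrier X).
        0 \<le> mnorm X n m x \<and> (mnorm X n m x = 0 \<longleftrightarrow> x = 0) \<and>
        (\<forall>c. mnorm X n m (c *\<^sub>C x) = cmod c * mnorm X n m x) \<and>
        (\<forall>y\<in>mats n m (carrier X). mnorm X n m (x + y) \<le> mnorm X n m x + mnorm X n m y)) \<and>
     (\<forall>p>0. \<forall>q>0. \<forall>n>0. \<forall>m>0. \<forall>\<alpha>\<in>cmats p n. \<forall>x\<in>mats n m (carrier X). \<forall>\<beta>\<in>cmats m q.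
        mnorm X p q (sandwich n m \<alpha> x \<beta>) \<le> opnorm p n \<alpha> * mnorm X n m x * opnorm m q \<beta>) \<and>
     (\<forall>n>0. \<forall>m>0. \<forall>k>0. \<forall>l>0. \<forall>x\<in>mats n m (carrier X). \<forall>y\<in>mats k l (carrier X).
        mnorm X (n + k) (m + l) (dsum n m x y) = max (mnorm X n m x) (mnorm X k l y)) \<and>
     (\<forall>s :: nat \<Rightarrow> 'a. (\<forall>k. s k \<in> carrier X) \<and>
        (\<forall>e>0. \<exists>N. \<forall>k\<ge>N. \<forall>l\<ge>N. elem_norm X (s k - s l) < e) \<longrightarrow>
        (\<exists>x\<in>carrier X. (\<lambda>k. elem_norm X (s k - x)) \<longlonglongrightarrow> 0))"

text \<open>Maps defined on a subset of a type (here and for matrix convex sets below) are represented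
  by functions that vanish outside that subset, so that equality of maps is equality of functions.\<close>

definition op_hom :: "'a::complex_vector opspace \<Rightarrow> 'b::complex_vector opspace \<Rightarrow> ('a \<Rightarrow> 'b) set"
  where
  "op_hom X Y = {\<phi>.
     (\<forall>x. x \<notin> carrier X \<longrightarrow> \<phi> x = 0) \<and>
     (\<forall>x\<in>carrier X. \<phi> x \<in> carrier Y) \<and>
     (\<forall>x\<in>carrier X. \<forall>y\<in>carrier X. \<phi> (x + y) = \<phi> x + \<phi> y) \<and>
     (\<forall>c. \<forall>x\<in>carrier X. \<phi> (c *\<^sub>C x) = c *\<^sub>C \<phi> x) \<and>
     (\<forall>p>0. \<forall>q>0. \<forall>x\<in>mats p q (carrier X).
        mnorm Y p q (\<lambda>i j. \<phi> (x i j)) \<le> mnorm X p q x)}"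

definition op_id :: "'a::zero opspace \<Rightarrow> 'a \<Rightarrow> 'a" where
  "op_id X = (\<lambda>x. if x \<in> carrier X then x else 0)"

text \<open>Surjective complete isometries, the isomorphisms of operator spaces.\<close>

definition op_iso ::
  "'a::complex_vector opspace \<Rightarrow> 'b::complex_vector opspace \<Rightarrow> ('a \<Rightarrow> 'b) \<Rightarrow> bool" where
  "op_iso X Y \<phi> \<longleftrightarrow> \<phi> \<in> op_hom X Y \<and> bij_betw \<phi> (carrier X) (carrier Y) \<and>
     (\<forall>p>0. \<forall>q>0. \<forall>x\<in>mats p q (carrier X).
        mnorm Y p q (\<lambda>i j. \<phi> (x i j)) = mnorm X p q x)"

definition mat_opspace :: "nat \<Rightarrow> nat \<Rightarrow> complex matrix opspace" where
  "mat_opspace n m = \<lparr>carrier = cmats n m, mnorm = (\<lambda>p q X. opnorm (p * n) (q * m) (flatten n m X))\<rparr>"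

definition complex_opspace :: "complex opspace" where
  "complex_opspace = \<lparr>carrier = UNIV, mnorm = opnorm\<rparr>"


section \<open>Rectangular matrix convex sets\<close>

text \<open>The levels are indexed by positive integers: a level with index \<open>0\<close> is empty by convention.
  All levels at positive indices are nonempty, that is, contain \<open>0\<close>; this only excludes the family
  all of whose levels are empty.\<close>

type_synonym 'a matrix_family = "nat \<Rightarrow> nat \<Rightarrow> 'a matrix set"

definition rmconvex :: "'a::complex_vector matrix_family \<Rightarrow> bool" where
  "rmconvex K \<longleftrightarrow>
     (\<forall>n m. K n m \<subseteq> mats n m UNIV) \<and>
     (\<forall>n m. K n m \<noteq> {} \<longleftrightarrow> 0 < n \<and> 0 < m) \<and>
     (\<forall>(l::nat) n m N M \<alpha> \<beta> v. 0 < l \<and> 0 < n \<and> 0 < m \<and>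
        (\<forall>i<l. \<alpha> i \<in> cmats (N i) n \<and> \<beta> i \<in> cmats (M i) m \<and> v i \<in> K (N i) (M i)) \<and>
        opnorm n n (\<Sum>i<l. gram (N i) (\<alpha> i)) * opnorm m m (\<Sum>i<l. gram (M i) (\<beta> i)) \<le> 1 \<longrightarrow>
        (\<Sum>i<l. sandwich (N i) (M i) (adj (\<alpha> i)) (v i) (\<beta> i)) \<in> K n m)"

definition compact_rmconvex :: "'a::complex_lctvs matrix_family \<Rightarrow> bool" where
  "compact_rmconvex K \<longleftrightarrow> rmconvex K \<and> (\<forall>n m. compact (K n m))"

type_synonym ('a, 'b) family_map = "nat \<Rightarrow> nat \<Rightarrow> 'a matrix \<Rightarrow> 'b matrix"

definition rm_affine ::
  "'a::complex_vector matrix_family \<Rightarrow> 'b::complex_vector matrix_family \<Rightarrow> ('a, 'b) family_map \<Rightarrow> bool"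
  where
  "rm_affine K T \<theta> \<longleftrightarrow>
     (\<forall>n m v. v \<notin> K n m \<longrightarrow> \<theta> n m v = 0) \<and>
     (\<forall>n m. \<forall>v\<in>K n m. \<theta> n m v \<in> T n m) \<and>
     (\<forall>(l::nat) n m N M \<alpha> \<beta> v. 0 < l \<and> 0 < n \<and> 0 < m \<and>
        (\<forall>i<l. \<alpha> i \<in> cmats (N i) n \<and> \<beta> i \<in> cmats (M i) m \<and> v i \<in> K (N i) (M i)) \<and>
        (\<Sum>i<l. gram (N i) (\<alpha> i)) = id_mat n \<and> (\<Sum>i<l. gram (M i) (\<beta> i)) = id_mat m \<longrightarrow>
        \<theta> n m (\<Sum>i<l. sandwich (N i) (M i) (adj (\<alpha> i)) (v i) (\<beta> i)) =
          (\<Sum>i<l. sandwich (N i) (M i) (adj (\<alpha> i)) (\<theta> (N i) (M i) (v i)) (\<beta> i)))"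

definition rm_hom ::
  "'a::complex_lctvs matrix_family \<Rightarrow> 'b::complex_lctvs matrix_family \<Rightarrow> ('a, 'b) family_map set" where
  "rm_hom K T = {\<theta>. rm_affine K T \<theta> \<and> (\<forall>n m. continuous_on (K n m) (\<theta> n m))}"

definition rm_id :: "'a::zero matrix_family \<Rightarrow> ('a, 'a) family_map" where
  "rm_id K = (\<lambda>n m v. if v \<in> K n m then v else 0)"

definition rm_comp :: "('b, 'c) family_map \<Rightarrow> ('a, 'b) family_map \<Rightarrow> ('a, 'c) family_map" where
  "rm_comp \<eta> \<theta> = (\<lambda>n m v. \<eta> n m (\<theta> n m v))"

definition rm_homeo ::
  "'a::complex_lctvs matrix_family \<Rightarrow> 'b::complex_lctvs matrix_family \<Rightarrow> ('a, 'b) family_map \<Rightarrow> bool"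
  where
  "rm_homeo K T \<theta> \<longleftrightarrow> rm_affine K T \<theta> \<and> (\<forall>n m. \<exists>\<eta>. homeomorphism (K n m) (T n m) (\<theta> n m) \<eta>)"


section \<open>The functor \<open>X \<mapsto> CBall(X')\<close>\<close>

text \<open>The dual \<open>X'\<close> lives in the type \<open>'a \<Rightarrow> complex\<close>, whose product topology induces the weak*
  topology. A matrix \<open>\<phi>\<close> of functionals is identified with the map \<open>x \<mapsto> [\<phi>\<^sub>i\<^sub>j(x)]\<close>.\<close>

definition CBall :: "'a::complex_vector opspace \<Rightarrow> ('a \<Rightarrow> complex) matrix_family" where
  "CBall X n m = {\<phi>. 0 < n \<and> 0 < m \<and> (\<lambda>x i j. \<phi> i j x) \<in> op_hom X (mat_opspace n m)}"

definition CBall_map ::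
  "'b::complex_vector opspace \<Rightarrow> ('a \<Rightarrow> 'b) \<Rightarrow> ('b \<Rightarrow> complex, 'a \<Rightarrow> complex) family_map" where
  "CBall_map Y \<phi> = (\<lambda>n m \<psi>. if \<psi> \<in> CBall Y n m then (\<lambda>i j x. \<psi> i j (\<phi> x)) else 0)"


section \<open>The functor \<open>K \<mapsto> A\<^sub>\<rho>(K)\<close>\<close>

text \<open>\<open>CBall(\<complex>)\<close>, with a linear map from \<open>\<complex>\<close> to \<open>M\<^sub>n\<^sub>,\<^sub>m(\<complex>)\<close> identified with its value at \<open>1\<close>.\<close>

definition CBall_complex :: "complex matrix_family" where
  "CBall_complex n m = {A. (\<lambda>i j c. c * A i j) \<in> CBall complex_opspace n m}"

text \<open>The mappings into \<open>CBall(\<complex>)\<close> themselves only form a unit ball; the vector space consists of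
  their scalar multiples. An element \<open>F\<close> of \<open>M\<^sub>p\<^sub>,\<^sub>q(A\<^sub>\<rho>(K))\<close> is identified with the function
  \<open>v \<mapsto> [F\<^sub>a\<^sub>b(v)]\<close> on \<open>K\<^sub>p\<^sub>,\<^sub>q\<close> with values in \<open>M\<^sub>p\<^sub>,\<^sub>q(M\<^sub>p\<^sub>,\<^sub>q(\<complex>))\<close>.\<close>

definition A_rho :: "'a::complex_lctvs matrix_family \<Rightarrow> ('a, complex) family_map opspace" where
  "A_rho K = \<lparr>carrier = {c *\<^sub>C f | c f. f \<in> rm_hom K CBall_complex},
     mnorm = (\<lambda>p q F. SUP v\<in>K p q. opnorm (p * p) (q * q) (flatten p q (\<lambda>a b. F a b p q v)))\<rparr>"

definition A_rho_map ::
  "'a::complex_lctvs matrix_family \<Rightarrow> 'b::complex_lctvs matrix_family \<Rightarrow> ('a, 'b) family_map \<Rightarrow>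
     ('b, complex) family_map \<Rightarrow> ('a, complex) family_map" where
  "A_rho_map K T \<theta> f = (if f \<in> carrier (A_rho T)
     then (\<lambda>n m v. if v \<in> K n m then f n m (\<theta> n m v) else 0) else 0)"


section \<open>Point evaluations\<close>

definition point_eval ::
  "'a::complex_lctvs matrix_family \<Rightarrow> ('a, ('a, complex) family_map \<Rightarrow> complex) family_map" where
  "point_eval K = (\<lambda>n m v. if v \<in> K n m
     then (\<lambda>i j f. if f \<in> carrier (A_rho K) then f n m v i j else 0) else 0)"

definition functional_eval ::
  "'a::complex_vector opspace \<Rightarrow> 'a \<Rightarrow> ('a \<Rightarrow> complex, complex) family_map" where
  "functional_eval X x = (if x \<in> carrier X
     then (\<lambda>n m \<phi>. if \<phi> \<in> CBall X n m then (\<lambda>i j. \<phi> i j x) else 0) else 0)"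

end

theory Submission
  imports Defs
begin

text \<open>A rectangular matrix affine map on \<open>K\<close> is entrywise a linear map on the space spanned by
  the entries of points of \<open>K\<close>, so \<open>A\<^sub>\<rho>(K)\<close> is a space of linear functionals that are continuous
  on \<open>K\<^sub>1\<^sub>,\<^sub>1\<close>. The core is a minimax argument of Effros and Winkler: a functional \<open>F\<close> on
  \<open>n \<times> m\<close> matrices with \<open>Re F \<le> 1\<close> on \<open>K\<^sub>n\<^sub>,\<^sub>m\<close> has the form \<open>F\<^sub>i\<^sub>j = (R\<^sup>* G S)\<^sub>i\<^sub>j\<close>, where \<open>R\<close>
  and \<open>S\<close> have Hilbert--Schmidt norm at most \<open>1\<close> and \<open>G\<close> is completely contractive on \<open>K\<close>.

  If \<open>\<phi>\<close> is in level \<open>(n, m)\<close> of \<open>CBall(A\<^sub>\<rho>(K)')\<close>, this gives \<open>Re \<phi>(F) \<le> 1\<close> for all such \<open>F\<close>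
  with entries in \<open>A\<^sub>\<rho>(K)\<close>; by separation in finitely many coordinates and by compactness, \<open>\<phi>\<close>
  is a point evaluation. Applied to the matrix unit balls of \<open>X\<close>, the same factorization shows that
  \<open>X \<rightarrow> A\<^sub>\<rho>(CBall(X'))\<close> is completely isometric; it is onto because a functional that is weak*
  continuous on the dual ball is a uniform limit of evaluations and \<open>X\<close> is complete. The
  equivalence of categories follows formally from these two natural isomorphisms.\<close>

section \<open>Operator norms\<close>

text \<open>The obstacle is that hypotheses and norms concern one level at a time:
  \<open>Re F \<le> 1\<close> is known on level (n, m) only, and the norm on level (p, q) of
  \<open>A_rho K\<close> is a supremum over \<open>K p q\<close> alone, whereas complete
  contractivity speaks of all levels. Two devices cross levels. Upwards, direct sums combine points
  of arbitrary levels, which makes the infimum in the minimax argument subadditive. Downwards, p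
  vectors span at most p dimensions, so a point of any level can be compressed to level (p, q)
  without loss. The minimax lemma is stated for \<open>ds_convex\<close> families because it is
  applied both to K and to the matrix unit balls of X. Positive functionals on matrices appear as
  semi-inner products and are treated by orthonormalization, which takes the place of square roots
  of density matrices; null vectors are then the only degenerate case. Norms on M_{p,q}(M_{n,m}) are
  handled through the form \<open>quad\<close>, for which exchanging the two tensor factors is an
  interchange of sums.\<close>

abbreviation nrm :: "nat \<Rightarrow> (nat \<Rightarrow> complex) \<Rightarrow> real" where
  "nrm n x \<equiv> L2_set (\<lambda>i. cmod (x i)) {..<n}"

abbreviation hs :: "nat \<Rightarrow> nat \<Rightarrow> complex matrix \<Rightarrow> real" where
  "hs p n \<xi> \<equiv> L2_set (\<lambda>a. nrm n (\<xi> a)) {..<p}"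

text \<open>Norm estimates are proved for this sesquilinear form: it is additive in
  \<open>A\<close>, and adjoints, compressions and reindexings of \<open>A\<close> become
  interchanges of sums.\<close>

definition bil :: "nat \<Rightarrow> nat \<Rightarrow> complex matrix \<Rightarrow> (nat \<Rightarrow> complex) \<Rightarrow> (nat \<Rightarrow> complex) \<Rightarrow> complex" where
  "bil n m A x y = (\<Sum>i<n. \<Sum>j<m. cnj (x i) * A i j * y j)"

text \<open>\<open>quad p q n m X \<xi> \<eta>\<close> is \<open>\<langle>X \<eta>, \<xi>\<rangle>\<close> for \<open>X \<in> M\<^sub>p\<^sub>,\<^sub>q(M\<^sub>n\<^sub>,\<^sub>m)\<close> as an operator from \<open>\<complex>\<^sup>q\<^sup>m\<close> to
  \<open>\<complex>\<^sup>p\<^sup>n\<close>, with vectors of \<open>\<complex>\<^sup>p\<^sup>n\<close> written as \<open>p \<times> n\<close> matrices, whose norm is then \<open>hs\<close>.\<close>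

definition quad :: "nat \<Rightarrow> nat \<Rightarrow> nat \<Rightarrow> nat \<Rightarrow> complex matrix matrix \<Rightarrow> complex matrix \<Rightarrow> complex matrix \<Rightarrow> complex"
  where "quad p q n m X \<xi> \<eta> =
    (\<Sum>a<p. \<Sum>i<n. \<Sum>b<q. \<Sum>j<m. cnj (\<xi> a i) * X a b i j * \<eta> b j)"

lemma sum_fun_apply: "(\<Sum>k\<in>S. f k) x = (\<Sum>k\<in>S. f k x)"
  by (induction S rule: infinite_finite_induct) auto

lemma nrm_sq: "(nrm n x)\<^sup>2 = (\<Sum>i<n. (cmod (x i))\<^sup>2)"
  unfolding L2_set_def by (simp add: sum_nonneg)

lemma hs_sq: "(hs p n \<xi>)\<^sup>2 = (\<Sum>a<p. \<Sum>i<n. (cmod (\<xi> a i))\<^sup>2)"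
proof -
  have "(hs p n \<xi>)\<^sup>2 = (\<Sum>a<p. (nrm n (\<xi> a))\<^sup>2)"
    by (simp add: L2_set_def sum_nonneg)
  then show ?thesis by (simp add: nrm_sq)
qed

lemma nrm_scale: "nrm n (\<lambda>i. c * x i) = cmod c * nrm n x"
  unfolding norm_mult by (rule L2_set_right_distrib[symmetric]) simp

lemma nrm_eq_0: "nrm n x = 0 \<longleftrightarrow> (\<forall>i<n. x i = 0)"
  by (simp add: L2_set_eq_0_iff Ball_def)

lemma L2_set_zero [simp]: "L2_set (\<lambda>i. 0) A = 0"
  by (simp add: L2_set_0')

lemma cauchy_schwarz: "cmod (\<Sum>i<n. cnj (x i) * y i) \<le> nrm n x * nrm n y"
proof -
  have "cmod (\<Sum>i<n. cnj (x i) * y i) \<le> (\<Sum>i<n. \<bar>cmod (x i)\<bar> * \<bar>cmod (y i)\<bar>)"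
    by (rule order_trans[OF norm_sum]) (simp add: norm_mult)
  also have "\<dots> \<le> nrm n x * nrm n y" by (rule L2_set_mult_ineq)
  finally show ?thesis .
qed

lemma bil_apply: "bil n m A x y = (\<Sum>i<n. cnj (x i) * (\<Sum>j<m. A i j * y j))"
  unfolding bil_def by (simp add: sum_distrib_left mult.assoc)

text \<open>The Cauchy-Schwarz inequality in each row bounds the image of the unit ball; without
  such a bound the real supremum in \<open>opnorm\<close> carries no information.\<close>

lemma opnorm_set_bdd:
  fixes n m :: nat
  shows "bdd_above ((\<lambda>y. L2_set (\<lambda>i. cmod (\<Sum>j<m. A i j * y j)) {..<n}) `
     {y. L2_set (\<lambda>j. cmod (y j)) {..<m} \<le> 1})"
proof (rule bdd_aboveI2)
  fix y assume "y \<in> {y. nrm m y \<le> 1}"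
  then have y: "nrm m y \<le> 1" by simp
  show "L2_set (\<lambda>i. cmod (\<Sum>j<m. A i j * y j)) {..<n} \<le> L2_set (\<lambda>i. nrm m (A i)) {..<n}"
  proof (rule L2_set_mono)
    fix i
    have "cmod (\<Sum>j<m. A i j * y j) \<le> nrm m (A i) * nrm m y"
      using cauchy_schwarz[where x="\<lambda>j. cnj (A i j)" and y=y and n=m] by simp
    also have "\<dots> \<le> nrm m (A i) * 1" using y by (intro mult_left_mono) auto
    finally show "cmod (\<Sum>j<m. A i j * y j) \<le> nrm m (A i)" by simp
  qed auto
qed

lemma opnorm_nonneg [simp]: "0 \<le> opnorm n m A"
proof -
  have "L2_set (\<lambda>i. cmod (\<Sum>j<m. A i j * 0)) {..<n} \<le> opnorm n m A"
    unfolding opnorm_def by (rule cSUP_upper[OF _ opnorm_set_bdd]) (simp add: L2_set_0')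
  then show ?thesis by (simp add: L2_set_0')
qed

lemma opnorm_apply: "nrm n (\<lambda>i. \<Sum>j<m. A i j * y j) \<le> opnorm n m A * nrm m y"
proof (cases "nrm m y = 0")
  case True
  then have "\<And>i. (\<Sum>j<m. A i j * y j) = 0" by (simp add: nrm_eq_0)
  then show ?thesis using True by simp
next
  case False
  then have pos: "nrm m y > 0" using L2_set_nonneg[of "\<lambda>i. cmod (y i)" "{..<m}"] by linarith
  let ?c = "complex_of_real (inverse (nrm m y))"
  let ?z = "\<lambda>j. ?c * y j"
  have "nrm m ?z = 1" unfolding nrm_scale using pos by (simp add: norm_inverse del: of_real_inverse)
  then have le: "nrm n (\<lambda>i. \<Sum>j<m. A i j * ?z j) \<le> opnorm n m A"
    unfolding opnorm_def by (intro cSUP_upper[OF _ opnorm_set_bdd]) simp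
  have eq: "(\<Sum>j<m. A i j * ?z j) = ?c * (\<Sum>j<m. A i j * y j)" for i
    by (simp add: sum_distrib_left mult_ac del: of_real_inverse)
  have "cmod ?c * nrm n (\<lambda>i. \<Sum>j<m. A i j * y j) \<le> opnorm n m A"
    using le unfolding eq nrm_scale .
  then have "inverse (nrm m y) * nrm n (\<lambda>i. \<Sum>j<m. A i j * y j) \<le> opnorm n m A"
    by (simp only: norm_of_real abs_of_nonneg inverse_nonnegative_iff_nonnegative L2_set_nonneg)
  then show ?thesis using pos by (simp add: field_simps)
qed

lemma bil_le_opnorm: "cmod (bil n m A x y) \<le> opnorm n m A * nrm n x * nrm m y"
proof -
  have "cmod (bil n m A x y) \<le> nrm n x * nrm n (\<lambda>i. \<Sum>j<m. A i j * y j)"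
    unfolding bil_apply by (rule cauchy_schwarz)
  also have "\<dots> \<le> nrm n x * (opnorm n m A * nrm m y)"
    by (intro mult_left_mono opnorm_apply) simp
  finally show ?thesis by (simp add: mult_ac)
qed

lemma cnj_mult_self: "cnj z * z = complex_of_real ((cmod z)\<^sup>2)"
  by (simp only: complex_norm_square mult.commute)

lemma opnorm_leI:
  assumes "0 \<le> c" and "\<And>x y. cmod (bil n m A x y) \<le> c * nrm n x * nrm m y"
  shows "opnorm n m A \<le> c"
  unfolding opnorm_def
proof (rule cSUP_least)
  show "{y. nrm m y \<le> 1} \<noteq> {}" by (auto intro!: exI[of _ "\<lambda>i. 0"])
next
  fix y assume "y \<in> {y. nrm m y \<le> 1}"
  then have y: "nrm m y \<le> 1" by simp
  \<comment> \<open>The extremal choice \<open>x = A y\<close> turns the form into the squared norm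
    of \<open>A y\<close>, from which one factor cancels.\<close>
  let ?x = "\<lambda>i. \<Sum>j<m. A i j * y j"
  have "bil n m A ?x y = complex_of_real ((nrm n ?x)\<^sup>2)"
    unfolding bil_apply nrm_sq cnj_mult_self of_real_sum ..
  then have "(nrm n ?x)\<^sup>2 = cmod (bil n m A ?x y)"
    by (simp only: norm_of_real abs_of_nonneg zero_le_power2)
  then have "(nrm n ?x)\<^sup>2 \<le> c * nrm n ?x * nrm m y"
    using assms(2)[of ?x y] by simp
  also have "\<dots> \<le> c * nrm n ?x * 1"
    using assms(1) y by (intro mult_left_mono mult_nonneg_nonneg) auto
  finally have "nrm n ?x * nrm n ?x \<le> c * nrm n ?x" by (simp add: power2_eq_square)
  then show "nrm n ?x \<le> c"
    using assms(1) L2_set_nonneg[of "\<lambda>i. cmod (?x i)" "{..<n}"]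
    by (smt (verit) mult_right_le_imp_le)
qed

lemma opnorm_leI2:
  assumes "0 \<le> c" and "\<And>y. nrm n (\<lambda>i. \<Sum>j<m. A i j * y j) \<le> c * nrm m y"
  shows "opnorm n m A \<le> c"
proof (rule opnorm_leI[OF assms(1)])
  fix x y
  have "cmod (bil n m A x y) \<le> nrm n x * nrm n (\<lambda>i. \<Sum>j<m. A i j * y j)"
    unfolding bil_apply by (rule cauchy_schwarz)
  also have "\<dots> \<le> nrm n x * (c * nrm m y)"
    by (intro mult_left_mono assms(2)) simp
  finally show "cmod (bil n m A x y) \<le> c * nrm n x * nrm m y" by (simp add: mult_ac)
qed

lemma bil_add: "bil n m (A + B) x y = bil n m A x y + bil n m B x y"
  by (simp add: bil_def sum.distrib algebra_simps)

lemma bil_scale: "bil n m (c *\<^sub>C A) x y = c * bil n m A x y"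
  by (simp add: bil_def scaleC_fun_def scaleC_complex_def sum_distrib_left mult_ac)

lemma opnorm_triangle: "opnorm n m (A + B) \<le> opnorm n m A + opnorm n m B"
proof (rule opnorm_leI)
  fix x y
  have "cmod (bil n m (A + B) x y) \<le> cmod (bil n m A x y) + cmod (bil n m B x y)"
    unfolding bil_add by (rule norm_triangle_ineq)
  also have "\<dots> \<le> (opnorm n m A + opnorm n m B) * nrm n x * nrm m y"
    using bil_le_opnorm[of n m A x y] bil_le_opnorm[of n m B x y] by (simp add: algebra_simps)
  finally show "cmod (bil n m (A + B) x y) \<le> \<dots>" .
qed simp

lemma opnorm_scale_le: "opnorm n m (c *\<^sub>C A) \<le> cmod c * opnorm n m A"
proof (rule opnorm_leI)
  fix x y
  show "cmod (bil n m (c *\<^sub>C A) x y) \<le> cmod c * opnorm n m A * nrm n x * nrm m y"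
    unfolding bil_scale norm_mult
    using mult_left_mono[OF bil_le_opnorm[of n m A x y], of "cmod c"] by (simp add: mult_ac)
qed simp

lemma opnorm_scale: "opnorm n m (c *\<^sub>C A) = cmod c * opnorm n m A"
proof (cases "c = 0")
  case True
  then show ?thesis using opnorm_scale_le[of n m c A] opnorm_nonneg[of n m "c *\<^sub>C A"]
    by (intro antisym) simp_all
next
  case False
  have "opnorm n m (inverse c *\<^sub>C c *\<^sub>C A) \<le> cmod (inverse c) * opnorm n m (c *\<^sub>C A)"
    by (rule opnorm_scale_le)
  then have "cmod c * opnorm n m A \<le> opnorm n m (c *\<^sub>C A)"
    using False by (simp add: norm_divide field_simps)
  then show ?thesis using opnorm_scale_le[of n m c A] by simp
qed

lemma bil_unit:
  assumes "i < n" "j < m"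
  shows "bil n m A (\<lambda>k. if k = i then 1 else 0) (\<lambda>k. if k = j then 1 else 0) = A i j"
proof -
  have "bil n m A (\<lambda>k. if k = i then 1 else 0) (\<lambda>k. if k = j then 1 else 0) =
     (\<Sum>k<n. if k = i then A i j else 0)"
    unfolding bil_def using assms by (intro sum.cong) (auto simp: if_distrib cong: if_cong)
  then show ?thesis using assms by simp
qed

lemma nrm_unit: "i < n \<Longrightarrow> nrm n (\<lambda>k. if k = i then 1 else 0) = 1"
proof -
  assume "i < n"
  have "(nrm n (\<lambda>k. if k = i then 1 else 0))\<^sup>2 = (\<Sum>k<n. if k = i then 1 else 0)"
    unfolding nrm_sq by (intro sum.cong) auto
  also have "\<dots> = 1" using \<open>i < n\<close> by simp
  finally show ?thesis
    by (metis L2_set_nonneg abs_of_nonneg power2_eq_1_iff zero_le_one zero_neq_neg_one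
        neg_0_le_iff_le not_one_le_zero)
qed

lemma entry_le_opnorm: "i < n \<Longrightarrow> j < m \<Longrightarrow> cmod (A i j) \<le> opnorm n m A"
  using bil_le_opnorm[of n m A "\<lambda>k. if k = i then 1 else 0" "\<lambda>k. if k = j then 1 else 0"]
  by (simp add: bil_unit nrm_unit)

lemma opnorm_cong:
  assumes "\<And>i j. i < n \<Longrightarrow> j < m \<Longrightarrow> A i j = B i j"
  shows "opnorm n m A = opnorm n m B"
proof -
  have "(\<Sum>j<m. A i j * y j) = (\<Sum>j<m. B i j * y j)" if "i < n" for i y
    using assms that by (intro sum.cong) auto
  then show ?thesis unfolding opnorm_def by (intro SUP_cong refl L2_set_cong) auto
qed

lemma opnorm_zero [simp]: "opnorm n m (\<lambda>i j. 0) = 0"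
  using opnorm_leI[of 0 n m "\<lambda>i j. 0"] opnorm_nonneg[of n m "\<lambda>i j. 0"]
  by (simp add: bil_def)

text \<open>Crude, but it uses entrywise bounds only: it yields the finiteness of the supremum in
  the norm of \<open>A_rho\<close> and the norm of 1 x 1 matrices.\<close>

lemma opnorm_entry_bound:
  assumes "\<And>i j. i < n \<Longrightarrow> j < m \<Longrightarrow> cmod (A i j) \<le> c i j"
  shows "opnorm n m A \<le> (\<Sum>i<n. \<Sum>j<m. c i j)"
proof (rule opnorm_leI)
  show "0 \<le> (\<Sum>i<n. \<Sum>j<m. c i j)"
    using assms by (intro sum_nonneg) (meson lessThan_iff norm_ge_zero order_trans)
  fix x y
  have "cmod (bil n m A x y) \<le> (\<Sum>i<n. \<Sum>j<m. cmod (cnj (x i) * A i j * y j))"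
    unfolding bil_def by (intro order_trans[OF norm_sum] sum_mono order_refl)
  also have "\<dots> \<le> (\<Sum>i<n. \<Sum>j<m. c i j * (nrm n x * nrm m y))"
  proof (intro sum_mono)
    fix i j assume ij: "i \<in> {..<n}" "j \<in> {..<m}"
    have "cmod (x i) \<le> nrm n x" "cmod (y j) \<le> nrm m y"
      using ij by (auto intro!: member_le_L2_set)
    then have "cmod (A i j) * (cmod (x i) * cmod (y j)) \<le> c i j * (nrm n x * nrm m y)"
      using ij assms[of i j] by (intro mult_mono) (auto intro: order_trans[OF norm_ge_zero])
    then show "cmod (cnj (x i) * A i j * y j) \<le> c i j * (nrm n x * nrm m y)"
      by (simp add: norm_mult mult_ac)
  qed
  also have "\<dots> = (\<Sum>i<n. \<Sum>j<m. c i j) * nrm n x * nrm m y"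
    by (simp add: sum_distrib_right mult.assoc)
  finally show "cmod (bil n m A x y) \<le> (\<Sum>i<n. \<Sum>j<m. c i j) * nrm n x * nrm m y" .
qed

lemma opnorm_1_1: "opnorm 1 1 A = cmod (A 0 0)"
  using entry_le_opnorm[of 0 1 0 1 A] opnorm_entry_bound[of 1 1 A "\<lambda>i j. cmod (A i j)"]
  by simp

lemma adj_adj [simp]: "adj (adj A) = A" by (simp add: adj_def)

lemma bil_adj: "bil n m (adj A) x y = cnj (bil m n A y x)"
  unfolding bil_def adj_def by (subst sum.swap) (simp add: cnj_sum mult_ac)

lemma opnorm_adj_le: "opnorm n m (adj A) \<le> opnorm m n A"
proof (rule opnorm_leI)
  fix x y
  show "cmod (bil n m (adj A) x y) \<le> opnorm m n A * nrm n x * nrm m y"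
    using bil_le_opnorm[of m n A y x] by (simp add: bil_adj mult_ac)
qed simp

lemma opnorm_adj: "opnorm n m (adj A) = opnorm m n A"
  using opnorm_adj_le[of n m A] opnorm_adj_le[of m n "adj A"] by simp

section \<open>Amplified matrices: flattened indices and the form \<open>quad\<close>\<close>

lemma mult_add_less: "a * n + i < p * n" if "a < p" "i < n" for a n i p :: nat
proof -
  have "a * n + i < Suc a * n" using that by simp
  also have "\<dots> \<le> p * n" using that by (intro mult_right_mono) auto
  finally show ?thesis .
qed

lemma sum_mult_div_mod:
  "(\<Sum>r<p * n. f (r div n) (r mod n)) = (\<Sum>a<p. \<Sum>i<(n::nat). f a i)"
proof -
  have "(\<Sum>r<p * n. f (r div n) (r mod n)) =
     (\<Sum>a<p. sum (\<lambda>r. f (r div n) (r mod n)) {a * n..<a * n + n})"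
    by (rule sum.nat_group[symmetric])
  also have "\<dots> = (\<Sum>a<p. \<Sum>i<n. f a i)"
  proof (rule sum.cong[OF refl])
    fix a
    show "sum (\<lambda>r. f (r div n) (r mod n)) {a * n..<a * n + n} = (\<Sum>i<n. f a i)"
      by (rule sum.reindex_bij_witness[where i="\<lambda>i. a * n + i" and j="\<lambda>r. r - a * n"])
        (auto simp: div_mult_self3 add.commute dest!: le_Suc_ex)
  qed
  finally show ?thesis .
qed

lemma nrm_flat: "nrm (p * n) (\<lambda>r. \<xi> (r div n) (r mod n)) = hs p n \<xi>"
proof -
  have "(nrm (p * n) (\<lambda>r. \<xi> (r div n) (r mod n)))\<^sup>2 = (hs p n \<xi>)\<^sup>2"
    unfolding nrm_sq hs_sq by (rule sum_mult_div_mod)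
  then show ?thesis by simp
qed

lemma bil_flatten:
  "bil (p * n) (q * m) (flatten n m X) (\<lambda>r. \<xi> (r div n) (r mod n)) (\<lambda>s. \<eta> (s div m) (s mod m)) =
     quad p q n m X \<xi> \<eta>"
proof -
  have "(\<Sum>s<q * m. cnj (\<xi> a i) * X a (s div m) i (s mod m) * \<eta> (s div m) (s mod m)) =
     (\<Sum>b<q. \<Sum>j<m. cnj (\<xi> a i) * X a b i j * \<eta> b j)" for a i
    by (rule sum_mult_div_mod)
  then show ?thesis
    unfolding bil_def flatten_def quad_def
    using sum_mult_div_mod[where f="\<lambda>a i. \<Sum>b<q. \<Sum>j<m. cnj (\<xi> a i) * X a b i j * \<eta> b j"
        and p=p and n=n] by simp
qed

lemma quad_le_opnorm:
  "cmod (quad p q n m X \<xi> \<eta>) \<le> opnorm (p * n) (q * m) (flatten n m X) * hs p n \<xi> * hs q m \<eta>"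
  using bil_le_opnorm[of "p * n" "q * m" "flatten n m X" "\<lambda>r. \<xi> (r div n) (r mod n)"
      "\<lambda>s. \<eta> (s div m) (s mod m)"]
  by (simp only: bil_flatten nrm_flat)

lemma opnorm_flatten_leI:
  assumes "0 \<le> c" and "\<And>\<xi> \<eta>. cmod (quad p q n m X \<xi> \<eta>) \<le> c * hs p n \<xi> * hs q m \<eta>"
  shows "opnorm (p * n) (q * m) (flatten n m X) \<le> c"
proof (cases "n = 0 \<or> m = 0")
  case True
  then show ?thesis using assms(1) by (intro opnorm_leI) (auto simp: bil_def)
next
  case False
  show ?thesis
  proof (rule opnorm_leI[OF assms(1)])
    fix x y :: "nat \<Rightarrow> complex"
    let ?\<xi> = "\<lambda>a i. x (a * n + i)" and ?\<eta> = "\<lambda>b j. y (b * m + j)"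
    have x: "(\<lambda>r. ?\<xi> (r div n) (r mod n)) = x" and y: "(\<lambda>r. ?\<eta> (r div m) (r mod m)) = y"
      by simp_all
    show "cmod (bil (p * n) (q * m) (flatten n m X) x y) \<le> c * nrm (p * n) x * nrm (q * m) y"
      using assms(2)[of ?\<xi> ?\<eta>]
        bil_flatten[of p n q m X ?\<xi> ?\<eta>] nrm_flat[where p=p and n=n and \<xi>="?\<xi>"]
        nrm_flat[where p=q and n=m and \<xi>="?\<eta>"]
      unfolding x y by simp
  qed
qed

lemma entry_le_opnorm_flatten:
  assumes "a < p" "b < q" "i < n" "j < m"
  shows "cmod (X a b i j) \<le> opnorm (p * n) (q * m) (flatten n m X)"
proof -
  have "a * n + i < p * n" "b * m + j < q * m"
    using assms by (auto intro: mult_add_less)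
  from entry_le_opnorm[OF this, of "flatten n m X"] show ?thesis
    using assms by (simp add: flatten_def div_mult_self3)
qed

lemma opnorm_flatten_cong:
  assumes "\<And>a b i j. a < p \<Longrightarrow> b < q \<Longrightarrow> i < n \<Longrightarrow> j < m \<Longrightarrow> X a b i j = Y a b i j"
  shows "opnorm (p * n) (q * m) (flatten n m X) = opnorm (p * n) (q * m) (flatten n m Y)"
proof (rule opnorm_cong)
  fix r s assume "r < p * n" "s < q * m"
  then have "r div n < p" "r mod n < n" "s div m < q" "s mod m < m"
    by (auto simp: less_mult_imp_div_less intro!: mod_less_divisor gr0I)
  then show "flatten n m X r s = flatten n m Y r s"
    by (simp add: flatten_def assms)
qed

section \<open>Gram matrices\<close>

lemma bil_gram: "bil n n (gram k \<alpha>) x y = (\<Sum>a<k. cnj (\<Sum>i<n. \<alpha> a i * x i) * (\<Sum>j<n. \<alpha> a j * y j))"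
proof -
  have "bil n n (gram k \<alpha>) x y =
      (\<Sum>i<n. \<Sum>a<k. \<Sum>j<n. cnj (x i) * (cnj (\<alpha> a i) * \<alpha> a j) * y j)"
    unfolding bil_def gram_def adj_def
    by (subst (2) sum.swap) (simp add: sum_distrib_left sum_distrib_right)
  also have "\<dots> = (\<Sum>a<k. \<Sum>i<n. \<Sum>j<n. cnj (x i) * (cnj (\<alpha> a i) * \<alpha> a j) * y j)"
    by (rule sum.swap)
  also have "\<dots> = (\<Sum>a<k. cnj (\<Sum>i<n. \<alpha> a i * x i) * (\<Sum>j<n. \<alpha> a j * y j))"
    unfolding sum_product cnj_sum
    by (intro sum.cong refl) (simp add: mult_ac)
  finally show ?thesis .
qed

lemma bil_gram_diag: "bil n n (gram k \<alpha>) x x = complex_of_real ((nrm k (\<lambda>a. \<Sum>i<n. \<alpha> a i * x i))\<^sup>2)"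
  unfolding bil_gram nrm_sq cnj_mult_self of_real_sum ..

text \<open>Together with \<open>opnorm_le_sqrt_gram\<close> this is the C*-identity; it translates
  between the Gram norms in the definition of matrix convexity and the norms of the
  coefficients.\<close>

lemma opnorm_gram_le: "opnorm n n (gram k \<alpha>) \<le> (opnorm k n \<alpha>)\<^sup>2"
proof (rule opnorm_leI)
  fix x y
  have "cmod (bil n n (gram k \<alpha>) x y) \<le>
      nrm k (\<lambda>a. \<Sum>i<n. \<alpha> a i * x i) * nrm k (\<lambda>a. \<Sum>i<n. \<alpha> a i * y i)"
    unfolding bil_gram by (rule cauchy_schwarz)
  also have "\<dots> \<le> (opnorm k n \<alpha> * nrm n x) * (opnorm k n \<alpha> * nrm n y)"
    by (intro mult_mono opnorm_apply) auto
  finally show "cmod (bil n n (gram k \<alpha>) x y) \<le> (opnorm k n \<alpha>)\<^sup>2 * nrm n x * nrm n y"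
    by (simp add: power2_eq_square mult_ac)
qed simp

lemma opnorm_le_sqrt_gram: "opnorm k n \<alpha> \<le> sqrt (opnorm n n (gram k \<alpha>))"
proof (rule opnorm_leI2)
  fix y
  have "(nrm k (\<lambda>a. \<Sum>i<n. \<alpha> a i * y i))\<^sup>2 = cmod (bil n n (gram k \<alpha>) y y)"
    by (simp only: bil_gram_diag norm_of_real abs_of_nonneg zero_le_power2)
  also have "\<dots> \<le> opnorm n n (gram k \<alpha>) * (nrm n y)\<^sup>2"
    using bil_le_opnorm[of n n "gram k \<alpha>" y y] by (simp add: power2_eq_square mult.assoc)
  also have "\<dots> = (sqrt (opnorm n n (gram k \<alpha>)) * nrm n y)\<^sup>2"
    unfolding power_mult_distrib real_sqrt_pow2[OF opnorm_nonneg] ..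
  finally show "nrm k (\<lambda>a. \<Sum>i<n. \<alpha> a i * y i) \<le> sqrt (opnorm n n (gram k \<alpha>)) * nrm n y"
    by (rule power2_le_imp_le) simp
qed simp

section \<open>The Hahn--Banach theorem\<close>

text \<open>Functionals are total functions that are linear on a set only, because carriers and
  spans are subsets of a type.\<close>

definition linear_on :: "'a::complex_vector set \<Rightarrow> ('a \<Rightarrow> 'b::complex_vector) \<Rightarrow> bool" where
  "linear_on E h \<longleftrightarrow> (\<forall>x\<in>E. \<forall>y\<in>E. h (x + y) = h x + h y) \<and> (\<forall>c. \<forall>x\<in>E. h (c *\<^sub>C x) = c *\<^sub>C h x)"

abbreviation scaleRC :: "real \<Rightarrow> 'a::complex_vector \<Rightarrow> 'a" (infixr "*\<^sub>R\<^sub>C" 75) where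
  "t *\<^sub>R\<^sub>C x \<equiv> complex_of_real t *\<^sub>C x"

definition real_linear_on :: "'a::complex_vector set \<Rightarrow> ('a \<Rightarrow> real) \<Rightarrow> bool" where
  "real_linear_on E l \<longleftrightarrow> (\<forall>x\<in>E. \<forall>y\<in>E. l (x + y) = l x + l y) \<and> (\<forall>t. \<forall>x\<in>E. l (t *\<^sub>R\<^sub>C x) = t * l x)"

definition sublinear_on :: "'a::complex_vector set \<Rightarrow> ('a \<Rightarrow> real) \<Rightarrow> bool" where
  "sublinear_on E P \<longleftrightarrow> (\<forall>x\<in>E. \<forall>y\<in>E. P (x + y) \<le> P x + P y) \<and>
     (\<forall>t\<ge>0. \<forall>x\<in>E. P (t *\<^sub>R\<^sub>C x) = t * P x)"

lemma sublinear_onD: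
  assumes "sublinear_on E P"
  shows "x \<in> E \<Longrightarrow> y \<in> E \<Longrightarrow> P (x + y) \<le> P x + P y"
    and "0 \<le> t \<Longrightarrow> x \<in> E \<Longrightarrow> P (t *\<^sub>R\<^sub>C x) = t * P x"
    and "x \<in> E \<Longrightarrow> P 0 = 0"
    and "x \<in> E \<Longrightarrow> - x \<in> E \<Longrightarrow> - P (- x) \<le> P x"
proof -
  show 1: "x \<in> E \<Longrightarrow> y \<in> E \<Longrightarrow> P (x + y) \<le> P x + P y" for x y
    using assms unfolding sublinear_on_def by blast
  show 2: "0 \<le> t \<Longrightarrow> x \<in> E \<Longrightarrow> P (t *\<^sub>R\<^sub>C x) = t * P x" for t x
    using assms unfolding sublinear_on_def by blast
  show 3: "x \<in> E \<Longrightarrow> P 0 = 0" for x using 2[of 0 x] by simp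
  show "x \<in> E \<Longrightarrow> - x \<in> E \<Longrightarrow> - P (- x) \<le> P x"
    using 1[of x "- x"] 3[of x] by simp
qed

lemma sublinear_onI:
  assumes E: "complex_vector.subspace E"
    and "\<And>x y. x \<in> E \<Longrightarrow> y \<in> E \<Longrightarrow> P (x + y) \<le> P x + P y"
    and le: "\<And>t x. 0 < t \<Longrightarrow> x \<in> E \<Longrightarrow> P (t *\<^sub>R\<^sub>C x) \<le> t * P x"
    and 0: "P 0 = 0"
  shows "sublinear_on E P"
  unfolding sublinear_on_def
proof (intro conjI ballI allI impI)
  fix t :: real and x assume t: "0 \<le> t" and x: "x \<in> E"
  show "P (t *\<^sub>R\<^sub>C x) = t * P x"
  proof (cases "t = 0")
    case False
    then have t: "0 < t" using t by simp
    have "P (inverse t *\<^sub>R\<^sub>C t *\<^sub>R\<^sub>C x) \<le> inverse t * P (t *\<^sub>R\<^sub>C x)"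
      using t by (intro le complex_vector.subspace_scale[OF E] x) simp
    moreover have "inverse t *\<^sub>R\<^sub>C t *\<^sub>R\<^sub>C x = x"
      using t by (simp add: scaleC_scaleC scaleC_one)
    ultimately have "P x \<le> inverse t * P (t *\<^sub>R\<^sub>C x)" by simp
    then have "t * P x \<le> P (t *\<^sub>R\<^sub>C x)" using t by (simp add: field_simps)
    then show ?thesis using le[OF t x] by simp
  qed (simp add: 0)
qed (use assms in auto)

lemma le_cINF_add:
  fixes f :: "'a \<Rightarrow> real" and g :: "'b \<Rightarrow> real"
  assumes "S \<noteq> {}" "T \<noteq> {}" and "\<And>s t. s \<in> S \<Longrightarrow> t \<in> T \<Longrightarrow> c \<le> f s + g t"
  shows "c \<le> (INF s\<in>S. f s) + (INF t\<in>T. g t)"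
proof -
  have "c - g t \<le> (INF s\<in>S. f s)" if "t \<in> T" for t
    using assms(1) assms(3)[OF _ that] by (intro cINF_greatest) (auto simp: algebra_simps)
  then have "c - (INF s\<in>S. f s) \<le> (INF t\<in>T. g t)"
    using assms(2) by (intro cINF_greatest) (auto simp: algebra_simps)
  then show ?thesis by simp
qed

lemma le_cINF_mult:
  fixes f :: "'a \<Rightarrow> real"
  assumes "S \<noteq> {}" "0 < t" and "\<And>s. s \<in> S \<Longrightarrow> c \<le> t * f s"
  shows "c \<le> t * (INF s\<in>S. f s)"
proof -
  have "c / t \<le> (INF s\<in>S. f s)"
    using assms by (intro cINF_greatest) (auto simp: field_simps)
  then show ?thesis using assms(2) by (simp add: field_simps)
qed

text \<open>The functional is \<open>Q x = inf {P (x + t x0) - t P x0 | t \<ge> 0}\<close>: t = 0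
  gives \<open>Q \<le> P\<close>, t = 1 at \<open>- x0\<close> gives the last inequality, and
  subadditivity of \<open>P\<close> bounds the infimum below by \<open>- P (- x)\<close>.\<close>

lemma sublinear_shift:
  fixes P :: "'a::complex_vector \<Rightarrow> real"
  assumes E: "complex_vector.subspace E" and P: "sublinear_on E P" and x0: "x0 \<in> E"
  shows "\<exists>Q. sublinear_on E Q \<and> (\<forall>x\<in>E. Q x \<le> P x) \<and> Q (- x0) \<le> - P x0"
proof -
  note [intro] = complex_vector.subspace_scale[OF E] complex_vector.subspace_add[OF E]
    complex_vector.subspace_neg[OF E] x0
  note D = sublinear_onD[OF P]
  define f where "f x t = P (x + t *\<^sub>R\<^sub>C x0) - t * P x0" for x t
  define Q where "Q x = (INF t\<in>{0..}. f x t)" for x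
  have lower: "- P (- x) \<le> f x t" if "x \<in> E" "0 \<le> t" for x and t :: real
  proof -
    have "t * P x0 = P (t *\<^sub>R\<^sub>C x0)" using D(2) that x0 by simp
    also have "\<dots> = P ((x + t *\<^sub>R\<^sub>C x0) + - x)" by simp
    also have "\<dots> \<le> P (x + t *\<^sub>R\<^sub>C x0) + P (- x)" using that by (intro D(1)) auto
    finally show ?thesis by (simp add: f_def)
  qed
  have le: "Q x \<le> f x t" if "x \<in> E" "0 \<le> t" for x and t :: real
    unfolding Q_def using that lower[OF that(1)] by (intro cINF_lower bdd_belowI2) auto
  have "sublinear_on E Q"
  proof (rule sublinear_onI[OF E])
    fix x y assume xy: "x \<in> E" "y \<in> E"
    show "Q (x + y) \<le> Q x + Q y"
      unfolding Q_def[of x] Q_def[of y]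
    proof (rule le_cINF_add)
      fix s t :: real assume st: "s \<in> {0..}" "t \<in> {0..}"
      have "Q (x + y) \<le> f (x + y) (s + t)" using xy st by (intro le) auto
      also have "P (x + y + (s + t) *\<^sub>R\<^sub>C x0) = P ((x + s *\<^sub>R\<^sub>C x0) + (y + t *\<^sub>R\<^sub>C x0))"
        by (simp add: scaleC_add_left algebra_simps)
      then have "f (x + y) (s + t) \<le> f x s + f y t"
        using D(1)[of "x + s *\<^sub>R\<^sub>C x0" "y + t *\<^sub>R\<^sub>C x0"] xy
        by (auto simp: f_def algebra_simps)
      finally show "Q (x + y) \<le> f x s + f y t" .
    qed auto
  next
    fix t :: real and x assume t: "0 < t" and x: "x \<in> E"
    show "Q (t *\<^sub>R\<^sub>C x) \<le> t * Q x"
      unfolding Q_def[of x]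
    proof (rule le_cINF_mult[OF _ t])
      fix s :: real assume s: "s \<in> {0..}"
      have "Q (t *\<^sub>R\<^sub>C x) \<le> f (t *\<^sub>R\<^sub>C x) (t * s)" using t s x by (intro le) auto
      also have "t *\<^sub>R\<^sub>C x + (t * s) *\<^sub>R\<^sub>C x0 = t *\<^sub>R\<^sub>C (x + s *\<^sub>R\<^sub>C x0)"
        by (simp add: scaleC_add_right scaleC_scaleC)
      then have "f (t *\<^sub>R\<^sub>C x) (t * s) = t * f x s"
        using D(2)[of t "x + s *\<^sub>R\<^sub>C x0"] x t by (auto simp: f_def algebra_simps)
      finally show "Q (t *\<^sub>R\<^sub>C x) \<le> t * f x s" .
    qed auto
  next
    have "0 \<in> E" by (rule complex_vector.subspace_0[OF E])
    then have "0 \<le> Q 0"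
      unfolding Q_def using lower[of 0] D(3)[OF x0] by (intro cINF_greatest) auto
    moreover have "Q 0 \<le> 0" using le[of 0 0] \<open>0 \<in> E\<close> D(3)[OF x0] by (simp add: f_def)
    ultimately show "Q 0 = 0" by simp
  qed
  moreover have "Q x \<le> P x" if "x \<in> E" for x using le[OF that, of 0] by (simp add: f_def)
  moreover have "Q (- x0) \<le> - P x0"
    using le[of "- x0" 1] x0 D(3)[OF x0] by (auto simp: f_def scaleC_one)
  ultimately show ?thesis by blast
qed

text \<open>Subadditivity of the infimum involves two members of \<open>C\<close>; since they are
  comparable, the smaller one can be used for both arguments.\<close>

lemma sublinear_cINF:
  fixes C :: "('a::complex_vector \<Rightarrow> real) set"
  assumes E: "complex_vector.subspace E" and ne: "C \<noteq> {}"
    and sub: "\<And>Q. Q \<in> C \<Longrightarrow> sublinear_on E Q"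
    and chain: "\<And>Q R. Q \<in> C \<Longrightarrow> R \<in> C \<Longrightarrow> (\<forall>x\<in>E. Q x \<le> R x) \<or> (\<forall>x\<in>E. R x \<le> Q x)"
    and bdd: "\<And>x. x \<in> E \<Longrightarrow> bdd_below ((\<lambda>Q. Q x) ` C)"
  shows "sublinear_on E (\<lambda>x. INF Q\<in>C. Q x)"
proof (rule sublinear_onI[OF E])
  note [intro] = complex_vector.subspace_scale[OF E] complex_vector.subspace_add[OF E]
  fix x y assume xy: "x \<in> E" "y \<in> E"
  show "(INF Q\<in>C. Q (x + y)) \<le> (INF Q\<in>C. Q x) + (INF Q\<in>C. Q y)"
  proof (rule le_cINF_add[OF ne ne])
    fix Q R assume QR: "Q \<in> C" "R \<in> C"
    have "(INF Q\<in>C. Q (x + y)) \<le> Q (x + y)" "(INF Q\<in>C. Q (x + y)) \<le> R (x + y)"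
      using xy QR by (auto intro!: cINF_lower bdd)
    moreover have "Q (x + y) \<le> Q x + Q y" "R (x + y) \<le> R x + R y"
      using sublinear_onD(1)[OF sub] QR xy by blast+
    moreover have "Q y \<le> R y \<or> R x \<le> Q x"
      using chain[OF QR] xy by blast
    ultimately show "(INF Q\<in>C. Q (x + y)) \<le> Q x + R y" by linarith
  qed
next
  note [intro] = complex_vector.subspace_scale[OF E]
  fix t :: real and x assume t: "0 < t" and x: "x \<in> E"
  show "(INF Q\<in>C. Q (t *\<^sub>R\<^sub>C x)) \<le> t * (INF Q\<in>C. Q x)"
  proof (rule le_cINF_mult[OF ne t])
    fix Q assume Q: "Q \<in> C"
    have "(INF Q\<in>C. Q (t *\<^sub>R\<^sub>C x)) \<le> Q (t *\<^sub>R\<^sub>C x)"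
      using x Q by (auto intro!: cINF_lower bdd)
    also have "\<dots> = t * Q x" using sublinear_onD(2)[OF sub[OF Q]] t x by simp
    finally show "(INF Q\<in>C. Q (t *\<^sub>R\<^sub>C x)) \<le> t * Q x" .
  qed
next
  have "0 \<in> E" by (rule complex_vector.subspace_0[OF E])
  then have "(INF Q\<in>C. Q 0) = (INF Q\<in>C. 0)"
    using sublinear_onD(3)[OF sub] by (intro INF_cong) auto
  then show "(INF Q\<in>C. Q 0) = 0" using ne by simp
qed

text \<open>A minimal sublinear functional is linear, because shifting it in the direction of a vector
  \<open>x\<close> does not change it, which forces \<open>P (- x) \<le> - P x\<close>.\<close>

theorem hahn_banach:
  fixes P :: "'a::complex_vector \<Rightarrow> real"
  assumes E: "complex_vector.subspace E" and P: "sublinear_on E P"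
  shows "\<exists>l. real_linear_on E l \<and> (\<forall>x\<in>E. l x \<le> P x)"
proof -
  define A where "A = {Q. sublinear_on E Q \<and> (\<forall>x\<in>E. Q x \<le> P x) \<and> (\<forall>x. x \<notin> E \<longrightarrow> Q x = 0)}"
  \<comment> \<open>Zorn's lemma compares functions on the whole type, so the values outside
    \<open>E\<close> are fixed to 0; otherwise they could be lowered forever and no minimal element
    would exist.\<close>
  define ext where "ext Q = (\<lambda>x. if x \<in> E then Q x else 0)" for Q :: "'a \<Rightarrow> real"
  note [intro] = complex_vector.subspace_scale[OF E] complex_vector.subspace_add[OF E]
    complex_vector.subspace_neg[OF E]
  have ext_sub: "sublinear_on E (ext Q) \<longleftrightarrow> sublinear_on E Q" for Q
    unfolding sublinear_on_def ext_def by (auto simp: complex_vector.subspace_scale[OF E]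
      complex_vector.subspace_add[OF E])
  have extA: "ext Q \<in> A" if "sublinear_on E Q" "\<And>x. x \<in> E \<Longrightarrow> Q x \<le> P x" for Q
    using that unfolding A_def mem_Collect_eq ext_sub by (simp add: ext_def)
  have lower: "- P (- x) \<le> Q x" if "Q \<in> A" "x \<in> E" for Q x
  proof -
    have "- Q (- x) \<le> Q x" "Q (- x) \<le> P (- x)"
      using that sublinear_onD(4)[of E Q x] unfolding A_def by auto
    then show ?thesis by simp
  qed
  \<comment> \<open>The order is reversed, so that the maximal element supplied by Zorn's lemma is a
    minimal functional.\<close>
  have "\<exists>M\<in>A. \<forall>Q\<in>A. (\<forall>x. Q x \<le> M x) \<longrightarrow> Q = M"
  proof (rule predicate_Zorn)
    show "partial_order_on A (relation_of (\<lambda>M Q. \<forall>x. Q x \<le> M x) A)"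
      by (rule partial_order_on_relation_ofI) (auto intro: order_trans intro!: ext antisym)
    fix C assume C: "C \<in> Chains (relation_of (\<lambda>M Q. \<forall>x. Q x \<le> M x) A)"
    then have CA: "C \<subseteq> A"
      and ch: "\<And>Q R. Q \<in> C \<Longrightarrow> R \<in> C \<Longrightarrow> (\<forall>x. Q x \<le> R x) \<or> (\<forall>x. R x \<le> Q x)"
      by (auto simp: Chains_def relation_of_def)
    show "\<exists>u\<in>A. \<forall>Q\<in>C. \<forall>x. u x \<le> Q x"
    proof (cases "C = {}")
      case True
      then show ?thesis using extA[OF P] by auto
    next
      case False
      have bdd: "bdd_below ((\<lambda>Q. Q x) ` C)" if "x \<in> E" for x
        using lower[OF _ that] CA by (intro bdd_belowI2) auto
      have sub: "sublinear_on E (\<lambda>x. INF Q\<in>C. Q x)"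
      proof (rule sublinear_cINF[OF E False _ _ bdd])
        show "sublinear_on E Q" if "Q \<in> C" for Q using that CA by (auto simp: A_def)
        show "(\<forall>x\<in>E. Q x \<le> R x) \<or> (\<forall>x\<in>E. R x \<le> Q x)" if "Q \<in> C" "R \<in> C" for Q R
          using ch[OF that] by blast
      qed
      have le: "(INF Q\<in>C. Q x) \<le> Q x" if "Q \<in> C" "x \<in> E" for Q x
        using that by (auto intro!: cINF_lower bdd)
      have "ext (\<lambda>x. INF Q\<in>C. Q x) \<in> A"
      proof (rule extA[OF sub])
        fix x assume x: "x \<in> E"
        obtain Q where Q: "Q \<in> C" using False by blast
        then show "(INF Q\<in>C. Q x) \<le> P x"
          using le[OF Q x] CA x unfolding A_def by force
      qed
      moreover have "ext (\<lambda>x. INF Q\<in>C. Q x) x \<le> Q x" if "Q \<in> C" for Q x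
        using le[OF that] that CA by (auto simp: ext_def A_def)
      ultimately show ?thesis by blast
    qed
  qed
  then obtain M where M: "M \<in> A" "\<And>Q. Q \<in> A \<Longrightarrow> (\<forall>x. Q x \<le> M x) \<Longrightarrow> Q = M" by blast
  then have sM: "sublinear_on E M" and leM: "\<And>x. x \<in> E \<Longrightarrow> M x \<le> P x" and M0: "\<And>x. x \<notin> E \<Longrightarrow> M x = 0"
    by (auto simp: A_def)
  have neg: "M (- x) = - M x" if x: "x \<in> E" for x
  proof -
    obtain Q where Q: "sublinear_on E Q" "\<And>x. x \<in> E \<Longrightarrow> Q x \<le> M x" "Q (- x) \<le> - M x"
      using sublinear_shift[OF E sM x] by blast
    have "ext Q \<in> A" using Q leM by (intro extA) force+
    moreover have "ext Q y \<le> M y" for y using Q(2) M0 by (auto simp: ext_def)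
    ultimately have "ext Q = M" using M(2) by blast
    moreover have nx: "- x \<in> E" by (rule complex_vector.subspace_neg[OF E x])
    ultimately have "M (- x) \<le> - M x" using Q(3) by (auto simp: ext_def)
    then show ?thesis using sublinear_onD(4)[OF sM x nx] by simp
  qed
  have "M (x + y) = M x + M y" if "x \<in> E" "y \<in> E" for x y
  proof -
    have "M (x + y) \<le> M x + M y" using sublinear_onD(1)[OF sM that] .
    moreover have "M (- x + - y) \<le> M (- x) + M (- y)"
      using that complex_vector.subspace_neg[OF E] by (intro sublinear_onD(1)[OF sM])
    moreover have "- x + - y = - (x + y)" by simp
    moreover have "M (- (x + y)) = - M (x + y)"
      by (rule neg[OF complex_vector.subspace_add[OF E that]])
    ultimately show ?thesis using neg[OF that(1)] neg[OF that(2)] by simp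
  qed
  moreover have "M (t *\<^sub>R\<^sub>C x) = t * M x" if "x \<in> E" for t x
  proof (cases "0 \<le> t")
    case False
    have "M (t *\<^sub>R\<^sub>C x) = M (- ((- t) *\<^sub>R\<^sub>C x))" by (simp add: complex_vector.scale_minus_left)
    also have "\<dots> = - ((- t) * M x)"
      using False that sublinear_onD(2)[OF sM, of "- t" x] by (subst neg) auto
    finally show ?thesis by simp
  qed (use sublinear_onD(2)[OF sM] that in auto)
  ultimately show ?thesis using leM unfolding real_linear_on_def by blast
qed

text \<open>Shifting first in the direction \<open>x\<close> gives
  \<open>l (- x) \<le> Q (- x) \<le> - P x\<close>, which makes the domination an equality at
  \<open>x\<close>.\<close>

corollary hahn_banach_point:
  fixes P :: "'a::complex_vector \<Rightarrow> real"
  assumes E: "complex_vector.subspace E" and P: "sublinear_on E P" and x: "x \<in> E"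
  shows "\<exists>l. real_linear_on E l \<and> (\<forall>x\<in>E. l x \<le> P x) \<and> l x = P x"
proof -
  obtain Q where Q: "sublinear_on E Q" "\<And>x. x \<in> E \<Longrightarrow> Q x \<le> P x" "Q (- x) \<le> - P x"
    using sublinear_shift[OF E P x] by blast
  obtain l where l: "real_linear_on E l" "\<And>x. x \<in> E \<Longrightarrow> l x \<le> Q x"
    using hahn_banach[OF E Q(1)] by blast
  have "l ((- 1) *\<^sub>R\<^sub>C x) = - 1 * l x" using l(1) x unfolding real_linear_on_def by blast
  then have "l (- x) = - l x" by (simp add: complex_vector.scale_minus_left scaleC_one)
  then have "P x \<le> l x"
    using l(2)[of "- x"] Q(3) complex_vector.subspace_neg[OF E x] by simp
  moreover have "l y \<le> P y" if "y \<in> E" for y using l(2)[OF that] Q(2)[OF that] by simp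
  ultimately show ?thesis using l(1) x by (intro exI[of _ l]) force
qed

text \<open>\<open>l x - i l (i x)\<close> is the complex linear functional with real part
  \<open>l\<close>; homogeneity follows by splitting the scalar into real and imaginary
  part.\<close>

lemma complexify:
  assumes E: "complex_vector.subspace E" and l: "real_linear_on E l"
  shows "linear_on E (\<lambda>x. Complex (l x) (- l (\<i> *\<^sub>C x)))"
proof -
  note [intro] = complex_vector.subspace_scale[OF E] complex_vector.subspace_add[OF E]
  have add: "l (x + y) = l x + l y" if "x \<in> E" "y \<in> E" for x y
    using l that unfolding real_linear_on_def by blast
  have scale: "l (t *\<^sub>R\<^sub>C x) = t * l x" if "x \<in> E" for x t
    using l that unfolding real_linear_on_def by blast
  have split: "c *\<^sub>C x = Re c *\<^sub>R\<^sub>C x + Im c *\<^sub>R\<^sub>C \<i> *\<^sub>C x" for c :: complex and x :: 'a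
    by (metis (no_types, lifting) complex_eq mult.commute scaleC_add_left scaleC_scaleC)
  have lc: "l (c *\<^sub>C x) = Re c * l x + Im c * l (\<i> *\<^sub>C x)" if "x \<in> E" for c x
  proof -
    have ix: "\<i> *\<^sub>C x \<in> E" using that by auto
    have "l (c *\<^sub>C x) = l (Re c *\<^sub>R\<^sub>C x) + l (Im c *\<^sub>R\<^sub>C \<i> *\<^sub>C x)"
      using that ix by (subst split, intro add) blast+
    then show ?thesis by (simp only: scale[OF that] scale[OF ix])
  qed
  show ?thesis
    unfolding linear_on_def
  proof (intro conjI ballI allI)
    fix x y assume xy: "x \<in> E" "y \<in> E"
    then have "\<i> *\<^sub>C x \<in> E" "\<i> *\<^sub>C y \<in> E" by auto
    then show "Complex (l (x + y)) (- l (\<i> *\<^sub>C (x + y))) =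
        Complex (l x) (- l (\<i> *\<^sub>C x)) + Complex (l y) (- l (\<i> *\<^sub>C y))"
      by (simp add: scaleC_add_right add xy complex_eq_iff)
  next
    fix c x assume x: "x \<in> E"
    show "Complex (l (c *\<^sub>C x)) (- l (\<i> *\<^sub>C c *\<^sub>C x)) = c *\<^sub>C Complex (l x) (- l (\<i> *\<^sub>C x))"
      unfolding scaleC_scaleC lc[OF x, of c] lc[OF x, of "\<i> * c"]
      by (simp add: complex_eq_iff scaleC_complex_def)
  qed
qed

lemma Complex_linear_rotate:
  obtains u :: complex where "cmod u = 1" "u * z = complex_of_real (cmod z)"
proof (cases "z = 0")
  case True
  then show ?thesis using that[of 1] by simp
next
  case False
  have "cnj z / cmod z * z = cmod z"
    using False by (simp add: cnj_mult_self power2_eq_square)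
  then show ?thesis using False that[of "cnj z / cmod z"] by (simp add: norm_divide)
qed

section \<open>Semi-inner products and the Gram--Schmidt process\<close>

text \<open>Linear in the second argument. Definiteness is not demanded, as the forms obtained from
  positive functionals may be degenerate.\<close>

definition semi_ip :: "('a::complex_vector \<Rightarrow> 'a \<Rightarrow> complex) \<Rightarrow> bool" where
  "semi_ip p \<longleftrightarrow> (\<forall>x y z. p x (y + z) = p x y + p x z) \<and> (\<forall>c x y. p x (c *\<^sub>C y) = c * p x y) \<and>
     (\<forall>x y. p y x = cnj (p x y)) \<and> (\<forall>x. 0 \<le> Re (p x x))"

context
  fixes p :: "'a::complex_vector \<Rightarrow> 'a \<Rightarrow> complex"
  assumes p: "semi_ip p"
begin

lemma semi_ip_add_right: "p x (y + z) = p x y + p x z"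
  and semi_ip_scale_right: "p x (c *\<^sub>C y) = c * p x y"
  and semi_ip_herm: "p y x = cnj (p x y)"
  and semi_ip_nonneg: "0 \<le> Re (p x x)"
  using p unfolding semi_ip_def by blast+

lemma semi_ip_add_left: "p (x + y) z = p x z + p y z"
  by (subst (1 2 3) semi_ip_herm) (simp add: semi_ip_add_right)

lemma semi_ip_scale_left: "p (c *\<^sub>C x) y = cnj c * p x y"
  by (subst (1 2) semi_ip_herm) (simp add: semi_ip_scale_right)

lemma semi_ip_zero_right: "p x 0 = 0"
  using semi_ip_scale_right[of x 0 0] by simp

lemma semi_ip_zero_left: "p 0 x = 0"
  using semi_ip_scale_left[of 0 0 x] by simp

lemma semi_ip_diff_right: "p x (y - z) = p x y - p x z"
  using semi_ip_add_right[of x "y - z" z] by simp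

lemma semi_ip_diff_left: "p (x - y) z = p x z - p y z"
  using semi_ip_add_left[of "x - y" y z] by simp

lemma semi_ip_sum_right: "p x (\<Sum>a\<in>S. f a) = (\<Sum>a\<in>S. p x (f a))"
  by (induction S rule: infinite_finite_induct) (simp_all add: semi_ip_zero_right semi_ip_add_right)

lemma semi_ip_sum_left: "p (\<Sum>a\<in>S. f a) x = (\<Sum>a\<in>S. p (f a) x)"
  by (induction S rule: infinite_finite_induct) (simp_all add: semi_ip_zero_left semi_ip_add_left)

lemma semi_ip_self: "p x x = complex_of_real (Re (p x x))"
proof -
  have "p x x = cnj (p x x)" by (rule semi_ip_herm)
  then show ?thesis by (simp add: complex_eq_iff)
qed

text \<open>If \<open>p x u\<close> were nonzero, adding multiples of the null vector
  \<open>u\<close> to \<open>x\<close> would let the quadratic form decrease linearly without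
  bound.\<close>

lemma semi_ip_null_right:
  assumes "p u u = 0"
  shows "p x u = 0"
proof (rule ccontr)
  assume ne: "p x u \<noteq> 0"
  define d where "d = (cmod (p x u))\<^sup>2"
  have d: "d > 0" using ne by (simp add: d_def)
  \<comment> \<open>This \<open>s\<close> makes the quadratic form at \<open>x + c u\<close> exactly
    -1.\<close>
  define s where "s = (Re (p x x) + 1) / (2 * d)"
  define c where "c = - complex_of_real s * cnj (p x u)"
  have "c * p x u = - complex_of_real (s * d)"
    by (simp add: c_def d_def mult.assoc cnj_mult_self)
  moreover have "p (x + c *\<^sub>C u) (x + c *\<^sub>C u) = p x x + c * p x u + cnj (c * p x u)"
    using assms semi_ip_herm[of x u]
    by (simp add: semi_ip_add_left semi_ip_add_right semi_ip_scale_left semi_ip_scale_right)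
  ultimately have "Re (p (x + c *\<^sub>C u) (x + c *\<^sub>C u)) = Re (p x x) - 2 * (s * d)" by simp
  also have "s * d = (Re (p x x) + 1) / 2" using d by (simp add: s_def)
  also have "Re (p x x) - 2 * ((Re (p x x) + 1) / 2) = - 1" by (simp add: field_simps)
  finally show False using semi_ip_nonneg[of "x + c *\<^sub>C u"] by simp
qed

lemma semi_ip_null_left: "p u u = 0 \<Longrightarrow> p u x = 0"
  using semi_ip_null_right[of u x] semi_ip_herm[of u x] by simp

text \<open>A vector with null residual contributes the vector 0, which keeps its place; so there
  are exactly \<open>n\<close> vectors \<open>u\<close>, of square norm 0 or 1, and the residuals
  vanish only up to null vectors.\<close>

lemma gram_schmidt_vectors:
  fixes x :: "nat \<Rightarrow> 'a"
  shows "\<exists>u. (\<forall>a<n. \<forall>b<n. a \<noteq> b \<longrightarrow> p (u a) (u b) = 0) \<and>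
    (\<forall>a<n. p (u a) (u a) = 0 \<or> p (u a) (u a) = 1) \<and>
    (\<forall>i<n. \<forall>r. r = x i - (\<Sum>a<n. p (u a) (x i) *\<^sub>C u a) \<longrightarrow> p r r = 0)"
proof (induction n)
  case (Suc n)
  then obtain u where U: "(\<forall>a<n. \<forall>b<n. a \<noteq> b \<longrightarrow> p (u a) (u b) = 0) \<and>
    (\<forall>a<n. p (u a) (u a) = 0 \<or> p (u a) (u a) = 1) \<and>
    (\<forall>i<n. \<forall>r. r = x i - (\<Sum>a<n. p (u a) (x i) *\<^sub>C u a) \<longrightarrow> p r r = 0)"
    ..
  note orth = U[THEN conjunct1, rule_format]
    and unit = U[THEN conjunct2, THEN conjunct1, rule_format]
    and res = U[THEN conjunct2, THEN conjunct2, rule_format]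
  define v where "v = x n - (\<Sum>a<n. p (u a) (x n) *\<^sub>C u a)"
  have uv: "p (u a) v = 0" if "a < n" for a
  proof -
    have "(\<Sum>b<n. p (u b) (x n) * p (u a) (u b)) = (\<Sum>b<n. if b = a then p (u a) (x n) * p (u a) (u a) else 0)"
      using orth that by (intro sum.cong) auto
    then have "p (u a) v = p (u a) (x n) - p (u a) (x n) * p (u a) (u a)"
      using that by (simp add: v_def semi_ip_diff_right semi_ip_sum_right semi_ip_scale_right)
    then show ?thesis using unit[OF that] semi_ip_null_left[of "u a" "x n"] by auto
  qed
  define nv where "nv = Re (p v v)"
  define w where "w = (if nv = 0 then 0 else inverse (sqrt nv) *\<^sub>R\<^sub>C v)"
  have pvv: "p v v = complex_of_real nv" unfolding nv_def by (rule semi_ip_self)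
  have nv0: "0 \<le> nv" unfolding nv_def by (rule semi_ip_nonneg)
  have uw: "p (u a) w = 0" if "a < n" for a
    using uv[OF that] by (simp add: w_def semi_ip_scale_right semi_ip_zero_right)
  have wu: "p w (u a) = 0" if "a < n" for a
    using uw[OF that] by (subst semi_ip_herm) simp
  have sq: "complex_of_real (sqrt nv) * complex_of_real (sqrt nv) = complex_of_real nv"
    using nv0 by (simp flip: of_real_mult)
  have ww: "p w w = 0 \<or> p w w = 1"
  proof (cases "nv = 0")
    case False
    then have "p w w = 1"
      using nv0 sq by (simp add: w_def semi_ip_scale_left semi_ip_scale_right pvv field_simps)
    then show ?thesis ..
  qed (simp add: w_def semi_ip_zero_left)
  define u' where "u' = (\<lambda>a. if a < n then u a else w)"
  have split: "(\<Sum>a<Suc n. p (u' a) y *\<^sub>C u' a) = (\<Sum>a<n. p (u a) y *\<^sub>C u a) + p w y *\<^sub>C w" for y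
    by (simp add: u'_def)
  have wx: "p w (x n) = p w v"
    using wu by (simp add: v_def semi_ip_diff_right semi_ip_sum_right semi_ip_scale_right)
  have "p r r = 0" if i: "i < Suc n" and r: "r = x i - (\<Sum>a<Suc n. p (u' a) (x i) *\<^sub>C u' a)" for i r
  proof (cases "i < n")
    case True
    \<comment> \<open>The new vector does not disturb earlier residuals: \<open>r0\<close> is null,
      hence orthogonal to \<open>w\<close>, so the new coefficient is 0.\<close>
    define r0 where "r0 = x i - (\<Sum>a<n. p (u a) (x i) *\<^sub>C u a)"
    have r0: "p r0 r0 = 0" using res[OF True] r0_def by blast
    have "p w r0 = p w (x i)"
      using wu by (simp add: r0_def semi_ip_diff_right semi_ip_sum_right semi_ip_scale_right)
    then have "p w (x i) = 0" using semi_ip_null_right[OF r0] by simp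
    then have "r = r0" unfolding r split by (simp add: r0_def)
    then show ?thesis using r0 by simp
  next
    case False
    then have i: "i = n" using i by simp
    have r: "r = v - p w v *\<^sub>C w"
      unfolding r i split wx by (simp add: v_def)
    show ?thesis
    proof (cases "nv = 0")
      case True
      then show ?thesis using r pvv by (simp add: w_def)
    next
      case False
      then have "p w v *\<^sub>C w = v"
        using sq nv0 by (simp add: w_def semi_ip_scale_left pvv scaleC_scaleC field_simps scaleC_one)
      then show ?thesis using r by (simp add: semi_ip_zero_left)
    qed
  qed
  moreover have "p (u' a) (u' b) = 0" if "a < Suc n" "b < Suc n" "a \<noteq> b" for a b
    using that orth uw wu by (auto simp: u'_def less_Suc_eq)
  moreover have "p (u' a) (u' a) = 0 \<or> p (u' a) (u' a) = 1" if "a < Suc n" for a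
    using that unit ww by (auto simp: u'_def)
  ultimately show ?case by (intro exI[of _ u']) blast
qed simp

text \<open>The consequences of orthonormality that survive degeneracy: synthesis from coefficients
  is contractive, Bessel's inequality holds, and each \<open>x i\<close> has an expansion up to a
  null vector.\<close>

lemma gram_schmidt:
  fixes x :: "nat \<Rightarrow> 'a"
  shows "\<exists>u. (\<forall>\<xi>. Re (p (\<Sum>a<n. \<xi> a *\<^sub>C u a) (\<Sum>a<n. \<xi> a *\<^sub>C u a)) \<le> (\<Sum>a<n. (cmod (\<xi> a))\<^sup>2)) \<and>
    (\<forall>y. (\<Sum>a<n. (cmod (p (u a) y))\<^sup>2) \<le> Re (p y y)) \<and>
    (\<forall>i<n. \<forall>r. r = x i - (\<Sum>a<n. p (u a) (x i) *\<^sub>C u a) \<longrightarrow> p r r = 0)"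
proof -
  obtain u where U: "(\<forall>a<n. \<forall>b<n. a \<noteq> b \<longrightarrow> p (u a) (u b) = 0) \<and>
    (\<forall>a<n. p (u a) (u a) = 0 \<or> p (u a) (u a) = 1) \<and>
    (\<forall>i<n. \<forall>r. r = x i - (\<Sum>a<n. p (u a) (x i) *\<^sub>C u a) \<longrightarrow> p r r = 0)"
    using gram_schmidt_vectors[of n x] ..
  note orth = U[THEN conjunct1, rule_format]
    and unit = U[THEN conjunct2, THEN conjunct1, rule_format]
    and res = U[THEN conjunct2, THEN conjunct2, rule_format]
  have norm: "p (\<Sum>a<n. \<xi> a *\<^sub>C u a) (\<Sum>a<n. \<xi> a *\<^sub>C u a) =
      (\<Sum>a<n. complex_of_real ((cmod (\<xi> a))\<^sup>2) * p (u a) (u a))" for \<xi>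
  proof -
    have "(\<Sum>b<n. cnj (\<xi> a) * (\<xi> b * p (u a) (u b))) = complex_of_real ((cmod (\<xi> a))\<^sup>2) * p (u a) (u a)"
      if "a < n" for a
    proof -
      have "(\<Sum>b<n. cnj (\<xi> a) * (\<xi> b * p (u a) (u b))) =
          (\<Sum>b<n. if b = a then cnj (\<xi> a) * (\<xi> a * p (u a) (u a)) else 0)"
        using orth that by (intro sum.cong) auto
      also have "\<dots> = (cnj (\<xi> a) * \<xi> a) * p (u a) (u a)" using that by simp
      finally show ?thesis unfolding cnj_mult_self .
    qed
    then show ?thesis
      unfolding semi_ip_sum_left unfolding semi_ip_sum_right semi_ip_scale_left semi_ip_scale_right
      by (intro sum.cong refl) (simp add: mult_ac)
  qed
  have 1: "Re (p (\<Sum>a<n. \<xi> a *\<^sub>C u a) (\<Sum>a<n. \<xi> a *\<^sub>C u a)) \<le> (\<Sum>a<n. (cmod (\<xi> a))\<^sup>2)" for \<xi>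
    unfolding norm Re_sum
  proof (rule sum_mono)
    fix a assume "a \<in> {..<n}"
    then show "Re (complex_of_real ((cmod (\<xi> a))\<^sup>2) * p (u a) (u a)) \<le> (cmod (\<xi> a))\<^sup>2"
      using unit[of a] by auto
  qed
  have 2: "(\<Sum>a<n. (cmod (p (u a) y))\<^sup>2) \<le> Re (p y y)" for y
  proof -
    define c where "c a = p (u a) y" for a
    define s where "s = (\<Sum>a<n. c a *\<^sub>C u a)"
    define t where "t = (\<Sum>a<n. (cmod (c a))\<^sup>2)"
    have "complex_of_real ((cmod (c a))\<^sup>2) * p (u a) (u a) = complex_of_real ((cmod (c a))\<^sup>2)" if "a < n" for a
      using unit[OF that] semi_ip_null_left[of "u a" y] by (auto simp: c_def)
    then have ss: "p s s = complex_of_real t"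
      unfolding s_def norm t_def of_real_sum by (intro sum.cong) auto
    have sy: "p s y = complex_of_real t"
      unfolding s_def t_def semi_ip_sum_left semi_ip_scale_left of_real_sum c_def[symmetric]
      by (intro sum.cong refl) (simp only: cnj_mult_self)
    have ys: "p y s = complex_of_real t" by (subst semi_ip_herm) (simp add: sy)
    have "p (y - s) (y - s) = p y y - complex_of_real t"
      by (simp add: semi_ip_diff_left semi_ip_diff_right ss sy ys)
    then have "0 \<le> Re (p y y) - t" using semi_ip_nonneg[of "y - s"] by simp
    then show ?thesis by (simp add: t_def c_def)
  qed
  show ?thesis by (intro exI[of _ u] conjI allI impI 1 2) (rule res)
qed

end


section \<open>Families closed under direct sums and contractive compressions\<close>

definition sing :: "'a::zero \<Rightarrow> 'a matrix" where
  "sing x = (\<lambda>i j. if i = 0 \<and> j = 0 then x else 0)"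

text \<open>The closure properties behind the minimax argument. They hold for rectangular matrix
  convex sets and, by Ruan's axioms, for the matrix unit balls of an operator space.\<close>

definition ds_convex :: "'a::complex_vector matrix_family \<Rightarrow> bool" where
  "ds_convex K \<longleftrightarrow>
     (\<forall>n m. K n m \<subseteq> mats n m UNIV) \<and>
     (\<forall>n>0. \<forall>m>0. 0 \<in> K n m) \<and>
     (\<forall>n>0. \<forall>m>0. \<forall>k>0. \<forall>l>0. \<forall>v\<in>K n m. \<forall>w\<in>K k l. dsum n m v w \<in> K (n + k) (m + l)) \<and>
     (\<forall>n>0. \<forall>m>0. \<forall>p>0. \<forall>q>0. \<forall>\<alpha>\<in>cmats n p. \<forall>\<beta>\<in>cmats m q. \<forall>v\<in>K n m.
        opnorm n p \<alpha> \<le> 1 \<and> opnorm m q \<beta> \<le> 1 \<longrightarrow> sandwich n m (adj \<alpha>) v \<beta> \<in> K p q)"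

text \<open>\<open>F\<close> is a matrix of functionals. For fixed \<open>w\<close> this is the
  sesquilinear form of a scalar matrix, for fixed vectors it is a linear functional of
  \<open>w\<close>; both views are used.\<close>

definition bform :: "(nat \<Rightarrow> nat \<Rightarrow> 'a \<Rightarrow> complex) \<Rightarrow> nat \<Rightarrow> nat \<Rightarrow> 'a \<Rightarrow> (nat \<Rightarrow> complex) \<Rightarrow> (nat \<Rightarrow> complex) \<Rightarrow> complex"
  where "bform F n m w x y = (\<Sum>i<n. \<Sum>j<m. cnj (x i) * y j * F i j w)"

text \<open>The block column of \<alpha> over \<beta>: Gram matrices add, and compressing a direct
  sum by block columns gives the sum of the compressions.\<close>

definition stack :: "nat \<Rightarrow> complex matrix \<Rightarrow> complex matrix \<Rightarrow> complex matrix" where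
  "stack r \<alpha> \<beta> = (\<lambda>a i. if a < r then \<alpha> a i else \<beta> (a - r) i)"

lemma sum_lessThan_add: "(\<Sum>i<n + k. f i) = (\<Sum>i<n. f i) + (\<Sum>i<(k::nat). f (n + i))"
  by (induction k) (simp_all add: add.assoc)

lemma stack_cmats: "\<alpha> \<in> cmats r n \<Longrightarrow> \<beta> \<in> cmats s n \<Longrightarrow> stack r \<alpha> \<beta> \<in> cmats (r + s) n"
  by (auto simp: mats_def stack_def)

lemma gram_stack: "gram (r + s) (stack r \<alpha> \<beta>) = gram r \<alpha> + gram s \<beta>"
  by (simp add: gram_def adj_def stack_def sum_lessThan_add fun_eq_iff)

lemma linear_onD:
  assumes "linear_on E h"
  shows "x \<in> E \<Longrightarrow> y \<in> E \<Longrightarrow> h (x + y) = h x + h y"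
    and "x \<in> E \<Longrightarrow> h (c *\<^sub>C x) = c *\<^sub>C h x"
    and "x \<in> E \<Longrightarrow> h 0 = 0"
proof -
  show 2: "x \<in> E \<Longrightarrow> h (c *\<^sub>C x) = c *\<^sub>C h x" for c x
    using assms unfolding linear_on_def by blast
  show "x \<in> E \<Longrightarrow> h 0 = 0" using 2[of x 0] by simp
qed (use assms in \<open>unfold linear_on_def, blast\<close>)

lemma linear_on_sum:
  assumes E: "complex_vector.subspace E" and h: "linear_on E h" and "\<And>i. i \<in> S \<Longrightarrow> f i \<in> E"
  shows "h (\<Sum>i\<in>S. f i) = (\<Sum>i\<in>S. h (f i))"
  using assms(3)
proof (induction S rule: infinite_finite_induct)
  case (insert i S)
  then show ?case
    using linear_onD(1)[OF h, of "f i" "\<Sum>i\<in>S. f i"] complex_vector.subspace_sum[OF E, of S f] by auto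
qed (use linear_onD(3)[OF h complex_vector.subspace_0[OF E]] in auto)

lemma bform_linear:
  assumes E: "complex_vector.subspace E" and F: "\<And>i j. linear_on E (F i j)"
  shows "linear_on E (\<lambda>w. bform F n m w x y)"
  unfolding linear_on_def bform_def
  using linear_onD(1,2)[OF F]
  by (auto simp: sum.distrib algebra_simps sum_distrib_left scaleC_complex_def)

lemma bform_add_left: "bform F n m w (x + x') y = bform F n m w x y + bform F n m w x' y"
  by (simp add: bform_def sum.distrib algebra_simps)

lemma bform_add_right: "bform F n m w x (y + y') = bform F n m w x y + bform F n m w x y'"
  by (simp add: bform_def sum.distrib algebra_simps)

lemma bform_scale_left: "bform F n m w (c *\<^sub>C x) y = cnj c * bform F n m w x y"
  by (simp add: bform_def sum_distrib_left scaleC_fun_def scaleC_complex_def mult_ac)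

lemma bform_scale_right: "bform F n m w x (c *\<^sub>C y) = c * bform F n m w x y"
  by (simp add: bform_def sum_distrib_left scaleC_fun_def scaleC_complex_def mult_ac)

lemma bform_zero_left: "bform F n m w 0 y = 0"
  and bform_zero_right: "bform F n m w x 0 = 0"
  by (simp_all add: bform_def)

lemma bform_sum_left: "bform F n m w (\<Sum>a\<in>S. x a) y = (\<Sum>a\<in>S. bform F n m w (x a) y)"
  using sum_comp_morphism[where h="\<lambda>x. bform F n m w x y" and g=x and A=S]
  by (simp only: bform_zero_left bform_add_left o_def)

lemma bform_sum_right: "bform F n m w x (\<Sum>a\<in>S. y a) = (\<Sum>a\<in>S. bform F n m w x (y a))"
  using sum_comp_morphism[where h="\<lambda>y. bform F n m w x y" and g=y and A=S]
  by (simp only: bform_zero_right bform_add_right o_def)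

lemma bform_expand:
  "bform F n m w (\<Sum>a\<in>S. \<xi> a *\<^sub>C u a) (\<Sum>b\<in>T. \<eta> b *\<^sub>C z b) =
     (\<Sum>a\<in>S. \<Sum>b\<in>T. cnj (\<xi> a) * \<eta> b * bform F n m w (u a) (z b))"
  by (subst sum.swap) (simp add: bform_sum_left bform_sum_right bform_scale_left bform_scale_right
      sum_distrib_left mult_ac)

lemma bform_cong:
  assumes "\<And>i. i < n \<Longrightarrow> x i = x' i" "\<And>j. j < m \<Longrightarrow> y j = y' j"
  shows "bform F n m w x y = bform F n m w x' y'"
  unfolding bform_def using assms by (intro sum.cong refl) auto

text \<open>Normalising by slightly larger numbers covers norms that may vanish and could not be
  divided by.\<close>

lemma le_mult_of_gt:
  fixes c x y :: real
  assumes "0 \<le> x" "0 \<le> y" and le: "\<And>s r. x < s \<Longrightarrow> y < r \<Longrightarrow> c \<le> s * r"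
  shows "c \<le> x * y"
proof -
  have 1: "c \<le> s * y" if s: "x < s" for s
  proof -
    have "c / s \<le> y"
    proof (rule dense_ge)
      fix r assume "y < r"
      then show "c / s \<le> r" using le[OF s] s assms(1) by (simp add: field_simps)
    qed
    then show ?thesis using s assms(1) by (simp add: field_simps)
  qed
  show ?thesis
  proof (cases "y = 0")
    case True
    then show ?thesis using 1[of "x + 1"] by simp
  next
    case False
    then have y: "y > 0" using assms by simp
    have "c / y \<le> x"
    proof (rule dense_ge)
      fix s assume "x < s"
      then show "c / y \<le> s" using 1 y by (simp add: field_simps)
    qed
    then show ?thesis using y by (simp add: field_simps)
  qed
qed

text \<open>The right-hand side is smallest for \<open>t^4 = b / a\<close>. As \<open>a\<close> or
  \<open>b\<close> may be 0, larger numbers \<open>s\<close> and \<open>r\<close> replace their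
  roots, and \<open>t^2 = r / s\<close>.\<close>

lemma le_sqrt_mult:
  fixes a b c :: real
  assumes a: "0 \<le> a" and b: "0 \<le> b" and le: "\<And>t. 0 < t \<Longrightarrow> 2 * c \<le> t\<^sup>2 * a + b / t\<^sup>2"
  shows "c \<le> sqrt a * sqrt b"
proof (rule le_mult_of_gt)
  fix s r assume sr: "sqrt a < s" "sqrt b < r"
  then have pos: "s > 0" "r > 0"
    using real_sqrt_ge_zero[OF a] real_sqrt_ge_zero[OF b] by linarith+
  have as: "a \<le> s\<^sup>2" "b \<le> r\<^sup>2"
    using sr by (simp_all add: real_less_lsqrt sqrt_le_D less_imp_le)
  have "2 * c \<le> (r / s) * a + b / (r / s)"
    using le[of "sqrt (r / s)"] pos by simp
  also have "\<dots> \<le> (r / s) * s\<^sup>2 + r\<^sup>2 / (r / s)"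
    using as pos by (intro add_mono mult_left_mono divide_right_mono) auto
  also have "\<dots> = 2 * (s * r)" using pos by (simp add: power2_eq_square)
  finally show "c \<le> s * r" by simp
qed (use a b in auto)

section \<open>A minimax argument\<close>

lemma ds_convexD:
  assumes K: "ds_convex K"
  shows "K n m \<subseteq> mats n m UNIV"
    and "0 < n \<Longrightarrow> 0 < m \<Longrightarrow> 0 \<in> K n m"
    and "0 < n \<Longrightarrow> 0 < m \<Longrightarrow> 0 < k \<Longrightarrow> 0 < l \<Longrightarrow> v \<in> K n m \<Longrightarrow> w \<in> K k l \<Longrightarrow>
      dsum n m v w \<in> K (n + k) (m + l)"
    and "0 < n \<Longrightarrow> 0 < m \<Longrightarrow> 0 < r \<Longrightarrow> 0 < s \<Longrightarrow> \<alpha> \<in> cmats r n \<Longrightarrow> \<beta> \<in> cmats s m \<Longrightarrow>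
      v \<in> K r s \<Longrightarrow> opnorm r n \<alpha> \<le> 1 \<Longrightarrow> opnorm s m \<beta> \<le> 1 \<Longrightarrow> sandwich r s (adj \<alpha>) v \<beta> \<in> K n m"
proof -
  note D = K[unfolded ds_convex_def]
  show "K n m \<subseteq> mats n m UNIV" using D[THEN conjunct1] by simp
  show "0 < n \<Longrightarrow> 0 < m \<Longrightarrow> 0 \<in> K n m" using D[THEN conjunct2, THEN conjunct1] by simp
  show "0 < n \<Longrightarrow> 0 < m \<Longrightarrow> 0 < k \<Longrightarrow> 0 < l \<Longrightarrow> v \<in> K n m \<Longrightarrow> w \<in> K k l \<Longrightarrow>
      dsum n m v w \<in> K (n + k) (m + l)"
    by (rule D[THEN conjunct2, THEN conjunct2, THEN conjunct1, rule_format])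
  show "0 < n \<Longrightarrow> 0 < m \<Longrightarrow> 0 < r \<Longrightarrow> 0 < s \<Longrightarrow> \<alpha> \<in> cmats r n \<Longrightarrow> \<beta> \<in> cmats s m \<Longrightarrow>
      v \<in> K r s \<Longrightarrow> opnorm r n \<alpha> \<le> 1 \<Longrightarrow> opnorm s m \<beta> \<le> 1 \<Longrightarrow> sandwich r s (adj \<alpha>) v \<beta> \<in> K n m"
    by (rule D[THEN conjunct2, THEN conjunct2, THEN conjunct2, rule_format, OF _ _ _ _ _ _ _ conjI])
qed

lemma sum_swap4:
  "(\<Sum>k\<in>A. \<Sum>l\<in>B. \<Sum>i\<in>C. \<Sum>j\<in>D. f k l i j) = (\<Sum>i\<in>C. \<Sum>j\<in>D. \<Sum>k\<in>A. \<Sum>l\<in>B. f k l i j)"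
proof -
  have "(\<Sum>k\<in>A. \<Sum>l\<in>B. \<Sum>i\<in>C. \<Sum>j\<in>D. f k l i j) = (\<Sum>k\<in>A. \<Sum>i\<in>C. \<Sum>l\<in>B. \<Sum>j\<in>D. f k l i j)"
    by (intro sum.cong refl sum.swap)
  also have "\<dots> = (\<Sum>i\<in>C. \<Sum>k\<in>A. \<Sum>l\<in>B. \<Sum>j\<in>D. f k l i j)"
    by (rule sum.swap)
  also have "\<dots> = (\<Sum>i\<in>C. \<Sum>k\<in>A. \<Sum>j\<in>D. \<Sum>l\<in>B. f k l i j)"
    by (intro sum.cong refl sum.swap)
  also have "\<dots> = (\<Sum>i\<in>C. \<Sum>j\<in>D. \<Sum>k\<in>A. \<Sum>l\<in>B. f k l i j)"
    by (intro sum.cong refl sum.swap)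
  finally show ?thesis .
qed

lemma opnorm_zero_fun [simp]: "opnorm n m 0 = 0"
  unfolding zero_fun_def by (rule opnorm_zero)

lemma opnorm_minus: "opnorm n m (- A) = opnorm n m A"
  using opnorm_scale[of n m "- 1" A] by (simp add: complex_vector.scale_minus_left scaleC_one)

lemma gram_scale: "gram r (c *\<^sub>C \<alpha>) = complex_of_real ((cmod c)\<^sup>2) *\<^sub>C gram r \<alpha>"
proof -
  have "cnj (c * x) * (c * y) = complex_of_real ((cmod c)\<^sup>2) * (cnj x * y)" for x y
  proof -
    have "cnj (c * x) * (c * y) = (cnj c * c) * (cnj x * y)" by (simp add: mult_ac)
    then show ?thesis unfolding cnj_mult_self .
  qed
  then show ?thesis
    by (simp only: gram_def adj_def scaleC_fun_def scaleC_complex_def sum_distrib_left)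
qed

lemma gram_zero [simp]: "gram r 0 = 0"
  by (simp add: gram_def adj_def fun_eq_iff)

lemma opnorm_id_mat: "opnorm n n (id_mat n) \<le> 1"
proof (rule opnorm_leI2)
  fix y
  have "(\<Sum>j<n. id_mat n i j * y j) = y i" if "i < n" for i
  proof -
    have "(\<Sum>j<n. id_mat n i j * y j) = (\<Sum>j<n. if j = i then y i else 0)"
      by (intro sum.cong) (auto simp: id_mat_def)
    then show ?thesis using that by simp
  qed
  then show "nrm n (\<lambda>i. \<Sum>j<n. id_mat n i j * y j) \<le> 1 * nrm n y"
    by (simp cong: L2_set_cong_simp)
qed simp

text \<open>The matrix \<open>x^* y\<close> for row vectors. For \<open>x = y\<close> it is the Gram
  matrix of a single row, and every Gram matrix is a sum of such matrices.\<close>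

definition rank1 :: "nat \<Rightarrow> (nat \<Rightarrow> complex) \<Rightarrow> (nat \<Rightarrow> complex) \<Rightarrow> complex matrix" where
  "rank1 n x y = (\<lambda>i j. if i < n \<and> j < n then cnj (x i) * y j else 0)"

text \<open>Only the real part of \<open>L\<close> is controlled on positive matrices, so the form
  is made hermitian by averaging with its adjoint; on the diagonal the real part of \<open>L\<close>
  remains.\<close>

lemma semi_ip_rank1:
  assumes L: "linear_on UNIV L" and pos: "\<And>x. 0 \<le> Re (L (rank1 n x x))"
  shows "semi_ip (\<lambda>x y. (L (rank1 n x y) + cnj (L (rank1 n y x))) / 2)"
proof -
  have "rank1 n x (y + z) = rank1 n x y + rank1 n x z" for x y z
    by (auto simp: rank1_def fun_eq_iff algebra_simps)
  moreover have "rank1 n (y + z) x = rank1 n y x + rank1 n z x" for x y z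
    by (auto simp: rank1_def fun_eq_iff algebra_simps)
  moreover have "rank1 n x (c *\<^sub>C y) = c *\<^sub>C rank1 n x y" for c x y
    by (auto simp: rank1_def fun_eq_iff scaleC_fun_def scaleC_complex_def)
  moreover have "rank1 n (c *\<^sub>C y) x = cnj c *\<^sub>C rank1 n y x" for c x y
    by (auto simp: rank1_def fun_eq_iff scaleC_fun_def scaleC_complex_def)
  moreover have "L (A + B) = L A + L B" "L (c *\<^sub>C A) = c * L A" for A B c
    using linear_onD(1,2)[OF L, of A] by (simp_all add: scaleC_complex_def)
  ultimately show ?thesis
    unfolding semi_ip_def using pos by (simp add: add_divide_distrib algebra_simps)
qed

text \<open>The pairing of \<open>F\<close> with the compression
  \<open>\<alpha>^* v \<beta>\<close>, see \<open>cval_sandwich\<close>. It involves the rows of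
  \<alpha> and \<beta> only through sesquilinear forms, so the rows can be rescaled, stacked and
  expanded in other systems.\<close>

definition cval :: "(nat \<Rightarrow> nat \<Rightarrow> 'a \<Rightarrow> complex) \<Rightarrow> nat \<Rightarrow> nat \<Rightarrow> nat \<Rightarrow> nat \<Rightarrow>
    complex matrix \<Rightarrow> 'a matrix \<Rightarrow> complex matrix \<Rightarrow> complex" where
  "cval F n m r s \<alpha> v \<beta> = (\<Sum>k<r. \<Sum>l<s. bform F n m (v k l) (\<alpha> k) (\<beta> l))"

lemma cval_scale: "cval F n m r s (c *\<^sub>C \<alpha>) v (d *\<^sub>C \<beta>) = cnj c * d * cval F n m r s \<alpha> v \<beta>"
proof -
  have "(c *\<^sub>C \<alpha>) k = c *\<^sub>C \<alpha> k" "(d *\<^sub>C \<beta>) k = d *\<^sub>C \<beta> k" for k by (simp_all add: scaleC_fun_def)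
  then show ?thesis
    by (simp add: cval_def bform_scale_left bform_scale_right sum_distrib_left mult_ac)
qed

lemma cval_sandwich:
  fixes F :: "nat \<Rightarrow> nat \<Rightarrow> 'a::complex_vector \<Rightarrow> complex"
  assumes E: "complex_vector.subspace E" and F: "\<And>i j. linear_on E (F i j)"
    and v: "\<And>k l. v k l \<in> E"
  shows "(\<Sum>i<n. \<Sum>j<m. F i j (sandwich r s (adj \<alpha>) v \<beta> i j)) = cval F n m r s \<alpha> v \<beta>"
proof -
  have "F i j (sandwich r s (adj \<alpha>) v \<beta> i j) = (\<Sum>k<r. \<Sum>l<s. cnj (\<alpha> k i) * \<beta> l j * F i j (v k l))" for i j
    unfolding sandwich_def adj_def
    by (simp add: linear_on_sum[OF E F] complex_vector.subspace_sum[OF E]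
      complex_vector.subspace_scale[OF E] v linear_onD(2)[OF F] scaleC_complex_def)
  then show ?thesis unfolding cval_def bform_def by (simp add: sum_swap4[where A="{..<r}"])
qed

lemma cval_stack:
  fixes F :: "nat \<Rightarrow> nat \<Rightarrow> 'a::complex_vector \<Rightarrow> complex"
  assumes E: "complex_vector.subspace E" and F: "\<And>i j. linear_on E (F i j)"
  shows "cval F n m (r + r') (s + s') (stack r \<alpha> \<alpha>') (dsum r s v w) (stack s \<beta> \<beta>') =
    cval F n m r s \<alpha> v \<beta> + cval F n m r' s' \<alpha>' w \<beta>'"
proof -
  have "bform F n m 0 x y = 0" for x y
    using linear_onD(3)[OF bform_linear[OF E F] complex_vector.subspace_0[OF E]] .
  then show ?thesis
    by (simp add: cval_def stack_def dsum_def sum_lessThan_add)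
qed

text \<open>The assumption and the arithmetic-geometric mean inequality give
  \<open>2 Re F(\<alpha>\<^sup>* v \<beta>) \<le> \<parallel>\<alpha>\<^sup>* \<alpha>\<parallel> + \<parallel>\<beta>\<^sup>* \<beta>\<parallel>\<close>. Since \<open>K\<close> is closed under direct sums,
  \<open>(A, B) \<mapsto> inf (\<parallel>A + \<alpha>\<^sup>* \<alpha>\<parallel> + \<parallel>B + \<beta>\<^sup>* \<beta>\<parallel> - 2 Re F(\<alpha>\<^sup>* v \<beta>))\<close> is sublinear, and a linear
  functional below it restricts to positive functionals on the two summands that dominate \<open>F\<close>.
  These are expressed as semi-inner products \<open>p\<close> and \<open>q\<close> of trace at most \<open>1\<close>.\<close>

lemma states_exist:
  fixes F :: "nat \<Rightarrow> nat \<Rightarrow> 'a::complex_vector \<Rightarrow> complex"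
  assumes K: "ds_convex K" and E: "complex_vector.subspace E"
    and KE: "\<forall>r s. \<forall>v\<in>K r s. \<forall>k l. v k l \<in> E"
    and F: "\<And>i j. linear_on E (F i j)" and n: "0 < n" and m: "0 < m"
    and le1: "\<forall>v\<in>K n m. Re (\<Sum>i<n. \<Sum>j<m. F i j (v i j)) \<le> 1"
  shows "\<exists>p q. semi_ip p \<and> semi_ip q \<and>
    (\<Sum>i<n. Re (p (\<lambda>k. if k = i then 1 else 0) (\<lambda>k. if k = i then 1 else 0))) \<le> 1 \<and>
    (\<Sum>i<m. Re (q (\<lambda>k. if k = i then 1 else 0) (\<lambda>k. if k = i then 1 else 0))) \<le> 1 \<and>
    (\<forall>r s \<alpha> \<beta> v. 0 < r \<longrightarrow> 0 < s \<longrightarrow> v \<in> K r s \<longrightarrow>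
      cmod (cval F n m r s \<alpha> v \<beta>) \<le> sqrt (\<Sum>k<r. Re (p (\<alpha> k) (\<alpha> k))) * sqrt (\<Sum>l<s. Re (q (\<beta> l) (\<beta> l))))"
proof -
  have contr: "Re (cval F n m r s \<alpha> v \<beta>) \<le> 1"
    if "0 < r" "0 < s" "\<alpha> \<in> cmats r n" "\<beta> \<in> cmats s m" "v \<in> K r s" "opnorm r n \<alpha> \<le> 1" "opnorm s m \<beta> \<le> 1"
    for r s \<alpha> \<beta> v
  proof -
    have "sandwich r s (adj \<alpha>) v \<beta> \<in> K n m"
      by (rule ds_convexD(4)[OF K n m that])
    from le1[rule_format, OF this] show ?thesis using cval_sandwich[OF E F KE[rule_format, OF that(5)]] by simp
  qed
  have key: "2 * Re (cval F n m r s \<alpha> v \<beta>) \<le> opnorm n n (gram r \<alpha>) + opnorm m m (gram s \<beta>)"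
    if "0 < r" "0 < s" "\<alpha> \<in> cmats r n" "\<beta> \<in> cmats s m" "v \<in> K r s" for r s \<alpha> \<beta> v
  proof -
    have "Re (cval F n m r s \<alpha> v \<beta>) \<le> opnorm r n \<alpha> * opnorm s m \<beta>"
    proof (rule le_mult_of_gt[OF opnorm_nonneg opnorm_nonneg])
      fix a b assume ab: "opnorm r n \<alpha> < a" "opnorm s m \<beta> < b"
      then have pos: "a > 0" "b > 0"
        using opnorm_nonneg[of r n \<alpha>] opnorm_nonneg[of s m \<beta>] by linarith+
      have "Re (cval F n m r s (inverse a *\<^sub>R\<^sub>C \<alpha>) v (inverse b *\<^sub>R\<^sub>C \<beta>)) \<le> 1"
      proof (rule contr)
        show "inverse a *\<^sub>R\<^sub>C \<alpha> \<in> cmats r n" "inverse b *\<^sub>R\<^sub>C \<beta> \<in> cmats s m"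
          using that(3,4) by (auto simp: mats_def scaleC_fun_def scaleC_complex_def)
        show "opnorm r n (inverse a *\<^sub>R\<^sub>C \<alpha>) \<le> 1" "opnorm s m (inverse b *\<^sub>R\<^sub>C \<beta>) \<le> 1"
          unfolding opnorm_scale norm_of_real using pos ab by (simp_all add: field_simps)
      qed (use that in auto)
      then show "Re (cval F n m r s \<alpha> v \<beta>) \<le> a * b"
        unfolding cval_scale using pos by (simp add: field_simps flip: of_real_mult of_real_inverse)
    qed
    then have "2 * Re (cval F n m r s \<alpha> v \<beta>) \<le> 2 * (opnorm r n \<alpha> * opnorm s m \<beta>)" by simp
    also have "\<dots> \<le> (opnorm r n \<alpha>)\<^sup>2 + (opnorm s m \<beta>)\<^sup>2"
      using sum_squares_bound[of "opnorm r n \<alpha>" "opnorm s m \<beta>"] by simp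
    also have "\<dots> \<le> opnorm n n (gram r \<alpha>) + opnorm m m (gram s \<beta>)"
      using power_mono[OF opnorm_le_sqrt_gram[of r n \<alpha>] opnorm_nonneg, of 2]
        power_mono[OF opnorm_le_sqrt_gram[of s m \<beta>] opnorm_nonneg, of 2] by simp
    finally show ?thesis .
  qed
  \<comment> \<open>\<open>I\<close> collects the points of \<open>K\<close> together with
    coefficients. A pair of matrices is coded as a function on \<open>bool\<close>, with
    \<open>False\<close> for the n x n and \<open>True\<close> for the m x m summand, so that pairs
    form a \<open>complex_vector\<close>.\<close>
  define I where "I = {(r, s, \<alpha>, \<beta>, v). 0 < r \<and> 0 < s \<and> \<alpha> \<in> cmats r n \<and> \<beta> \<in> cmats s m \<and> v \<in> K r s}"
  define f where "f z = (\<lambda>(r, s, \<alpha>, \<beta>, v). opnorm n n (z False + gram r \<alpha>) + opnorm m m (z True + gram s \<beta>)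
      - 2 * Re (cval F n m r s \<alpha> v \<beta>))" for z :: "bool \<Rightarrow> complex matrix"
  define P where "P z = (INF i\<in>I. f z i)" for z
  have zero: "(1, 1, 0, 0, 0) \<in> I"
    using ds_convexD(2)[OF K, of 1 1] by (simp add: I_def mats_def)
  have cval0: "cval F n m r s 0 v 0 = 0" "cval F n m r s \<alpha> v 0 = 0" "cval F n m r s 0 v \<beta> = 0" for r s v \<alpha> \<beta>
    by (simp_all add: cval_def bform_zero_left bform_zero_right)
  \<comment> \<open>The triangle inequality separates \<open>z\<close> from the Gram matrices, and
    \<open>key\<close> makes the rest nonnegative; hence the infimum is finite.\<close>
  have lower: "- opnorm n n (z False) - opnorm m m (z True) \<le> f z i" if i: "i \<in> I" for z i
  proof -
    obtain r s \<alpha> \<beta> v where ieq: "i = (r, s, \<alpha>, \<beta>, v)"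
      and mem: "0 < r" "0 < s" "\<alpha> \<in> cmats r n" "\<beta> \<in> cmats s m" "v \<in> K r s"
      using i by (auto simp: I_def)
    have "opnorm n n (gram r \<alpha>) \<le> opnorm n n (z False + gram r \<alpha>) + opnorm n n (z False)"
      using opnorm_triangle[of n n "z False + gram r \<alpha>" "- z False"] by (simp add: opnorm_minus)
    moreover have "opnorm m m (gram s \<beta>) \<le> opnorm m m (z True + gram s \<beta>) + opnorm m m (z True)"
      using opnorm_triangle[of m m "z True + gram s \<beta>" "- z True"] by (simp add: opnorm_minus)
    ultimately show ?thesis using key[OF mem] by (simp add: f_def ieq)
  qed
  have le: "P z \<le> f z i" if "i \<in> I" for z i
    unfolding P_def using that lower[of _ z] by (intro cINF_lower bdd_belowI2) auto
  have ne: "I \<noteq> {}" using zero by blast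
  have subP: "sublinear_on UNIV P"
  proof (rule sublinear_onI[OF complex_vector.subspace_UNIV])
    fix z w
    show "P (z + w) \<le> P z + P w"
      unfolding P_def[of z] P_def[of w]
    proof (rule le_cINF_add[OF ne ne])
      fix i j assume "i \<in> I" "j \<in> I"
      then obtain r s \<alpha> \<beta> v r' s' \<alpha>' \<beta>' v'
        where ieq: "i = (r, s, \<alpha>, \<beta>, v)" "j = (r', s', \<alpha>', \<beta>', v')"
          and mem: "0 < r" "0 < s" "\<alpha> \<in> cmats r n" "\<beta> \<in> cmats s m" "v \<in> K r s"
          and mem': "0 < r'" "0 < s'" "\<alpha>' \<in> cmats r' n" "\<beta>' \<in> cmats s' m" "v' \<in> K r' s'"
        by (auto simp: I_def)
      have "dsum r s v v' \<in> K (r + r') (s + s')"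
        by (rule ds_convexD(3)[OF K mem(1,2) mem'(1,2) mem(5) mem'(5)])
      then have "(r + r', s + s', stack r \<alpha> \<alpha>', stack s \<beta> \<beta>', dsum r s v v') \<in> I"
        using mem mem' by (simp add: I_def stack_cmats)
      then have "P (z + w) \<le> f (z + w) (r + r', s + s', stack r \<alpha> \<alpha>', stack s \<beta> \<beta>', dsum r s v v')"
        by (rule le)
      have ab4: "a + b + (c + d) = a + c + (b + d)" for a b c d :: "complex matrix"
        by (simp add: add_ac)
      have eq1: "(z + w) False + (gram r \<alpha> + gram r' \<alpha>') = (z False + gram r \<alpha>) + (w False + gram r' \<alpha>')"
        unfolding plus_fun_apply[of z w] by (rule ab4)
      have eq2: "(z + w) True + (gram s \<beta> + gram s' \<beta>') = (z True + gram s \<beta>) + (w True + gram s' \<beta>')"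
        unfolding plus_fun_apply[of z w] by (rule ab4)
      have arith: "a \<le> b + c \<Longrightarrow> d \<le> e + g \<Longrightarrow> a + d - 2 * (x + y) \<le> b + e - 2 * x + (c + g - 2 * y)"
        for a b c d e g x y :: real by simp
      note \<open>P (z + w) \<le> f (z + w) (r + r', s + s', stack r \<alpha> \<alpha>', stack s \<beta> \<beta>', dsum r s v v')\<close>
      also have "f (z + w) (r + r', s + s', stack r \<alpha> \<alpha>', stack s \<beta> \<beta>', dsum r s v v') \<le> f z i + f w j"
        using opnorm_triangle[of n n "z False + gram r \<alpha>" "w False + gram r' \<alpha>'"]
          opnorm_triangle[of m m "z True + gram s \<beta>" "w True + gram s' \<beta>'"]
        unfolding f_def ieq prod.case gram_stack cval_stack[OF E F] eq1 eq2 plus_complex.simps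
        by (rule arith)
      finally show "P (z + w) \<le> f z i + f w j" .
    qed
  next
    fix t :: real and z assume t: "0 < t"
    show "P (t *\<^sub>R\<^sub>C z) \<le> t * P z"
      unfolding P_def[of z]
    proof (rule le_cINF_mult[OF ne t])
      fix i assume i: "i \<in> I"
      then obtain r s \<alpha> \<beta> v where ieq: "i = (r, s, \<alpha>, \<beta>, v)"
        and mem: "0 < r" "0 < s" "\<alpha> \<in> cmats r n" "\<beta> \<in> cmats s m" "v \<in> K r s"
        by (auto simp: I_def)
      \<comment> \<open>Gram matrices and the pairing are quadratic in the coefficients, hence the
        factor \<open>sqrt t\<close>.\<close>
      let ?j = "(r, s, sqrt t *\<^sub>R\<^sub>C \<alpha>, sqrt t *\<^sub>R\<^sub>C \<beta>, v)"
      have "?j \<in> I" using mem by (auto simp: I_def mats_def scaleC_fun_def scaleC_complex_def)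
      then have "P (t *\<^sub>R\<^sub>C z) \<le> f (t *\<^sub>R\<^sub>C z) ?j" by (rule le)
      also have "\<dots> = t * f z i"
      proof -
        have sq: "(cmod (complex_of_real (sqrt t)))\<^sup>2 = t" using t by simp
        have g: "(t *\<^sub>R\<^sub>C z) c + t *\<^sub>R\<^sub>C A = t *\<^sub>R\<^sub>C (z c + A)" for c A
          by (simp add: scaleC_add_right scaleC_fun_def[of _ z])
        have "cnj (complex_of_real (sqrt t)) * complex_of_real (sqrt t) = complex_of_real t"
          using t by (simp flip: of_real_mult)
        then show ?thesis
          unfolding f_def ieq prod.case gram_scale sq g opnorm_scale cval_scale
          using t by (simp add: algebra_simps)
      qed
      finally show "P (t *\<^sub>R\<^sub>C z) \<le> t * f z i" .
    qed
  next
    have "P 0 \<le> 0" using le[OF zero, of 0] by (simp add: f_def cval0)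
    moreover have "0 \<le> P 0"
      unfolding P_def using ne lower[of _ 0] by (intro cINF_greatest) auto
    ultimately show "P 0 = 0" by simp
  qed
  obtain l where l: "real_linear_on UNIV l" "\<And>z. l z \<le> P z"
    using hahn_banach[OF complex_vector.subspace_UNIV subP] by auto
  have ladd: "l (x + y) = l x + l y" and lscale: "l (t *\<^sub>R\<^sub>C x) = t * l x" for x y t
    using l(1) unfolding real_linear_on_def by blast+
  have lneg: "l (- x) = - l x" for x
    using lscale[of "- 1" x] by (simp add: complex_vector.scale_minus_left scaleC_one)
  define L where "L z = Complex (l z) (- l (\<i> *\<^sub>C z))" for z
  have L: "linear_on UNIV L"
    unfolding L_def by (rule complexify[OF complex_vector.subspace_UNIV l(1)])
  have ReL: "Re (L z) = l z" for z by (simp add: L_def)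
  define e where "e b A = (\<lambda>c. if c = b then A else 0)" for b :: bool and A :: "complex matrix"
  have eadd: "e b (A + B) = e b A + e b B" and escale: "e b (c *\<^sub>C A) = c *\<^sub>C e b A" for b A B c
    by (auto simp: e_def fun_eq_iff scaleC_fun_def scaleC_complex_def)
  have Le: "linear_on UNIV (\<lambda>A. L (e b A))" for b
    using linear_onD(1,2)[OF L] unfolding linear_on_def by (simp add: eadd escale)
  have lsum: "l (e b (\<Sum>k\<in>S. A k)) = (\<Sum>k\<in>S. l (e b (A k)))" for b A and S :: "nat set"
    using linear_on_sum[OF complex_vector.subspace_UNIV Le, of S A b]
    by (simp flip: ReL)
  have le0: "l z \<le> f z i" if "i \<in> I" for z i using l(2)[of z] le[OF that, of z] by simp
  have leop: "l (e b A) \<le> opnorm (if b then m else n) (if b then m else n) A" for b A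
    using le0[OF zero, of "e b A"] by (cases b) (simp_all add: f_def e_def cval0)
  define row :: "nat \<Rightarrow> (nat \<Rightarrow> complex) \<Rightarrow> complex matrix"
    where "row N x = (\<lambda>a i. if a = 0 \<and> i < N then x i else 0)" for N x
  have row: "row N x \<in> cmats 1 N" "gram 1 (row N x) = rank1 N x x" for N x
    by (auto simp: row_def mats_def gram_def adj_def rank1_def fun_eq_iff)
  have K0: "0 \<in> K 1 1" using ds_convexD(2)[OF K, of 1 1] by simp
  \<comment> \<open>Positivity: at minus the Gram matrix of the row \<open>x\<close>, with that row
    as \<alpha> and with \<beta> = 0, the bound \<open>le0\<close> equals 0.\<close>
  have pos0: "0 \<le> l (e False (rank1 n x x))" for x
  proof -
    have "(1, 1, row n x, 0, 0) \<in> I" using row[of n x] K0 by (simp add: I_def mats_def)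
    from le0[OF this, of "- e False (rank1 n x x)"] show ?thesis
      using row(2)[of n x] by (simp add: f_def cval0 lneg e_def)
  qed
  have pos1: "0 \<le> l (e True (rank1 m x x))" for x
  proof -
    have "(1, 1, 0, row m x, 0) \<in> I" using row[of m x] K0 by (simp add: I_def mats_def)
    from le0[OF this, of "- e True (rank1 m x x)"] show ?thesis
      using row(2)[of m x] by (simp add: f_def cval0 lneg e_def)
  qed
  define p where "p = (\<lambda>x y. (L (e False (rank1 n x y)) + cnj (L (e False (rank1 n y x)))) / 2)"
  define q where "q = (\<lambda>x y. (L (e True (rank1 m x y)) + cnj (L (e True (rank1 m y x)))) / 2)"
  have p: "semi_ip p" unfolding p_def
    by (rule semi_ip_rank1[OF Le]) (simp add: ReL pos0)
  have q: "semi_ip q" unfolding q_def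
    by (rule semi_ip_rank1[OF Le]) (simp add: ReL pos1)
  have Rep: "Re (p x x) = l (e False (rank1 n x x))" for x by (simp add: p_def ReL)
  have Req: "Re (q x x) = l (e True (rank1 m x x))" for x by (simp add: q_def ReL)
  \<comment> \<open>The traces of \<open>p\<close> and \<open>q\<close> are the values of
    \<open>l\<close> at the two identity matrices, which \<open>leop\<close> bounds by their
    norms.\<close>
  have sum_unit: "(\<Sum>i<N. rank1 N (\<lambda>k. if k = i then 1 else 0) (\<lambda>k. if k = i then 1 else 0)) = id_mat N" for N
  proof (intro ext)
    fix a b
    have "(\<Sum>i<N. rank1 N (\<lambda>k. if k = i then 1 else 0) (\<lambda>k. if k = i then 1 else 0)) a b =
       (\<Sum>i<N. if i = a then (if a = b \<and> a < N then 1 else 0) else 0)"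
      unfolding sum_fun_apply by (intro sum.cong) (auto simp: rank1_def)
    then show "(\<Sum>i<N. rank1 N (\<lambda>k. if k = i then 1 else 0) (\<lambda>k. if k = i then 1 else 0)) a b = id_mat N a b"
      by (auto simp: id_mat_def)
  qed
  have trp: "(\<Sum>i<n. Re (p (\<lambda>k. if k = i then 1 else 0) (\<lambda>k. if k = i then 1 else 0))) \<le> 1"
    unfolding Rep lsum[symmetric] sum_unit using leop[of False "id_mat n"] opnorm_id_mat[of n] by simp
  have trq: "(\<Sum>i<m. Re (q (\<lambda>k. if k = i then 1 else 0) (\<lambda>k. if k = i then 1 else 0))) \<le> 1"
    unfolding Req lsum[symmetric] sum_unit using leop[of True "id_mat m"] opnorm_id_mat[of m] by simp
  have two: "2 * Re (cval F n m r s \<alpha> v \<beta>) \<le> (\<Sum>k<r. Re (p (\<alpha> k) (\<alpha> k))) + (\<Sum>k<s. Re (q (\<beta> k) (\<beta> k)))"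
    if rs: "0 < r" "0 < s" "v \<in> K r s" for r s \<alpha> \<beta> v
  proof -
    \<comment> \<open>The rows are cut off to lie in \<open>cmats\<close>; the pairing reads only
      the entries that remain.\<close>
    define tr where "tr R N \<gamma> = (\<lambda>k i. if k < R \<and> i < N then \<gamma> k i else 0)" for R N and \<gamma> :: "complex matrix"
    have trm: "tr R N \<gamma> \<in> cmats R N" for R N \<gamma> by (auto simp: tr_def mats_def)
    have gr: "gram R (tr R N \<gamma>) = (\<Sum>k<R. rank1 N (\<gamma> k) (\<gamma> k))" for R N \<gamma>
      by (auto simp: gram_def adj_def tr_def rank1_def fun_eq_iff sum_fun_apply intro!: sum.cong)
    have cv: "cval F n m r s (tr r n \<alpha>) v (tr s m \<beta>) = cval F n m r s \<alpha> v \<beta>"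
      unfolding cval_def by (intro sum.cong refl bform_cong) (auto simp: tr_def)
    \<comment> \<open>At minus the two Gram matrices both norms in \<open>f\<close> vanish, and only
      minus twice the real part of the pairing is left.\<close>
    let ?z = "- (e False (gram r (tr r n \<alpha>)) + e True (gram s (tr s m \<beta>)))"
    have "(r, s, tr r n \<alpha>, tr s m \<beta>, v) \<in> I" using that trm by (simp add: I_def)
    from le0[OF this, of ?z]
    have "l ?z \<le> - 2 * Re (cval F n m r s \<alpha> v \<beta>)"
      by (simp add: f_def e_def cv)
    moreover have "l ?z = - (l (e False (gram r (tr r n \<alpha>))) + l (e True (gram s (tr s m \<beta>))))"
      by (simp only: lneg ladd)
    ultimately show ?thesis unfolding gr lsum Rep Req by simp
  qed
  have bound: "cmod (cval F n m r s \<alpha> v \<beta>) \<le> sqrt (\<Sum>k<r. Re (p (\<alpha> k) (\<alpha> k))) * sqrt (\<Sum>l<s. Re (q (\<beta> l) (\<beta> l)))"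
    if rs: "0 < r" "0 < s" "v \<in> K r s" for r s \<alpha> \<beta> v
  proof (rule le_sqrt_mult)
    show "0 \<le> (\<Sum>k<r. Re (p (\<alpha> k) (\<alpha> k)))" "0 \<le> (\<Sum>l<s. Re (q (\<beta> l) (\<beta> l)))"
      using semi_ip_nonneg[OF p] semi_ip_nonneg[OF q] by (auto intro!: sum_nonneg)
    fix t :: real assume t: "0 < t"
    obtain u where u: "cmod u = 1" "u * cval F n m r s \<alpha> v \<beta> = complex_of_real (cmod (cval F n m r s \<alpha> v \<beta>))"
      by (rule Complex_linear_rotate)
    \<comment> \<open>\<alpha> is multiplied by \<open>t\<close> and \<beta> by
      \<open>u / t\<close>: the phase \<open>u\<close> turns the pairing into its modulus, and
      \<open>t\<close> balances the two sums as \<open>le_sqrt_mult\<close> requires.\<close>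
    define d where "d = complex_of_real (inverse t) * u"
    have "cval F n m r s (t *\<^sub>R\<^sub>C \<alpha>) v (d *\<^sub>C \<beta>) = complex_of_real (cmod (cval F n m r s \<alpha> v \<beta>))"
      unfolding cval_scale u(2)[symmetric] d_def using t by simp
    moreover have "Re (p ((t *\<^sub>R\<^sub>C \<alpha>) k) ((t *\<^sub>R\<^sub>C \<alpha>) k)) = t\<^sup>2 * Re (p (\<alpha> k) (\<alpha> k))" for k
      unfolding scaleC_fun_def[of _ \<alpha>]
      by (simp add: semi_ip_scale_left[OF p] semi_ip_scale_right[OF p] power2_eq_square)
    moreover have "Re (q ((d *\<^sub>C \<beta>) k) ((d *\<^sub>C \<beta>) k)) = Re (q (\<beta> k) (\<beta> k)) / t\<^sup>2" for k
    proof -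
      have "cmod d = inverse t"
        unfolding d_def norm_mult norm_of_real u(1) using t by simp
      then have "cnj d * d = complex_of_real (1 / t\<^sup>2)"
        unfolding cnj_mult_self by (simp add: inverse_eq_divide power_divide)
      then have "cnj d * (d * q (\<beta> k) (\<beta> k)) = complex_of_real (1 / t\<^sup>2) * q (\<beta> k) (\<beta> k)"
        by (simp only: mult.assoc[symmetric])
      moreover have "q (d *\<^sub>C x) (d *\<^sub>C x) = cnj d * (d * q x x)" for x
        by (simp add: semi_ip_scale_left[OF q] semi_ip_scale_right[OF q] mult_ac)
      ultimately have "q ((d *\<^sub>C \<beta>) k) ((d *\<^sub>C \<beta>) k) = complex_of_real (1 / t\<^sup>2) * q (\<beta> k) (\<beta> k)"
        unfolding scaleC_fun_def[of _ \<beta>] by simp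
      then show ?thesis by (simp del: of_real_divide of_real_power)
    qed
    ultimately show "2 * cmod (cval F n m r s \<alpha> v \<beta>) \<le>
        t\<^sup>2 * (\<Sum>k<r. Re (p (\<alpha> k) (\<alpha> k))) + (\<Sum>l<s. Re (q (\<beta> l) (\<beta> l))) / t\<^sup>2"
      using two[OF rs, of "t *\<^sub>R\<^sub>C \<alpha>" "d *\<^sub>C \<beta>"] by (simp add: sum_distrib_left sum_divide_distrib)
  qed
  show ?thesis
    using p q trp trq bound by (intro exI[of _ p] exI[of _ q] conjI allI impI)
qed

text \<open>\<open>u\<close> and \<open>z\<close> are orthonormal for \<open>p\<close> and \<open>q\<close>, so that \<open>F(u\<^sub>a, z\<^sub>b)\<close> is contractive on
  \<open>K\<close>, while \<open>R\<close> and \<open>S\<close> express the standard basis up to null vectors, which \<open>F\<close> ignores.\<close>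

lemma factorization:
  fixes F :: "nat \<Rightarrow> nat \<Rightarrow> 'a::complex_vector \<Rightarrow> complex"
  assumes K: "ds_convex K" and E: "complex_vector.subspace E"
    and KE: "\<forall>r s. \<forall>v\<in>K r s. \<forall>k l. v k l \<in> E"
    and absorb: "\<forall>w\<in>E. \<exists>t>0. sing (t *\<^sub>R\<^sub>C w) \<in> K 1 1"
    and F: "\<And>i j. linear_on E (F i j)" and n: "0 < n" and m: "0 < m"
    and le1: "\<forall>v\<in>K n m. Re (\<Sum>i<n. \<Sum>j<m. F i j (v i j)) \<le> 1"
  shows "\<exists>u z R S. (\<forall>i<n. \<forall>j<m. \<forall>w\<in>E.
      F i j w = (\<Sum>a<n. \<Sum>b<m. cnj (R a i) * S b j * bform F n m w (u a) (z b))) \<and>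
    hs n n R \<le> 1 \<and> hs m m S \<le> 1 \<and>
    (\<forall>r>0. \<forall>s>0. \<forall>v\<in>K r s. \<forall>\<xi> \<eta>.
      cmod (quad r s n m (\<lambda>k l a b. bform F n m (v k l) (u a) (z b)) \<xi> \<eta>) \<le> hs r n \<xi> * hs s m \<eta>)"
proof -
  define e :: "nat \<Rightarrow> nat \<Rightarrow> complex" where "e i = (\<lambda>k. if k = i then 1 else 0)" for i
  have "\<exists>p q. semi_ip p \<and> semi_ip q \<and>
      (\<Sum>i<n. Re (p (e i) (e i))) \<le> 1 \<and> (\<Sum>i<m. Re (q (e i) (e i))) \<le> 1 \<and>
      (\<forall>r s \<alpha> \<beta> v. 0 < r \<longrightarrow> 0 < s \<longrightarrow> v \<in> K r s \<longrightarrow> cmod (cval F n m r s \<alpha> v \<beta>) \<le>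
        sqrt (\<Sum>k<r. Re (p (\<alpha> k) (\<alpha> k))) * sqrt (\<Sum>l<s. Re (q (\<beta> l) (\<beta> l))))"
    unfolding e_def by (rule states_exist[where F=F and n=n and m=m and E=E and K=K, OF K E KE F n m le1])
  then obtain p q where p: "semi_ip p" and q: "semi_ip q"
    and trp: "(\<Sum>i<n. Re (p (e i) (e i))) \<le> 1" and trq: "(\<Sum>i<m. Re (q (e i) (e i))) \<le> 1"
    and bound': "\<forall>r s \<alpha> \<beta> v. 0 < r \<longrightarrow> 0 < s \<longrightarrow> v \<in> K r s \<longrightarrow> cmod (cval F n m r s \<alpha> v \<beta>) \<le>
        sqrt (\<Sum>k<r. Re (p (\<alpha> k) (\<alpha> k))) * sqrt (\<Sum>l<s. Re (q (\<beta> l) (\<beta> l)))"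
    by (elim exE conjE)
  note bound = bound'[rule_format]
  obtain u where U: "(\<forall>\<xi>. Re (p (\<Sum>a<n. \<xi> a *\<^sub>C u a) (\<Sum>a<n. \<xi> a *\<^sub>C u a)) \<le> (\<Sum>a<n. (cmod (\<xi> a))\<^sup>2)) \<and>
    (\<forall>y. (\<Sum>a<n. (cmod (p (u a) y))\<^sup>2) \<le> Re (p y y)) \<and>
    (\<forall>i<n. \<forall>r. r = e i - (\<Sum>a<n. p (u a) (e i) *\<^sub>C u a) \<longrightarrow> p r r = 0)"
    using gram_schmidt[OF p, where x=e and n=n] ..
  note u1 = U[THEN conjunct1, rule_format] and u2 = U[THEN conjunct2, THEN conjunct1, rule_format]
    and u3 = U[THEN conjunct2, THEN conjunct2, rule_format]
  obtain z where Z: "(\<forall>\<xi>. Re (q (\<Sum>a<m. \<xi> a *\<^sub>C z a) (\<Sum>a<m. \<xi> a *\<^sub>C z a)) \<le> (\<Sum>a<m. (cmod (\<xi> a))\<^sup>2)) \<and>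
    (\<forall>y. (\<Sum>a<m. (cmod (q (z a) y))\<^sup>2) \<le> Re (q y y)) \<and>
    (\<forall>i<m. \<forall>r. r = e i - (\<Sum>a<m. q (z a) (e i) *\<^sub>C z a) \<longrightarrow> q r r = 0)"
    using gram_schmidt[OF q, where x=e and n=m] ..
  note z1 = Z[THEN conjunct1, rule_format] and z2 = Z[THEN conjunct2, THEN conjunct1, rule_format]
    and z3 = Z[THEN conjunct2, THEN conjunct2, rule_format]
  define R where "R a i = p (u a) (e i)" for a i
  define S where "S b j = q (z b) (e j)" for b j
  \<comment> \<open>Bessel's inequality at each standard basis vector, summed over the basis, bounds
    the squared Hilbert-Schmidt norm by the trace of \<open>p\<close>.\<close>
  have "(hs n n R)\<^sup>2 \<le> 1\<^sup>2"
  proof -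
    have "(hs n n R)\<^sup>2 = (\<Sum>i<n. \<Sum>a<n. (cmod (p (u a) (e i)))\<^sup>2)"
      unfolding hs_sq R_def by (rule sum.swap)
    also have "\<dots> \<le> (\<Sum>i<n. Re (p (e i) (e i)))" by (intro sum_mono u2)
    finally show ?thesis using trp by simp
  qed
  then have R1: "hs n n R \<le> 1" by (rule power2_le_imp_le) simp
  have "(hs m m S)\<^sup>2 \<le> 1\<^sup>2"
  proof -
    have "(hs m m S)\<^sup>2 = (\<Sum>i<m. \<Sum>a<m. (cmod (q (z a) (e i)))\<^sup>2)"
      unfolding hs_sq S_def by (rule sum.swap)
    also have "\<dots> \<le> (\<Sum>i<m. Re (q (e i) (e i)))" by (intro sum_mono z2)
    finally show ?thesis using trq by simp
  qed
  then have S1: "hs m m S \<le> 1" by (rule power2_le_imp_le) simp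
  \<comment> \<open>Level (1, 1) of the bound, after scaling \<open>w\<close> into \<open>K\<close>:
    it shows that the form of \<open>F\<close> at any \<open>w\<close> in \<open>E\<close> vanishes
    on null vectors of \<open>p\<close> and of \<open>q\<close>.\<close>
  have scalar: "cmod (bform F n m w x y) \<le> sqrt (Re (p x x)) * sqrt (Re (q y y)) / t"
    if t: "0 < t" and mem: "sing (t *\<^sub>R\<^sub>C w) \<in> K 1 1" and w: "w \<in> E" for w x y t
  proof -
    have "cval F n m 1 1 (\<lambda>k. x) (sing (t *\<^sub>R\<^sub>C w)) (\<lambda>l. y) = bform F n m (t *\<^sub>R\<^sub>C w) x y"
      by (simp add: cval_def sing_def)
    also have "\<dots> = complex_of_real t * bform F n m w x y"
      using linear_onD(2)[OF bform_linear[OF E F] w] by (simp add: scaleC_complex_def)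
    finally show ?thesis
      using bound[OF _ _ mem, of "\<lambda>k. x" "\<lambda>l. y"] t by (simp add: norm_mult field_simps)
  qed
  have nullL: "bform F n m w x y = 0" if null: "p x x = 0" and w: "w \<in> E" for w x y
  proof -
    obtain t where "t > 0" "sing (t *\<^sub>R\<^sub>C w) \<in> K 1 1" using absorb w by blast
    from scalar[OF this w, of x y] show ?thesis using null by simp
  qed
  have nullR: "bform F n m w x y = 0" if null: "q y y = 0" and w: "w \<in> E" for w x y
  proof -
    obtain t where "t > 0" "sing (t *\<^sub>R\<^sub>C w) \<in> K 1 1" using absorb w by blast
    from scalar[OF this w, of x y] show ?thesis using null by simp
  qed
  have eq: "F i j w = (\<Sum>a<n. \<Sum>b<m. cnj (R a i) * S b j * bform F n m w (u a) (z b))"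
    if i: "i < n" and j: "j < m" and w: "w \<in> E" for i j w
  proof -
    define x where "x = (\<Sum>a<n. R a i *\<^sub>C u a)"
    define y where "y = (\<Sum>b<m. S b j *\<^sub>C z b)"
    have px: "p (e i - x) (e i - x) = 0" by (rule u3[OF i]) (simp add: x_def R_def)
    have qy: "q (e j - y) (e j - y) = 0" by (rule z3[OF j]) (simp add: y_def S_def)
    have "F i j w = bform F n m w (e i) (e j)"
    proof -
      have inner: "(\<Sum>l<m. cnj (e i k) * e j l * F k l w) = (if k = i then F i j w else 0)" for k
      proof -
        have "(\<Sum>l<m. cnj (e i k) * e j l * F k l w) =
            (\<Sum>l<m. if l = j then (if k = i then F i j w else 0) else 0)"
          by (rule sum.cong) (simp_all add: e_def)
        then show ?thesis using j by simp
      qed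
      have "bform F n m w (e i) (e j) = (\<Sum>k<n. if k = i then F i j w else 0)"
        unfolding bform_def inner ..
      then show ?thesis using i by simp
    qed
    also have "\<dots> = bform F n m w (x + (e i - x)) (e j)" by simp
    also have "\<dots> = bform F n m w x (e j)"
      unfolding bform_add_left nullL[OF px w] by simp
    also have "\<dots> = bform F n m w x (y + (e j - y))" by simp
    also have "\<dots> = bform F n m w x y"
      unfolding bform_add_right nullR[OF qy w] by simp
    also have "\<dots> = (\<Sum>a<n. \<Sum>b<m. cnj (R a i) * S b j * bform F n m w (u a) (z b))"
      unfolding x_def y_def by (rule bform_expand)
    finally show ?thesis .
  qed
  have qb: "cmod (quad r s n m (\<lambda>k l a b. bform F n m (v k l) (u a) (z b)) \<xi> \<eta>) \<le> hs r n \<xi> * hs s m \<eta>"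
    if rs: "0 < r" "0 < s" "v \<in> K r s" for r s v \<xi> \<eta>
  proof -
    \<comment> \<open>With rows synthesized from \<xi> and \<eta> the amplified form is a value of
      \<open>cval\<close>, and contractivity of the synthesis replaces \<open>p\<close> and
      \<open>q\<close> by Euclidean norms.\<close>
    define \<alpha> where "\<alpha> k = (\<Sum>a<n. \<xi> k a *\<^sub>C u a)" for k
    define \<beta> where "\<beta> k = (\<Sum>a<m. \<eta> k a *\<^sub>C z a)" for k
    have "quad r s n m (\<lambda>k l a b. bform F n m (v k l) (u a) (z b)) \<xi> \<eta> =
        (\<Sum>k<r. \<Sum>l<s. \<Sum>a<n. \<Sum>b<m. cnj (\<xi> k a) * bform F n m (v k l) (u a) (z b) * \<eta> l b)"
      unfolding quad_def by (intro sum.cong refl sum.swap)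
    also have "\<dots> = cval F n m r s \<alpha> v \<beta>"
      unfolding cval_def \<alpha>_def \<beta>_def bform_expand by (simp add: mult_ac)
    finally have "cmod (quad r s n m (\<lambda>k l a b. bform F n m (v k l) (u a) (z b)) \<xi> \<eta>) \<le>
        sqrt (\<Sum>k<r. Re (p (\<alpha> k) (\<alpha> k))) * sqrt (\<Sum>l<s. Re (q (\<beta> l) (\<beta> l)))"
      using bound[OF rs] by simp
    also have "\<dots> \<le> sqrt ((hs r n \<xi>)\<^sup>2) * sqrt ((hs s m \<eta>)\<^sup>2)"
      unfolding hs_sq \<alpha>_def \<beta>_def
      by (intro mult_mono real_sqrt_le_mono sum_mono u1 z1)
        (auto intro!: sum_nonneg semi_ip_nonneg[OF q])
    finally show ?thesis by simp
  qed
  show ?thesis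
    by (intro exI[of _ u] exI[of _ z] exI[of _ R] exI[of _ S] conjI allI ballI impI eq R1 S1 qb)
qed

section \<open>Affine maps between rectangular matrix convex sets\<close>

lemma rmconvexD:
  assumes K: "rmconvex K"
  shows "K n m \<subseteq> mats n m UNIV"
    and "K n m \<noteq> {} \<longleftrightarrow> 0 < n \<and> 0 < m"
    and "0 < (l::nat) \<Longrightarrow> 0 < n \<Longrightarrow> 0 < m \<Longrightarrow>
      (\<And>i. i < l \<Longrightarrow> \<alpha> i \<in> cmats (N i) n \<and> \<beta> i \<in> cmats (M i) m \<and> v i \<in> K (N i) (M i)) \<Longrightarrow>
      opnorm n n (\<Sum>i<l. gram (N i) (\<alpha> i)) * opnorm m m (\<Sum>i<l. gram (M i) (\<beta> i)) \<le> 1 \<Longrightarrow>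
      (\<Sum>i<l. sandwich (N i) (M i) (adj (\<alpha> i)) (v i) (\<beta> i)) \<in> K n m"
proof -
  note D = K[unfolded rmconvex_def]
  show "K n m \<subseteq> mats n m UNIV" using D[THEN conjunct1] by simp
  show "K n m \<noteq> {} \<longleftrightarrow> 0 < n \<and> 0 < m" using D[THEN conjunct2, THEN conjunct1] by simp
  assume "0 < (l::nat)" "0 < n" "0 < m"
    "\<And>i. i < l \<Longrightarrow> \<alpha> i \<in> cmats (N i) n \<and> \<beta> i \<in> cmats (M i) m \<and> v i \<in> K (N i) (M i)"
    "opnorm n n (\<Sum>i<l. gram (N i) (\<alpha> i)) * opnorm m m (\<Sum>i<l. gram (M i) (\<beta> i)) \<le> 1"
  then show "(\<Sum>i<l. sandwich (N i) (M i) (adj (\<alpha> i)) (v i) (\<beta> i)) \<in> K n m"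
    by (intro D[THEN conjunct2, THEN conjunct2, rule_format] conjI allI impI) blast+
qed

lemma rm_affineD:
  assumes "rm_affine K T \<theta>"
  shows "v \<notin> K n m \<Longrightarrow> \<theta> n m v = 0"
    and "v \<in> K n m \<Longrightarrow> \<theta> n m v \<in> T n m"
proof -
  note D = assms[unfolded rm_affine_def]
  show "v \<notin> K n m \<Longrightarrow> \<theta> n m v = 0" using D[THEN conjunct1] by simp
  show "v \<in> K n m \<Longrightarrow> \<theta> n m v \<in> T n m" using D[THEN conjunct2, THEN conjunct1] by simp
qed

lemma rm_affine_comb:
  assumes "rm_affine K T \<theta>"
    and "0 < (l::nat)" "0 < n" "0 < m"
    and "\<And>i. i < l \<Longrightarrow> \<alpha> i \<in> cmats (N i) n \<and> \<beta> i \<in> cmats (M i) m \<and> v i \<in> K (N i) (M i)"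
    and "(\<Sum>i<l. gram (N i) (\<alpha> i)) = id_mat n" "(\<Sum>i<l. gram (M i) (\<beta> i)) = id_mat m"
  shows "\<theta> n m (\<Sum>i<l. sandwich (N i) (M i) (adj (\<alpha> i)) (v i) (\<beta> i)) =
          (\<Sum>i<l. sandwich (N i) (M i) (adj (\<alpha> i)) (\<theta> (N i) (M i) (v i)) (\<beta> i))"
  using assms(2-)
  by (intro assms(1)[unfolded rm_affine_def, THEN conjunct2, THEN conjunct2, rule_format] conjI allI impI) blast+

text \<open>The coordinate coisometry that places a block at offset \<open>p\<close>: a compression
  by two such matrices moves \<open>x\<close> to position (p, q), see
  \<open>sandwich_emb\<close>.\<close>

definition emb :: "nat \<Rightarrow> nat \<Rightarrow> complex matrix" where
  "emb n p = (\<lambda>a i. if a < n \<and> i = p + a then 1 else 0)"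

definition col :: "nat \<Rightarrow> (nat \<Rightarrow> complex) \<Rightarrow> complex matrix" where
  "col n x = (\<lambda>a k. if a < n \<and> k = 0 then x a else 0)"

lemma emb_cmats: "p + n \<le> N \<Longrightarrow> emb n p \<in> cmats n N"
  by (auto simp: emb_def mats_def)

lemma col_cmats: "col n x \<in> cmats n 1"
  by (auto simp: col_def mats_def)

lemma sing_mats: "sing x \<in> mats 1 1 UNIV"
  by (auto simp: sing_def mats_def)

lemma sing_zero [simp]: "sing 0 = 0"
  by (auto simp: sing_def fun_eq_iff)

lemma sing_00 [simp]: "sing x 0 0 = x"
  by (simp add: sing_def)

lemma mats_1_eq_sing: "v \<in> mats 1 1 S \<Longrightarrow> v = sing (v 0 0)"
  by (auto simp: mats_def sing_def fun_eq_iff)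

lemma sandwich_emb:
  "sandwich n m (adj (emb n p)) x (emb m q) =
    (\<lambda>i j. if p \<le> i \<and> i < p + n \<and> q \<le> j \<and> j < q + m then x (i - p) (j - q) else 0)"
proof (intro ext)
  fix i j
  have "(\<Sum>b<m. (adj (emb n p) i a * emb m q b j) *\<^sub>C x a b) =
      (if a < n \<and> i = p + a then (if q \<le> j \<and> j < q + m then x a (j - q) else 0) else 0)" for a
  proof -
    have "(\<Sum>b<m. (adj (emb n p) i a * emb m q b j) *\<^sub>C x a b) =
      (\<Sum>b<m. if b = j - q then (if q \<le> j \<and> a < n \<and> i = p + a then x a (j - q) else 0) else 0)"
      by (rule sum.cong) (auto simp: adj_def emb_def scaleC_one)
    then show ?thesis by auto
  qed
  then have "sandwich n m (adj (emb n p)) x (emb m q) i j =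
      (\<Sum>a<n. if a < n \<and> i = p + a then (if q \<le> j \<and> j < q + m then x a (j - q) else 0) else 0)"
    by (simp only: sandwich_def)
  also have "\<dots> = (\<Sum>a<n. if a = i - p then (if p \<le> i \<and> q \<le> j \<and> j < q + m then x (i - p) (j - q) else 0) else 0)"
    by (rule sum.cong) auto
  also have "\<dots> = (if p \<le> i \<and> i < p + n \<and> q \<le> j \<and> j < q + m then x (i - p) (j - q) else 0)"
    by auto
  finally show "sandwich n m (adj (emb n p)) x (emb m q) i j = \<dots>" .
qed

lemma sandwich_col:
  "sandwich n m (adj (col n x)) v (col m y) = sing (\<Sum>a<n. \<Sum>b<m. (cnj (x a) * y b) *\<^sub>C v a b)"
  by (auto simp: sandwich_def adj_def col_def sing_def fun_eq_iff intro!: sum.cong sum.neutral)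

lemma gram_emb: "gram n (emb n p) = (\<lambda>i j. if i = j \<and> p \<le> i \<and> i < p + n then 1 else 0)"
proof (intro ext)
  fix i j
  have "gram n (emb n p) i j = (\<Sum>a<n. if a = i - p then (if i = j \<and> p \<le> i then 1 else 0) else 0)"
    unfolding gram_def by (rule sum.cong) (auto simp: adj_def emb_def)
  then show "gram n (emb n p) i j = (if i = j \<and> p \<le> i \<and> i < p + n then 1 else 0)" by auto
qed

lemma opnorm_col: "opnorm n 1 (col n x) \<le> nrm n x"
proof (rule opnorm_leI2)
  fix y
  have eq: "nrm n (\<lambda>i. \<Sum>j<1. col n x i j * y j) = nrm n (\<lambda>i. y 0 * x i)"
    by (rule L2_set_cong) (auto simp: col_def mult.commute)
  show "nrm n (\<lambda>i. \<Sum>j<1. col n x i j * y j) \<le> nrm n x * nrm 1 y"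
    unfolding eq nrm_scale by (simp add: lessThan_Suc mult.commute)
qed simp

lemma rmconvex_sandwich:
  assumes K: "rmconvex K" and nm: "0 < n" "0 < m" and mem: "\<alpha> \<in> cmats r n" "\<beta> \<in> cmats s m" "v \<in> K r s"
    and le: "opnorm r n \<alpha> \<le> 1" "opnorm s m \<beta> \<le> 1"
  shows "sandwich r s (adj \<alpha>) v \<beta> \<in> K n m"
proof -
  have "opnorm n n (gram r \<alpha>) * opnorm m m (gram s \<beta>) \<le> 1 * 1"
  proof (rule mult_mono)
    show "opnorm n n (gram r \<alpha>) \<le> 1"
      using opnorm_gram_le[of n r \<alpha>] power_mono[OF le(1) opnorm_nonneg, of 2] by simp
    show "opnorm m m (gram s \<beta>) \<le> 1"
      using opnorm_gram_le[of m s \<beta>] power_mono[OF le(2) opnorm_nonneg, of 2] by simp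
  qed auto
  then show ?thesis
    using rmconvexD(3)[OF K zero_less_one nm, where \<alpha>="\<lambda>_. \<alpha>" and \<beta>="\<lambda>_. \<beta>" and N="\<lambda>_. r" and M="\<lambda>_. s"
        and v="\<lambda>_. v"] mem by simp
qed

lemma zero_in_rmconvex:
  assumes K: "rmconvex K" and nm: "0 < n" "0 < m"
  shows "0 \<in> K n m"
proof -
  obtain v where "v \<in> K n m" using rmconvexD(2)[OF K, of n m] nm by blast
  from rmconvex_sandwich[OF K nm _ _ this, of 0 0]
  have "sandwich n m (adj 0) v 0 \<in> K n m" by (simp add: mats_def)
  moreover have "sandwich n m (adj 0) v 0 = 0" by (simp add: sandwich_def adj_def fun_eq_iff)
  ultimately show ?thesis by simp
qed

text \<open>The direct sum is the convex combination of the two points with coordinate embeddings as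
  coefficients, whose Gram matrices add up to the identity.\<close>

lemma rmconvex_dsum:
  assumes K: "rmconvex K" and pos: "0 < n" "0 < m" "0 < k" "0 < l" and v: "v \<in> K n m" and w: "w \<in> K k l"
  shows "dsum n m v w \<in> K (n + k) (m + l)"
proof -
  define N where "N i = (if i = 0 then n else k)" for i :: nat
  define M where "M i = (if i = 0 then m else l)" for i :: nat
  define \<alpha> where "\<alpha> i = (if i = 0 then emb n 0 else emb k n)" for i :: nat
  define \<beta> where "\<beta> i = (if i = 0 then emb m 0 else emb l m)" for i :: nat
  define x where "x i = (if i = 0 then v else w)" for i :: nat
  have two: "(\<Sum>i<2. f i) = f 0 + f (1::nat)" for f :: "nat \<Rightarrow> 'z::comm_monoid_add"
    by (simp add: numeral_2_eq_2)
  have g1: "(\<Sum>i<2. gram (N i) (\<alpha> i)) = id_mat (n + k)"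
    unfolding two by (auto simp: N_def \<alpha>_def gram_emb id_mat_def fun_eq_iff)
  have g2: "(\<Sum>i<2. gram (M i) (\<beta> i)) = id_mat (m + l)"
    unfolding two by (auto simp: M_def \<beta>_def gram_emb id_mat_def fun_eq_iff)
  have "(\<Sum>i<2. sandwich (N i) (M i) (adj (\<alpha> i)) (x i) (\<beta> i)) \<in> K (n + k) (m + l)"
  proof (rule rmconvexD(3)[OF K])
    show "opnorm (n + k) (n + k) (\<Sum>i<2. gram (N i) (\<alpha> i)) * opnorm (m + l) (m + l) (\<Sum>i<2. gram (M i) (\<beta> i)) \<le> 1"
      unfolding g1 g2 using mult_mono[OF opnorm_id_mat opnorm_id_mat] by fastforce
    show "\<alpha> i \<in> cmats (N i) (n + k) \<and> \<beta> i \<in> cmats (M i) (m + l) \<and> x i \<in> K (N i) (M i)" if "i < 2" for i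
      using v w by (simp add: \<alpha>_def \<beta>_def N_def M_def x_def emb_cmats)
  qed (use pos in auto)
  moreover have "(\<Sum>i<2. sandwich (N i) (M i) (adj (\<alpha> i)) (x i) (\<beta> i)) = dsum n m v w"
  proof -
    have "w (i - n) (j - m) = 0" if "n + k \<le> i \<or> m + l \<le> j" "n \<le> i" "m \<le> j" for i j
    proof -
      have "k \<le> i - n \<or> l \<le> j - m" using that by auto
      then show ?thesis using rmconvexD(1)[OF K, of k l] w by (auto simp: mats_def)
    qed
    then show ?thesis
      unfolding two
      by (auto simp: N_def M_def \<alpha>_def \<beta>_def x_def sandwich_emb dsum_def fun_eq_iff not_less)
  qed
  ultimately show ?thesis by simp
qed

lemma rmconvex_imp_ds_convex:
  assumes K: "rmconvex K"
  shows "ds_convex K"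
  unfolding ds_convex_def
proof (intro conjI allI impI ballI)
  show "K n m \<subseteq> mats n m UNIV" for n m by (rule rmconvexD(1)[OF K])
qed (use zero_in_rmconvex[OF K] rmconvex_dsum[OF K] rmconvex_sandwich[OF K] in auto)

lemma entry_eq_sum:
  fixes v :: "'a::complex_vector matrix"
  assumes "i < n" "j < m"
  shows "(\<Sum>a<n. \<Sum>b<m. (cnj (if a = i then 1 else 0) * (if b = j then 1 else 0)) *\<^sub>C v a b) = v i j"
proof -
  have "(\<Sum>b<m. (cnj (if a = i then 1 else 0) * (if b = j then 1 else 0)) *\<^sub>C v a b) = (if a = i then v i j else 0)" for a
  proof -
    have "(\<Sum>b<m. (cnj (if a = i then 1 else 0) * (if b = j then 1 else 0)) *\<^sub>C v a b) =
      (\<Sum>b<m. if b = j then (if a = i then v i j else 0) else 0)"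
      by (rule sum.cong) (auto simp: scaleC_one)
    then show ?thesis using assms by simp
  qed
  then show ?thesis using assms by simp
qed

text \<open>For rectangular matrix convex \<open>K\<close> this is the span of all entries of points of \<open>K\<close>.\<close>

definition Esp :: "'a::complex_vector matrix_family \<Rightarrow> 'a set" where
  "Esp K = {w. \<exists>t>0. sing (t *\<^sub>R\<^sub>C w) \<in> K 1 1}"

text \<open>The amplification of \<open>h\<close> to all levels; the value 0 outside
  \<open>K\<close> is the convention for maps on a subset of a type.\<close>

definition lift :: "'a::complex_vector matrix_family \<Rightarrow> ('a \<Rightarrow> 'b::complex_vector) \<Rightarrow> ('a, 'b) family_map" where
  "lift K h = (\<lambda>n m v. if v \<in> K n m then (\<lambda>i j. h (v i j)) else 0)"

context
  fixes K :: "'a::complex_vector matrix_family"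
  assumes K: "rmconvex K"
begin

lemma compress_in_K:
  assumes v: "v \<in> K n m" and x: "nrm n x \<le> 1" and y: "nrm m y \<le> 1"
  shows "sing (\<Sum>a<n. \<Sum>b<m. (cnj (x a) * y b) *\<^sub>C v a b) \<in> K 1 1"
  unfolding sandwich_col[symmetric]
  using x y opnorm_col[of n x] opnorm_col[of m y]
  by (intro rmconvex_sandwich[OF K _ _ col_cmats col_cmats v]) auto

lemma sing_entry_in_K:
  assumes v: "v \<in> K n m" and "i < n" "j < m"
  shows "sing (v i j) \<in> K 1 1"
  using compress_in_K[OF v, of "\<lambda>k. if k = i then 1 else 0" "\<lambda>k. if k = j then 1 else 0"] assms(2,3)
  by (simp only: nrm_unit entry_eq_sum order_refl)

text \<open>Level (1, 1) is absolutely convex: the scalars arise by compressing the direct sum with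
  columns whose entries have moduli \<open>sqrt |c|\<close> and \<open>sqrt |d|\<close>, and the
  phases are put into the left column.\<close>

lemma sing_comb_in_K:
  assumes x: "sing x \<in> K 1 1" and y: "sing y \<in> K 1 1" and le: "cmod c + cmod d \<le> 1"
  shows "sing (c *\<^sub>C x + d *\<^sub>C y) \<in> K 1 1"
proof -
  obtain u where u: "cmod u = 1" "u * c = complex_of_real (cmod c)" by (rule Complex_linear_rotate)
  obtain u' where u': "cmod u' = 1" "u' * d = complex_of_real (cmod d)" by (rule Complex_linear_rotate)
  define a where "a = (\<lambda>i::nat. if i = 0 then complex_of_real (sqrt (cmod c)) * u else complex_of_real (sqrt (cmod d)) * u')"
  define b where "b = (\<lambda>i::nat. if i = 0 then complex_of_real (sqrt (cmod c)) else complex_of_real (sqrt (cmod d)))"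
  have sq: "complex_of_real (sqrt (cmod z)) * complex_of_real (sqrt (cmod z)) = complex_of_real (cmod z)" for z
    by (simp flip: of_real_mult)
  have cu: "cnj u * complex_of_real (cmod c) = c" "cnj u' * complex_of_real (cmod d) = d"
  proof -
    have "cnj u * (u * c) = c" "cnj u' * (u' * d) = d"
      using cnj_mult_self[of u] cnj_mult_self[of u'] u(1) u'(1) by (simp_all flip: mult.assoc)
    then show "cnj u * complex_of_real (cmod c) = c" "cnj u' * complex_of_real (cmod d) = d"
      by (simp_all only: u(2) u'(2))
  qed
  have two: "(\<Sum>i<2. f i) = f 0 + f (1::nat)" for f :: "nat \<Rightarrow> 'z::comm_monoid_add"
    by (simp add: numeral_2_eq_2)
  have na: "(nrm 2 a)\<^sup>2 \<le> 1\<^sup>2" and nb: "(nrm 2 b)\<^sup>2 \<le> 1\<^sup>2"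
    using le u(1) u'(1) unfolding nrm_sq two by (simp_all add: a_def b_def norm_mult)
  have "nrm 2 a \<le> 1" "nrm 2 b \<le> 1"
    by (rule power2_le_imp_le[OF na], simp, rule power2_le_imp_le[OF nb], simp)
  moreover have "dsum 1 1 (sing x) (sing y) \<in> K 2 2"
    using rmconvex_dsum[OF K _ _ _ _ x y] by (simp add: numeral_2_eq_2)
  ultimately have "sing (\<Sum>i<2. \<Sum>j<2. (cnj (a i) * b j) *\<^sub>C dsum 1 1 (sing x) (sing y) i j) \<in> K 1 1"
    by (intro compress_in_K)
  moreover have "(\<Sum>i<2. \<Sum>j<2. (cnj (a i) * b j) *\<^sub>C dsum 1 1 (sing x) (sing y) i j) =
      (cnj u * (complex_of_real (sqrt (cmod c)) * complex_of_real (sqrt (cmod c)))) *\<^sub>C x +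
      (cnj u' * (complex_of_real (sqrt (cmod d)) * complex_of_real (sqrt (cmod d)))) *\<^sub>C y"
    unfolding two by (simp add: dsum_def a_def b_def sing_def mult_ac)
  ultimately show ?thesis unfolding sq cu by simp
qed

lemma Esp_comb:
  assumes t: "0 < t1" "0 < t2" and K1: "sing (t1 *\<^sub>R\<^sub>C w1) \<in> K 1 1" and K2: "sing (t2 *\<^sub>R\<^sub>C w2) \<in> K 1 1"
  obtains t where "t > 0" "cmod (complex_of_real (t / t1) * c) + cmod (complex_of_real (t / t2) * d) \<le> 1"
    "t *\<^sub>R\<^sub>C (c *\<^sub>C w1 + d *\<^sub>C w2) = (complex_of_real (t / t1) * c) *\<^sub>C (t1 *\<^sub>R\<^sub>C w1) + (complex_of_real (t / t2) * d) *\<^sub>C (t2 *\<^sub>R\<^sub>C w2)"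
proof -
  define r where "r = cmod c / t1 + cmod d / t2"
  have r: "r \<ge> 0" using t by (simp add: r_def)
  \<comment> \<open>The summand 1 keeps the denominator positive when
    \<open>c = d = 0\<close>.\<close>
  define t where "t = 1 / (r + 1)"
  have tpos: "t > 0" using r by (simp add: t_def)
  have "cmod (complex_of_real (t / t1) * c) + cmod (complex_of_real (t / t2) * d) = t * r"
    using t tpos unfolding norm_mult norm_of_real by (simp add: r_def field_simps)
  also have "\<dots> \<le> 1" using r by (simp add: t_def)
  finally have 1: "cmod (complex_of_real (t / t1) * c) + cmod (complex_of_real (t / t2) * d) \<le> 1" .
  have "complex_of_real (t / t1) * c * complex_of_real t1 = complex_of_real t * c"
    "complex_of_real (t / t2) * d * complex_of_real t2 = complex_of_real t * d" using t by simp_all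
  then have "t *\<^sub>R\<^sub>C (c *\<^sub>C w1 + d *\<^sub>C w2) = (complex_of_real (t / t1) * c) *\<^sub>C (t1 *\<^sub>R\<^sub>C w1) + (complex_of_real (t / t2) * d) *\<^sub>C (t2 *\<^sub>R\<^sub>C w2)"
    by (simp only: scaleC_scaleC scaleC_add_right)
  then show ?thesis by (rule that[OF tpos 1])
qed

lemma Esp_add_scale: "w1 \<in> Esp K \<Longrightarrow> w2 \<in> Esp K \<Longrightarrow> c *\<^sub>C w1 + d *\<^sub>C w2 \<in> Esp K"
proof -
  assume "w1 \<in> Esp K" "w2 \<in> Esp K"
  then obtain t1 t2 where t: "0 < t1" "0 < t2" "sing (t1 *\<^sub>R\<^sub>C w1) \<in> K 1 1" "sing (t2 *\<^sub>R\<^sub>C w2) \<in> K 1 1"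
    by (auto simp: Esp_def)
  obtain t where t': "t > 0" "cmod (complex_of_real (t / t1) * c) + cmod (complex_of_real (t / t2) * d) \<le> 1"
    "t *\<^sub>R\<^sub>C (c *\<^sub>C w1 + d *\<^sub>C w2) = (complex_of_real (t / t1) * c) *\<^sub>C (t1 *\<^sub>R\<^sub>C w1) + (complex_of_real (t / t2) * d) *\<^sub>C (t2 *\<^sub>R\<^sub>C w2)"
    by (rule Esp_comb[OF t])
  have "sing (t *\<^sub>R\<^sub>C (c *\<^sub>C w1 + d *\<^sub>C w2)) \<in> K 1 1"
    unfolding t'(3) by (rule sing_comb_in_K[OF t(3,4) t'(2)])
  then show ?thesis using t'(1) by (auto simp: Esp_def)
qed

lemma Esp_sing: "sing w \<in> K 1 1 \<Longrightarrow> w \<in> Esp K"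
  unfolding Esp_def by (auto intro!: exI[of _ 1] simp: scaleC_one)

lemma Esp_zero: "0 \<in> Esp K"
  by (rule Esp_sing) (simp add: zero_in_rmconvex[OF K])

lemma Esp_subspace: "complex_vector.subspace (Esp K)"
proof (rule complex_vector.subspaceI)
  show "x + y \<in> Esp K" if "x \<in> Esp K" "y \<in> Esp K" for x y
    using Esp_add_scale[OF that, of 1 1] by (simp add: scaleC_one)
  show "c *\<^sub>C x \<in> Esp K" if "x \<in> Esp K" for c x
    using Esp_add_scale[OF that that, of c 0] by simp
qed (rule Esp_zero)

lemma entry_in_Esp:
  assumes v: "v \<in> K n m"
  shows "v i j \<in> Esp K"
proof (cases "i < n \<and> j < m")
  case True
  then show ?thesis using Esp_sing[OF sing_entry_in_K[OF v]] by blast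
next
  case False
  then have "v i j = 0" using rmconvexD(1)[OF K, of n m] v by (auto simp: mats_def not_less)
  then show ?thesis using Esp_zero by simp
qed

lemma linear_on_sandwich:
  fixes h :: "'a \<Rightarrow> 'b::complex_vector"
  assumes h: "linear_on (Esp K) h" and v: "\<And>a b. v a b \<in> Esp K"
  shows "h (sandwich n m \<alpha> v \<beta> i j) = sandwich n m \<alpha> (\<lambda>i j. h (v i j)) \<beta> i j"
  unfolding sandwich_def
  by (simp add: linear_on_sum[OF Esp_subspace h] complex_vector.subspace_sum[OF Esp_subspace]
      complex_vector.subspace_scale[OF Esp_subspace] v linear_onD(2)[OF h])

lemma sandwich_in_Esp: "(\<And>a b. v a b \<in> Esp K) \<Longrightarrow> sandwich n m \<alpha> v \<beta> i j \<in> Esp K"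
  unfolding sandwich_def
  by (intro complex_vector.subspace_sum[OF Esp_subspace] complex_vector.subspace_scale[OF Esp_subspace])

lemma rm_affine_lift:
  fixes h :: "'a \<Rightarrow> 'b::complex_vector"
  assumes h: "linear_on (Esp K) h" and T: "\<forall>n m. \<forall>v\<in>K n m. (\<lambda>i j. h (v i j)) \<in> T n m"
  shows "rm_affine K T (lift K h)"
  unfolding rm_affine_def
proof (intro conjI allI impI ballI)
  show "lift K h n m v = 0" if "v \<notin> K n m" for n m v using that by (simp add: lift_def)
  show "lift K h n m v \<in> T n m" if "v \<in> K n m" for n m v using that T by (simp add: lift_def)
  fix l n m N M \<alpha> \<beta> and v :: "nat \<Rightarrow> 'a matrix"
  assume A: "0 < (l::nat) \<and> 0 < n \<and> 0 < m \<and>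
    (\<forall>i<l. \<alpha> i \<in> cmats (N i) n \<and> \<beta> i \<in> cmats (M i) m \<and> v i \<in> K (N i) (M i)) \<and>
    (\<Sum>i<l. gram (N i) (\<alpha> i)) = id_mat n \<and> (\<Sum>i<l. gram (M i) (\<beta> i)) = id_mat m"
  let ?s = "\<Sum>i<l. sandwich (N i) (M i) (adj (\<alpha> i)) (v i) (\<beta> i)"
  have sK: "?s \<in> K n m"
  proof (rule rmconvexD(3)[OF K])
    show "opnorm n n (\<Sum>i<l. gram (N i) (\<alpha> i)) * opnorm m m (\<Sum>i<l. gram (M i) (\<beta> i)) \<le> 1"
      using A mult_mono[OF opnorm_id_mat[of n] opnorm_id_mat[of m]] by simp
  qed (use A in blast)+
  have vE: "v i a b \<in> Esp K" if "i < l" for i a b using A that by (blast intro: entry_in_Esp)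
  show "lift K h n m ?s = (\<Sum>i<l. sandwich (N i) (M i) (adj (\<alpha> i)) (lift K h (N i) (M i) (v i)) (\<beta> i))"
  proof (intro ext)
    fix a b
    have "lift K h n m ?s a b = h (\<Sum>i<l. sandwich (N i) (M i) (adj (\<alpha> i)) (v i) (\<beta> i) a b)"
      using sK by (simp add: lift_def sum_fun_apply)
    also have "\<dots> = (\<Sum>i<l. h (sandwich (N i) (M i) (adj (\<alpha> i)) (v i) (\<beta> i) a b))"
      using vE by (intro linear_on_sum[OF Esp_subspace h] sandwich_in_Esp) auto
    also have "\<dots> = (\<Sum>i<l. sandwich (N i) (M i) (adj (\<alpha> i)) (lift K h (N i) (M i) (v i)) (\<beta> i) a b)"
    proof (rule sum.cong[OF refl])
      fix i assume i: "i \<in> {..<l}"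
      then have "lift K h (N i) (M i) (v i) = (\<lambda>a b. h (v i a b))" using A by (simp add: lift_def)
      then show "h (sandwich (N i) (M i) (adj (\<alpha> i)) (v i) (\<beta> i) a b) =
          sandwich (N i) (M i) (adj (\<alpha> i)) (lift K h (N i) (M i) (v i)) (\<beta> i) a b"
        using linear_on_sandwich[OF h, of "v i"] vE i by simp
    qed
    finally show "lift K h n m ?s a b =
        (\<Sum>i<l. sandwich (N i) (M i) (adj (\<alpha> i)) (lift K h (N i) (M i) (v i)) (\<beta> i)) a b"
      by (simp add: sum_fun_apply)
  qed
qed

text \<open>On level (1, 1) the two weight vectors are unit vectors independently of each other, so
  the products \<open>cnj a * b\<close> may have arbitrary phases and may cancel.\<close>

lemma rm_affine_scalar:
  fixes T :: "'b::complex_vector matrix_family"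
  assumes th: "rm_affine K T \<theta>" and l: "0 < (l::nat)" and x: "\<And>i. i < l \<Longrightarrow> sing (x i) \<in> K 1 1"
    and a: "(\<Sum>i<l. (cmod (a i))\<^sup>2) = 1" and b: "(\<Sum>i<l. (cmod (b i))\<^sup>2) = 1"
  shows "\<theta> 1 1 (sing (\<Sum>i<l. (cnj (a i) * b i) *\<^sub>C x i)) 0 0 =
     (\<Sum>i<l. (cnj (a i) * b i) *\<^sub>C \<theta> 1 1 (sing (x i)) 0 0)"
proof -
  have sw: "sandwich 1 1 (adj (sing c)) y (sing d) = sing ((cnj c * d) *\<^sub>C y 0 0)"
    for c d and y :: "'z::complex_vector matrix"
    by (auto simp: sandwich_def adj_def sing_def fun_eq_iff)
  have gr: "gram 1 (sing c) = sing (complex_of_real ((cmod c)\<^sup>2))" for c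
    by (auto simp: gram_def adj_def sing_def fun_eq_iff cnj_mult_self simp del: of_real_power)
  have ss: "(\<Sum>i<l. sing (y i)) = sing (\<Sum>i<l. y i)" for y :: "nat \<Rightarrow> 'z::comm_monoid_add"
    by (auto simp: sing_def fun_eq_iff sum_fun_apply)
  have id1: "id_mat 1 = sing 1" by (auto simp: id_mat_def sing_def fun_eq_iff)
  have "\<theta> 1 1 (\<Sum>i<l. sandwich 1 1 (adj (sing (a i))) (sing (x i)) (sing (b i))) =
     (\<Sum>i<l. sandwich 1 1 (adj (sing (a i))) (\<theta> 1 1 (sing (x i))) (sing (b i)))"
  proof (rule rm_affine_comb[OF th l])
    show "sing (a i) \<in> cmats 1 1 \<and> sing (b i) \<in> cmats 1 1 \<and> sing (x i) \<in> K 1 1" if "i < l" for i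
      using x[OF that] sing_mats by blast
    show "(\<Sum>i<l. gram 1 (sing (a i))) = id_mat 1" "(\<Sum>i<l. gram 1 (sing (b i))) = id_mat 1"
      unfolding gr ss id1 of_real_sum[symmetric] a b by simp_all
  qed auto
  then have "\<theta> 1 1 (sing (\<Sum>i<l. (cnj (a i) * b i) *\<^sub>C x i)) =
     sing (\<Sum>i<l. (cnj (a i) * b i) *\<^sub>C \<theta> 1 1 (sing (x i)) 0 0)"
    unfolding sw ss sing_00 .
  then show ?thesis by (simp only: sing_00)
qed

text \<open>Level (1, 1) determines \<theta>: there \<theta> respects the linear combinations that
  stay inside \<open>K\<close>, it extends by homogeneity to \<open>Esp K\<close>, and compressions
  by standard unit columns recover the entries on every level.\<close>

lemma rm_affine_rep:
  fixes T :: "'b::complex_vector matrix_family"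
  assumes T: "\<forall>n m. T n m \<subseteq> mats n m UNIV" and th: "rm_affine K T \<theta>"
  shows "\<exists>h. linear_on (Esp K) h \<and> \<theta> = lift K h"
proof -
  define g where "g x = \<theta> 1 1 (sing x) 0 0" for x
  have two: "(\<Sum>i<2. f i) = f 0 + f (1::nat)" for f :: "nat \<Rightarrow> 'z::comm_monoid_add"
    by (simp add: numeral_2_eq_2)
  have three: "(\<Sum>i<3. f i) = f 0 + f (1::nat) + f 2" for f :: "nat \<Rightarrow> 'z::comm_monoid_add"
    by (simp add: numeral_3_eq_3 numeral_2_eq_2)
  have K0: "sing 0 \<in> K 1 1" using zero_in_rmconvex[OF K, of 1 1] by simp
  have g0: "g 0 = 0"
  proof -
    \<comment> \<open>A combination of 0 with itself whose weights 1/2 and -1/2 cancel forces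
      \<open>g 0 = 0\<close>.\<close>
    define s where "s = complex_of_real (sqrt (1 / 2))"
    have s: "(cmod s)\<^sup>2 = 1 / 2" by (simp add: s_def)
    have "\<theta> 1 1 (sing (\<Sum>i<(2::nat). (cnj s * (if i = 0 then s else - s)) *\<^sub>C 0)) 0 0 =
       (\<Sum>i<(2::nat). (cnj s * (if i = 0 then s else - s)) *\<^sub>C \<theta> 1 1 (sing 0) 0 0)"
      by (rule rm_affine_scalar[OF th, where x="\<lambda>_. 0" and a="\<lambda>_. s" and b="\<lambda>i. if i = 0 then s else - s"])
        (use K0 in \<open>simp_all add: s two\<close>)
    then show ?thesis
      unfolding two by (simp add: g_def complex_vector.scale_minus_left)
  qed
  have gcomb: "g (c *\<^sub>C x + d *\<^sub>C y) = c *\<^sub>C g x + d *\<^sub>C g y"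
    if x: "sing x \<in> K 1 1" and y: "sing y \<in> K 1 1" and le: "cmod c + cmod d \<le> 1" for c d x y
  proof -
    obtain u where u: "cmod u = 1" "u * c = complex_of_real (cmod c)" by (rule Complex_linear_rotate)
    obtain u' where u': "cmod u' = 1" "u' * d = complex_of_real (cmod d)" by (rule Complex_linear_rotate)
    \<comment> \<open>Affine combinations need weights of total 1; the missing part \<open>r\<close>
      goes to the point 0, where \<open>g\<close> vanishes.\<close>
    define r where "r = 1 - cmod c - cmod d"
    have r: "r \<ge> 0" using le by (simp add: r_def)
    define a where "a = (\<lambda>i::nat. if i = 0 then complex_of_real (sqrt (cmod c)) * u
      else if i = 1 then complex_of_real (sqrt (cmod d)) * u' else complex_of_real (sqrt r))"
    define b where "b = (\<lambda>i::nat. if i = 0 then complex_of_real (sqrt (cmod c))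
      else if i = 1 then complex_of_real (sqrt (cmod d)) else complex_of_real (sqrt r))"
    define z where "z = (\<lambda>i::nat. if i = 0 then x else if i = 1 then y else 0)"
    have sq: "complex_of_real (sqrt (cmod z)) * complex_of_real (sqrt (cmod z)) = complex_of_real (cmod z)" for z
      by (simp flip: of_real_mult)
    have cu: "cnj u * complex_of_real (cmod c) = c" "cnj u' * complex_of_real (cmod d) = d"
    proof -
      have "cnj u * (u * c) = c" "cnj u' * (u' * d) = d"
        using cnj_mult_self[of u] cnj_mult_self[of u'] u(1) u'(1) by (simp_all flip: mult.assoc)
      then show "cnj u * complex_of_real (cmod c) = c" "cnj u' * complex_of_real (cmod d) = d"
        by (simp_all only: u(2) u'(2))
    qed
    have ab0: "cnj (a 0) * b 0 = c"
    proof -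
      have "cnj (a 0) * b 0 = cnj u * (complex_of_real (sqrt (cmod c)) * complex_of_real (sqrt (cmod c)))"
        by (simp add: a_def b_def mult_ac)
      then show ?thesis unfolding sq cu .
    qed
    have ab1: "cnj (a 1) * b 1 = d"
    proof -
      have "cnj (a 1) * b 1 = cnj u' * (complex_of_real (sqrt (cmod d)) * complex_of_real (sqrt (cmod d)))"
        by (simp add: a_def b_def mult_ac)
      then show ?thesis unfolding sq cu .
    qed
    have "\<theta> 1 1 (sing (\<Sum>i<3. (cnj (a i) * b i) *\<^sub>C z i)) 0 0 =
        (\<Sum>i<3. (cnj (a i) * b i) *\<^sub>C \<theta> 1 1 (sing (z i)) 0 0)"
    proof (rule rm_affine_scalar[OF th])
      show "sing (z i) \<in> K 1 1" for i using x y K0 by (simp add: z_def)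
      show "(\<Sum>i<3. (cmod (a i))\<^sup>2) = 1" "(\<Sum>i<3. (cmod (b i))\<^sup>2) = 1"
        unfolding three using u(1) u'(1) r by (simp_all add: a_def b_def norm_mult r_def)
    qed simp
    then show ?thesis
      using g0 unfolding three ab0 ab1 by (simp add: z_def g_def)
  qed
  \<comment> \<open>The choice of \<open>t\<close> is immaterial: by \<open>gsc\<close> the rescaled
    value is the same for all admissible \<open>t\<close>.\<close>
  define h where "h w = (let t = SOME t. t > 0 \<and> sing (t *\<^sub>R\<^sub>C w) \<in> K 1 1 in inverse t *\<^sub>R\<^sub>C g (t *\<^sub>R\<^sub>C w))" for w
  have gsc: "inverse s *\<^sub>R\<^sub>C g (s *\<^sub>R\<^sub>C w) = inverse t *\<^sub>R\<^sub>C g (t *\<^sub>R\<^sub>C w)"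
    if st: "0 < s" "s \<le> t" and mem: "sing (t *\<^sub>R\<^sub>C w) \<in> K 1 1" for s t w
  proof -
    have "g ((s / t) *\<^sub>R\<^sub>C (t *\<^sub>R\<^sub>C w) + 0 *\<^sub>C (t *\<^sub>R\<^sub>C w)) = (s / t) *\<^sub>R\<^sub>C g (t *\<^sub>R\<^sub>C w) + 0 *\<^sub>C g (t *\<^sub>R\<^sub>C w)"
      using st by (intro gcomb mem) (simp add: norm_divide)
    moreover have "complex_of_real (s / t) * complex_of_real t = complex_of_real s" using st by simp
    then have "(s / t) *\<^sub>R\<^sub>C (t *\<^sub>R\<^sub>C w) = s *\<^sub>R\<^sub>C w" by (simp only: scaleC_scaleC)
    ultimately have "g (s *\<^sub>R\<^sub>C w) = (s / t) *\<^sub>R\<^sub>C g (t *\<^sub>R\<^sub>C w)"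
      by (simp only: complex_vector.scale_zero_left add_0_right)
    moreover have "complex_of_real (inverse s) * complex_of_real (s / t) = complex_of_real (inverse t)"
      using st by (simp flip: of_real_mult add: field_simps)
    ultimately show ?thesis by (simp only: scaleC_scaleC)
  qed
  have h_eq: "h w = inverse t *\<^sub>R\<^sub>C g (t *\<^sub>R\<^sub>C w)" if t: "t > 0" "sing (t *\<^sub>R\<^sub>C w) \<in> K 1 1" for t w
  proof -
    define s where "s = (SOME t. t > 0 \<and> sing (t *\<^sub>R\<^sub>C w) \<in> K 1 1)"
    have s: "s > 0 \<and> sing (s *\<^sub>R\<^sub>C w) \<in> K 1 1"
      unfolding s_def by (rule someI[of _ t]) (use t in auto)
    have "h w = inverse s *\<^sub>R\<^sub>C g (s *\<^sub>R\<^sub>C w)" by (simp add: h_def s_def Let_def)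
    also have "\<dots> = inverse t *\<^sub>R\<^sub>C g (t *\<^sub>R\<^sub>C w)"
    proof (cases "s \<le> t")
      case True
      then show ?thesis using s t by (intro gsc) auto
    next
      case False
      then show ?thesis using s t by (intro gsc[symmetric]) auto
    qed
    finally show ?thesis .
  qed
  have hcomb: "h (c *\<^sub>C w1 + d *\<^sub>C w2) = c *\<^sub>C h w1 + d *\<^sub>C h w2" if w: "w1 \<in> Esp K" "w2 \<in> Esp K" for c d w1 w2
  proof -
    obtain t1 t2 where t: "0 < t1" "0 < t2" "sing (t1 *\<^sub>R\<^sub>C w1) \<in> K 1 1" "sing (t2 *\<^sub>R\<^sub>C w2) \<in> K 1 1"
      using w by (auto simp: Esp_def)
    obtain t where t': "t > 0" "cmod (complex_of_real (t / t1) * c) + cmod (complex_of_real (t / t2) * d) \<le> 1"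
      "t *\<^sub>R\<^sub>C (c *\<^sub>C w1 + d *\<^sub>C w2) = (complex_of_real (t / t1) * c) *\<^sub>C (t1 *\<^sub>R\<^sub>C w1) + (complex_of_real (t / t2) * d) *\<^sub>C (t2 *\<^sub>R\<^sub>C w2)"
      by (rule Esp_comb[OF t])
    have mem: "sing (t *\<^sub>R\<^sub>C (c *\<^sub>C w1 + d *\<^sub>C w2)) \<in> K 1 1"
      unfolding t'(3) by (rule sing_comb_in_K[OF t(3,4) t'(2)])
    have "h (c *\<^sub>C w1 + d *\<^sub>C w2) = inverse t *\<^sub>R\<^sub>C g (t *\<^sub>R\<^sub>C (c *\<^sub>C w1 + d *\<^sub>C w2))"
      by (rule h_eq[OF t'(1) mem])
    also have "\<dots> = inverse t *\<^sub>R\<^sub>C ((complex_of_real (t / t1) * c) *\<^sub>C g (t1 *\<^sub>R\<^sub>C w1) + (complex_of_real (t / t2) * d) *\<^sub>C g (t2 *\<^sub>R\<^sub>C w2))"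
      unfolding t'(3) gcomb[OF t(3,4) t'(2)] ..
    also have "\<dots> = c *\<^sub>C h w1 + d *\<^sub>C h w2"
    proof -
      have "complex_of_real (inverse t) * (complex_of_real (t / r) * e) = e * complex_of_real (inverse r)"
        if "r > 0" for r e using t'(1) that by (simp add: field_simps)
      then show ?thesis
        unfolding h_eq[OF t(1,3)] h_eq[OF t(2,4)] scaleC_add_right scaleC_scaleC using t(1,2) by simp
    qed
    finally show ?thesis .
  qed
  have "linear_on (Esp K) h"
    unfolding linear_on_def
  proof (intro conjI ballI allI)
    show "h (x + y) = h x + h y" if "x \<in> Esp K" "y \<in> Esp K" for x y
      using hcomb[OF that, of 1 1] by (simp add: scaleC_one)
    show "h (c *\<^sub>C x) = c *\<^sub>C h x" if "x \<in> Esp K" for c x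
      using hcomb[OF that that, of c 0] by simp
  qed
  moreover have "\<theta> = lift K h"
  proof (intro ext)
    fix n m v i j
    show "\<theta> n m v i j = lift K h n m v i j"
    proof (cases "v \<in> K n m")
      case False
      then show ?thesis using rm_affineD(1)[OF th] by (simp add: lift_def)
    next
      case v: True
      have thv: "\<theta> n m v \<in> mats n m UNIV" using rm_affineD(2)[OF th v] T by blast
      show ?thesis
      proof (cases "i < n \<and> j < m")
        case False
        then have "v i j = 0" "\<theta> n m v i j = 0"
          using thv rmconvexD(1)[OF K, of n m] v by (auto simp: mats_def not_less)
        moreover have "h 0 = 0" using h_eq[of 1 0] K0 g0 by simp
        ultimately show ?thesis using v by (simp add: lift_def)
      next
        case True
        define x where "x = (\<lambda>k. if k = i then 1 else 0 :: complex)"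
        define y where "y = (\<lambda>k. if k = j then 1 else 0 :: complex)"
        have gc: "gram N (col N (\<lambda>k. if k = i' then 1 else 0)) = id_mat 1" if "i' < N" for i' N
        proof (intro ext)
          fix a b
          have "gram N (col N (\<lambda>k. if k = i' then 1 else 0)) a b = (\<Sum>k<N. if k = i' then id_mat 1 a b else 0)"
            unfolding gram_def by (rule sum.cong) (auto simp: adj_def col_def id_mat_def)
          then show "gram N (col N (\<lambda>k. if k = i' then 1 else 0)) a b = id_mat 1 a b" using that by simp
        qed
        have one: "(\<Sum>k<(1::nat). f k) = f 0" for f :: "nat \<Rightarrow> 'z::comm_monoid_add" by simp
        have "\<theta> 1 1 (\<Sum>k<(1::nat). sandwich n m (adj (col n x)) v (col m y)) =
            (\<Sum>k<(1::nat). sandwich n m (adj (col n x)) (\<theta> n m v) (col m y))"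
          by (rule rm_affine_comb[OF th, where N="\<lambda>_. n" and M="\<lambda>_. m"])
            (use True v col_cmats in \<open>simp_all add: x_def y_def gc del: One_nat_def\<close>)
        then have "\<theta> 1 1 (sing (v i j)) = sing (\<theta> n m v i j)"
          unfolding one sandwich_col x_def y_def entry_eq_sum[OF conjunct1[OF True] conjunct2[OF True]] .
        then have "g (v i j) = \<theta> n m v i j" by (simp add: g_def)
        moreover have "h (v i j) = g (v i j)"
          using h_eq[of 1 "v i j"] sing_entry_in_K[OF v] True by (simp add: scaleC_one)
        ultimately show ?thesis using v by (simp add: lift_def)
      qed
    qed
  qed
  ultimately show ?thesis by blast
qed

end

section \<open>Exchange of tensor factors and compressions in amplified forms\<close>

lemma bil_cong:
  assumes "\<And>i j. i < n \<Longrightarrow> j < m \<Longrightarrow> A i j = B i j" "\<And>i. i < n \<Longrightarrow> x i = x' i" "\<And>j. j < m \<Longrightarrow> y j = y' j"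
  shows "bil n m A x y = bil n m B x' y'"
  unfolding bil_def using assms by (intro sum.cong refl) auto

lemma quad_rows: "quad p q n m X \<xi> \<eta> = (\<Sum>a<p. \<Sum>b<q. bil n m (X a b) (\<xi> a) (\<eta> b))"
  unfolding quad_def bil_def by (intro sum.cong refl sum.swap)

lemma quad_entries:
  "quad p q n m X \<xi> \<eta> = (\<Sum>i<n. \<Sum>j<m. bil p q (\<lambda>a b. X a b i j) (\<lambda>a. \<xi> a i) (\<lambda>b. \<eta> b j))"
  unfolding quad_rows bil_def by (rule sum_swap4)

text \<open>The canonical shuffle that identifies M_{p,q}(M_{n,m}) with M_{n,m}(M_{p,q}) is here a
  reordering of sums.\<close>

lemma quad_flip:
  "quad p q n m X \<xi> \<eta> = quad n m p q (\<lambda>i j a b. X a b i j) (\<lambda>i a. \<xi> a i) (\<lambda>j b. \<eta> b j)"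
  by (subst quad_entries) (simp only: quad_rows)

lemma hs_flip: "hs p n (\<lambda>a i. \<xi> i a) = hs n p \<xi>"
proof -
  have "(hs p n (\<lambda>a i. \<xi> i a))\<^sup>2 = (hs n p \<xi>)\<^sup>2" unfolding hs_sq by (rule sum.swap)
  then show ?thesis by simp
qed

lemma quad_cong:
  assumes "\<And>a b i j. a < p \<Longrightarrow> b < q \<Longrightarrow> i < n \<Longrightarrow> j < m \<Longrightarrow> X a b i j = Y a b i j"
  shows "quad p q n m X \<xi> \<eta> = quad p q n m Y \<xi> \<eta>"
  unfolding quad_rows using assms by (intro sum.cong refl bil_cong) auto

lemma bil_sandwich:
  "bil p q (\<lambda>a b. \<Sum>a'<n. \<Sum>b'<m. \<alpha> a a' * \<beta> b' b * Y a' b') x y =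
    bil n m Y (\<lambda>a'. \<Sum>a<p. adj \<alpha> a' a * x a) (\<lambda>b'. \<Sum>b<q. \<beta> b' b * y b)"
proof -
  have "bil p q (\<lambda>a b. \<Sum>a'<n. \<Sum>b'<m. \<alpha> a a' * \<beta> b' b * Y a' b') x y =
     (\<Sum>a<p. \<Sum>b<q. \<Sum>a'<n. \<Sum>b'<m. (cnj (x a) * \<alpha> a a') * Y a' b' * (\<beta> b' b * y b))"
    unfolding bil_def by (intro sum.cong refl) (simp add: sum_distrib_left sum_distrib_right mult_ac)
  also have "\<dots> = (\<Sum>a'<n. \<Sum>b'<m. \<Sum>a<p. \<Sum>b<q. (cnj (x a) * \<alpha> a a') * Y a' b' * (\<beta> b' b * y b))"
    by (rule sum_swap4)
  also have "\<dots> = bil n m Y (\<lambda>a'. \<Sum>a<p. adj \<alpha> a' a * x a) (\<lambda>b'. \<Sum>b<q. \<beta> b' b * y b)"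
    unfolding bil_def
  proof (intro sum.cong refl)
    fix a' b'
    have "(\<Sum>a<p. \<Sum>b<q. (cnj (x a) * \<alpha> a a') * Y a' b' * (\<beta> b' b * y b)) =
       (\<Sum>a<p. (cnj (x a) * \<alpha> a a') * Y a' b') * (\<Sum>b<q. \<beta> b' b * y b)"
      by (simp add: sum_product)
    also have "(\<Sum>a<p. (cnj (x a) * \<alpha> a a') * Y a' b') = cnj (\<Sum>a<p. adj \<alpha> a' a * x a) * Y a' b'"
      by (simp add: adj_def mult.commute flip: sum_distrib_right sum_distrib_left)
    finally show "(\<Sum>a<p. \<Sum>b<q. (cnj (x a) * \<alpha> a a') * Y a' b' * (\<beta> b' b * y b)) =
       cnj (\<Sum>a<p. adj \<alpha> a' a * x a) * Y a' b' * (\<Sum>b<q. \<beta> b' b * y b)" .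
  qed
  finally show ?thesis .
qed

lemma quad_sandwich:
  "quad p q k l (\<lambda>a b i j. \<Sum>a'<n. \<Sum>b'<m. \<alpha> a a' * \<beta> b' b * Y a' b' i j) \<xi> \<eta> =
    quad n m k l Y (\<lambda>a' i. \<Sum>a<p. adj \<alpha> a' a * \<xi> a i) (\<lambda>b' j. \<Sum>b<q. \<beta> b' b * \<eta> b j)"
  unfolding quad_entries bil_sandwich ..

text \<open>\<open>A\<close> acts on one tensor factor only, so its norm bound applies to each
  column of \<xi>, and the squares are added.\<close>

lemma hs_apply: "hs n k (\<lambda>a' i. \<Sum>a<p. A a' a * \<xi> a i) \<le> opnorm n p A * hs p k \<xi>"
proof (rule power2_le_imp_le)
  have "(hs n k (\<lambda>a' i. \<Sum>a<p. A a' a * \<xi> a i))\<^sup>2 = (\<Sum>i<k. (nrm n (\<lambda>a'. \<Sum>a<p. A a' a * \<xi> a i))\<^sup>2)"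
    unfolding hs_sq nrm_sq by (rule sum.swap)
  also have "\<dots> \<le> (\<Sum>i<k. (opnorm n p A * nrm p (\<lambda>a. \<xi> a i))\<^sup>2)"
    by (intro sum_mono power_mono opnorm_apply) simp
  also have "\<dots> = (opnorm n p A)\<^sup>2 * (\<Sum>i<k. \<Sum>a<p. (cmod (\<xi> a i))\<^sup>2)"
    by (simp add: power_mult_distrib nrm_sq sum_distrib_left)
  also have "\<dots> = (opnorm n p A * hs p k \<xi>)\<^sup>2"
    unfolding power_mult_distrib hs_sq by (subst sum.swap) (rule refl)
  finally show "(hs n k (\<lambda>a' i. \<Sum>a<p. A a' a * \<xi> a i))\<^sup>2 \<le> (opnorm n p A * hs p k \<xi>)\<^sup>2" .
qed (simp add: mult_nonneg_nonneg)

lemma hs_add_sq: "(hs (n + k) r \<xi>)\<^sup>2 = (hs n r \<xi>)\<^sup>2 + (hs k r (\<lambda>a. \<xi> (n + a)))\<^sup>2"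
  unfolding hs_sq sum_lessThan_add ..

lemma cs2:
  fixes a b c d :: real
  shows "a * c + b * d \<le> sqrt (a\<^sup>2 + b\<^sup>2) * sqrt (c\<^sup>2 + d\<^sup>2)"
proof -
  have "(a * c + b * d)\<^sup>2 + (a * d - b * c)\<^sup>2 = (a\<^sup>2 + b\<^sup>2) * (c\<^sup>2 + d\<^sup>2)"
    by (simp add: power2_eq_square algebra_simps)
  then have "(a * c + b * d)\<^sup>2 \<le> (a\<^sup>2 + b\<^sup>2) * (c\<^sup>2 + d\<^sup>2)"
    using zero_le_power2[of "a * d - b * c"] by linarith
  then show ?thesis unfolding real_sqrt_mult[symmetric] by (rule real_le_rsqrt)
qed

text \<open>The Cauchy-Schwarz inequality in the plane; it is the reason why the norm of a direct
  sum is a maximum and not a sum.\<close>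

lemma hs_add_ge:
  "hs n r \<xi> * hs m s \<eta> + hs k r (\<lambda>a. \<xi> (n + a)) * hs l s (\<lambda>b. \<eta> (m + b)) \<le> hs (n + k) r \<xi> * hs (m + l) s \<eta>"
proof -
  have "hs (n + k) r \<xi> = sqrt ((hs n r \<xi>)\<^sup>2 + (hs k r (\<lambda>a. \<xi> (n + a)))\<^sup>2)"
    "hs (m + l) s \<eta> = sqrt ((hs m s \<eta>)\<^sup>2 + (hs l s (\<lambda>b. \<eta> (m + b)))\<^sup>2)"
    unfolding hs_add_sq[symmetric] by simp_all
  then show ?thesis by (simp only: cs2)
qed

lemma cont_entry: "continuous_on S (\<lambda>v::'a::topological_space matrix. v i j)"
proof -
  have "continuous_on UNIV (\<lambda>f::nat \<Rightarrow> 'a. f j)" "continuous_on UNIV (\<lambda>v::'a matrix. v i)"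
    by (rule continuous_on_product_coordinates)+
  then have "continuous_on UNIV (\<lambda>v::'a matrix. v i j)"
    using continuous_on_compose2[of UNIV "\<lambda>f. f j" UNIV "\<lambda>v. v i"] by auto
  then show ?thesis by (rule continuous_on_subset) simp
qed

lemma cont_matrixI:
  assumes "\<And>i j. continuous_on S (\<lambda>x. f x i j)"
  shows "continuous_on S f"
  by (intro continuous_on_coordinatewise_then_product assms)

text \<open>Complete contractivity is restated through \<open>quad\<close>. Only nonnegative norms
  are assumed, so that the equivalence also serves \<open>complex_opspace\<close>.\<close>

lemma CBall_iff:
  fixes X :: "'x::complex_vector opspace"
  assumes nn: "\<forall>p>0. \<forall>q>0. \<forall>x\<in>mats p q (carrier X). 0 \<le> mnorm X p q x"
  shows "\<phi> \<in> CBall X n m \<longleftrightarrow> 0 < n \<and> 0 < m \<and> (\<forall>i j. linear_on (carrier X) (\<phi> i j)) \<and>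
    (\<forall>i j x. x \<notin> carrier X \<or> n \<le> i \<or> m \<le> j \<longrightarrow> \<phi> i j x = 0) \<and>
    (\<forall>p>0. \<forall>q>0. \<forall>x\<in>mats p q (carrier X). \<forall>\<xi> \<eta>.
       cmod (quad p q n m (\<lambda>a b i j. \<phi> i j (x a b)) \<xi> \<eta>) \<le> mnorm X p q x * hs p n \<xi> * hs q m \<eta>)"
proof -
  have *: "opnorm (p * n) (q * m) (flatten n m (\<lambda>a b i j. \<phi> i j (x a b))) \<le> mnorm X p q x \<longleftrightarrow>
     (\<forall>\<xi> \<eta>. cmod (quad p q n m (\<lambda>a b i j. \<phi> i j (x a b)) \<xi> \<eta>) \<le> mnorm X p q x * hs p n \<xi> * hs q m \<eta>)"
    if "0 < p" "0 < q" "x \<in> mats p q (carrier X)" for p q x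
  proof
    assume le: "opnorm (p * n) (q * m) (flatten n m (\<lambda>a b i j. \<phi> i j (x a b))) \<le> mnorm X p q x"
    show "\<forall>\<xi> \<eta>. cmod (quad p q n m (\<lambda>a b i j. \<phi> i j (x a b)) \<xi> \<eta>) \<le> mnorm X p q x * hs p n \<xi> * hs q m \<eta>"
      by (intro allI order_trans[OF quad_le_opnorm] mult_right_mono le) auto
  next
    assume "\<forall>\<xi> \<eta>. cmod (quad p q n m (\<lambda>a b i j. \<phi> i j (x a b)) \<xi> \<eta>) \<le> mnorm X p q x * hs p n \<xi> * hs q m \<eta>"
    then show "opnorm (p * n) (q * m) (flatten n m (\<lambda>a b i j. \<phi> i j (x a b))) \<le> mnorm X p q x"
      using nn that by (intro opnorm_flatten_leI) blast+
  qed
  have norm: "(\<forall>p>0. \<forall>q>0. \<forall>x\<in>mats p q (carrier X). opnorm (p * n) (q * m) (flatten n m (\<lambda>a b i j. \<phi> i j (x a b))) \<le> mnorm X p q x) \<longleftrightarrow>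
    (\<forall>p>0. \<forall>q>0. \<forall>x\<in>mats p q (carrier X). \<forall>\<xi> \<eta>.
       cmod (quad p q n m (\<lambda>a b i j. \<phi> i j (x a b)) \<xi> \<eta>) \<le> mnorm X p q x * hs p n \<xi> * hs q m \<eta>)"
    using * by meson
  have lin: "(\<forall>i j. linear_on (carrier X) (\<phi> i j)) \<longleftrightarrow>
    (\<forall>x\<in>carrier X. \<forall>y\<in>carrier X. (\<lambda>i j. \<phi> i j (x + y)) = (\<lambda>i j. \<phi> i j x) + (\<lambda>i j. \<phi> i j y)) \<and>
    (\<forall>c. \<forall>x\<in>carrier X. (\<lambda>i j. \<phi> i j (c *\<^sub>C x)) = c *\<^sub>C (\<lambda>i j. \<phi> i j x))"
    by (auto simp: linear_on_def fun_eq_iff scaleC_fun_def)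
  have zero: "(\<forall>i j x. x \<notin> carrier X \<or> n \<le> i \<or> m \<le> j \<longrightarrow> \<phi> i j x = 0) \<longleftrightarrow>
     (\<forall>x. x \<notin> carrier X \<longrightarrow> (\<lambda>i j. \<phi> i j x) = 0) \<and> (\<forall>x\<in>carrier X. (\<lambda>i j. \<phi> i j x) \<in> cmats n m)"
    by (auto simp: fun_eq_iff mats_def)
  show ?thesis
    unfolding CBall_def op_hom_def mat_opspace_def opspace.simps mem_Collect_eq norm lin zero
    by (intro iffI; elim conjE; intro conjI; assumption)
qed

text \<open>The amplification of \<open>c \<mapsto> c A\<close> at \<open>x\<close> is the Kronecker
  product of \<open>x\<close> and \<open>A\<close>, whose norm is at most the product of the norms;
  testing at the 1 x 1 matrix 1 gives the converse.\<close>

lemma CBall_complex_iff: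
  "A \<in> CBall_complex n m \<longleftrightarrow> 0 < n \<and> 0 < m \<and> A \<in> cmats n m \<and> opnorm n m A \<le> 1"
proof -
  have "A \<in> CBall_complex n m \<longleftrightarrow> 0 < n \<and> 0 < m \<and> (\<forall>i j. linear_on UNIV (\<lambda>c. c * A i j)) \<and>
    (\<forall>i j x. x \<notin> (UNIV :: complex set) \<or> n \<le> i \<or> m \<le> j \<longrightarrow> x * A i j = 0) \<and>
    (\<forall>p>0. \<forall>q>0. \<forall>x\<in>cmats p q. \<forall>\<xi> \<eta>.
       cmod (quad p q n m (\<lambda>a b i j. x a b * A i j) \<xi> \<eta>) \<le> opnorm p q x * hs p n \<xi> * hs q m \<eta>)"
    unfolding CBall_complex_def mem_Collect_eq
    using CBall_iff[of complex_opspace "\<lambda>i j c. c * A i j" n m] by (simp add: complex_opspace_def)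
  moreover have "linear_on UNIV (\<lambda>c. c * A i j)" for i j
    by (simp add: linear_on_def scaleC_complex_def algebra_simps)
  moreover have "(\<forall>i j x. x \<notin> (UNIV :: complex set) \<or> n \<le> i \<or> m \<le> j \<longrightarrow> x * A i j = 0) \<longleftrightarrow> A \<in> cmats n m"
  proof -
    have "(\<forall>x::complex. x * c = 0) \<longleftrightarrow> c = 0" for c by (metis mult_1 mult_zero_right)
    then show ?thesis by (auto simp: mats_def)
  qed
  moreover have "(\<forall>p>0. \<forall>q>0. \<forall>x\<in>cmats p q. \<forall>\<xi> \<eta>.
       cmod (quad p q n m (\<lambda>a b i j. x a b * A i j) \<xi> \<eta>) \<le> opnorm p q x * hs p n \<xi> * hs q m \<eta>) \<longleftrightarrow> opnorm n m A \<le> 1"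
    (is "?L \<longleftrightarrow> ?R")
  proof
    assume L: ?L
    show ?R
    proof (rule opnorm_leI)
      fix x y :: "nat \<Rightarrow> complex"
      have one: "sing (1::complex) \<in> cmats 1 1" by (rule sing_mats)
      have "cmod (quad 1 1 n m (\<lambda>a b i j. sing 1 a b * A i j) (\<lambda>_. x) (\<lambda>_. y)) \<le>
          opnorm 1 1 (sing 1) * hs 1 n (\<lambda>_. x) * hs 1 m (\<lambda>_. y)"
        using L[rule_format, OF zero_less_one zero_less_one one] .
      moreover have "quad 1 1 n m (\<lambda>a b i j. sing 1 a b * A i j) (\<lambda>_. x) (\<lambda>_. y) = bil n m A x y"
        by (simp add: quad_rows)
      moreover have "opnorm 1 1 (sing (1::complex)) = 1" by (simp only: opnorm_1_1 sing_00 norm_one)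
      moreover have "hs 1 n (\<lambda>_. x) = nrm n x" for n and x :: "nat \<Rightarrow> complex" by (simp add: lessThan_Suc)
      ultimately show "cmod (bil n m A x y) \<le> 1 * nrm n x * nrm m y" by (simp only:)
    qed simp
  next
    assume R: ?R
    show ?L
    proof (intro allI impI ballI)
      fix p q :: nat and x \<xi> \<eta> :: "complex matrix" assume "0 < p" "0 < q"
      \<comment> \<open>First \<open>A\<close> acts on the second factor of \<eta>; then, for each
        index \<open>i\<close> of that factor, \<open>x\<close> acts on the first.\<close>
      define \<zeta> where "\<zeta> = (\<lambda>b i. \<Sum>j<m. A i j * \<eta> b j)"
      have "quad p q n m (\<lambda>a b i j. x a b * A i j) \<xi> \<eta> = (\<Sum>i<n. bil p q x (\<lambda>a. \<xi> a i) (\<lambda>b. \<zeta> b i))"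
      proof -
        have "quad p q n m (\<lambda>a b i j. x a b * A i j) \<xi> \<eta> =
           (\<Sum>a<p. \<Sum>i<n. \<Sum>b<q. cnj (\<xi> a i) * x a b * \<zeta> b i)"
          unfolding quad_def \<zeta>_def by (simp add: sum_distrib_left mult_ac)
        also have "\<dots> = (\<Sum>i<n. bil p q x (\<lambda>a. \<xi> a i) (\<lambda>b. \<zeta> b i))"
          unfolding bil_def by (rule sum.swap)
        finally show ?thesis .
      qed
      also have "cmod \<dots> \<le> (\<Sum>i<n. opnorm p q x * (nrm p (\<lambda>a. \<xi> a i) * nrm q (\<lambda>b. \<zeta> b i)))"
        using bil_le_opnorm[of p q x] by (intro order_trans[OF norm_sum] sum_mono) (simp add: mult.assoc)
      also have "\<dots> \<le> opnorm p q x * (hs n p (\<lambda>i a. \<xi> a i) * hs n q (\<lambda>i b. \<zeta> b i))"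
        unfolding sum_distrib_left[symmetric]
        using L2_set_mult_ineq[of "\<lambda>i. nrm p (\<lambda>a. \<xi> a i)" "\<lambda>i. nrm q (\<lambda>b. \<zeta> b i)" "{..<n}"]
        by (intro mult_left_mono) simp_all
      also have "hs n p (\<lambda>i a. \<xi> a i) = hs p n \<xi>" by (rule hs_flip)
      also have "hs n q (\<lambda>i b. \<zeta> b i) \<le> hs q m \<eta>"
      proof -
        have "hs n q (\<lambda>i b. \<zeta> b i) \<le> opnorm n m A * hs m q (\<lambda>j b. \<eta> b j)"
          unfolding \<zeta>_def by (rule hs_apply)
        also have "\<dots> \<le> 1 * hs q m \<eta>"
          unfolding hs_flip[where p=m and n=q and \<xi>=\<eta>] by (rule mult_right_mono[OF R]) simp
        finally show ?thesis by simp
      qed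
      finally show "cmod (quad p q n m (\<lambda>a b i j. x a b * A i j) \<xi> \<eta>) \<le> opnorm p q x * hs p n \<xi> * hs q m \<eta>"
        by (simp add: mult_left_mono mult.assoc)
    qed
  qed
  ultimately show ?thesis by simp
qed

section \<open>The space of continuous affine maps\<close>

text \<open>Continuity is required on level (1, 1) only and passes to all levels, because
  \<open>v \<mapsto> sing (v i j)\<close> maps each level continuously into level (1, 1) for indices
  in range. Values outside \<open>Esp K\<close> are arbitrary.\<close>

definition cfun :: "'a::complex_lctvs matrix_family \<Rightarrow> ('a \<Rightarrow> complex) \<Rightarrow> bool" where
  "cfun K g \<longleftrightarrow> linear_on (Esp K) g \<and> continuous_on (K 1 1) (\<lambda>v. g (v 0 0))"

lemma linear_on_combine:
  fixes g h :: "'a::complex_vector \<Rightarrow> 'b::complex_vector"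
  assumes "linear_on E g" "linear_on E h"
  shows "linear_on E (\<lambda>w. c *\<^sub>C g w + d *\<^sub>C h w)"
  using linear_onD(1,2)[OF assms(1)] linear_onD(1,2)[OF assms(2)]
  unfolding linear_on_def by (simp add: scaleC_add_right scaleC_scaleC algebra_simps)

lemma cfun_combine:
  assumes "cfun K g" "cfun K h"
  shows "cfun K (\<lambda>w. c * g w + d * h w)"
  using assms linear_on_combine[of "Esp K" g h c d]
  unfolding cfun_def scaleC_complex_def by (auto intro!: continuous_intros)

lemma cfun_zero: "cfun K (\<lambda>w. 0)"
  by (simp add: cfun_def linear_on_def)

lemma lift_combine:
  "lift K (\<lambda>w. c * g w + d * h w) = c *\<^sub>C lift K g + d *\<^sub>C lift K h" for g h :: "'a::complex_vector \<Rightarrow> complex"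
  by (auto simp: lift_def scaleC_fun_def scaleC_complex_def fun_eq_iff)

lemma lift_zero: "lift K (\<lambda>w. 0) = 0"
  by (auto simp: lift_def fun_eq_iff)

lemma compact_rmconvexD: "compact_rmconvex K \<Longrightarrow> rmconvex K" "compact_rmconvex K \<Longrightarrow> compact (K n m)"
  by (simp_all add: compact_rmconvex_def)

lemma cfun_cont:
  fixes K :: "'a::complex_lctvs matrix_family"
  assumes K: "rmconvex K" and g: "cfun K g"
  shows "continuous_on (K n m) (\<lambda>v. g (v i j))"
proof (cases "i < n \<and> j < m")
  case True
  have "continuous_on (K n m) (\<lambda>v. sing (v i j))"
  proof (rule cont_matrixI)
    fix a b
    show "continuous_on (K n m) (\<lambda>v. sing (v i j) a b)"
    proof (cases "a = 0 \<and> b = 0")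
      case True
      then have eq: "(\<lambda>v. sing (v i j) a b) = (\<lambda>v :: 'a matrix. v i j)" by (auto simp: sing_def)
      show ?thesis unfolding eq by (rule cont_entry)
    next
      case False
      then have eq: "(\<lambda>v. sing (v i j) a b) = (\<lambda>v :: 'a matrix. 0)" by (auto simp: sing_def fun_eq_iff)
      show ?thesis unfolding eq by (rule continuous_on_const)
    qed
  qed
  moreover have "(\<lambda>v. sing (v i j)) ` K n m \<subseteq> K 1 1" using sing_entry_in_K[OF K] True by blast
  ultimately have "continuous_on (K n m) (\<lambda>v. g (sing (v i j) 0 0))"
    by (rule continuous_on_compose2[OF conjunct2[OF g[unfolded cfun_def]]])
  then show ?thesis by (simp only: sing_00)
next
  case False
  then have eq: "g (v i j) = g 0" if "v \<in> K n m" for v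
    using rmconvexD(1)[OF K, of n m] that by (intro arg_cong[where f=g]) (auto simp: mats_def not_less)
  have "continuous_on (K n m) (\<lambda>v. g (v i j)) \<longleftrightarrow> continuous_on (K n m) (\<lambda>v. g 0)"
    by (rule continuous_on_cong[OF refl eq])
  then show ?thesis by simp
qed

lemma cfun_bdd:
  assumes K: "compact_rmconvex K" and g: "cfun K g"
  shows "\<exists>C>0. \<forall>w. sing w \<in> K 1 1 \<longrightarrow> cmod (g w) \<le> C"
proof -
  have "compact ((\<lambda>v. g (v 0 0)) ` K 1 1)"
    using compact_continuous_image compact_rmconvexD(2)[OF K] g unfolding cfun_def by blast
  then have "bounded ((\<lambda>v. g (v 0 0)) ` K 1 1)" by (rule compact_imp_bounded)
  then obtain C where C: "C > 0" "\<And>z. z \<in> (\<lambda>v. g (v 0 0)) ` K 1 1 \<Longrightarrow> cmod z \<le> C"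
    unfolding bounded_pos by auto
  have "cmod (g w) \<le> C" if "sing w \<in> K 1 1" for w
    using C(2)[of "g w"] imageI[OF that, of "\<lambda>v. g (v 0 0)"] by simp
  then show ?thesis using C(1) by blast
qed

text \<open>At vectors of norm at most 1 the form is \<open>g\<close> at a compression of
  \<open>v\<close> to level (1, 1), so the bound on level (1, 1) holds on all levels.\<close>

lemma linear_bil_bound:
  assumes K: "rmconvex K" and g: "linear_on (Esp K) g" and C: "0 \<le> C" "\<And>w. sing w \<in> K 1 1 \<Longrightarrow> cmod (g w) \<le> C"
    and v: "v \<in> K n m"
  shows "opnorm n m (\<lambda>i j. g (v i j)) \<le> C"
proof (rule opnorm_leI[OF C(1)])
  fix x y
  have eq: "bil n m (\<lambda>i j. g (v i j)) x y = g (\<Sum>i<n. \<Sum>j<m. (cnj (x i) * y j) *\<^sub>C v i j)" for x y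
    unfolding bil_def using entry_in_Esp[OF K v]
    by (simp add: linear_on_sum[OF Esp_subspace[OF K] g] complex_vector.subspace_sum[OF Esp_subspace[OF K]]
      complex_vector.subspace_scale[OF Esp_subspace[OF K]] linear_onD(2)[OF g] scaleC_complex_def mult_ac)
  show "cmod (bil n m (\<lambda>i j. g (v i j)) x y) \<le> C * nrm n x * nrm m y"
  proof (cases "nrm n x = 0 \<or> nrm m y = 0")
    case True
    then have "bil n m (\<lambda>i j. g (v i j)) x y = 0"
      unfolding bil_def nrm_eq_0 by (auto intro!: sum.neutral)
    then show ?thesis using C(1) by simp
  next
    case False
    then have pos: "nrm n x > 0" "nrm m y > 0"
      using L2_set_nonneg[of "\<lambda>i. cmod (x i)" "{..<n}"] L2_set_nonneg[of "\<lambda>i. cmod (y i)" "{..<m}"] by linarith+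
    define s t where "s = complex_of_real (inverse (nrm n x))" and "t = complex_of_real (inverse (nrm m y))"
    have st: "cmod s = inverse (nrm n x)" "cmod t = inverse (nrm m y)"
      unfolding s_def t_def norm_of_real using pos by simp_all
    have "nrm n (\<lambda>i. s * x i) \<le> 1" "nrm m (\<lambda>i. t * y i) \<le> 1"
      unfolding nrm_scale st using pos by simp_all
    from compress_in_K[OF K v this]
    have "cmod (bil n m (\<lambda>i j. g (v i j)) (\<lambda>i. s * x i) (\<lambda>i. t * y i)) \<le> C"
      unfolding eq by (rule C(2))
    moreover have "bil n m (\<lambda>i j. g (v i j)) (\<lambda>i. s * x i) (\<lambda>i. t * y i) = cnj s * t * bil n m (\<lambda>i j. g (v i j)) x y"
      unfolding bil_def by (simp add: sum_distrib_left mult_ac)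
    ultimately have "inverse (nrm n x) * inverse (nrm m y) * cmod (bil n m (\<lambda>i j. g (v i j)) x y) \<le> C"
      by (simp only: norm_mult complex_mod_cnj st)
    then show ?thesis using pos by (simp add: field_simps)
  qed
qed

text \<open>A continuous functional is bounded on the compact level (1, 1); by
  \<open>linear_bil_bound\<close> a multiple of it then maps every level into
  \<open>CBall_complex\<close>. The other direction is the linear representation of affine
  maps.\<close>

lemma A_rho_carrier:
  assumes K: "compact_rmconvex K"
  shows "f \<in> carrier (A_rho K) \<longleftrightarrow> (\<exists>g. cfun K g \<and> f = lift K g)"
proof
  note rK = compact_rmconvexD(1)[OF K]
  assume "f \<in> carrier (A_rho K)"
  then obtain c f0 where f: "f = c *\<^sub>C f0" and f0: "f0 \<in> rm_hom K CBall_complex"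
    by (auto simp: A_rho_def)
  then have aff: "rm_affine K CBall_complex f0" and cont: "continuous_on (K 1 1) (f0 1 1)"
    by (auto simp: rm_hom_def)
  have "\<forall>n m. CBall_complex n m \<subseteq> cmats n m" using CBall_complex_iff by blast
  from rm_affine_rep[OF rK this aff] obtain g where g: "linear_on (Esp K) g" "f0 = lift K g" by blast
  have "continuous_on (K 1 1) (\<lambda>v. f0 1 1 v 0 0)"
    using continuous_on_compose2[OF cont_entry[of UNIV 0 0] cont] by simp
  then have "continuous_on (K 1 1) (\<lambda>v. g (v 0 0))"
    by (rule continuous_on_eq) (simp add: g(2) lift_def)
  then have "cfun K g" using g(1) by (simp add: cfun_def)
  \<comment> \<open>The zero summand brings a single multiple into the form of
    \<open>cfun_combine\<close>.\<close>
  then have "cfun K (\<lambda>w. c * g w + 0 * g w)" by (intro cfun_combine)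
  moreover have "f = lift K (\<lambda>w. c * g w + 0 * g w)" unfolding lift_combine f g(2) by simp
  ultimately show "\<exists>g. cfun K g \<and> f = lift K g" by blast
next
  note rK = compact_rmconvexD(1)[OF K]
  assume "\<exists>g. cfun K g \<and> f = lift K g"
  then obtain g where g: "cfun K g" and f: "f = lift K g" by blast
  obtain C where C: "C > 0" "\<And>w. sing w \<in> K 1 1 \<Longrightarrow> cmod (g w) \<le> C" using cfun_bdd[OF K g] by blast
  define h where "h = (\<lambda>w. complex_of_real (inverse C) * g w + 0 * g w)"
  have h: "cfun K h" unfolding h_def by (intro cfun_combine g)
  then have lin: "linear_on (Esp K) h" by (simp add: cfun_def)
  have "cmod (h w) \<le> 1" if "sing w \<in> K 1 1" for w
    using C(2)[OF that] C(1) by (simp add: h_def norm_mult norm_divide field_simps)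
  then have op: "opnorm n m (\<lambda>i j. h (v i j)) \<le> 1" if "v \<in> K n m" for n m v
    using that by (intro linear_bil_bound[OF rK lin]) auto
  have "rm_affine K CBall_complex (lift K h)"
  proof (rule rm_affine_lift[OF rK lin], intro allI ballI)
    fix n m v assume v: "v \<in> K n m"
    have "(\<lambda>i j. h (v i j)) \<in> cmats n m"
      using v rmconvexD(1)[OF rK, of n m] linear_onD(3)[OF lin Esp_zero[OF rK]]
      by (auto simp: mats_def)
    moreover have "0 < n \<and> 0 < m" using rmconvexD(2)[OF rK, of n m] v by blast
    ultimately show "(\<lambda>i j. h (v i j)) \<in> CBall_complex n m"
      unfolding CBall_complex_iff using op[OF v] by blast
  qed
  moreover have "continuous_on (K n m) (lift K h n m)" for n m
  proof -
    have "continuous_on (K n m) (\<lambda>v i j. h (v i j))"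
      by (intro cont_matrixI cfun_cont[OF rK h])
    then show ?thesis by (rule continuous_on_eq) (simp add: lift_def)
  qed
  ultimately have "lift K h \<in> rm_hom K CBall_complex" by (simp add: rm_hom_def)
  moreover have "f = complex_of_real C *\<^sub>C lift K h"
    unfolding f h_def lift_combine using C(1)
    by (simp add: scaleC_scaleC scaleC_one flip: of_real_mult)
  ultimately show "f \<in> carrier (A_rho K)" by (auto simp: A_rho_def)
qed

section \<open>The operator space structure of \<open>A\<^sub>\<rho>(K)\<close>\<close>

lemma A_rho_mnorm:
  "mnorm (A_rho K) p q F = (SUP v\<in>K p q. opnorm (p * p) (q * q) (flatten p q (\<lambda>a b. F a b p q v)))"
  by (simp add: A_rho_def)

lemma elem_norm_sing: "elem_norm X x = mnorm X 1 1 (sing x)" for X :: "'z::zero opspace"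
  by (simp add: elem_norm_def sing_def)

lemma sing_mats_iff: "sing x \<in> mats 1 1 S \<longleftrightarrow> x \<in> S"
  by (auto simp: mats_def sing_def)

lemma mats_combine:
  assumes E: "complex_vector.subspace E" and "x \<in> mats n m E" "y \<in> mats n m E"
  shows "c *\<^sub>C x + d *\<^sub>C y \<in> mats n m E"
  using assms by (auto simp: mats_def scaleC_fun_def intro!: complex_vector.subspace_add[OF E] complex_vector.subspace_scale[OF E])

lemma flatten_combine:
  "flatten p q (\<lambda>a b. (c *\<^sub>C F + d *\<^sub>C G) a b k l v) =
    c *\<^sub>C flatten p q (\<lambda>a b. F a b k l v) + d *\<^sub>C flatten p q (\<lambda>a b. G a b k l v)"
  for F G :: "('a, complex) family_map matrix"
  by (simp add: flatten_def scaleC_fun_def fun_eq_iff)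

lemma dsum_mats:
  assumes "complex_vector.subspace E" "x \<in> mats n m E" "y \<in> mats k l E"
  shows "dsum n m x y \<in> mats (n + k) (m + l) E"
  using assms complex_vector.subspace_0[OF assms(1)] by (auto simp: mats_def dsum_def)

lemma quad_dsum:
  fixes x y :: "('b, complex) family_map matrix"
  shows "quad (n + k) (m + l) r s (\<lambda>a b. dsum n m x y a b r s v) \<xi> \<eta> =
    quad n m r s (\<lambda>a b. x a b r s v) \<xi> \<eta> + quad k l r s (\<lambda>a b. y a b r s v) (\<lambda>a. \<xi> (n + a)) (\<lambda>b. \<eta> (m + b))"
proof -
  have "bil r s (0 r s v) a b = 0" for a b by (simp add: bil_def)
  then show ?thesis by (simp add: quad_rows sum_lessThan_add dsum_def)
qed

lemma semi_ip_std: "semi_ip (\<lambda>x y. \<Sum>i<k. cnj (x i) * y i)"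
  unfolding semi_ip_def
  by (auto simp: sum.distrib algebra_simps scaleC_fun_def scaleC_complex_def sum_distrib_left
      intro!: sum_nonneg add_nonneg_nonneg)

lemma std_self: "Re (\<Sum>i<k. cnj (x i) * x i) = (nrm k x)\<^sup>2"
  unfolding nrm_sq Re_sum cnj_mult_self by simp

text \<open>However large \<open>k\<close> is, the \<open>p\<close> rows are combinations of
  \<open>p\<close> vectors that are orthonormal or null, and Bessel's inequality controls the
  coefficients. The coefficients of row \<open>a\<close> form column \<open>a\<close> of
  \<open>R\<close>, hence the transpositions in later uses.\<close>

lemma orthonormal_rows:
  fixes \<xi> :: "complex matrix"
  shows "\<exists>u R. (\<forall>a<p. \<forall>i<k. \<xi> a i = (\<Sum>c<p. R c a * u c i)) \<and> hs p p R \<le> hs p k \<xi> \<and>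
    (\<lambda>i c. if i < k \<and> c < p then u c i else 0) \<in> cmats k p \<and>
    opnorm k p (\<lambda>i c. if i < k \<and> c < p then u c i else 0) \<le> 1"
proof -
  let ?p = "\<lambda>x y. \<Sum>i<k. cnj (x i) * y i :: complex"
  obtain u where U: "(\<forall>y. Re (?p (\<Sum>a<p. y a *\<^sub>C u a) (\<Sum>a<p. y a *\<^sub>C u a)) \<le> (\<Sum>a<p. (cmod (y a))\<^sup>2)) \<and>
    (\<forall>y. (\<Sum>a<p. (cmod (?p (u a) y))\<^sup>2) \<le> Re (?p y y)) \<and>
    (\<forall>i<p. \<forall>r. r = \<xi> i - (\<Sum>a<p. ?p (u a) (\<xi> i) *\<^sub>C u a) \<longrightarrow> ?p r r = 0)"
    using gram_schmidt[OF semi_ip_std, where x=\<xi> and n=p] ..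
  note u1 = U[THEN conjunct1, rule_format] and u2 = U[THEN conjunct2, THEN conjunct1, rule_format]
    and u3 = U[THEN conjunct2, THEN conjunct2, rule_format]
  define R where "R c a = ?p (u c) (\<xi> a)" for c a
  have comb: "(\<Sum>a<p. y a *\<^sub>C u a) = (\<lambda>i. \<Sum>a<p. y a * u a i)" for y
    by (simp add: fun_eq_iff sum_fun_apply scaleC_fun_def scaleC_complex_def)
  have 1: "\<xi> a i = (\<Sum>c<p. R c a * u c i)" if "a < p" "i < k" for a i
  proof -
    define r where "r = \<xi> a - (\<Sum>c<p. R c a *\<^sub>C u c)"
    have "?p r r = 0" by (rule u3[OF that(1)]) (simp only: r_def R_def)
    then have "(nrm k r)\<^sup>2 = 0" unfolding std_self[symmetric] by simp
    then have "r i = 0" using that(2) nrm_eq_0[where n=k and x=r] by simp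
    then show ?thesis unfolding r_def comb by simp
  qed
  have 2: "hs p p R \<le> hs p k \<xi>"
  proof (rule power2_le_imp_le)
    have "(hs p p R)\<^sup>2 = (\<Sum>a<p. \<Sum>c<p. (cmod (?p (u c) (\<xi> a)))\<^sup>2)"
      unfolding hs_sq R_def by (rule sum.swap)
    also have "\<dots> \<le> (\<Sum>a<p. Re (?p (\<xi> a) (\<xi> a)))" by (intro sum_mono u2)
    also have "\<dots> = (hs p k \<xi>)\<^sup>2" unfolding std_self hs_sq nrm_sq ..
    finally show "(hs p p R)\<^sup>2 \<le> (hs p k \<xi>)\<^sup>2" .
  qed simp
  have 3: "opnorm k p (\<lambda>i c. if i < k \<and> c < p then u c i else 0) \<le> 1"
  proof (rule opnorm_leI2)
    fix y
    have "nrm k (\<lambda>i. \<Sum>j<p. (if i < k \<and> j < p then u j i else 0) * y j) = nrm k (\<lambda>i. \<Sum>a<p. y a * u a i)"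
      by (intro L2_set_cong refl arg_cong[where f=cmod] sum.cong) auto
    also have "\<dots> \<le> nrm p y"
    proof (rule power2_le_imp_le)
      show "(nrm k (\<lambda>i. \<Sum>a<p. y a * u a i))\<^sup>2 \<le> (nrm p y)\<^sup>2"
        using u1[of y] unfolding comb std_self nrm_sq[where n=p and x=y] .
    qed simp
    finally show "nrm k (\<lambda>i. \<Sum>j<p. (if i < k \<and> j < p then u j i else 0) * y j) \<le> 1 * nrm p y" by simp
  qed simp
  have 4: "(\<lambda>i c. if i < k \<and> c < p then u c i else 0) \<in> cmats k p" by (auto simp: mats_def)
  show ?thesis using 1 2 3 4 by blast
qed

text \<open>A scalar matrix is viewed as a matrix of constant functions on the unit type, which
  makes \<open>bform_expand\<close> available.\<close>

lemma bil_bform: "bil n m A x y = bform (\<lambda>i j _. A i j) n m () x y"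
  by (simp add: bil_def bform_def mult_ac)

context
  fixes K :: "'a::complex_lctvs matrix_family"
  assumes cK: "compact_rmconvex K"
begin

lemma rK: "rmconvex K" by (rule compact_rmconvexD(1)[OF cK])

lemma A_rho_carrierE:
  assumes "f \<in> carrier (A_rho K)"
  obtains g where "cfun K g" "f = lift K g"
  using assms A_rho_carrier[OF cK] by blast

lemma zero_in_A_rho: "0 \<in> carrier (A_rho K)"
  unfolding A_rho_carrier[OF cK] using cfun_zero lift_zero by metis

lemma A_rho_combine:
  assumes "f \<in> carrier (A_rho K)" "f' \<in> carrier (A_rho K)"
  shows "c *\<^sub>C f + d *\<^sub>C f' \<in> carrier (A_rho K)"
proof -
  obtain g g' where "cfun K g" "f = lift K g" "cfun K g'" "f' = lift K g'"
    using assms A_rho_carrier[OF cK] by blast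
  then have "cfun K (\<lambda>w. c * g w + d * g' w)" "c *\<^sub>C f + d *\<^sub>C f' = lift K (\<lambda>w. c * g w + d * g' w)"
    using cfun_combine[of K g g' c d] lift_combine[of K c g d g'] by simp_all
  then show ?thesis unfolding A_rho_carrier[OF cK] by blast
qed

lemma A_rho_subspace: "complex_vector.subspace (carrier (A_rho K))"
proof (rule complex_vector.subspaceI)
  show "x + y \<in> carrier (A_rho K)" if "x \<in> carrier (A_rho K)" "y \<in> carrier (A_rho K)" for x y
    using A_rho_combine[OF that, of 1 1] by (simp add: scaleC_one)
  show "c *\<^sub>C x \<in> carrier (A_rho K)" if "x \<in> carrier (A_rho K)" for c x
    using A_rho_combine[OF that that, of c 0] by simp
qed (rule zero_in_A_rho)

lemma A_rho_entries:
  assumes F: "F \<in> mats p q (carrier (A_rho K))"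
  shows "\<exists>G. \<forall>a b. cfun K (G a b) \<and> F a b = lift K (G a b)"
proof -
  have "F a b \<in> carrier (A_rho K)" for a b
    using F zero_in_A_rho by (cases "a < p \<and> b < q") (auto simp: mats_def not_less)
  then have "\<forall>a. \<exists>G. \<forall>b. cfun K (G b) \<and> F a b = lift K (G b)"
    unfolding A_rho_carrier[OF cK] by (intro allI choice)
  then show ?thesis by (rule choice)
qed

lemma A_rho_norm_bdd:
  assumes F: "F \<in> mats p q (carrier (A_rho K))"
  shows "bdd_above ((\<lambda>v. opnorm (p * p) (q * q) (flatten p q (\<lambda>a b. F a b p q v))) ` K p q)"
proof -
  obtain G where G: "\<And>a b. cfun K (G a b)" "\<And>a b. F a b = lift K (G a b)"
    using A_rho_entries[OF F] by blast
  have "\<forall>a. \<exists>C. \<forall>b. C b > 0 \<and> (\<forall>w. sing w \<in> K 1 1 \<longrightarrow> cmod (G a b w) \<le> C b)"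
    by (intro allI choice cfun_bdd[OF cK] G)
  then obtain C where C: "\<And>a b. C a b > 0" "\<And>a b w. sing w \<in> K 1 1 \<Longrightarrow> cmod (G a b w) \<le> C a b"
    by (metis choice)
  show ?thesis
  proof (rule bdd_aboveI2)
    fix v assume v: "v \<in> K p q"
    show "opnorm (p * p) (q * q) (flatten p q (\<lambda>a b. F a b p q v)) \<le>
        (\<Sum>r<p * p. \<Sum>s<q * q. C (r div p) (s div q))"
    proof (rule opnorm_entry_bound)
      fix r s assume "r < p * p" "s < q * q"
      then have "r mod p < p" "s mod q < q" by (auto intro!: mod_less_divisor gr0I)
      from sing_entry_in_K[OF rK v this]
      show "cmod (flatten p q (\<lambda>a b. F a b p q v) r s) \<le> C (r div p) (s div q)"
        using C(2) v by (simp add: flatten_def G(2) lift_def)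
    qed
  qed
qed

lemma A_rho_norm_le:
  assumes pq: "0 < p" "0 < q" and le: "\<And>v. v \<in> K p q \<Longrightarrow> opnorm (p * p) (q * q) (flatten p q (\<lambda>a b. F a b p q v)) \<le> c"
  shows "mnorm (A_rho K) p q F \<le> c"
  unfolding A_rho_mnorm using rmconvexD(2)[OF rK, of p q] pq le by (intro cSUP_least) auto

lemma A_rho_norm_upper:
  assumes "F \<in> mats p q (carrier (A_rho K))" "v \<in> K p q"
  shows "opnorm (p * p) (q * q) (flatten p q (\<lambda>a b. F a b p q v)) \<le> mnorm (A_rho K) p q F"
  unfolding A_rho_mnorm by (rule cSUP_upper[OF assms(2) A_rho_norm_bdd[OF assms(1)]])

lemma A_rho_norm_nonneg:
  assumes "0 < p" "0 < q" "F \<in> mats p q (carrier (A_rho K))"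
  shows "0 \<le> mnorm (A_rho K) p q F"
  using A_rho_norm_upper[OF assms(3) zero_in_rmconvex[OF rK assms(1,2)]] opnorm_nonneg
  by (rule order_trans[rotated])

text \<open>By orthonormalization, the rows of a \<open>p \<times> k\<close> matrix span a space of dimension at most \<open>p\<close>,
  so that a point of level \<open>(k, l)\<close> can be compressed to level \<open>(p, q)\<close>.\<close>

lemma A_rho_norm_quad:
  assumes F: "F \<in> mats p q (carrier (A_rho K))" and pq: "0 < p" "0 < q" and v: "v \<in> K k l"
  shows "cmod (quad p q k l (\<lambda>a b. F a b k l v) \<xi> \<eta>) \<le> mnorm (A_rho K) p q F * hs p k \<xi> * hs q l \<eta>"
proof -
  obtain G where G: "\<And>a b. cfun K (G a b)" "\<And>a b. F a b = lift K (G a b)"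
    using A_rho_entries[OF F] by blast
  have lin: "linear_on (Esp K) (G a b)" for a b using G(1) by (simp add: cfun_def)
  obtain u R where u: "\<forall>a<p. \<forall>i<k. \<xi> a i = (\<Sum>c<p. R c a * u c i)" "hs p p R \<le> hs p k \<xi>"
    "(\<lambda>i c. if i < k \<and> c < p then u c i else 0) \<in> cmats k p"
    "opnorm k p (\<lambda>i c. if i < k \<and> c < p then u c i else 0) \<le> 1"
    using orthonormal_rows[where p=p and k=k and \<xi>=\<xi>] by (elim exE conjE)
  obtain z S where z: "\<forall>a<q. \<forall>i<l. \<eta> a i = (\<Sum>c<q. S c a * z c i)" "hs q q S \<le> hs q l \<eta>"
    "(\<lambda>i c. if i < l \<and> c < q then z c i else 0) \<in> cmats l q"
    "opnorm l q (\<lambda>i c. if i < l \<and> c < q then z c i else 0) \<le> 1"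
    using orthonormal_rows[where p=q and k=l and \<xi>=\<eta>] by (elim exE conjE)
  define U where "U = (\<lambda>i c. if i < k \<and> c < p then u c i else 0)"
  define Z where "Z = (\<lambda>i c. if i < l \<and> c < q then z c i else 0)"
  \<comment> \<open>The columns of \<open>U\<close> and \<open>Z\<close> are the orthonormal
    systems, so testing \<open>v\<close> at the rows of \<xi> and \<eta> amounts to testing
    \<open>w\<close> at the coefficients \<open>R\<close> and \<open>S\<close>.\<close>
  define w where "w = sandwich k l (adj U) v Z"
  have w: "w \<in> K p q" unfolding w_def U_def Z_def
    by (rule rmconvex_sandwich[OF rK pq u(3) z(3) v u(4) z(4)])
  have Gw: "G a b (w c d) = bform (\<lambda>i j _. G a b (v i j)) k l () (u c) (z d)" if "c < p" "d < q" for a b c d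
  proof -
    have "G a b (w c d) = (\<Sum>i<k. \<Sum>j<l. (cnj (U i c) * Z j d) * G a b (v i j))"
      unfolding w_def sandwich_def adj_def
      by (simp add: linear_on_sum[OF Esp_subspace[OF rK] lin] complex_vector.subspace_sum[OF Esp_subspace[OF rK]]
        complex_vector.subspace_scale[OF Esp_subspace[OF rK]] linear_onD(2)[OF lin] scaleC_complex_def
        entry_in_Esp[OF rK v])
    then show ?thesis unfolding bform_def using that by (simp add: U_def Z_def)
  qed
  have "quad p q k l (\<lambda>a b. F a b k l v) \<xi> \<eta> = (\<Sum>a<p. \<Sum>b<q. bil p q (\<lambda>c d. G a b (w c d)) (\<lambda>c. R c a) (\<lambda>d. S d b))"
    unfolding quad_rows
  proof (intro sum.cong refl)
    fix a b assume "a \<in> {..<p}" "b \<in> {..<q}"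
    then have ab: "a < p" "b < q" by auto
    have "bil k l (F a b k l v) (\<xi> a) (\<eta> b) = bform (\<lambda>i j _. G a b (v i j)) k l () (\<xi> a) (\<eta> b)"
      unfolding bil_bform G(2) using v by (simp add: lift_def)
    also have "\<dots> = bform (\<lambda>i j _. G a b (v i j)) k l () (\<Sum>c<p. R c a *\<^sub>C u c) (\<Sum>d<q. S d b *\<^sub>C z d)"
      using u(1) z(1) ab
      by (intro bform_cong) (simp_all add: sum_fun_apply scaleC_fun_def scaleC_complex_def)
    also have "\<dots> = (\<Sum>c<p. \<Sum>d<q. cnj (R c a) * S d b * G a b (w c d))"
      unfolding bform_expand by (intro sum.cong refl) (simp add: Gw)
    also have "\<dots> = bil p q (\<lambda>c d. G a b (w c d)) (\<lambda>c. R c a) (\<lambda>d. S d b)"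
      unfolding bil_def by (simp add: mult_ac)
    finally show "bil k l (F a b k l v) (\<xi> a) (\<eta> b) = bil p q (\<lambda>c d. G a b (w c d)) (\<lambda>c. R c a) (\<lambda>d. S d b)" .
  qed
  also have "\<dots> = quad p q p q (\<lambda>a b. F a b p q w) (\<lambda>a c. R c a) (\<lambda>b d. S d b)"
    unfolding quad_rows G(2) using w by (simp add: lift_def)
  finally have eq: "quad p q k l (\<lambda>a b. F a b k l v) \<xi> \<eta> =
    quad p q p q (\<lambda>a b. F a b p q w) (\<lambda>a c. R c a) (\<lambda>b d. S d b)" .
  have "cmod (quad p q k l (\<lambda>a b. F a b k l v) \<xi> \<eta>) \<le>
    opnorm (p * p) (q * q) (flatten p q (\<lambda>a b. F a b p q w)) * hs p p (\<lambda>a c. R c a) * hs q q (\<lambda>b d. S d b)"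
    unfolding eq by (rule quad_le_opnorm)
  also have "\<dots> \<le> mnorm (A_rho K) p q F * hs p k \<xi> * hs q l \<eta>"
    unfolding hs_flip[where p=p and n=p and \<xi>=R] hs_flip[where p=q and n=q and \<xi>=S]
    by (intro mult_mono A_rho_norm_upper[OF F w] u(2) z(2) mult_nonneg_nonneg
      A_rho_norm_nonneg[OF pq F] L2_set_nonneg)
  finally show ?thesis .
qed

lemma A_rho_norm_leI:
  assumes "0 < p" "0 < q" "0 \<le> c"
    and "\<And>v \<xi> \<eta>. v \<in> K p q \<Longrightarrow> cmod (quad p q p q (\<lambda>a b. F a b p q v) \<xi> \<eta>) \<le> c * hs p p \<xi> * hs q q \<eta>"
  shows "mnorm (A_rho K) p q F \<le> c"
  using assms by (intro A_rho_norm_le opnorm_flatten_leI) auto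

lemma A_rho_norm_entry:
  assumes F: "F \<in> mats p q (carrier (A_rho K))" and v: "v \<in> K k l" and "a < p" "b < q" "i < k" "j < l"
  shows "cmod (F a b k l v i j) \<le> mnorm (A_rho K) p q F"
proof -
  have pq: "0 < p" "0 < q" using assms by auto
  have "opnorm (p * k) (q * l) (flatten k l (\<lambda>a b. F a b k l v)) \<le> mnorm (A_rho K) p q F"
    by (intro opnorm_flatten_leI A_rho_norm_nonneg[OF pq F] A_rho_norm_quad[OF F pq v])
  then show ?thesis
    using entry_le_opnorm_flatten[of a p b q i k j l "\<lambda>a b. F a b k l v"] assms by simp
qed

lemma A_rho_norm_combine:
  assumes pq: "0 < p" "0 < q" and F: "F \<in> mats p q (carrier (A_rho K))" and G: "G \<in> mats p q (carrier (A_rho K))"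
  shows "mnorm (A_rho K) p q (c *\<^sub>C F + d *\<^sub>C G) \<le> cmod c * mnorm (A_rho K) p q F + cmod d * mnorm (A_rho K) p q G"
proof (rule A_rho_norm_le[OF pq])
  fix v assume v: "v \<in> K p q"
  have "opnorm (p * p) (q * q) (flatten p q (\<lambda>a b. (c *\<^sub>C F + d *\<^sub>C G) a b p q v)) \<le>
     cmod c * opnorm (p * p) (q * q) (flatten p q (\<lambda>a b. F a b p q v)) +
     cmod d * opnorm (p * p) (q * q) (flatten p q (\<lambda>a b. G a b p q v))"
    unfolding flatten_combine opnorm_scale[symmetric] by (rule opnorm_triangle)
  also have "\<dots> \<le> cmod c * mnorm (A_rho K) p q F + cmod d * mnorm (A_rho K) p q G"
    using A_rho_norm_upper[OF F v] A_rho_norm_upper[OF G v] by (intro add_mono mult_left_mono) auto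
  finally show "opnorm (p * p) (q * q) (flatten p q (\<lambda>a b. (c *\<^sub>C F + d *\<^sub>C G) a b p q v)) \<le> \<dots>" .
qed

lemma A_rho_norm_zero: "0 < p \<Longrightarrow> 0 < q \<Longrightarrow> mnorm (A_rho K) p q 0 \<le> 0"
  by (rule A_rho_norm_leI) (auto simp: quad_def)

lemma A_rho_norm_scale:
  assumes pq: "0 < p" "0 < q" and F: "F \<in> mats p q (carrier (A_rho K))"
  shows "mnorm (A_rho K) p q (c *\<^sub>C F) = cmod c * mnorm (A_rho K) p q F"
proof -
  have le: "mnorm (A_rho K) p q (c *\<^sub>C F) \<le> cmod c * mnorm (A_rho K) p q F"
    if "F \<in> mats p q (carrier (A_rho K))" for c F
    using A_rho_norm_combine[OF pq that that, of c 0] by simp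
  have cF: "c *\<^sub>C F \<in> mats p q (carrier (A_rho K))"
    using mats_combine[OF A_rho_subspace F F, of c 0] by simp
  show ?thesis
  proof (cases "c = 0")
    case True
    then show ?thesis using le[OF F, of c] A_rho_norm_nonneg[OF pq cF] by simp
  next
    case False
    have "mnorm (A_rho K) p q (inverse c *\<^sub>C c *\<^sub>C F) \<le> cmod (inverse c) * mnorm (A_rho K) p q (c *\<^sub>C F)"
      by (rule le[OF cF])
    moreover have "inverse c *\<^sub>C c *\<^sub>C F = F" using False by (simp add: scaleC_scaleC scaleC_one)
    ultimately have "cmod c * mnorm (A_rho K) p q F \<le> mnorm (A_rho K) p q (c *\<^sub>C F)"
      using False by (simp only: norm_inverse) (simp add: field_simps)
    then show ?thesis using le[OF F, of c] by simp
  qed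
qed

text \<open>The norm sees level (p, q) alone, while equality of affine maps concerns all levels;
  \<open>A_rho_norm_entry\<close> bounds the entries on every level.\<close>

lemma A_rho_norm_eq_0:
  assumes pq: "0 < p" "0 < q" and F: "F \<in> mats p q (carrier (A_rho K))" and 0: "mnorm (A_rho K) p q F = 0"
  shows "F = 0"
proof (intro ext)
  fix a b k l v i j
  obtain G where G: "\<And>a b. cfun K (G a b)" "\<And>a b. F a b = lift K (G a b)"
    using A_rho_entries[OF F] by blast
  show "F a b k l v i j = 0 a b k l v i j"
  proof (cases "a < p \<and> b < q \<and> v \<in> K k l \<and> i < k \<and> j < l")
    case True
    then show ?thesis using A_rho_norm_entry[OF F, of v k l a b i j] 0 by simp
  next
    case False
    moreover have "F a b = 0" if "\<not> (a < p \<and> b < q)" using F that by (auto simp: mats_def not_less)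
    moreover have "F a b k l v = 0" if "v \<notin> K k l" using that by (simp add: G(2) lift_def)
    moreover have "F a b k l v i j = 0" if v: "v \<in> K k l" and "\<not> (i < k \<and> j < l)"
    proof -
      have "v i j = 0" using rmconvexD(1)[OF rK, of k l] v that by (auto simp: mats_def not_less)
      moreover have "G a b 0 = 0" using linear_onD(3)[OF _ Esp_zero[OF rK]] G(1) unfolding cfun_def by blast
      ultimately show ?thesis using v by (simp add: G(2) lift_def)
    qed
    ultimately show ?thesis by (metis zero_fun_apply)
  qed
qed

lemma A_rho_norm_sandwich:
  assumes pos: "0 < p" "0 < q" "0 < n" "0 < m" and F: "F \<in> mats n m (carrier (A_rho K))"
  shows "mnorm (A_rho K) p q (sandwich n m \<alpha> F \<beta>) \<le> opnorm p n \<alpha> * mnorm (A_rho K) n m F * opnorm m q \<beta>"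
proof (rule A_rho_norm_leI[OF pos(1,2)])
  show "0 \<le> opnorm p n \<alpha> * mnorm (A_rho K) n m F * opnorm m q \<beta>"
    using A_rho_norm_nonneg[OF pos(3,4) F] by simp
  fix v \<xi> \<eta> assume v: "v \<in> K p q"
  have "quad p q p q (\<lambda>a b. sandwich n m \<alpha> F \<beta> a b p q v) \<xi> \<eta> =
     quad p q p q (\<lambda>a b i j. \<Sum>a'<n. \<Sum>b'<m. \<alpha> a a' * \<beta> b' b * F a' b' p q v i j) \<xi> \<eta>"
    by (rule quad_cong) (simp add: sandwich_def sum_fun_apply scaleC_fun_def scaleC_complex_def)
  also have "\<dots> = quad n m p q (\<lambda>a b. F a b p q v) (\<lambda>a' i. \<Sum>a<p. adj \<alpha> a' a * \<xi> a i) (\<lambda>b' j. \<Sum>b<q. \<beta> b' b * \<eta> b j)"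
    by (rule quad_sandwich)
  finally have eq: "quad p q p q (\<lambda>a b. sandwich n m \<alpha> F \<beta> a b p q v) \<xi> \<eta> =
     quad n m p q (\<lambda>a b. F a b p q v) (\<lambda>a' i. \<Sum>a<p. adj \<alpha> a' a * \<xi> a i) (\<lambda>b' j. \<Sum>b<q. \<beta> b' b * \<eta> b j)" .
  have "cmod (quad p q p q (\<lambda>a b. sandwich n m \<alpha> F \<beta> a b p q v) \<xi> \<eta>) \<le> mnorm (A_rho K) n m F * hs n p (\<lambda>a' i. \<Sum>a<p. adj \<alpha> a' a * \<xi> a i) * hs m q (\<lambda>b' j. \<Sum>b<q. \<beta> b' b * \<eta> b j)"
    unfolding eq by (rule A_rho_norm_quad[OF F pos(3,4) v])
  also have "\<dots> \<le> mnorm (A_rho K) n m F * (opnorm p n \<alpha> * hs p p \<xi>) * (opnorm m q \<beta> * hs q q \<eta>)"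
    unfolding opnorm_adj[of n p \<alpha>, symmetric]
    by (intro mult_mono hs_apply order_refl mult_nonneg_nonneg A_rho_norm_nonneg[OF pos(3,4) F]) auto
  finally show "cmod (quad p q p q (\<lambda>a b. sandwich n m \<alpha> F \<beta> a b p q v) \<xi> \<eta>) \<le>
     opnorm p n \<alpha> * mnorm (A_rho K) n m F * opnorm m q \<beta> * hs p p \<xi> * hs q q \<eta>"
    by (simp add: mult_ac)
qed

text \<open>Upper bound: the test vectors split into two blocks, which \<open>hs_add_ge\<close>
  recombines. Lower bounds: test vectors of a summand are padded with zeros; as they live on a
  smaller level than the one defining the norm of the direct sum, \<open>A_rho_norm_quad\<close> is
  applied across levels.\<close>

lemma A_rho_norm_dsum:
  assumes pos: "0 < n" "0 < m" "0 < k" "0 < l"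
    and x: "x \<in> mats n m (carrier (A_rho K))" and y: "y \<in> mats k l (carrier (A_rho K))"
  shows "mnorm (A_rho K) (n + k) (m + l) (dsum n m x y) = max (mnorm (A_rho K) n m x) (mnorm (A_rho K) k l y)"
proof (rule antisym)
  let ?N = "mnorm (A_rho K)"
  let ?M = "max (?N n m x) (?N k l y)"
  have nn: "0 \<le> ?N n m x" "0 \<le> ?N k l y"
    using A_rho_norm_nonneg[OF pos(1,2) x] A_rho_norm_nonneg[OF pos(3,4) y] .
  have pos': "0 < n + k" "0 < m + l" using pos by auto
  have d: "dsum n m x y \<in> mats (n + k) (m + l) (carrier (A_rho K))"
    by (rule dsum_mats[OF A_rho_subspace x y])
  show "?N (n + k) (m + l) (dsum n m x y) \<le> ?M"
  proof (rule A_rho_norm_leI[OF pos'])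
    show "0 \<le> ?M" using nn by simp
    fix v and \<xi> \<eta> :: "complex matrix" assume v: "v \<in> K (n + k) (m + l)"
    let ?r = "n + k" and ?s = "m + l"
    let ?\<xi> = "\<lambda>a. \<xi> (n + a)" and ?\<eta> = "\<lambda>b. \<eta> (m + b)"
    have "cmod (quad ?r ?s ?r ?s (\<lambda>a b. dsum n m x y a b ?r ?s v) \<xi> \<eta>) \<le>
       cmod (quad n m ?r ?s (\<lambda>a b. x a b ?r ?s v) \<xi> \<eta>) + cmod (quad k l ?r ?s (\<lambda>a b. y a b ?r ?s v) ?\<xi> ?\<eta>)"
      unfolding quad_dsum by (rule norm_triangle_ineq)
    also have "\<dots> \<le> ?N n m x * hs n ?r \<xi> * hs m ?s \<eta> + ?N k l y * hs k ?r ?\<xi> * hs l ?s ?\<eta>"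
      by (intro add_mono A_rho_norm_quad[OF x pos(1,2) v] A_rho_norm_quad[OF y pos(3,4) v])
    also have "\<dots> \<le> ?M * hs n ?r \<xi> * hs m ?s \<eta> + ?M * hs k ?r ?\<xi> * hs l ?s ?\<eta>"
      by (intro add_mono mult_right_mono) auto
    also have "\<dots> = ?M * (hs n ?r \<xi> * hs m ?s \<eta> + hs k ?r ?\<xi> * hs l ?s ?\<eta>)"
      by (simp add: algebra_simps)
    also have "\<dots> \<le> ?M * (hs ?r ?r \<xi> * hs ?s ?s \<eta>)"
      using nn by (intro mult_left_mono hs_add_ge) simp
    finally show "cmod (quad ?r ?s ?r ?s (\<lambda>a b. dsum n m x y a b ?r ?s v) \<xi> \<eta>) \<le> ?M * hs ?r ?r \<xi> * hs ?s ?s \<eta>"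
      by (simp add: mult.assoc)
  qed
  have "?N n m x \<le> ?N (n + k) (m + l) (dsum n m x y)"
  proof (rule A_rho_norm_leI[OF pos(1,2) A_rho_norm_nonneg[OF pos' d]])
    fix v and \<xi> \<eta> :: "complex matrix" assume v: "v \<in> K n m"
    define \<xi>' where "\<xi>' = (\<lambda>a. if a < n then \<xi> a else (\<lambda>i. 0))"
    define \<eta>' where "\<eta>' = (\<lambda>b. if b < m then \<eta> b else (\<lambda>i. 0))"
    have h: "hs (n + k) n \<xi>' = hs n n \<xi>" "hs (m + l) m \<eta>' = hs m m \<eta>"
    proof -
      have "(hs (n + k) n \<xi>')\<^sup>2 = (hs n n \<xi>)\<^sup>2" "(hs (m + l) m \<eta>')\<^sup>2 = (hs m m \<eta>)\<^sup>2"
        unfolding hs_sq sum_lessThan_add by (simp_all add: \<xi>'_def \<eta>'_def)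
      then show "hs (n + k) n \<xi>' = hs n n \<xi>" "hs (m + l) m \<eta>' = hs m m \<eta>" by simp_all
    qed
    have "quad (n + k) (m + l) n m (\<lambda>a b. dsum n m x y a b n m v) \<xi>' \<eta>' = quad n m n m (\<lambda>a b. x a b n m v) \<xi> \<eta>"
      unfolding quad_dsum unfolding quad_def by (simp add: \<xi>'_def \<eta>'_def)
    then show "cmod (quad n m n m (\<lambda>a b. x a b n m v) \<xi> \<eta>) \<le> ?N (n + k) (m + l) (dsum n m x y) * hs n n \<xi> * hs m m \<eta>"
      using A_rho_norm_quad[OF d pos' v, of \<xi>' \<eta>'] unfolding h by simp
  qed
  moreover have "?N k l y \<le> ?N (n + k) (m + l) (dsum n m x y)"
  proof (rule A_rho_norm_leI[OF pos(3,4) A_rho_norm_nonneg[OF pos' d]])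
    fix v and \<xi> \<eta> :: "complex matrix" assume v: "v \<in> K k l"
    define \<xi>' where "\<xi>' = (\<lambda>a. if a < n then (\<lambda>i. 0) else \<xi> (a - n))"
    define \<eta>' where "\<eta>' = (\<lambda>b. if b < m then (\<lambda>i. 0) else \<eta> (b - m))"
    have h: "hs (n + k) k \<xi>' = hs k k \<xi>" "hs (m + l) l \<eta>' = hs l l \<eta>"
    proof -
      have "(hs (n + k) k \<xi>')\<^sup>2 = (hs k k \<xi>)\<^sup>2" "(hs (m + l) l \<eta>')\<^sup>2 = (hs l l \<eta>)\<^sup>2"
        unfolding hs_sq sum_lessThan_add by (simp_all add: \<xi>'_def \<eta>'_def)
      then show "hs (n + k) k \<xi>' = hs k k \<xi>" "hs (m + l) l \<eta>' = hs l l \<eta>" by simp_all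
    qed
    have "quad (n + k) (m + l) k l (\<lambda>a b. dsum n m x y a b k l v) \<xi>' \<eta>' = quad k l k l (\<lambda>a b. y a b k l v) \<xi> \<eta>"
      unfolding quad_dsum unfolding quad_def by (simp add: \<xi>'_def \<eta>'_def)
    then show "cmod (quad k l k l (\<lambda>a b. y a b k l v) \<xi> \<eta>) \<le> ?N (n + k) (m + l) (dsum n m x y) * hs k k \<xi> * hs l l \<eta>"
      using A_rho_norm_quad[OF d pos' v, of \<xi>' \<eta>'] unfolding h by simp
  qed
  ultimately show "?M \<le> ?N (n + k) (m + l) (dsum n m x y)" by simp
qed

lemma A_rho_elem_upper:
  assumes "f \<in> carrier (A_rho K)" "sing w \<in> K 1 1"
  shows "cmod (f 1 1 (sing w) 0 0) \<le> elem_norm (A_rho K) f"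
  using A_rho_norm_entry[OF _ assms(2), of "sing f" 1 1 0 0 0 0] assms(1)
  by (simp only: elem_norm_sing sing_mats_iff sing_00 zero_less_one)

lemma A_rho_elem_le:
  assumes "\<And>w. sing w \<in> K 1 1 \<Longrightarrow> cmod (f 1 1 (sing w) 0 0) \<le> c"
  shows "elem_norm (A_rho K) f \<le> c"
  unfolding elem_norm_sing
proof (rule A_rho_norm_le)
  fix v assume v: "v \<in> K 1 1"
  then have sv: "v = sing (v 0 0)" using rmconvexD(1)[OF rK, of 1 1] mats_1_eq_sing by blast
  have "opnorm (1 * 1) (1 * 1) (flatten 1 1 (\<lambda>a b. sing f a b 1 1 v)) = cmod (f 1 1 v 0 0)"
    unfolding mult_1 opnorm_1_1 by (simp add: flatten_def)
  also have "\<dots> \<le> c" using assms[of "v 0 0"] v sv by metis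
  finally show "opnorm (1 * 1) (1 * 1) (flatten 1 1 (\<lambda>a b. sing f a b 1 1 v)) \<le> c" .
qed simp_all

lemma lift_sing: "sing w \<in> K 1 1 \<Longrightarrow> lift K g 1 1 (sing w) 0 0 = g w"
  by (simp add: lift_def)

text \<open>The norm gives uniform convergence on level (1, 1), which preserves continuity; scaling
  into this level gives pointwise convergence on \<open>Esp K\<close>, which preserves
  linearity.\<close>

lemma A_rho_complete:
  assumes s: "\<And>k. s k \<in> carrier (A_rho K)"
    and Cauchy: "\<And>e. e > 0 \<Longrightarrow> \<exists>N. \<forall>k\<ge>N. \<forall>l\<ge>N. elem_norm (A_rho K) (s k - s l) < e"
  shows "\<exists>x\<in>carrier (A_rho K). (\<lambda>k. elem_norm (A_rho K) (s k - x)) \<longlonglongrightarrow> 0"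
proof -
  obtain g where g: "\<And>k. cfun K (g k)" "\<And>k. s k = lift K (g k)"
    using s unfolding A_rho_carrier[OF cK] by metis
  have lin: "linear_on (Esp K) (g k)" for k using g(1) by (simp add: cfun_def)
  have diff: "s k - s l \<in> carrier (A_rho K)" for k l
    by (rule complex_vector.subspace_diff[OF A_rho_subspace s s])
  have close: "cmod (g k w - g l w) \<le> elem_norm (A_rho K) (s k - s l)" if "sing w \<in> K 1 1" for k l w
  proof -
    have "(s k - s l) 1 1 (sing w) 0 0 = g k w - g l w"
      unfolding g(2) minus_apply lift_sing[OF that] ..
    then show ?thesis using A_rho_elem_upper[OF diff that, of k l] by simp
  qed
  have "\<exists>L. (\<lambda>k. g k w) \<longlonglongrightarrow> L" if w: "w \<in> Esp K" for w
  proof -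
    obtain t where t: "t > 0" "sing (t *\<^sub>R\<^sub>C w) \<in> K 1 1" using w unfolding Esp_def by blast
    have "Cauchy (\<lambda>k. g k (t *\<^sub>R\<^sub>C w))"
      unfolding Cauchy_altdef2 dist_norm
    proof (intro allI impI)
      fix e :: real assume "e > 0"
      from Cauchy[OF this] obtain N where "\<forall>k\<ge>N. \<forall>l\<ge>N. elem_norm (A_rho K) (s k - s l) < e" by blast
      then show "\<exists>N. \<forall>n\<ge>N. cmod (g n (t *\<^sub>R\<^sub>C w) - g N (t *\<^sub>R\<^sub>C w)) < e"
        using close[OF t(2)] by (meson le_less_trans order_refl)
    qed
    then obtain L where L: "(\<lambda>k. g k (t *\<^sub>R\<^sub>C w)) \<longlonglongrightarrow> L" using Cauchy_convergent_iff convergent_def by blast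
    have "g k w = complex_of_real (inverse t) * g k (t *\<^sub>R\<^sub>C w)" for k
      using linear_onD(2)[OF lin w, of k "complex_of_real t"] t(1) by (simp add: scaleC_complex_def)
    then have "(\<lambda>k. g k w) \<longlonglongrightarrow> complex_of_real (inverse t) * L"
      using tendsto_mult_left[OF L, of "complex_of_real (inverse t)"] by simp
    then show ?thesis ..
  qed
  then obtain G where G: "\<And>w. w \<in> Esp K \<Longrightarrow> (\<lambda>k. g k w) \<longlonglongrightarrow> G w" by metis
  have Glin: "linear_on (Esp K) G"
    unfolding linear_on_def
  proof (intro conjI ballI allI)
    fix x y assume xy: "x \<in> Esp K" "y \<in> Esp K"
    have "(\<lambda>k. g k (x + y)) \<longlonglongrightarrow> G x + G y"
      using tendsto_add[OF G[OF xy(1)] G[OF xy(2)]] linear_onD(1)[OF lin xy] by simp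
    with G[OF complex_vector.subspace_add[OF Esp_subspace[OF rK] xy]] show "G (x + y) = G x + G y"
      by (rule LIMSEQ_unique)
  next
    fix c x assume x: "x \<in> Esp K"
    have "(\<lambda>k. g k (c *\<^sub>C x)) \<longlonglongrightarrow> c * G x"
      using tendsto_mult_left[OF G[OF x], of c] linear_onD(2)[OF lin x] by (simp add: scaleC_complex_def)
    with G[OF complex_vector.subspace_scale[OF Esp_subspace[OF rK] x]] show "G (c *\<^sub>C x) = c *\<^sub>C G x"
      unfolding scaleC_complex_def by (rule LIMSEQ_unique)
  qed
  have unif: "\<exists>N. \<forall>k\<ge>N. \<forall>w. sing w \<in> K 1 1 \<longrightarrow> cmod (g k w - G w) \<le> e" if e: "e > 0" for e
  proof -
    obtain N where N: "\<forall>k\<ge>N. \<forall>l\<ge>N. elem_norm (A_rho K) (s k - s l) < e" using Cauchy[OF e] by blast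
    have "cmod (g k w - G w) \<le> e" if k: "k \<ge> N" and w: "sing w \<in> K 1 1" for k w
    proof (rule LIMSEQ_le_const2)
      show "(\<lambda>l. cmod (g k w - g l w)) \<longlonglongrightarrow> cmod (g k w - G w)"
        by (intro tendsto_norm tendsto_diff tendsto_const G Esp_sing[OF rK w])
      show "\<exists>M. \<forall>l\<ge>M. cmod (g k w - g l w) \<le> e"
        using N k close[OF w, of k] by (intro exI[of _ N]) (meson le_less_trans less_imp_le)
    qed
    then show ?thesis by blast
  qed
  have svw: "v = sing (v 0 0)" if "v \<in> K 1 1" for v
    using rmconvexD(1)[OF rK, of 1 1] that mats_1_eq_sing by blast
  have "uniform_limit (K 1 1) (\<lambda>k v. g k (v 0 0)) (\<lambda>v. G (v 0 0)) sequentially"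
    unfolding uniform_limit_sequentially_iff dist_norm
  proof (intro allI impI)
    fix e :: real assume "e > 0"
    then obtain N where N: "\<forall>k\<ge>N. \<forall>w. sing w \<in> K 1 1 \<longrightarrow> cmod (g k w - G w) \<le> e / 2"
      using unif[of "e / 2"] by auto
    have "cmod (g k (v 0 0) - G (v 0 0)) < e" if "k \<ge> N" "v \<in> K 1 1" for k v
    proof -
      have "sing (v 0 0) \<in> K 1 1" using svw[OF that(2)] that(2) by simp
      then have "cmod (g k (v 0 0) - G (v 0 0)) \<le> e / 2" using N that(1) by blast
      then show ?thesis using \<open>e > 0\<close> by simp
    qed
    then show "\<exists>N. \<forall>k\<ge>N. \<forall>v\<in>K 1 1. cmod (g k (v 0 0) - G (v 0 0)) < e" by blast
  qed
  then have "continuous_on (K 1 1) (\<lambda>v. G (v 0 0))"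
    using g(1) by (intro uniform_limit_theorem[OF always_eventually]) (auto simp: cfun_def)
  then have cG: "cfun K G" using Glin by (simp add: cfun_def)
  then have lG: "lift K G \<in> carrier (A_rho K)" unfolding A_rho_carrier[OF cK] by blast
  have d2: "s k - lift K G \<in> carrier (A_rho K)" for k
    by (rule complex_vector.subspace_diff[OF A_rho_subspace s lG])
  have "(\<lambda>k. elem_norm (A_rho K) (s k - lift K G)) \<longlonglongrightarrow> 0"
    unfolding LIMSEQ_iff
  proof (intro allI impI)
    fix e :: real assume e: "e > 0"
    then obtain N where N: "\<forall>k\<ge>N. \<forall>w. sing w \<in> K 1 1 \<longrightarrow> cmod (g k w - G w) \<le> e / 2"
      using unif[of "e / 2"] by auto
    have "norm (elem_norm (A_rho K) (s k - lift K G) - 0) < e" if k: "k \<ge> N" for k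
    proof -
      have "elem_norm (A_rho K) (s k - lift K G) \<le> e / 2"
      proof (rule A_rho_elem_le)
        fix w assume w: "sing w \<in> K 1 1"
        have "(s k - lift K G) 1 1 (sing w) 0 0 = g k w - G w"
          unfolding g(2) minus_apply lift_sing[OF w] ..
        then show "cmod ((s k - lift K G) 1 1 (sing w) 0 0) \<le> e / 2" using N k w by simp
      qed
      moreover have "0 \<le> elem_norm (A_rho K) (s k - lift K G)"
        unfolding elem_norm_sing using d2 by (intro A_rho_norm_nonneg) (simp_all only: sing_mats_iff zero_less_one)
      ultimately show ?thesis using e by simp
    qed
    then show "\<exists>N. \<forall>k\<ge>N. norm (elem_norm (A_rho K) (s k - lift K G) - 0) < e" by blast
  qed
  then show ?thesis using lG by blast
qed

theorem operator_space_A_rho: "operator_space (A_rho K)"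
  unfolding operator_space_def
proof (intro conjI allI impI ballI)
  show "complex_vector.subspace (carrier (A_rho K))" by (rule A_rho_subspace)
next
  fix n m F assume pos: "0 < n" "0 < m" and F: "F \<in> mats n m (carrier (A_rho K))"
  show "0 \<le> mnorm (A_rho K) n m F" by (rule A_rho_norm_nonneg[OF pos F])
  show "mnorm (A_rho K) n m F = 0 \<longleftrightarrow> F = 0"
    using A_rho_norm_eq_0[OF pos F] A_rho_norm_zero[OF pos] A_rho_norm_nonneg[OF pos F] by force
  show "mnorm (A_rho K) n m (c *\<^sub>C F) = cmod c * mnorm (A_rho K) n m F" for c
    by (rule A_rho_norm_scale[OF pos F])
  show "mnorm (A_rho K) n m (F + G) \<le> mnorm (A_rho K) n m F + mnorm (A_rho K) n m G"
    if "G \<in> mats n m (carrier (A_rho K))" for G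
    using A_rho_norm_combine[OF pos F that, of 1 1] by (simp add: scaleC_one)
next
  fix p q n m :: nat and \<alpha> F \<beta>
  assume "0 < p" "0 < q" "0 < n" "0 < m" "F \<in> mats n m (carrier (A_rho K))"
  then show "mnorm (A_rho K) p q (sandwich n m \<alpha> F \<beta>) \<le> opnorm p n \<alpha> * mnorm (A_rho K) n m F * opnorm m q \<beta>"
    by (rule A_rho_norm_sandwich)
next
  fix n m k l :: nat and x y
  assume "0 < n" "0 < m" "0 < k" "0 < l" "x \<in> mats n m (carrier (A_rho K))" "y \<in> mats k l (carrier (A_rho K))"
  then show "mnorm (A_rho K) (n + k) (m + l) (dsum n m x y) = max (mnorm (A_rho K) n m x) (mnorm (A_rho K) k l y)"
    by (rule A_rho_norm_dsum)
next
  fix s :: "nat \<Rightarrow> ('a, complex) family_map"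
  assume "(\<forall>k. s k \<in> carrier (A_rho K)) \<and>
    (\<forall>e>0. \<exists>N. \<forall>k\<ge>N. \<forall>l\<ge>N. elem_norm (A_rho K) (s k - s l) < e)"
  then show "\<exists>x\<in>carrier (A_rho K). (\<lambda>k. elem_norm (A_rho K) (s k - x)) \<longlonglongrightarrow> 0"
    by (intro A_rho_complete) auto
qed

end

section \<open>The dual unit ball of an operator space\<close>

lemma operator_spaceD:
  assumes X: "operator_space X"
  shows "complex_vector.subspace (carrier X)"
    and "0 < n \<Longrightarrow> 0 < m \<Longrightarrow> x \<in> mats n m (carrier X) \<Longrightarrow> 0 \<le> mnorm X n m x"
    and "0 < n \<Longrightarrow> 0 < m \<Longrightarrow> x \<in> mats n m (carrier X) \<Longrightarrow> mnorm X n m x = 0 \<longleftrightarrow> x = 0"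
    and "0 < n \<Longrightarrow> 0 < m \<Longrightarrow> x \<in> mats n m (carrier X) \<Longrightarrow> mnorm X n m (c *\<^sub>C x) = cmod c * mnorm X n m x"
    and "0 < n \<Longrightarrow> 0 < m \<Longrightarrow> x \<in> mats n m (carrier X) \<Longrightarrow> y \<in> mats n m (carrier X) \<Longrightarrow>
      mnorm X n m (x + y) \<le> mnorm X n m x + mnorm X n m y"
    and "0 < p \<Longrightarrow> 0 < q \<Longrightarrow> 0 < n \<Longrightarrow> 0 < m \<Longrightarrow> \<alpha> \<in> cmats p n \<Longrightarrow> x \<in> mats n m (carrier X) \<Longrightarrow> \<beta> \<in> cmats m q \<Longrightarrow>
      mnorm X p q (sandwich n m \<alpha> x \<beta>) \<le> opnorm p n \<alpha> * mnorm X n m x * opnorm m q \<beta>"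
    and "0 < n \<Longrightarrow> 0 < m \<Longrightarrow> 0 < k \<Longrightarrow> 0 < l \<Longrightarrow> x \<in> mats n m (carrier X) \<Longrightarrow> y' \<in> mats k l (carrier X) \<Longrightarrow>
      mnorm X (n + k) (m + l) (dsum n m x y') = max (mnorm X n m x) (mnorm X k l y')"
    and "(\<And>k::nat. s k \<in> carrier X) \<Longrightarrow> (\<And>e. e > 0 \<Longrightarrow> \<exists>N. \<forall>k\<ge>N. \<forall>l\<ge>N. elem_norm X (s k - s l) < e) \<Longrightarrow>
      \<exists>x\<in>carrier X. (\<lambda>k. elem_norm X (s k - x)) \<longlonglongrightarrow> 0"
proof -
  note D = X[unfolded operator_space_def]
  note D2 = D[THEN conjunct2]
  note N = D2[THEN conjunct1, rule_format]
  show "complex_vector.subspace (carrier X)" by (rule D[THEN conjunct1])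
  show "0 < n \<Longrightarrow> 0 < m \<Longrightarrow> x \<in> mats n m (carrier X) \<Longrightarrow> 0 \<le> mnorm X n m x"
    by (rule N[THEN conjunct1])
  show "0 < n \<Longrightarrow> 0 < m \<Longrightarrow> x \<in> mats n m (carrier X) \<Longrightarrow> mnorm X n m x = 0 \<longleftrightarrow> x = 0"
    by (rule N[THEN conjunct2, THEN conjunct1])
  show "0 < n \<Longrightarrow> 0 < m \<Longrightarrow> x \<in> mats n m (carrier X) \<Longrightarrow> mnorm X n m (c *\<^sub>C x) = cmod c * mnorm X n m x"
    by (rule N[THEN conjunct2, THEN conjunct2, THEN conjunct1, rule_format])
  show "0 < n \<Longrightarrow> 0 < m \<Longrightarrow> x \<in> mats n m (carrier X) \<Longrightarrow> y \<in> mats n m (carrier X) \<Longrightarrow>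
      mnorm X n m (x + y) \<le> mnorm X n m x + mnorm X n m y"
    by (rule N[THEN conjunct2, THEN conjunct2, THEN conjunct2, rule_format])
  show "0 < p \<Longrightarrow> 0 < q \<Longrightarrow> 0 < n \<Longrightarrow> 0 < m \<Longrightarrow> \<alpha> \<in> cmats p n \<Longrightarrow> x \<in> mats n m (carrier X) \<Longrightarrow> \<beta> \<in> cmats m q \<Longrightarrow>
      mnorm X p q (sandwich n m \<alpha> x \<beta>) \<le> opnorm p n \<alpha> * mnorm X n m x * opnorm m q \<beta>"
    by (rule D2[THEN conjunct2, THEN conjunct1, rule_format])
  show "0 < n \<Longrightarrow> 0 < m \<Longrightarrow> 0 < k \<Longrightarrow> 0 < l \<Longrightarrow> x \<in> mats n m (carrier X) \<Longrightarrow> y' \<in> mats k l (carrier X) \<Longrightarrow>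
      mnorm X (n + k) (m + l) (dsum n m x y') = max (mnorm X n m x) (mnorm X k l y')"
    by (rule D2[THEN conjunct2, THEN conjunct2, THEN conjunct1, rule_format])
  show "(\<And>k::nat. s k \<in> carrier X) \<Longrightarrow> (\<And>e. e > 0 \<Longrightarrow> \<exists>N. \<forall>k\<ge>N. \<forall>l\<ge>N. elem_norm X (s k - s l) < e) \<Longrightarrow>
      \<exists>x\<in>carrier X. (\<lambda>k. elem_norm X (s k - x)) \<longlonglongrightarrow> 0"
    by (intro D2[THEN conjunct2, THEN conjunct2, THEN conjunct2, rule_format] conjI allI impI)
qed

lemma compact_Pi_UNIV:
  fixes S :: "'i \<Rightarrow> 'b::topological_space set"
  assumes "\<And>i. compact (S i)"
  shows "compact {f. \<forall>i. f i \<in> S i}"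
proof -
  have "compactin (product_topology (\<lambda>i. euclidean) UNIV) (Pi\<^sub>E UNIV S)"
    unfolding compactin_PiE using assms by simp
  moreover have "Pi\<^sub>E UNIV S = {f. \<forall>i. f i \<in> S i}" by (auto simp: PiE_iff)
  ultimately show ?thesis by (simp add: euclidean_product_topology)
qed

lemma closed_Collect_imp_const: "(P \<Longrightarrow> closed {x. Q x}) \<Longrightarrow> closed {x. P \<longrightarrow> Q x}"
  by (cases P) auto

lemma closed_Collect_Ball: "(\<And>i. i \<in> A \<Longrightarrow> closed {x. P i x}) \<Longrightarrow> closed {x. \<forall>i\<in>A. P i x}"
  unfolding Ball_def by (intro closed_Collect_all closed_Collect_imp_const) auto

text \<open>For each row of \<xi> the sum of the squared norms of its images is the quadratic form
  of the total Gram matrix at that row.\<close>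

lemma hs_gram_sum:
  "(\<Sum>k<(l::nat). (hs p (N k) (\<lambda>a c. \<Sum>i<n. \<alpha> k c i * \<xi> a i))\<^sup>2) \<le> opnorm n n (\<Sum>k<l. gram (N k) (\<alpha> k)) * (hs p n \<xi>)\<^sup>2"
proof -
  have bs: "bil n n (\<Sum>k<l. A k) x y = (\<Sum>k<l. bil n n (A k) x y)" for A :: "nat \<Rightarrow> complex matrix" and l x y
  proof (induction l)
    case 0
    show ?case by (simp add: bil_def)
  next
    case (Suc l)
    then show ?case by (simp only: sum.lessThan_Suc bil_add)
  qed
  have row: "(\<Sum>k<l. (nrm (N k) (\<lambda>c. \<Sum>i<n. \<alpha> k c i * y i))\<^sup>2) \<le> opnorm n n (\<Sum>k<l. gram (N k) (\<alpha> k)) * (nrm n y)\<^sup>2" for y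
  proof -
    have eq: "complex_of_real (\<Sum>k<l. (nrm (N k) (\<lambda>c. \<Sum>i<n. \<alpha> k c i * y i))\<^sup>2) = bil n n (\<Sum>k<l. gram (N k) (\<alpha> k)) y y"
      unfolding bs bil_gram_diag of_real_sum ..
    have "cmod (bil n n (\<Sum>k<l. gram (N k) (\<alpha> k)) y y) = (\<Sum>k<l. (nrm (N k) (\<lambda>c. \<Sum>i<n. \<alpha> k c i * y i))\<^sup>2)"
      unfolding eq[symmetric] norm_of_real by (intro abs_of_nonneg sum_nonneg zero_le_power2)
    then show ?thesis
      using bil_le_opnorm[of n n "\<Sum>k<l. gram (N k) (\<alpha> k)" y y] by (simp add: power2_eq_square mult.assoc)
  qed
  have "(\<Sum>k<l. (hs p (N k) (\<lambda>a c. \<Sum>i<n. \<alpha> k c i * \<xi> a i))\<^sup>2) =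
      (\<Sum>a<p. \<Sum>k<l. (nrm (N k) (\<lambda>c. \<Sum>i<n. \<alpha> k c i * \<xi> a i))\<^sup>2)"
    unfolding hs_sq nrm_sq by (rule sum.swap)
  also have "\<dots> \<le> (\<Sum>a<p. opnorm n n (\<Sum>k<l. gram (N k) (\<alpha> k)) * (nrm n (\<xi> a))\<^sup>2)"
    by (intro sum_mono row)
  also have "\<dots> = opnorm n n (\<Sum>k<l. gram (N k) (\<alpha> k)) * (hs p n \<xi>)\<^sup>2"
    unfolding hs_sq nrm_sq sum_distrib_left ..
  finally show ?thesis .
qed

context
  fixes X :: "'x::complex_vector opspace"
  assumes X: "operator_space X"
begin

lemma X_nonneg: "\<forall>p>0. \<forall>q>0. \<forall>x\<in>mats p q (carrier X). 0 \<le> mnorm X p q x"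
  using operator_spaceD(2)[OF X] by blast

lemmas CBall_char = CBall_iff[OF X_nonneg]

lemma CBall_D:
  assumes "\<phi> \<in> CBall X n m"
  shows "0 < n" "0 < m" "linear_on (carrier X) (\<phi> i j)"
    and "x \<notin> carrier X \<or> n \<le> i \<or> m \<le> j \<Longrightarrow> \<phi> i j x = 0"
    and "0 < p \<Longrightarrow> 0 < q \<Longrightarrow> y \<in> mats p q (carrier X) \<Longrightarrow>
      cmod (quad p q n m (\<lambda>a b i j. \<phi> i j (y a b)) \<xi> \<eta>) \<le> mnorm X p q y * hs p n \<xi> * hs q m \<eta>"
proof -
  note D = assms[unfolded CBall_char]
  show "0 < n" by (rule D[THEN conjunct1])
  show "0 < m" by (rule D[THEN conjunct2, THEN conjunct1])
  show "linear_on (carrier X) (\<phi> i j)"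
    using D[THEN conjunct2, THEN conjunct2, THEN conjunct1] by blast
  show "x \<notin> carrier X \<or> n \<le> i \<or> m \<le> j \<Longrightarrow> \<phi> i j x = 0"
    using D[THEN conjunct2, THEN conjunct2, THEN conjunct2, THEN conjunct1] by blast
  show "0 < p \<Longrightarrow> 0 < q \<Longrightarrow> y \<in> mats p q (carrier X) \<Longrightarrow>
      cmod (quad p q n m (\<lambda>a b i j. \<phi> i j (y a b)) \<xi> \<eta>) \<le> mnorm X p q y * hs p n \<xi> * hs q m \<eta>"
    by (rule D[THEN conjunct2, THEN conjunct2, THEN conjunct2, THEN conjunct2, rule_format])
qed

lemma CBall_mats: "CBall X n m \<subseteq> mats n m UNIV"
  using CBall_D(4) by (auto simp: mats_def fun_eq_iff)

lemma zero_in_CBall: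
  assumes "0 < n" "0 < m"
  shows "0 \<in> CBall X n m"
  unfolding CBall_char
  using assms operator_spaceD(2)[OF X] by (auto simp: linear_on_def quad_def scaleC_complex_def)

text \<open>The coefficients move from the functionals to the test vectors. The Cauchy-Schwarz
  inequality over \<open>k\<close> and \<open>hs_gram_sum\<close> then leave the square root of the
  product of the two Gram norms, which is at most 1 by assumption.\<close>

lemma CBall_comb:
  fixes \<alpha> \<beta> :: "nat \<Rightarrow> complex matrix"
  assumes pos: "0 < n" "0 < m"
    and mem: "\<forall>k<l. \<alpha> k \<in> cmats (N k) n \<and> \<beta> k \<in> cmats (M k) m \<and> \<phi> k \<in> CBall X (N k) (M k)"
    and le: "opnorm n n (\<Sum>k<l. gram (N k) (\<alpha> k)) * opnorm m m (\<Sum>k<l. gram (M k) (\<beta> k)) \<le> 1"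
  shows "(\<Sum>k<l. sandwich (N k) (M k) (adj (\<alpha> k)) (\<phi> k) (\<beta> k)) \<in> CBall X n m"
proof -
  define \<psi> where "\<psi> = (\<Sum>k<l. sandwich (N k) (M k) (adj (\<alpha> k)) (\<phi> k) (\<beta> k))"
  have \<psi>: "\<psi> i j x = (\<Sum>k<l. \<Sum>a<N k. \<Sum>b<M k. adj (\<alpha> k) i a * \<beta> k b j * \<phi> k a b x)" for i j x
    by (simp add: \<psi>_def sum_fun_apply sandwich_def scaleC_fun_def scaleC_complex_def)
  have "linear_on (carrier X) (\<psi> i j)" for i j
  proof -
    have lin: "linear_on (carrier X) (\<phi> k a b)" if "k < l" for k a b using mem that CBall_D(3) by blast
    have "\<psi> i j (x + y) = \<psi> i j x + \<psi> i j y" if xy: "x \<in> carrier X" "y \<in> carrier X" for x y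
      unfolding \<psi> sum.distrib[symmetric]
      by (intro sum.cong refl) (simp add: linear_onD(1)[OF lin xy] distrib_left)
    moreover have "\<psi> i j (c *\<^sub>C x) = c *\<^sub>C \<psi> i j x" if x: "x \<in> carrier X" for c x
      unfolding \<psi> scaleC_complex_def sum_distrib_left
      by (intro sum.cong refl) (simp add: linear_onD(2)[OF lin x] scaleC_complex_def)
    ultimately show ?thesis unfolding linear_on_def by blast
  qed
  moreover have "\<psi> i j x = 0" if out: "x \<notin> carrier X \<or> n \<le> i \<or> m \<le> j" for i j x
  proof -
    have "adj (\<alpha> k) i a * \<beta> k b j * \<phi> k a b x = 0" if "k < l" for k a b
      using out CBall_D(4)[of "\<phi> k" "N k" "M k" x a b] mem that by (auto simp: mats_def adj_def)
    then show ?thesis unfolding \<psi> by (intro sum.neutral ballI) simp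
  qed
  moreover have "cmod (quad p q n m (\<lambda>a b i j. \<psi> i j (x a b)) \<xi> \<eta>) \<le> mnorm X p q x * hs p n \<xi> * hs q m \<eta>"
    if pq: "0 < p" "0 < q" and x: "x \<in> mats p q (carrier X)" for p q x \<xi> \<eta>
  proof -
    define \<xi>' where "\<xi>' = (\<lambda>k a c. \<Sum>i<n. \<alpha> k c i * \<xi> a i)"
    define \<eta>' where "\<eta>' = (\<lambda>k b c. \<Sum>j<m. \<beta> k c j * \<eta> b j)"
    have "bil n m (\<lambda>i j. \<psi> i j (x a b)) (\<xi> a) (\<eta> b) =
        (\<Sum>k<l. bil (N k) (M k) (\<lambda>c d. \<phi> k c d (x a b)) (\<xi>' k a) (\<eta>' k b))" for a b
    proof -
      have "bil n m (\<lambda>i j. \<psi> i j (x a b)) (\<xi> a) (\<eta> b) =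
        (\<Sum>k<l. bil n m (\<lambda>i j. \<Sum>c<N k. \<Sum>d<M k. adj (\<alpha> k) i c * \<beta> k d j * \<phi> k c d (x a b)) (\<xi> a) (\<eta> b))"
        unfolding bil_def \<psi> sum_distrib_left sum_distrib_right
        by (subst sum.swap[where B="{..<l}"])+ (simp add: sum.swap[where A="{..<m}" and B="{..<l}"] sum.swap[where A="{..<n}" and B="{..<l}"])
      then show ?thesis unfolding bil_sandwich by (simp only: adj_adj \<xi>'_def \<eta>'_def)
    qed
    then have "quad p q n m (\<lambda>a b i j. \<psi> i j (x a b)) \<xi> \<eta> =
        (\<Sum>a<p. \<Sum>b<q. \<Sum>k<l. bil (N k) (M k) (\<lambda>c d. \<phi> k c d (x a b)) (\<xi>' k a) (\<eta>' k b))"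
      unfolding quad_rows by simp
    also have "\<dots> = (\<Sum>a<p. \<Sum>k<l. \<Sum>b<q. bil (N k) (M k) (\<lambda>c d. \<phi> k c d (x a b)) (\<xi>' k a) (\<eta>' k b))"
      by (intro sum.cong refl sum.swap)
    also have "\<dots> = (\<Sum>k<l. quad p q (N k) (M k) (\<lambda>a b c d. \<phi> k c d (x a b)) (\<xi>' k) (\<eta>' k))"
      unfolding quad_rows by (rule sum.swap)
    finally have eq: "quad p q n m (\<lambda>a b i j. \<psi> i j (x a b)) \<xi> \<eta> =
        (\<Sum>k<l. quad p q (N k) (M k) (\<lambda>a b c d. \<phi> k c d (x a b)) (\<xi>' k) (\<eta>' k))" .
    let ?f = "\<lambda>k. hs p (N k) (\<xi>' k)" and ?g = "\<lambda>k. hs q (M k) (\<eta>' k)"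
    have nn: "0 \<le> mnorm X p q x" by (rule operator_spaceD(2)[OF X pq x])
    have "cmod (quad p q n m (\<lambda>a b i j. \<psi> i j (x a b)) \<xi> \<eta>) \<le> (\<Sum>k<l. mnorm X p q x * (?f k * ?g k))"
      unfolding eq
    proof (intro order_trans[OF norm_sum] sum_mono)
      fix k assume "k \<in> {..<l}"
      then have "\<phi> k \<in> CBall X (N k) (M k)" using mem by blast
      from CBall_D(5)[OF this pq x, of "\<xi>' k" "\<eta>' k"]
      show "cmod (quad p q (N k) (M k) (\<lambda>a b c d. \<phi> k c d (x a b)) (\<xi>' k) (\<eta>' k)) \<le> mnorm X p q x * (?f k * ?g k)"
        by (simp only: mult.assoc)
    qed
    also have "\<dots> = mnorm X p q x * (\<Sum>k<l. ?f k * ?g k)" by (simp add: sum_distrib_left)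
    also have "\<dots> \<le> mnorm X p q x * (hs p n \<xi> * hs q m \<eta>)"
    proof (intro mult_left_mono nn)
      let ?A = "opnorm n n (\<Sum>k<l. gram (N k) (\<alpha> k))" and ?B = "opnorm m m (\<Sum>k<l. gram (M k) (\<beta> k))"
      have "(\<Sum>k<l. ?f k * ?g k) \<le> L2_set ?f {..<l} * L2_set ?g {..<l}"
        using L2_set_mult_ineq[of ?f ?g "{..<l}"] by simp
      also have "\<dots> \<le> sqrt (?A * (hs p n \<xi>)\<^sup>2) * sqrt (?B * (hs q m \<eta>)\<^sup>2)"
        unfolding L2_set_def[of _ "{..<l}"] \<xi>'_def \<eta>'_def
        by (intro mult_mono real_sqrt_le_mono hs_gram_sum real_sqrt_ge_zero sum_nonneg zero_le_power2 mult_nonneg_nonneg opnorm_nonneg)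
      also have "\<dots> = sqrt (?A * ?B) * (hs p n \<xi> * hs q m \<eta>)"
        by (simp add: real_sqrt_mult)
      also have "\<dots> \<le> 1 * (hs p n \<xi> * hs q m \<eta>)"
        using le by (intro mult_right_mono mult_nonneg_nonneg L2_set_nonneg) simp
      finally show "(\<Sum>k<l. ?f k * ?g k) \<le> hs p n \<xi> * hs q m \<eta>" by simp
    qed
    finally show ?thesis by (simp only: mult.assoc)
  qed
  ultimately have "\<psi> \<in> CBall X n m" unfolding CBall_char using pos by blast
  then show ?thesis by (simp only: \<psi>_def)
qed

lemma rmconvex_CBall: "rmconvex (CBall X)"
  unfolding rmconvex_def
proof (intro conjI allI impI)
  show "CBall X n m \<subseteq> mats n m UNIV" for n m by (rule CBall_mats)
  show "CBall X n m \<noteq> {} \<longleftrightarrow> 0 < n \<and> 0 < m" for n m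
    using zero_in_CBall[of n m] CBall_D(1,2) by blast
  fix l n m N M \<alpha> \<beta> and v :: "nat \<Rightarrow> ('x \<Rightarrow> complex) matrix"
  assume A: "0 < (l::nat) \<and> 0 < n \<and> 0 < m \<and>
    (\<forall>i<l. \<alpha> i \<in> cmats (N i) n \<and> \<beta> i \<in> cmats (M i) m \<and> v i \<in> CBall X (N i) (M i)) \<and>
    opnorm n n (\<Sum>i<l. gram (N i) (\<alpha> i)) * opnorm m m (\<Sum>i<l. gram (M i) (\<beta> i)) \<le> 1"
  note A2 = A[THEN conjunct2] and A4 = A[THEN conjunct2, THEN conjunct2, THEN conjunct2]
  show "(\<Sum>i<l. sandwich (N i) (M i) (adj (\<alpha> i)) (v i) (\<beta> i)) \<in> CBall X n m"
    by (rule CBall_comb[where N=N and M=M and \<alpha>=\<alpha> and \<beta>=\<beta> and \<phi>=v and l=l,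
        OF A2[THEN conjunct1] A2[THEN conjunct2, THEN conjunct1] A4[THEN conjunct1] A4[THEN conjunct2]])
qed

lemma CBall_bound:
  assumes phi: "\<phi> \<in> CBall X n m" and x: "x \<in> carrier X"
  shows "cmod (\<phi> i j x) \<le> elem_norm X x"
proof (cases "i < n \<and> j < m")
  case True
  define e where "e = (\<lambda>i k :: nat. if k = i then 1 else 0 :: complex)"
  have sx: "sing x \<in> mats 1 1 (carrier X)" using x by (simp only: sing_mats_iff)
  have "quad 1 1 n m (\<lambda>a b i j. \<phi> i j (sing x a b)) (\<lambda>_. e i) (\<lambda>_. e j) = bil n m (\<lambda>i j. \<phi> i j x) (e i) (e j)"
    by (simp add: quad_rows)
  also have "\<dots> = \<phi> i j x" unfolding e_def using True by (simp only: bil_unit)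
  finally have "cmod (\<phi> i j x) \<le> mnorm X 1 1 (sing x) * hs 1 n (\<lambda>_. e i) * hs 1 m (\<lambda>_. e j)"
    using CBall_D(5)[OF phi zero_less_one zero_less_one sx, of "\<lambda>_. e i" "\<lambda>_. e j"] by simp
  moreover have "hs 1 N (\<lambda>_. e k) = 1" if "k < N" for k N
    using nrm_unit[OF that] by (simp add: e_def lessThan_Suc)
  ultimately show ?thesis unfolding elem_norm_sing using True by (simp only: mult_1_right)
next
  case False
  then have "\<phi> i j x = 0" using CBall_D(4)[OF phi] by (auto simp: not_less)
  moreover have "0 \<le> elem_norm X x"
    unfolding elem_norm_sing by (rule operator_spaceD(2)[OF X]) (simp_all only: zero_less_one sing_mats_iff x)
  ultimately show ?thesis by simp
qed

lemma cont_eval3: "continuous_on S (\<lambda>\<phi>::('x \<Rightarrow> complex) matrix. \<phi> i j x)"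
proof -
  have "continuous_on UNIV (\<lambda>f::'x \<Rightarrow> complex. f x)" by (rule continuous_on_product_coordinates)
  from continuous_on_compose2[OF this cont_entry[of S i j]] show ?thesis by simp
qed

text \<open>Banach-Alaoglu: the conditions in \<open>CBall_char\<close> are closed in the product
  topology, and \<open>CBall_bound\<close> places all coordinates in discs, of radius 0 outside the
  carrier.\<close>

lemma compact_CBall: "compact (CBall X n m)"
proof -
  define B where "B = {\<phi> :: ('x \<Rightarrow> complex) matrix. \<forall>i. \<phi> i \<in> {\<psi>. \<forall>j. \<psi> j \<in> {f. \<forall>x. f x \<in> cball 0 (if x \<in> carrier X then elem_norm X x else 0)}}}"
  have "compact B" unfolding B_def by (intro compact_Pi_UNIV compact_cball)
  moreover have "closed {\<phi>. (0 < n \<and> 0 < m) \<and>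
     (\<forall>i j. (\<forall>x\<in>carrier X. \<forall>y\<in>carrier X. \<phi> i j (x + y) = \<phi> i j x + \<phi> i j y) \<and>
        (\<forall>c. \<forall>x\<in>carrier X. \<phi> i j (c *\<^sub>C x) = c * \<phi> i j x)) \<and>
    (\<forall>i j x. x \<notin> carrier X \<or> n \<le> i \<or> m \<le> j \<longrightarrow> \<phi> i j x = 0) \<and>
    (\<forall>p>0. \<forall>q>0. \<forall>x\<in>mats p q (carrier X). \<forall>\<xi> \<eta>.
       cmod (quad p q n m (\<lambda>a b i j. \<phi> i j (x a b)) \<xi> \<eta>) \<le> mnorm X p q x * hs p n \<xi> * hs q m \<eta>)}"
    unfolding quad_def
    by (intro closed_Collect_conj closed_Collect_all closed_Collect_Ball closed_Collect_imp_const
        closed_Collect_const closed_Collect_eq closed_Collect_le continuous_intros cont_eval3)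
  moreover have "CBall X n m = B \<inter> {\<phi>. (0 < n \<and> 0 < m) \<and>
     (\<forall>i j. (\<forall>x\<in>carrier X. \<forall>y\<in>carrier X. \<phi> i j (x + y) = \<phi> i j x + \<phi> i j y) \<and>
        (\<forall>c. \<forall>x\<in>carrier X. \<phi> i j (c *\<^sub>C x) = c * \<phi> i j x)) \<and>
    (\<forall>i j x. x \<notin> carrier X \<or> n \<le> i \<or> m \<le> j \<longrightarrow> \<phi> i j x = 0) \<and>
    (\<forall>p>0. \<forall>q>0. \<forall>x\<in>mats p q (carrier X). \<forall>\<xi> \<eta>.
       cmod (quad p q n m (\<lambda>a b i j. \<phi> i j (x a b)) \<xi> \<eta>) \<le> mnorm X p q x * hs p n \<xi> * hs q m \<eta>)}"
    (is "_ = B \<inter> ?C")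
  proof -
    have C: "CBall X n m = ?C"
      by (rule set_eqI) (simp only: CBall_char linear_on_def scaleC_complex_def mem_Collect_eq conj_assoc)
    have sub: "CBall X n m \<subseteq> B"
    proof
      fix \<phi> assume phi: "\<phi> \<in> CBall X n m"
      have "\<phi> i j x \<in> cball 0 (if x \<in> carrier X then elem_norm X x else 0)" for i j x
        using CBall_bound[OF phi, of x i j] CBall_D(4)[OF phi, of x i j] by simp
      then show "\<phi> \<in> B" unfolding B_def mem_Collect_eq by (intro allI)
    qed
    show ?thesis unfolding C[symmetric] by (rule Int_absorb1[OF sub, symmetric])
  qed
  ultimately show ?thesis by (simp only: compact_Int_closed)
qed

theorem compact_rmconvex_CBall: "compact_rmconvex (CBall X)"
  unfolding compact_rmconvex_def using rmconvex_CBall compact_CBall by blast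

end

section \<open>Separation of points in locally convex spaces\<close>

lemma tendsto_scaleC:
  fixes a :: "'a::complex_lctvs"
  assumes "(c \<longlongrightarrow> d) F" "(f \<longlongrightarrow> a) F"
  shows "((\<lambda>x. c x *\<^sub>C f x) \<longlongrightarrow> d *\<^sub>C a) F"
  using filterlim_compose[OF tendsto_scaleC_Pair filterlim_Pair[OF assms]] by simp

text \<open>\<open>P\<close> is the Minkowski functional of a convex neighbourhood of 0 that misses
  \<open>x\<close>; a linear functional below \<open>P\<close> that equals \<open>P\<close> at
  \<open>x\<close> is nonzero there.\<close>

lemma exists_continuous_functional:
  fixes x :: "'a::complex_lctvs"
  assumes x: "x \<noteq> 0"
  shows "\<exists>h :: 'a \<Rightarrow> complex. linear_on UNIV h \<and> continuous_on UNIV h \<and> h x \<noteq> 0"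
proof -
  obtain U where U: "open U" "0 \<in> U" "x \<notin> U"
    using t1_space[of 0 x] x by metis
  obtain W where W: "open W" "0 \<in> W" "W \<subseteq> U"
    and conv: "\<And>x y t. x \<in> W \<Longrightarrow> y \<in> W \<Longrightarrow> t \<in> {0..1} \<Longrightarrow>
      complex_of_real t *\<^sub>C x + complex_of_real (1 - t) *\<^sub>C y \<in> W"
    using locally_convex[OF U(1,2)] by blast
  define T where "T y = {t. 0 < t \<and> inverse t *\<^sub>R\<^sub>C y \<in> W}" for y
  define P where "P y = (INF t\<in>T y. t)" for y
  have ne: "T y \<noteq> {}" for y
  proof -
    have "((\<lambda>s. s *\<^sub>R\<^sub>C y) \<longlongrightarrow> complex_of_real 0 *\<^sub>C y) (at_right 0)"
      by (intro tendsto_scaleC tendsto_of_real tendsto_const tendsto_ident_at)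
    then have "\<forall>\<^sub>F s in at_right 0. s *\<^sub>R\<^sub>C y \<in> W"
      using W(1,2) by (intro topological_tendstoD) simp_all
    moreover have "\<forall>\<^sub>F s in at_right 0. (0::real) < s" by (rule eventually_at_right_less)
    ultimately have "\<forall>\<^sub>F s in at_right 0. (0::real) < s \<and> s *\<^sub>R\<^sub>C y \<in> W" by eventually_elim simp
    then obtain s :: real where "0 < s" "s *\<^sub>R\<^sub>C y \<in> W"
      using eventually_happens[of _ "at_right (0::real)"] by auto
    then have "inverse s \<in> T y" by (simp add: T_def)
    then show ?thesis by blast
  qed
  have le: "P y \<le> t" if "t \<in> T y" for y t
    unfolding P_def using that by (intro cINF_lower bdd_belowI2[of _ 0]) (auto simp: T_def)
  have sub: "sublinear_on UNIV P"
  proof (rule sublinear_onI[OF complex_vector.subspace_UNIV])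
    fix y z
    show "P (y + z) \<le> P y + P z"
      unfolding P_def[of y] P_def[of z]
    proof (rule le_cINF_add[OF ne ne])
      fix s t assume st: "s \<in> T y" "t \<in> T z"
      then have pos: "0 < s" "0 < t" by (auto simp: T_def)
      have "complex_of_real (s / (s + t)) *\<^sub>C (inverse s *\<^sub>R\<^sub>C y) + complex_of_real (1 - s / (s + t)) *\<^sub>C (inverse t *\<^sub>R\<^sub>C z) \<in> W"
        using st pos by (intro conv) (auto simp: T_def)
      moreover have "s / (s + t) * inverse s = inverse (s + t)" "(1 - s / (s + t)) * inverse t = inverse (s + t)"
        using pos by (simp_all add: field_simps)
      then have "complex_of_real (s / (s + t)) * complex_of_real (inverse s) = complex_of_real (inverse (s + t))"
        "complex_of_real (1 - s / (s + t)) * complex_of_real (inverse t) = complex_of_real (inverse (s + t))"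
        by (simp_all only: of_real_mult[symmetric])
      ultimately have "inverse (s + t) *\<^sub>R\<^sub>C (y + z) \<in> W"
        by (simp only: scaleC_scaleC scaleC_add_right)
      then show "P (y + z) \<le> s + t" using pos by (intro le) (simp add: T_def)
    qed
  next
    fix c :: real and y assume c: "0 < c"
    show "P (c *\<^sub>R\<^sub>C y) \<le> c * P y"
      unfolding P_def[of y]
    proof (rule le_cINF_mult[OF ne c])
      fix t assume t: "t \<in> T y"
      then have "0 < t" by (simp add: T_def)
      have "inverse (c * t) * c = inverse t" using c by simp
      then have "complex_of_real (inverse (c * t)) * complex_of_real c = complex_of_real (inverse t)"
        by (simp only: of_real_mult[symmetric])
      then have eq: "inverse (c * t) *\<^sub>R\<^sub>C (c *\<^sub>R\<^sub>C y) = inverse t *\<^sub>R\<^sub>C y"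
        by (simp only: scaleC_scaleC)
      have "c * t \<in> T (c *\<^sub>R\<^sub>C y)"
        using t c \<open>0 < t\<close> unfolding T_def mem_Collect_eq eq by simp
      then show "P (c *\<^sub>R\<^sub>C y) \<le> c * t" by (rule le)
    qed
  next
    have "P 0 \<le> t" if "t > 0" for t using W(2) that by (intro le) (simp add: T_def)
    then have "P 0 \<le> 0" by (rule dense_ge)
    moreover have "0 \<le> P 0" unfolding P_def by (rule cINF_greatest[OF ne]) (auto simp: T_def)
    ultimately show "P 0 = 0" by simp
  qed
  obtain l where l: "real_linear_on UNIV l" "\<And>y. l y \<le> P y" "l x = P x"
    using hahn_banach_point[OF complex_vector.subspace_UNIV sub, of x] by auto
  have ladd: "l (y + z) = l y + l z" and lscale: "l (t *\<^sub>R\<^sub>C y) = t * l y" for y z t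
    using l(1) unfolding real_linear_on_def by blast+
  have lneg: "l (- y) = - l y" for y
    using lscale[of "- 1" y] by (simp add: complex_vector.scale_minus_left scaleC_one)
  \<comment> \<open>If \<open>x / t\<close> were in \<open>W\<close> for some \<open>t < 1\<close>,
    convexity with the point 0 would put \<open>x\<close> into \<open>W\<close>.\<close>
  have "1 \<le> P x"
    unfolding P_def
  proof (rule cINF_greatest[OF ne])
    fix t assume t: "t \<in> T x"
    show "1 \<le> t"
    proof (rule ccontr)
      assume "\<not> 1 \<le> t"
      then have "t *\<^sub>R\<^sub>C (inverse t *\<^sub>R\<^sub>C x) + complex_of_real (1 - t) *\<^sub>C 0 \<in> W"
        using t W(2) by (intro conv) (auto simp: T_def)
      moreover have "complex_of_real t * complex_of_real (inverse t) = 1"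
        using t by (simp add: T_def)
      ultimately have "x \<in> W" by (simp add: scaleC_scaleC scaleC_one del: of_real_inverse)
      then show False using W(3) U(3) by blast
    qed
  qed
  have lW: "l y \<le> 1" if "y \<in> W" for y
    using l(2)[of y] le[of 1 y] that by (force simp: T_def scaleC_one)
  have lcont: "continuous_on UNIV l"
    unfolding continuous_on_def
  proof (intro ballI)
    fix y
    show "(l \<longlongrightarrow> l y) (at y within UNIV)"
    proof (rule tendstoI)
      fix e :: real assume e: "e > 0"
      \<comment> \<open>\<open>W\<close> need not be symmetric, so the scaled difference is put into
        \<open>W\<close> with both signs; \<open>lW\<close> then gives
        \<open>|l z - l y| \<le> e / 2\<close>.\<close>
      have lim: "((\<lambda>z. z - y) \<longlongrightarrow> y - y) (at y)" by (intro tendsto_diff tendsto_ident_at tendsto_const)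
      have "((\<lambda>z. complex_of_real (2 / e) *\<^sub>C (z - y)) \<longlongrightarrow> complex_of_real (2 / e) *\<^sub>C (y - y)) (at y)"
        by (rule tendsto_scaleC[OF tendsto_const lim])
      then have "((\<lambda>z. complex_of_real (2 / e) *\<^sub>C (z - y)) \<longlongrightarrow> 0) (at y)" by simp
      then have "\<forall>\<^sub>F z in at y. complex_of_real (2 / e) *\<^sub>C (z - y) \<in> W"
        by (rule topological_tendstoD) (use W in auto)
      moreover
      have "((\<lambda>z. complex_of_real (- 2 / e) *\<^sub>C (z - y)) \<longlongrightarrow> complex_of_real (- 2 / e) *\<^sub>C (y - y)) (at y)"
        by (rule tendsto_scaleC[OF tendsto_const lim])
      then have "((\<lambda>z. complex_of_real (- 2 / e) *\<^sub>C (z - y)) \<longlongrightarrow> 0) (at y)" by simp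
      then have "\<forall>\<^sub>F z in at y. complex_of_real (- 2 / e) *\<^sub>C (z - y) \<in> W"
        by (rule topological_tendstoD) (use W in auto)
      ultimately show "\<forall>\<^sub>F z in at y within UNIV. dist (l z) (l y) < e"
      proof eventually_elim
        case (elim z)
        have "l (z - y) = l z - l y" using ladd[of "z - y" y] by simp
        then have "2 / e * (l z - l y) \<le> 1" "- 2 / e * (l z - l y) \<le> 1"
          using lW[OF elim(1)] lW[OF elim(2)] unfolding lscale by simp_all
        then have "l z - l y \<le> e / 2" "- (l z - l y) \<le> e / 2" using e by (simp_all add: field_simps)
        then have "\<bar>l z - l y\<bar> \<le> e / 2" by (simp only: abs_le_iff)
        then show ?case using e by (simp add: dist_real_def)
      qed
    qed
  qed
  define h where "h y = Complex (l y) (- l (\<i> *\<^sub>C y))" for y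
  have "linear_on UNIV h" unfolding h_def by (rule complexify[OF complex_vector.subspace_UNIV l(1)])
  moreover have "continuous_on UNIV h"
  proof -
    have "continuous_on UNIV (\<lambda>y::'a. \<i> *\<^sub>C y)"
      unfolding continuous_on_def by (intro ballI tendsto_scaleC tendsto_const tendsto_ident_at)
    then have "continuous_on UNIV (\<lambda>y. l (\<i> *\<^sub>C y))"
      using continuous_on_compose2[OF lcont] by blast
    then show ?thesis unfolding h_def Complex_eq using lcont by (intro continuous_intros)
  qed
  moreover have "h x \<noteq> 0"
  proof -
    have "Re (h x) \<ge> 1" using l(3) \<open>1 \<le> P x\<close> by (simp add: h_def)
    then show ?thesis by auto
  qed
  ultimately show ?thesis by blast
qed


section \<open>Point evaluations\<close>

lemma sandwich_scale:
  "sandwich n m (c *\<^sub>C \<alpha>) v (d *\<^sub>C \<beta>) = (c * d) *\<^sub>C sandwich n m \<alpha> v \<beta>"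
  by (intro ext) (simp add: sandwich_def scaleC_fun_def scaleC_complex_def
      complex_vector.scale_sum_right scaleC_scaleC mult_ac)

lemma emb_id: "emb n 0 = id_mat n"
  by (auto simp: emb_def id_mat_def fun_eq_iff)

text \<open>Coefficients act from both sides, hence the square roots of \<open>t\<close> and
  \<open>1 - t\<close> as multiples of identity matrices.\<close>

lemma rmconvex_convex:
  assumes K: "rmconvex K" and v: "v \<in> K n m" and w: "w \<in> K n m" and t: "0 \<le> t" "t \<le> 1"
  shows "t *\<^sub>R\<^sub>C v + (1 - t) *\<^sub>R\<^sub>C w \<in> K n m"
proof -
  define s where "s i = (if i = (0::nat) then sqrt t else sqrt (1 - t))" for i
  define x where "x i = (if i = (0::nat) then v else w)" for i
  have pos: "0 < n" "0 < m" using rmconvexD(2)[OF K, of n m] v by blast+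
  have two: "(\<Sum>i<2. f i) = f 0 + f (1::nat)" for f :: "nat \<Rightarrow> 'z::comm_monoid_add"
    by (simp add: numeral_2_eq_2)
  have adj_sc: "adj (r *\<^sub>R\<^sub>C A) = r *\<^sub>R\<^sub>C adj A" for r A
    by (simp add: adj_def scaleC_fun_def scaleC_complex_def fun_eq_iff)
  have gid: "gram N (id_mat N) = id_mat N" for N
    unfolding emb_id[symmetric] gram_emb by (auto simp: id_mat_def emb_id)
  have sq: "(cmod (complex_of_real (s 0)))\<^sup>2 = t" "(cmod (complex_of_real (s 1)))\<^sup>2 = 1 - t"
    "complex_of_real (s 0) * complex_of_real (s 0) = complex_of_real t"
    "complex_of_real (s 1) * complex_of_real (s 1) = complex_of_real (1 - t)"
    using t by (simp_all add: s_def flip: of_real_mult)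
  have g: "(\<Sum>i<2. gram N (s i *\<^sub>R\<^sub>C id_mat N)) = id_mat N" for N
    unfolding two gram_scale sq gid scaleC_add_left[symmetric] of_real_add[symmetric] by (simp add: scaleC_one)
  have sid: "sandwich n m (adj (id_mat n)) y (id_mat m) = y" if "y \<in> K n m" for y
  proof -
    have "y \<in> mats n m UNIV" using rmconvexD(1)[OF K] that by blast
    then show ?thesis unfolding emb_id[symmetric] sandwich_emb by (auto simp: mats_def fun_eq_iff not_less)
  qed
  have "(\<Sum>i<2. sandwich n m (adj (s i *\<^sub>R\<^sub>C id_mat n)) (x i) (s i *\<^sub>R\<^sub>C id_mat m)) \<in> K n m"
  proof (rule rmconvexD(3)[OF K _ pos, where N="\<lambda>_. n" and M="\<lambda>_. m"])
    show "opnorm n n (\<Sum>i<2. gram n (s i *\<^sub>R\<^sub>C id_mat n)) * opnorm m m (\<Sum>i<2. gram m (s i *\<^sub>R\<^sub>C id_mat m)) \<le> 1"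
      unfolding g using mult_mono[OF opnorm_id_mat[of n] opnorm_id_mat[of m]] by simp
    show "s i *\<^sub>R\<^sub>C id_mat n \<in> cmats n n \<and> s i *\<^sub>R\<^sub>C id_mat m \<in> cmats m m \<and> x i \<in> K n m" if "i < 2" for i
      using v w by (auto simp: mats_def id_mat_def scaleC_fun_def scaleC_complex_def x_def)
  qed simp
  moreover have "(\<Sum>i<2. sandwich n m (adj (s i *\<^sub>R\<^sub>C id_mat n)) (x i) (s i *\<^sub>R\<^sub>C id_mat m)) = t *\<^sub>R\<^sub>C v + (1 - t) *\<^sub>R\<^sub>C w"
    unfolding two adj_sc sandwich_scale sq using sid[OF v] sid[OF w] by (simp add: x_def)
  ultimately show ?thesis by simp
qed

lemma lift_cong:
  assumes K: "rmconvex K" and "\<And>w. w \<in> Esp K \<Longrightarrow> g w = h w"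
  shows "lift K g = lift K h"
  unfolding lift_def using entry_in_Esp[OF K] assms(2) by (intro ext) (simp add: fun_eq_iff)

lemma lift_linear:
  assumes K: "rmconvex K" and E: "linear_on (Esp K) g" and i: "n \<le> i \<or> m \<le> j" and v: "v \<in> K n m"
  shows "lift K g n m v i j = 0"
proof -
  have "v i j = 0" using rmconvexD(1)[OF K, of n m] v i by (auto simp: mats_def)
  then show ?thesis using v linear_onD(3)[OF E Esp_zero[OF K]] by (simp add: lift_def)
qed

context
  fixes K :: "'a::complex_lctvs matrix_family"
  assumes cK: "compact_rmconvex K"
begin

lemma point_eval_in_CBall:
  assumes v: "v \<in> K n m"
  shows "point_eval K n m v \<in> CBall (A_rho K) n m"
proof -
  note rK = compact_rmconvexD(1)[OF cK]
  note op = operator_space_A_rho[OF cK]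
  define \<phi> where "\<phi> = (\<lambda>i j f. if f \<in> carrier (A_rho K) then f n m v i j else 0)"
  have nm: "0 < n" "0 < m" using rmconvexD(2)[OF rK, of n m] v by blast+
  have "linear_on (carrier (A_rho K)) (\<phi> i j)" for i j
    unfolding linear_on_def
  proof (intro conjI ballI allI)
    fix x y assume xy: "x \<in> carrier (A_rho K)" "y \<in> carrier (A_rho K)"
    then have "x + y \<in> carrier (A_rho K)" by (rule complex_vector.subspace_add[OF A_rho_subspace[OF cK]])
    then show "\<phi> i j (x + y) = \<phi> i j x + \<phi> i j y" using xy by (simp add: \<phi>_def)
  next
    fix c x assume x: "x \<in> carrier (A_rho K)"
    then have "c *\<^sub>C x \<in> carrier (A_rho K)" by (rule complex_vector.subspace_scale[OF A_rho_subspace[OF cK]])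
    moreover have "(c *\<^sub>C x) n m v i j = c *\<^sub>C x n m v i j" by (simp add: scaleC_fun_def)
    ultimately show "\<phi> i j (c *\<^sub>C x) = c *\<^sub>C \<phi> i j x" using x by (simp add: \<phi>_def)
  qed
  moreover have "\<phi> i j f = 0" if "f \<notin> carrier (A_rho K) \<or> n \<le> i \<or> m \<le> j" for i j f
  proof (cases "f \<in> carrier (A_rho K)")
    case True
    then obtain g where "cfun K g" "f = lift K g" by (rule A_rho_carrierE[OF cK])
    then show ?thesis using lift_linear[OF rK _ _ v, of g i j] that True by (auto simp: \<phi>_def cfun_def)
  qed (simp add: \<phi>_def)
  moreover have "cmod (quad p q n m (\<lambda>a b i j. \<phi> i j (F a b)) \<xi> \<eta>) \<le> mnorm (A_rho K) p q F * hs p n \<xi> * hs q m \<eta>"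
    if pq: "0 < p" "0 < q" and F: "F \<in> mats p q (carrier (A_rho K))" for p q F \<xi> \<eta>
  proof -
    have "quad p q n m (\<lambda>a b i j. \<phi> i j (F a b)) \<xi> \<eta> = quad p q n m (\<lambda>a b. F a b n m v) \<xi> \<eta>"
      using F by (intro quad_cong) (simp add: \<phi>_def mats_def)
    then show ?thesis using A_rho_norm_quad[OF cK F pq v] by simp
  qed
  ultimately have "\<phi> \<in> CBall (A_rho K) n m" unfolding CBall_char[OF op] using nm by blast
  then show ?thesis using v by (simp add: point_eval_def \<phi>_def)
qed

text \<open>Each \<open>f\<close> is the lifting of some functional \<open>G f\<close> on
  \<open>Esp K\<close>, so the point evaluation is itself the lifting of
  \<open>w \<mapsto> (\<lambda>f. G f w)\<close>, and \<open>rm_affine_lift\<close> applies.\<close>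

lemma point_eval_affine: "rm_affine K (CBall (A_rho K)) (point_eval K)"
proof -
  note rK = compact_rmconvexD(1)[OF cK]
  have "\<forall>f. \<exists>g. f \<in> carrier (A_rho K) \<longrightarrow> cfun K g \<and> f = lift K g"
    using A_rho_carrier[OF cK] by blast
  then have "\<exists>G. \<forall>f. f \<in> carrier (A_rho K) \<longrightarrow> cfun K (G f) \<and> f = lift K (G f)" by (rule choice)
  then obtain G where G': "\<forall>f. f \<in> carrier (A_rho K) \<longrightarrow> cfun K (G f) \<and> f = lift K (G f)" ..
  note G = G'[rule_format]
  define h where "h w = (\<lambda>f. if f \<in> carrier (A_rho K) then G f w else 0)" for w
  have lin: "linear_on (Esp K) h"
  proof -
    have "G f (x + y) = G f x + G f y" "G f (c *\<^sub>C x) = c * G f x"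
      if "f \<in> carrier (A_rho K)" "x \<in> Esp K" "y \<in> Esp K" for f x y c
      using linear_onD(1,2)[of "Esp K" "G f"] G[OF that(1)] that unfolding cfun_def scaleC_complex_def by auto
    then show ?thesis
      unfolding linear_on_def h_def by (auto simp: fun_eq_iff scaleC_fun_def scaleC_complex_def)
  qed
  have eq: "point_eval K = lift K h"
  proof (intro ext)
    fix n m v i j f
    show "point_eval K n m v i j f = lift K h n m v i j f"
    proof (cases "v \<in> K n m \<and> f \<in> carrier (A_rho K)")
      case True
      then have "f n m v i j = lift K (G f) n m v i j"
        using arg_cong[OF conjunct2[OF G[of f]], of "\<lambda>f. f n m v i j"] by blast
      then show ?thesis using True by (simp add: point_eval_def lift_def h_def)
    qed (auto simp: point_eval_def lift_def h_def)
  qed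
  show ?thesis
    unfolding eq
  proof (rule rm_affine_lift[OF rK lin], intro allI ballI)
    fix n m v assume v: "v \<in> K n m"
    then show "(\<lambda>i j. h (v i j)) \<in> CBall (A_rho K) n m"
      using point_eval_in_CBall[OF v] unfolding eq by (simp add: lift_def)
  qed
qed

lemma point_eval_cont: "continuous_on (K n m) (point_eval K n m)"
proof -
  note rK = compact_rmconvexD(1)[OF cK]
  have "continuous_on (K n m) (\<lambda>v i j f. if f \<in> carrier (A_rho K) then f n m v i j else 0)"
  proof (intro cont_matrixI continuous_on_coordinatewise_then_product)
    fix i j f
    show "continuous_on (K n m) (\<lambda>v. if f \<in> carrier (A_rho K) then f n m v i j else 0)"
    proof (cases "f \<in> carrier (A_rho K)")
      case True
      then obtain g where g: "cfun K g" "f = lift K g" by (rule A_rho_carrierE[OF cK])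
      have "continuous_on (K n m) (\<lambda>v. g (v i j))" by (rule cfun_cont[OF rK g(1)])
      then have "continuous_on (K n m) (\<lambda>v. f n m v i j)"
        by (rule continuous_on_eq) (simp add: g(2) lift_def)
      then show ?thesis using True by simp
    qed simp
  qed
  then show ?thesis by (rule continuous_on_eq) (simp add: point_eval_def)
qed

text \<open>Here local convexity and the Hausdorff property enter: continuous functionals on the
  whole space separate the entries, and their liftings belong to \<open>A_rho K\<close>.\<close>

lemma point_eval_inj: "inj_on (point_eval K n m) (K n m)"
proof (rule inj_onI, rule ccontr)
  note rK = compact_rmconvexD(1)[OF cK]
  fix v w assume v: "v \<in> K n m" and w: "w \<in> K n m" and eq: "point_eval K n m v = point_eval K n m w"
    and "v \<noteq> w"
  then obtain i j where "v i j - w i j \<noteq> 0" by (auto simp: fun_eq_iff)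
  then obtain h :: "'a \<Rightarrow> complex" where h: "linear_on UNIV h" "continuous_on UNIV h" "h (v i j - w i j) \<noteq> 0"
    using exists_continuous_functional by blast
  have "linear_on (Esp K) h" using h(1) unfolding linear_on_def by blast
  moreover have "continuous_on (K 1 1) (\<lambda>v. h (v 0 0))"
    by (rule continuous_on_compose2[OF h(2) cont_entry]) simp
  ultimately have "lift K h \<in> carrier (A_rho K)" unfolding A_rho_carrier[OF cK] cfun_def by blast
  then have "lift K h n m v i j = lift K h n m w i j"
    using fun_cong[OF fun_cong[OF fun_cong[OF eq]], of i j "lift K h"] v w by (simp add: point_eval_def)
  then have "h (v i j) = h (w i j)" using v w by (simp add: lift_def)
  moreover have "h (v i j) = h (v i j - w i j) + h (w i j)"
    using linear_onD(1)[OF h(1), of "v i j - w i j" "w i j"] by simp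
  ultimately show False using h(3) by simp
qed

text \<open>With \<open>F = R\<^sup>* G S\<close> from the factorization, the pairing of \<open>\<phi>\<close> with \<open>F\<close> is
  \<open>\<langle>\<phi>(G) S, R\<rangle>\<close>, where \<open>\<parallel>\<phi>(G)\<parallel> \<le> \<parallel>G\<parallel> \<le> 1\<close>.\<close>

lemma CBall_A_rho_bound:
  assumes nm: "0 < n" "0 < m" and F: "\<forall>i j. F i j \<in> carrier (A_rho K)"
    and le: "\<forall>v\<in>K n m. Re (\<Sum>i<n. \<Sum>j<m. F i j n m v i j) \<le> 1"
    and phi: "\<phi> \<in> CBall (A_rho K) n m"
  shows "Re (\<Sum>i<n. \<Sum>j<m. \<phi> i j (F i j)) \<le> 1"
proof -
  note rK = compact_rmconvexD(1)[OF cK]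
  note op = operator_space_A_rho[OF cK]
  note sub = A_rho_subspace[OF cK]
  have "\<forall>i. \<exists>g. \<forall>j. cfun K (g j) \<and> F i j = lift K (g j)"
    using F unfolding A_rho_carrier[OF cK] by (intro allI choice) blast
  then obtain g where g: "\<And>i j. cfun K (g i j)" "\<And>i j. F i j = lift K (g i j)" by (metis choice)
  have lin: "linear_on (Esp K) (g i j)" for i j using g(1) by (simp add: cfun_def)
  have le': "\<forall>v\<in>K n m. Re (\<Sum>i<n. \<Sum>j<m. g i j (v i j)) \<le> 1"
    using le by (simp add: g(2) lift_def)
  have KE: "\<forall>r s. \<forall>v\<in>K r s. \<forall>k l. v k l \<in> Esp K" using entry_in_Esp[OF rK] by blast
  have absorb: "\<forall>w\<in>Esp K. \<exists>t>0. sing (t *\<^sub>R\<^sub>C w) \<in> K 1 1" unfolding Esp_def by blast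
  obtain u z R S where fac: "(\<forall>i<n. \<forall>j<m. \<forall>w\<in>Esp K.
      g i j w = (\<Sum>a<n. \<Sum>b<m. cnj (R a i) * S b j * bform g n m w (u a) (z b))) \<and>
    hs n n R \<le> 1 \<and> hs m m S \<le> 1 \<and>
    (\<forall>r>0. \<forall>s>0. \<forall>v\<in>K r s. \<forall>\<xi> \<eta>.
      cmod (quad r s n m (\<lambda>k l a b. bform g n m (v k l) (u a) (z b)) \<xi> \<eta>) \<le> hs r n \<xi> * hs s m \<eta>)"
    using factorization[OF rmconvex_imp_ds_convex[OF rK] Esp_subspace[OF rK] KE absorb lin nm le'] by (elim exE)
  note f1 = fac[THEN conjunct1, rule_format] and R = fac[THEN conjunct2, THEN conjunct1]
    and S = fac[THEN conjunct2, THEN conjunct2, THEN conjunct1]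
    and f2 = fac[THEN conjunct2, THEN conjunct2, THEN conjunct2, rule_format]
  \<comment> \<open>The completely contractive factor from the factorization, realised inside
    \<open>A_rho K\<close> as combinations of the entries of \<open>F\<close>.\<close>
  define G where "G = (\<lambda>a b. if a < n \<and> b < m then (\<Sum>i<n. \<Sum>j<m. (cnj (u a i) * z b j) *\<^sub>C F i j) else 0)"
  have Gc: "G a b \<in> carrier (A_rho K)" for a b
    unfolding G_def using F complex_vector.subspace_0[OF sub]
    by (auto intro!: complex_vector.subspace_sum[OF sub] complex_vector.subspace_scale[OF sub])
  have "G a b = 0" if "n \<le> a \<or> m \<le> b" for a b using that by (auto simp: G_def)
  then have Gm: "G \<in> mats n m (carrier (A_rho K))" by (simp add: mats_def Gc)
  have Gv: "G a b k l v i j = bform g n m (v i j) (u a) (z b)" if "a < n" "b < m" "v \<in> K k l" for a b k l v i j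
    using that by (simp add: G_def bform_def sum_fun_apply scaleC_fun_def scaleC_complex_def g(2) lift_def)
  have FG: "F i j = (\<Sum>a<n. \<Sum>b<m. (cnj (R a i) * S b j) *\<^sub>C G a b)" if ij: "i < n" "j < m" for i j
  proof (intro ext)
    fix k l v i' j'
    show "F i j k l v i' j' = (\<Sum>a<n. \<Sum>b<m. (cnj (R a i) * S b j) *\<^sub>C G a b) k l v i' j'"
    proof (cases "v \<in> K k l")
      case True
      have "F i j k l v i' j' = g i j (v i' j')" using True by (simp add: g(2) lift_def)
      also have "\<dots> = (\<Sum>a<n. \<Sum>b<m. cnj (R a i) * S b j * bform g n m (v i' j') (u a) (z b))"
        by (rule f1[OF ij entry_in_Esp[OF rK True]])
      also have "\<dots> = (\<Sum>a<n. \<Sum>b<m. (cnj (R a i) * S b j) *\<^sub>C G a b) k l v i' j'"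
        using Gv[OF _ _ True] by (simp add: sum_fun_apply scaleC_fun_def scaleC_complex_def)
      finally show ?thesis .
    next
      case False
      have z: "f k l v i' j' = 0" if f: "f \<in> carrier (A_rho K)" for f
      proof -
        obtain g' where "f = lift K g'" using A_rho_carrierE[OF cK f] by blast
        then show ?thesis using False by (simp add: lift_def)
      qed
      have m: "(\<Sum>a<n. \<Sum>b<m. (cnj (R a i) * S b j) *\<^sub>C G a b) \<in> carrier (A_rho K)"
        by (intro complex_vector.subspace_sum[OF sub] complex_vector.subspace_scale[OF sub] Gc)
      show ?thesis using z[OF m] z[OF F[rule_format], of i j] by simp
    qed
  qed
  \<comment> \<open>In the factorization the indices of the point are the outer ones;
    \<open>quad_flip\<close> makes them the inner ones, as in the norm of
    \<open>A_rho\<close>.\<close>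
  have norm: "mnorm (A_rho K) n m G \<le> 1"
  proof (rule A_rho_norm_leI[OF cK nm])
    fix v \<xi> \<eta> assume v: "v \<in> K n m"
    have "quad n m n m (\<lambda>a b. G a b n m v) \<xi> \<eta> = quad n m n m (\<lambda>a b k l. bform g n m (v k l) (u a) (z b)) \<xi> \<eta>"
      by (rule quad_cong) (simp add: Gv[OF _ _ v])
    also have "\<dots> = quad n m n m (\<lambda>k l a b. bform g n m (v k l) (u a) (z b)) (\<lambda>k a. \<xi> a k) (\<lambda>l b. \<eta> b l)"
      by (rule quad_flip)
    finally show "cmod (quad n m n m (\<lambda>a b. G a b n m v) \<xi> \<eta>) \<le> 1 * hs n n \<xi> * hs m m \<eta>"
      using f2[OF nm v, of "\<lambda>k a. \<xi> a k" "\<lambda>l b. \<eta> b l"]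
      unfolding hs_flip[where p=n and n=n and \<xi>=\<xi>] hs_flip[where p=m and n=m and \<xi>=\<eta>] by simp
  qed simp
  have plin: "linear_on (carrier (A_rho K)) (\<phi> i j)" for i j by (rule CBall_D(3)[OF op phi])
  have pF: "\<phi> i j (F i j) = (\<Sum>a<n. \<Sum>b<m. cnj (R a i) * S b j * \<phi> i j (G a b))" if ij: "i < n" "j < m" for i j
    unfolding FG[OF ij]
    by (simp add: linear_on_sum[OF sub plin] complex_vector.subspace_sum[OF sub]
      complex_vector.subspace_scale[OF sub] Gc linear_onD(2)[OF plin] scaleC_complex_def)
  have "(\<Sum>i<n. \<Sum>j<m. \<phi> i j (F i j)) = (\<Sum>i<n. \<Sum>j<m. \<Sum>a<n. \<Sum>b<m. cnj (R a i) * S b j * \<phi> i j (G a b))"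
    by (intro sum.cong refl) (simp add: pF)
  also have "\<dots> = (\<Sum>a<n. \<Sum>b<m. \<Sum>i<n. \<Sum>j<m. cnj (R a i) * S b j * \<phi> i j (G a b))"
    by (rule sum_swap4)
  also have "\<dots> = quad n m n m (\<lambda>a b i j. \<phi> i j (G a b)) R S"
    unfolding quad_rows bil_def by (intro sum.cong refl) (simp add: mult_ac)
  finally have eq: "(\<Sum>i<n. \<Sum>j<m. \<phi> i j (F i j)) = quad n m n m (\<lambda>a b i j. \<phi> i j (G a b)) R S" .
  have "Re (\<Sum>i<n. \<Sum>j<m. \<phi> i j (F i j)) \<le> cmod (quad n m n m (\<lambda>a b i j. \<phi> i j (G a b)) R S)"
    unfolding eq by (rule complex_Re_le_cmod)
  also have "\<dots> \<le> mnorm (A_rho K) n m G * hs n n R * hs m m S"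
    by (rule CBall_D(5)[OF op phi nm Gm])
  also have "\<dots> \<le> 1 * 1 * 1"
    using norm R S A_rho_norm_nonneg[OF cK nm Gm] by (intro mult_mono) auto
  finally show ?thesis by simp
qed

end

lemma cmod_diff_scale_sq:
  "(cmod (d - complex_of_real s * e))\<^sup>2 = (cmod d)\<^sup>2 - 2 * s * Re (cnj d * e) + s\<^sup>2 * (cmod e)\<^sup>2"
  unfolding cmod_power2 by (simp add: power2_eq_square algebra_simps)

context
  fixes K :: "'a::complex_lctvs matrix_family"
  assumes cK: "compact_rmconvex K"
begin

lemma CBall_A_rho_bound_scaled:
  assumes nm: "0 < n" "0 < m" and F: "\<forall>i j. F i j \<in> carrier (A_rho K)" and c: "0 < c"
    and le: "\<forall>v\<in>K n m. Re (\<Sum>i<n. \<Sum>j<m. F i j n m v i j) \<le> c"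
    and phi: "\<phi> \<in> CBall (A_rho K) n m"
  shows "Re (\<Sum>i<n. \<Sum>j<m. \<phi> i j (F i j)) \<le> c"
proof -
  note op = operator_space_A_rho[OF cK]
  define F' where "F' = (\<lambda>i j. inverse c *\<^sub>R\<^sub>C F i j)"
  have F': "\<forall>i j. F' i j \<in> carrier (A_rho K)"
    unfolding F'_def using F complex_vector.subspace_scale[OF A_rho_subspace[OF cK]] by blast
  have eqv: "(\<Sum>i<n. \<Sum>j<m. F' i j n m v i j) = complex_of_real (inverse c) * (\<Sum>i<n. \<Sum>j<m. F i j n m v i j)" for v
    unfolding F'_def scaleC_fun_def scaleC_complex_def sum_distrib_left ..
  have reof: "Re (complex_of_real r * z) = r * Re z" for r z by simp
  have "\<forall>v\<in>K n m. Re (\<Sum>i<n. \<Sum>j<m. F' i j n m v i j) \<le> 1"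
  proof
    fix v assume "v \<in> K n m"
    then have "inverse c * Re (\<Sum>i<n. \<Sum>j<m. F i j n m v i j) \<le> inverse c * c"
      using le c by (intro mult_left_mono) auto
    then show "Re (\<Sum>i<n. \<Sum>j<m. F' i j n m v i j) \<le> 1"
      unfolding eqv reof using c by simp
  qed
  from CBall_A_rho_bound[OF cK nm F' this phi]
  have le1: "Re (\<Sum>i<n. \<Sum>j<m. \<phi> i j (F' i j)) \<le> 1" .
  have eq: "(\<Sum>i<n. \<Sum>j<m. \<phi> i j (F' i j)) = complex_of_real (inverse c) * (\<Sum>i<n. \<Sum>j<m. \<phi> i j (F i j))"
    unfolding F'_def sum_distrib_left
    using linear_onD(2)[OF CBall_D(3)[OF op phi]] F by (intro sum.cong refl) (simp add: scaleC_complex_def)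
  have "inverse c * Re (\<Sum>i<n. \<Sum>j<m. \<phi> i j (F i j)) \<le> 1" using le1 unfolding eq reof .
  then show ?thesis using c by (simp add: field_simps)
qed

text \<open>\<open>v\<close> is the point of \<open>K\<^sub>n\<^sub>,\<^sub>m\<close> closest to \<open>\<phi>\<close> in the coordinates \<open>I\<close>; if the distance were
  positive, the functional given by the difference vector would violate the bound on \<open>\<phi>\<close>.\<close>

lemma point_eval_approx:
  assumes phi: "\<phi> \<in> CBall (A_rho K) n m" and fin: "finite I" and I: "I \<subseteq> {..<n} \<times> {..<m} \<times> carrier (A_rho K)"
  shows "\<exists>v\<in>K n m. \<forall>(i, j, f)\<in>I. f n m v i j = \<phi> i j f"
proof -
  note rK = compact_rmconvexD(1)[OF cK]
  note op = operator_space_A_rho[OF cK]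
  note sub = A_rho_subspace[OF cK]
  have nm: "0 < n" "0 < m" using CBall_D(1,2)[OF op phi] .
  define ev where "ev t v = (snd (snd t)) n m v (fst t) (fst (snd t))" for t :: "nat \<times> nat \<times> ('a, complex) family_map" and v
  define tgt where "tgt t = \<phi> (fst t) (fst (snd t)) (snd (snd t))" for t
  have rep: "\<exists>g. cfun K g \<and> (\<forall>v\<in>K n m. ev t v = g (v (fst t) (fst (snd t))))" if t: "t \<in> I" for t
  proof -
    have "snd (snd t) \<in> carrier (A_rho K)" using t I by auto
    then obtain g where "cfun K g" "snd (snd t) = lift K g" by (rule A_rho_carrierE[OF cK])
    then show ?thesis by (intro exI[of _ g]) (simp add: ev_def lift_def)
  qed
  have cont: "continuous_on (K n m) (ev t)" if t: "t \<in> I" for t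
  proof -
    obtain g where g: "cfun K g" "\<forall>v\<in>K n m. ev t v = g (v (fst t) (fst (snd t)))" using rep[OF t] by blast
    show ?thesis
      by (rule continuous_on_eq[OF cfun_cont[OF rK g(1)]]) (use g(2) in simp)
  qed
  have ev_conv: "ev t (s *\<^sub>R\<^sub>C v + (1 - s) *\<^sub>R\<^sub>C w) = ev t w + complex_of_real s * (ev t v - ev t w)"
    if t: "t \<in> I" and v: "v \<in> K n m" and w: "w \<in> K n m" and s: "0 \<le> s" "s \<le> 1" for t v w s
  proof -
    obtain g where g: "cfun K g" "\<forall>v\<in>K n m. ev t v = g (v (fst t) (fst (snd t)))" using rep[OF t] by blast
    let ?i = "fst t" and ?j = "fst (snd t)"
    have lin: "linear_on (Esp K) g" using g(1) by (simp add: cfun_def)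
    have "ev t (s *\<^sub>R\<^sub>C v + (1 - s) *\<^sub>R\<^sub>C w) = g (s *\<^sub>R\<^sub>C v ?i ?j + (1 - s) *\<^sub>R\<^sub>C w ?i ?j)"
      using g(2) rmconvex_convex[OF rK v w s] by (simp add: scaleC_fun_def)
    also have "\<dots> = complex_of_real s * g (v ?i ?j) + complex_of_real (1 - s) * g (w ?i ?j)"
      using entry_in_Esp[OF rK v] entry_in_Esp[OF rK w] complex_vector.subspace_scale[OF Esp_subspace[OF rK]]
      by (simp only: linear_onD(1,2)[OF lin] scaleC_complex_def)
    also have "\<dots> = ev t w + complex_of_real s * (ev t v - ev t w)"
      using g(2) v w by (simp add: algebra_simps)
    finally show ?thesis .
  qed
  define Dist where "Dist v = (\<Sum>t\<in>I. (cmod (tgt t - ev t v))\<^sup>2)" for v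
  have "continuous_on (K n m) Dist"
    unfolding Dist_def using cont by (intro continuous_intros) auto
  then obtain v0 where v0: "v0 \<in> K n m" "\<And>v. v \<in> K n m \<Longrightarrow> Dist v0 \<le> Dist v"
    using continuous_attains_inf[OF compact_rmconvexD(2)[OF cK, of n m]] zero_in_rmconvex[OF rK nm] by blast
  define d where "d t = tgt t - ev t v0" for t
  have key: "Re (\<Sum>t\<in>I. cnj (d t) * (ev t v - ev t v0)) \<le> 0" if v: "v \<in> K n m" for v
  proof (rule ccontr)
    define A where "A = Re (\<Sum>t\<in>I. cnj (d t) * (ev t v - ev t v0))"
    define B where "B = (\<Sum>t\<in>I. (cmod (ev t v - ev t v0))\<^sup>2)"
    assume "\<not> ?thesis"
    then have A: "A > 0" by (simp add: A_def)
    have B: "B \<ge> 0" unfolding B_def by (intro sum_nonneg) simp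
    \<comment> \<open>For this \<open>s\<close> one has \<open>s * B \<le> A\<close>, so the squared
      distance would change by at most \<open>- s * A < 0\<close>; the summand \<open>A\<close> in
      the denominator gives \<open>s \<le> 1\<close> and covers \<open>B = 0\<close>.\<close>
    define s where "s = A / (A + B)"
    have s: "0 < s" "s \<le> 1" using A B by (simp_all add: s_def)
    have "Dist (s *\<^sub>R\<^sub>C v + (1 - s) *\<^sub>R\<^sub>C v0) =
       (\<Sum>t\<in>I. (cmod (d t))\<^sup>2 - 2 * s * Re (cnj (d t) * (ev t v - ev t v0)) + s\<^sup>2 * (cmod (ev t v - ev t v0))\<^sup>2)"
      unfolding Dist_def cmod_diff_scale_sq[symmetric]
    proof (intro sum.cong refl)
      fix t assume t: "t \<in> I"
      show "(cmod (tgt t - ev t (s *\<^sub>R\<^sub>C v + (1 - s) *\<^sub>R\<^sub>C v0)))\<^sup>2 =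
          (cmod (d t - complex_of_real s * (ev t v - ev t v0)))\<^sup>2"
        using ev_conv[OF t v v0(1), of s] s by (simp add: d_def diff_diff_eq)
    qed
    also have "\<dots> = Dist v0 - 2 * s * A + s\<^sup>2 * B"
      by (simp only: Dist_def d_def A_def B_def Re_sum sum.distrib sum_subtractf sum_distrib_left)
    finally have "0 \<le> - 2 * s * A + s\<^sup>2 * B"
      using v0(2)[OF rmconvex_convex[OF rK v v0(1), of s]] s by simp
    then have "0 \<le> s * (s * B - 2 * A)" by (simp add: power2_eq_square algebra_simps)
    then have "2 * A \<le> s * B" using s(1) by (simp add: zero_le_mult_iff)
    also have "s * B \<le> A" using A B by (simp add: s_def field_simps)
    finally show False using A by simp
  qed
  define D0 where "D0 = (\<Sum>t\<in>I. (cmod (d t))\<^sup>2)"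
  \<comment> \<open>The functional given by the difference vector, with all coordinates at position
    (i, j) collected in the entry \<open>F i j\<close>.\<close>
  define F where "F i j = (\<Sum>t\<in>I. (if fst t = i \<and> fst (snd t) = j then cnj (d t) else 0) *\<^sub>C snd (snd t))" for i j
  have Ic: "t \<in> I \<Longrightarrow> snd (snd t) \<in> carrier (A_rho K)" "t \<in> I \<Longrightarrow> fst t < n" "t \<in> I \<Longrightarrow> fst (snd t) < m" for t
    using I by auto
  have F: "\<forall>i j. F i j \<in> carrier (A_rho K)"
    unfolding F_def by (intro allI complex_vector.subspace_sum[OF sub] complex_vector.subspace_scale[OF sub] Ic)
  have collapse: "(\<Sum>i<n. \<Sum>j<m. \<Sum>t\<in>I. (if fst t = i \<and> fst (snd t) = j then cnj (d t) else 0) * G i j t) =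
      (\<Sum>t\<in>I. cnj (d t) * G (fst t) (fst (snd t)) t)" for G :: "nat \<Rightarrow> nat \<Rightarrow> nat \<times> nat \<times> ('a, complex) family_map \<Rightarrow> complex"
  proof -
    have "(\<Sum>i<n. \<Sum>j<m. \<Sum>t\<in>I. (if fst t = i \<and> fst (snd t) = j then cnj (d t) else 0) * G i j t) =
      (\<Sum>i<n. \<Sum>t\<in>I. \<Sum>j<m. (if fst t = i \<and> fst (snd t) = j then cnj (d t) else 0) * G i j t)"
      by (intro sum.cong refl sum.swap)
    also have "\<dots> = (\<Sum>t\<in>I. \<Sum>i<n. \<Sum>j<m. (if fst t = i \<and> fst (snd t) = j then cnj (d t) else 0) * G i j t)"
      by (rule sum.swap)
    also have "\<dots> = (\<Sum>t\<in>I. cnj (d t) * G (fst t) (fst (snd t)) t)"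
    proof (intro sum.cong refl)
      fix t assume t: "t \<in> I"
      have "(\<Sum>j<m. (if fst t = i \<and> fst (snd t) = j then cnj (d t) else 0) * G i j t) =
          (if i = fst t then cnj (d t) * G (fst t) (fst (snd t)) t else 0)" for i
      proof -
        have "(\<Sum>j<m. (if fst t = i \<and> fst (snd t) = j then cnj (d t) else 0) * G i j t) =
          (\<Sum>j<m. if j = fst (snd t) then (if i = fst t then cnj (d t) * G (fst t) (fst (snd t)) t else 0) else 0)"
          by (intro sum.cong refl) auto
        then show ?thesis using Ic(3)[OF t] by simp
      qed
      then show "(\<Sum>i<n. \<Sum>j<m. (if fst t = i \<and> fst (snd t) = j then cnj (d t) else 0) * G i j t) =
          cnj (d t) * G (fst t) (fst (snd t)) t"
        using Ic(2)[OF t] by simp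
    qed
    finally show ?thesis .
  qed
  have Fv: "(\<Sum>i<n. \<Sum>j<m. F i j n m v i j) = (\<Sum>t\<in>I. cnj (d t) * ev t v)" for v
    using collapse[of "\<lambda>i j t. snd (snd t) n m v i j"]
    by (simp add: F_def sum_fun_apply scaleC_fun_def scaleC_complex_def ev_def)
  have Fphi: "(\<Sum>i<n. \<Sum>j<m. \<phi> i j (F i j)) = (\<Sum>t\<in>I. cnj (d t) * tgt t)"
  proof -
    have "\<phi> i j (F i j) = (\<Sum>t\<in>I. (if fst t = i \<and> fst (snd t) = j then cnj (d t) else 0) * \<phi> i j (snd (snd t)))" for i j
    proof -
      have lin: "linear_on (carrier (A_rho K)) (\<phi> i j)" by (rule CBall_D(3)[OF op phi])
      have "\<phi> i j (F i j) = (\<Sum>t\<in>I. \<phi> i j ((if fst t = i \<and> fst (snd t) = j then cnj (d t) else 0) *\<^sub>C snd (snd t)))"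
        unfolding F_def by (intro linear_on_sum[OF sub lin] complex_vector.subspace_scale[OF sub] Ic)
      also have "\<dots> = (\<Sum>t\<in>I. (if fst t = i \<and> fst (snd t) = j then cnj (d t) else 0) * \<phi> i j (snd (snd t)))"
        by (intro sum.cong refl) (simp only: linear_onD(2)[OF lin Ic(1)] scaleC_complex_def)
      finally show ?thesis .
    qed
    then show ?thesis using collapse[of "\<lambda>i j t. \<phi> i j (snd (snd t))"] by (simp only: tgt_def)
  qed
  define \<sigma> where "\<sigma> = Re (\<Sum>t\<in>I. cnj (d t) * ev t v0)"
  have le\<sigma>: "Re (\<Sum>t\<in>I. cnj (d t) * ev t v) \<le> \<sigma>" if "v \<in> K n m" for v
    using key[OF that] by (simp add: \<sigma>_def right_diff_distrib sum_subtractf)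
  \<comment> \<open>The bound handed to \<open>CBall_A_rho_bound_scaled\<close> must be positive;
    since 0 is a point of \<open>K n m\<close>, the maximum \<sigma> is nonnegative.\<close>
  have "0 \<le> \<sigma>"
  proof -
    have K0: "0 \<in> K n m" by (rule zero_in_rmconvex[OF rK nm])
    have "ev t 0 = 0" if t: "t \<in> I" for t
    proof -
      obtain g where g: "cfun K g" "\<forall>v\<in>K n m. ev t v = g (v (fst t) (fst (snd t)))" using rep[OF t] by blast
      have "linear_on (Esp K) g" using g(1) by (simp add: cfun_def)
      then show ?thesis using g(2) K0 linear_onD(3)[OF _ Esp_zero[OF rK]] by simp
    qed
    then have "(\<Sum>t\<in>I. cnj (d t) * ev t 0) = 0" by (intro sum.neutral) simp
    then show ?thesis using le\<sigma>[OF K0] by simp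
  qed
  have "Re (\<Sum>t\<in>I. cnj (d t) * tgt t) = \<sigma> + D0"
  proof -
    have "(\<Sum>t\<in>I. cnj (d t) * tgt t) = (\<Sum>t\<in>I. cnj (d t) * ev t v0) + (\<Sum>t\<in>I. cnj (d t) * d t)"
      by (simp add: d_def right_diff_distrib sum_subtractf)
    moreover have "(\<Sum>t\<in>I. cnj (d t) * d t) = complex_of_real D0"
      unfolding D0_def cnj_mult_self of_real_sum ..
    ultimately show ?thesis by (simp add: \<sigma>_def)
  qed
  moreover have D0nn: "0 \<le> D0" unfolding D0_def by (intro sum_nonneg) simp
  \<comment> \<open>\<open>\<sigma> + D0 / 2\<close> lies strictly between the maximum \<sigma> over
    \<open>K n m\<close> and the value \<open>\<sigma> + D0\<close> at \<phi>, which is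
    contradictory.\<close>
  moreover have "Re (\<Sum>i<n. \<Sum>j<m. \<phi> i j (F i j)) \<le> \<sigma> + D0 / 2" if "D0 > 0"
  proof (rule CBall_A_rho_bound_scaled[OF nm F _ _ phi])
    show "0 < \<sigma> + D0 / 2" using that \<open>0 \<le> \<sigma>\<close> by simp
    show "\<forall>v\<in>K n m. Re (\<Sum>i<n. \<Sum>j<m. F i j n m v i j) \<le> \<sigma> + D0 / 2"
      unfolding Fv using le\<sigma> D0nn by force
  qed
  ultimately have "D0 = 0" unfolding Fphi by force
  then have "\<forall>t\<in>I. d t = 0"
    unfolding D0_def using fin by (simp add: sum_nonneg_eq_0_iff)
  then have "\<forall>(i, j, f)\<in>I. f n m v0 i j = \<phi> i j f"
    by (auto simp: d_def tgt_def ev_def)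
  then show ?thesis using v0(1) by blast
qed

text \<open>Any finite set of coordinates can be matched at once, the matching sets are closed in
  the compact \<open>K n m\<close>, and coordinates outside the index range or the carrier vanish on
  both sides.\<close>

lemma point_eval_surj:
  assumes phi: "\<phi> \<in> CBall (A_rho K) n m"
  shows "\<phi> \<in> point_eval K n m ` K n m"
proof -
  note rK = compact_rmconvexD(1)[OF cK]
  note op = operator_space_A_rho[OF cK]
  define I where "I = {..<n} \<times> {..<m} \<times> carrier (A_rho K)"
  define C where "C t = {v \<in> K n m. (snd (snd t)) n m v (fst t) (fst (snd t)) = \<phi> (fst t) (fst (snd t)) (snd (snd t))}"
    for t :: "nat \<times> nat \<times> ('a, complex) family_map"
  have "K n m \<inter> (\<Inter>t\<in>I. C t) \<noteq> {}"
  proof (rule compact_imp_fip_image[OF compact_rmconvexD(2)[OF cK]])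
    fix t assume t: "t \<in> I"
    then have "snd (snd t) \<in> carrier (A_rho K)" by (auto simp: I_def)
    then obtain g where g: "cfun K g" "snd (snd t) = lift K g" by (rule A_rho_carrierE[OF cK])
    have "continuous_on (K n m) (\<lambda>v. (snd (snd t)) n m v (fst t) (fst (snd t)))"
      by (rule continuous_on_eq[OF cfun_cont[OF rK g(1), of n m "fst t" "fst (snd t)"]]) (simp add: g(2) lift_def)
    then show "closed (C t)"
      unfolding C_def
      by (rule continuous_closed_preimage_constant[OF _ compact_imp_closed[OF compact_rmconvexD(2)[OF cK]]])
  next
    fix I' assume I': "finite I'" "I' \<subseteq> I"
    obtain v where v: "v \<in> K n m" "\<forall>(i, j, f)\<in>I'. f n m v i j = \<phi> i j f"
      using point_eval_approx[OF phi I'(1)] I'(2) unfolding I_def by blast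
    then have "v \<in> K n m \<inter> (\<Inter>t\<in>I'. C t)" by (auto simp: C_def)
    then show "K n m \<inter> (\<Inter>t\<in>I'. C t) \<noteq> {}" by blast
  qed
  then obtain v where v: "v \<in> K n m" "\<And>t. t \<in> I \<Longrightarrow> v \<in> C t" by blast
  have "point_eval K n m v i j f = \<phi> i j f" for i j f
  proof (cases "(i, j, f) \<in> I")
    case True
    then show ?thesis using v(2)[OF True] v(1) by (auto simp: C_def point_eval_def I_def)
  next
    case False
    then have out: "f \<notin> carrier (A_rho K) \<or> n \<le> i \<or> m \<le> j" by (auto simp: I_def not_less)
    show ?thesis
      using CBall_D(4)[OF op phi out] CBall_D(4)[OF op point_eval_in_CBall[OF cK v(1)] out] by simp
  qed
  then have "point_eval K n m v = \<phi>" by (intro ext)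
  then show ?thesis using v(1) by blast
qed

theorem point_eval_homeo: "rm_homeo K (CBall (A_rho K)) (point_eval K)"
  unfolding rm_homeo_def
proof (intro conjI allI)
  show "rm_affine K (CBall (A_rho K)) (point_eval K)" by (rule point_eval_affine[OF cK])
  fix n m
  have "point_eval K n m ` K n m = CBall (A_rho K) n m"
    using point_eval_in_CBall[OF cK] point_eval_surj by blast
  then show "\<exists>\<eta>. homeomorphism (K n m) (CBall (A_rho K) n m) (point_eval K n m) \<eta>"
    by (rule homeomorphism_compact[OF compact_rmconvexD(2)[OF cK] point_eval_cont[OF cK] _ point_eval_inj[OF cK]])
qed

end

section \<open>Recovering an operator space from its dual unit ball\<close>

text \<open>These families take the role of \<open>K\<close> when the factorization is applied to an
  operator space; levels with index 0 are empty.\<close>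

definition unit_balls :: "'x::complex_vector opspace \<Rightarrow> 'x matrix_family" where
  "unit_balls X r s = {y \<in> mats r s (carrier X). 0 < r \<and> 0 < s \<and> mnorm X r s y \<le> 1}"

lemma sandwich_mats:
  assumes E: "complex_vector.subspace E" and x: "x \<in> mats n m E" and A: "\<alpha> \<in> cmats p n" and B: "\<beta> \<in> cmats m q"
  shows "sandwich n m \<alpha> x \<beta> \<in> mats p q E"
proof -
  have "sandwich n m \<alpha> x \<beta> i j \<in> E" for i j
    unfolding sandwich_def using x
    by (intro complex_vector.subspace_sum[OF E] complex_vector.subspace_scale[OF E]) (auto simp: mats_def)
  moreover have "sandwich n m \<alpha> x \<beta> i j = 0" if "p \<le> i \<or> q \<le> j" for i j
    unfolding sandwich_def using that A B by (intro sum.neutral ballI) (auto simp: mats_def)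
  ultimately show ?thesis by (auto simp: mats_def)
qed

lemma adj_cmats: "\<alpha> \<in> cmats n p \<Longrightarrow> adj \<alpha> \<in> cmats p n"
  by (auto simp: mats_def adj_def)

context
  fixes X :: "'x::complex_vector opspace"
  assumes X: "operator_space X"
begin

lemma carrier_subspace: "complex_vector.subspace (carrier X)"
  by (rule operator_spaceD(1)[OF X])

lemma unit_balls_ds_convex: "ds_convex (unit_balls X)"
  unfolding ds_convex_def
proof (intro conjI allI impI ballI)
  show "unit_balls X n m \<subseteq> mats n m UNIV" for n m
    by (auto simp: unit_balls_def mats_def)
  show "0 \<in> unit_balls X n m" if nm: "0 < n" "0 < m" for n m
  proof -
    have z: "0 \<in> mats n m (carrier X)"
      using complex_vector.subspace_0[OF carrier_subspace] by (auto simp: mats_def)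
    then have "mnorm X n m 0 = 0" using operator_spaceD(3)[OF X nm z] by simp
    then show ?thesis using z nm by (simp add: unit_balls_def)
  qed
  show "dsum n m v w \<in> unit_balls X (n + k) (m + l)"
    if "0 < n" "0 < m" "0 < k" "0 < l" and v: "v \<in> unit_balls X n m" and w: "w \<in> unit_balls X k l" for n m k l v w
  proof -
    have v': "v \<in> mats n m (carrier X)" "mnorm X n m v \<le> 1" and w': "w \<in> mats k l (carrier X)" "mnorm X k l w \<le> 1"
      using v w by (auto simp: unit_balls_def)
    have "mnorm X (n + k) (m + l) (dsum n m v w) \<le> 1"
      using operator_spaceD(7)[OF X that(1-4) v'(1) w'(1)] v'(2) w'(2) by simp
    then show ?thesis
      using dsum_mats[OF carrier_subspace v'(1) w'(1)] that(1,2) by (simp add: unit_balls_def)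
  qed
  show "sandwich n m (adj \<alpha>) v \<beta> \<in> unit_balls X p q"
    if pos: "0 < n" "0 < m" "0 < p" "0 < q" and A: "\<alpha> \<in> cmats n p" and B: "\<beta> \<in> cmats m q"
      and v: "v \<in> unit_balls X n m" and le: "opnorm n p \<alpha> \<le> 1 \<and> opnorm m q \<beta> \<le> 1" for n m p q \<alpha> \<beta> v
  proof -
    have v': "v \<in> mats n m (carrier X)" "mnorm X n m v \<le> 1" using v by (auto simp: unit_balls_def)
    have "mnorm X p q (sandwich n m (adj \<alpha>) v \<beta>) \<le> opnorm p n (adj \<alpha>) * mnorm X n m v * opnorm m q \<beta>"
      by (rule operator_spaceD(6)[OF X pos(3,4,1,2) adj_cmats[OF A] v'(1) B])
    also have "\<dots> \<le> 1 * 1 * 1"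
      unfolding opnorm_adj using le v'(2) operator_spaceD(2)[OF X pos(1,2) v'(1)]
      by (intro mult_mono) auto
    finally show ?thesis
      using sandwich_mats[OF carrier_subspace v'(1) adj_cmats[OF A] B] pos by (simp add: unit_balls_def)
  qed
qed

lemma functional_eval_lift:
  "x \<in> carrier X \<Longrightarrow> functional_eval X x = lift (CBall X) (\<lambda>\<psi>. \<psi> x)"
  by (auto simp: functional_eval_def lift_def fun_eq_iff)

lemma cfun_eval: "cfun (CBall X) (\<lambda>\<psi>. \<psi> x)"
  unfolding cfun_def linear_on_def by (auto simp: scaleC_fun_def cont_eval3[OF X])

lemma functional_eval_carrier: "x \<in> carrier X \<Longrightarrow> functional_eval X x \<in> carrier (A_rho (CBall X))"
  unfolding A_rho_carrier[OF compact_rmconvex_CBall[OF X]]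
  using functional_eval_lift cfun_eval by blast

lemma functional_eval_mats:
  assumes "x \<in> mats p q (carrier X)"
  shows "(\<lambda>i j. functional_eval X (x i j)) \<in> mats p q (carrier (A_rho (CBall X)))"
proof -
  have "functional_eval X 0 = 0"
  proof -
    have "\<phi> i j 0 = 0" if "\<phi> \<in> CBall X n m" for \<phi> n m i j
      using linear_onD(3)[OF CBall_D(3)[OF X that] complex_vector.subspace_0[OF carrier_subspace]] .
    then show ?thesis by (auto simp: functional_eval_def fun_eq_iff)
  qed
  then show ?thesis using assms functional_eval_carrier by (simp add: mats_def)
qed

lemma functional_eval_entry:
  "x \<in> carrier X \<Longrightarrow> \<phi> \<in> CBall X n m \<Longrightarrow> functional_eval X x n m \<phi> = (\<lambda>i j. \<phi> i j x)"
  by (simp add: functional_eval_def)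

lemma functional_eval_contractive:
  assumes pq: "0 < p" "0 < q" and x: "x \<in> mats p q (carrier X)"
  shows "mnorm (A_rho (CBall X)) p q (\<lambda>i j. functional_eval X (x i j)) \<le> mnorm X p q x"
proof (rule A_rho_norm_leI[OF compact_rmconvex_CBall[OF X] pq operator_spaceD(2)[OF X pq x]])
  fix \<phi> \<xi> \<eta> assume phi: "\<phi> \<in> CBall X p q"
  have "quad p q p q (\<lambda>a b. functional_eval X (x a b) p q \<phi>) \<xi> \<eta> = quad p q p q (\<lambda>a b i j. \<phi> i j (x a b)) \<xi> \<eta>"
    using x phi by (intro quad_cong) (simp add: functional_eval_entry mats_def)
  then show "cmod (quad p q p q (\<lambda>a b. functional_eval X (x a b) p q \<phi>) \<xi> \<eta>) \<le> mnorm X p q x * hs p p \<xi> * hs q q \<eta>"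
    using CBall_D(5)[OF X phi pq x, of \<xi> \<eta>] by simp
qed

lemma mats_subspace: "complex_vector.subspace (mats n m (carrier X))"
proof (rule complex_vector.subspaceI)
  show "0 \<in> mats n m (carrier X)"
    using complex_vector.subspace_0[OF carrier_subspace] by (auto simp: mats_def)
  show "x + y \<in> mats n m (carrier X)" if "x \<in> mats n m (carrier X)" "y \<in> mats n m (carrier X)" for x y
    using mats_combine[OF carrier_subspace that, of 1 1] by (simp add: scaleC_one)
  show "c *\<^sub>C x \<in> mats n m (carrier X)" if "x \<in> mats n m (carrier X)" for c x
    using mats_combine[OF carrier_subspace that that, of c 0] by simp
qed

lemma unit_balls_absorb: "\<forall>w\<in>carrier X. \<exists>t>0. sing (t *\<^sub>R\<^sub>C w) \<in> unit_balls X 1 1"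
proof
  fix w assume w: "w \<in> carrier X"
  define N where "N = mnorm X 1 1 (sing w)"
  have sw: "sing w \<in> mats 1 1 (carrier X)" using w by (simp only: sing_mats_iff)
  have N: "0 \<le> N" unfolding N_def by (rule operator_spaceD(2)[OF X zero_less_one zero_less_one sw])
  define t where "t = inverse (N + 1)"
  have t: "t > 0" using N by (simp add: t_def)
  have eq: "sing (t *\<^sub>R\<^sub>C w) = t *\<^sub>R\<^sub>C sing w" by (auto simp: sing_def scaleC_fun_def fun_eq_iff)
  have "mnorm X 1 1 (t *\<^sub>R\<^sub>C sing w) = cmod (complex_of_real t) * N"
    unfolding N_def by (rule operator_spaceD(4)[OF X zero_less_one zero_less_one sw])
  also have "\<dots> = t * N" using t by simp
  also have "\<dots> \<le> 1" using N by (simp add: t_def field_simps)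
  finally have "sing (t *\<^sub>R\<^sub>C w) \<in> unit_balls X 1 1"
    unfolding unit_balls_def mem_Collect_eq eq
    using complex_vector.subspace_scale[OF mats_subspace sw] by simp
  then show "\<exists>t>0. sing (t *\<^sub>R\<^sub>C w) \<in> unit_balls X 1 1" using t by blast
qed

text \<open>Ruan's theorem: a norming functional on \<open>M\<^sub>p\<^sub>,\<^sub>q(X)\<close> factors through a complete contraction
  \<open>X \<rightarrow> M\<^sub>p\<^sub>,\<^sub>q(\<complex>)\<close>.\<close>

lemma functional_eval_expansive:
  assumes pq: "0 < p" "0 < q" and x: "x \<in> mats p q (carrier X)"
  shows "mnorm X p q x \<le> mnorm (A_rho (CBall X)) p q (\<lambda>i j. functional_eval X (x i j))"
proof -
  note cB = compact_rmconvex_CBall[OF X]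
  let ?E = "mats p q (carrier X)"
  have "sublinear_on ?E (mnorm X p q)"
  proof (rule sublinear_onI[OF mats_subspace])
    show "mnorm X p q (y + z) \<le> mnorm X p q y + mnorm X p q z" if "y \<in> ?E" "z \<in> ?E" for y z
      by (rule operator_spaceD(5)[OF X pq that])
    show "mnorm X p q (t *\<^sub>R\<^sub>C y) \<le> t * mnorm X p q y" if "0 < t" "y \<in> ?E" for t y
      using operator_spaceD(4)[OF X pq that(2), of "complex_of_real t"] that(1) by simp
    show "mnorm X p q 0 = 0"
      using operator_spaceD(3)[OF X pq complex_vector.subspace_0[OF mats_subspace]] by simp
  qed
  from hahn_banach_point[OF mats_subspace this x]
  obtain l where l: "real_linear_on ?E l" "\<forall>y\<in>?E. l y \<le> mnorm X p q y" "l x = mnorm X p q x" by blast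
  define L where "L y = Complex (l y) (- l (\<i> *\<^sub>C y))" for y
  have L: "linear_on ?E L" unfolding L_def by (rule complexify[OF mats_subspace l(1)])
  \<comment> \<open>Matrix units: a functional on matrices is the matrix of its restrictions
    \<open>F i j\<close> to single entries.\<close>
  define U where "U i j w = (\<lambda>a b. if a = i \<and> b = j then w else 0)" for i j :: nat and w :: 'x
  have Um: "U i j w \<in> ?E" if "i < p" "j < q" "w \<in> carrier X" for i j w
    using that complex_vector.subspace_0[OF carrier_subspace] by (auto simp: U_def mats_def)
  define F where "F = (\<lambda>i j w. if i < p \<and> j < q then L (U i j w) else 0)"
  have F: "linear_on (carrier X) (F i j)" for i j
  proof (cases "i < p \<and> j < q")
    case True
    have "U i j (w + w') = U i j w + U i j w'" "U i j (c *\<^sub>C w) = c *\<^sub>C U i j w" for w w' c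
      by (auto simp: U_def fun_eq_iff scaleC_fun_def)
    then show ?thesis
      unfolding linear_on_def F_def using True linear_onD(1,2)[OF L] Um by simp
  qed (auto simp: linear_on_def F_def)
  have sumL: "(\<Sum>i<p. \<Sum>j<q. F i j (y i j)) = L y" if y: "y \<in> ?E" for y
  proof -
    have yc: "y i j \<in> carrier X" if "i < p" "j < q" for i j using y that by (auto simp: mats_def)
    have "y = (\<Sum>i<p. \<Sum>j<q. U i j (y i j))"
    proof (intro ext)
      fix a b
      have "(\<Sum>i<p. \<Sum>j<q. U i j (y i j)) a b = (\<Sum>i<p. \<Sum>j<q. if j = b then (if i = a then y a b else 0) else 0)"
        unfolding sum_fun_apply by (intro sum.cong refl) (auto simp: U_def)
      also have "\<dots> = (\<Sum>i<p. if i = a then (if b < q then y a b else 0) else 0)"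
        by (intro sum.cong refl) simp
      also have "\<dots> = y a b" using y by (auto simp: mats_def not_less)
      finally show "y a b = (\<Sum>i<p. \<Sum>j<q. U i j (y i j)) a b" ..
    qed
    then have "L y = L (\<Sum>i<p. \<Sum>j<q. U i j (y i j))" by simp
    also have "\<dots> = (\<Sum>i<p. L (\<Sum>j<q. U i j (y i j)))"
      using yc by (intro linear_on_sum[OF mats_subspace L] complex_vector.subspace_sum[OF mats_subspace] Um) auto
    also have "\<dots> = (\<Sum>i<p. \<Sum>j<q. L (U i j (y i j)))"
      using yc by (intro sum.cong refl linear_on_sum[OF mats_subspace L] Um) auto
    also have "\<dots> = (\<Sum>i<p. \<Sum>j<q. F i j (y i j))"
      by (intro sum.cong refl) (simp add: F_def)
    finally show ?thesis ..
  qed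
  have le1: "\<forall>y\<in>unit_balls X p q. Re (\<Sum>i<p. \<Sum>j<q. F i j (y i j)) \<le> 1"
  proof
    fix y assume "y \<in> unit_balls X p q"
    then have y: "y \<in> ?E" "mnorm X p q y \<le> 1" by (auto simp: unit_balls_def)
    then have "l y \<le> 1" using l(2) by force
    then show "Re (\<Sum>i<p. \<Sum>j<q. F i j (y i j)) \<le> 1" unfolding sumL[OF y(1)] by (simp add: L_def)
  qed
  have KE: "\<forall>r s. \<forall>v\<in>unit_balls X r s. \<forall>k l. v k l \<in> carrier X"
  proof (intro allI ballI)
    fix r s v k l assume "v \<in> unit_balls X r s"
    then show "v k l \<in> carrier X"
      using complex_vector.subspace_0[OF carrier_subspace]
      by (cases "k < r \<and> l < s") (auto simp: unit_balls_def mats_def not_less)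
  qed
  obtain u z R S where fac: "(\<forall>i<p. \<forall>j<q. \<forall>w\<in>carrier X.
      F i j w = (\<Sum>a<p. \<Sum>b<q. cnj (R a i) * S b j * bform F p q w (u a) (z b))) \<and>
    hs p p R \<le> 1 \<and> hs q q S \<le> 1 \<and>
    (\<forall>r>0. \<forall>s>0. \<forall>v\<in>unit_balls X r s. \<forall>\<xi> \<eta>.
      cmod (quad r s p q (\<lambda>k l a b. bform F p q (v k l) (u a) (z b)) \<xi> \<eta>) \<le> hs r p \<xi> * hs s q \<eta>)"
    using factorization[OF unit_balls_ds_convex carrier_subspace KE unit_balls_absorb F pq le1] by (elim exE)
  note f1 = fac[THEN conjunct1, rule_format] and R = fac[THEN conjunct2, THEN conjunct1]
    and S = fac[THEN conjunct2, THEN conjunct2, THEN conjunct1]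
    and f2 = fac[THEN conjunct2, THEN conjunct2, THEN conjunct2, rule_format]
  \<comment> \<open>The completely contractive factor of \<open>F\<close>: its bounds hold on all
    levels, so it is a point of \<open>CBall X p q\<close>.\<close>
  define \<phi> where "\<phi> = (\<lambda>a b w. if a < p \<and> b < q \<and> w \<in> carrier X then bform F p q w (u a) (z b) else 0)"
  have lin: "linear_on (carrier X) (\<phi> a b)" for a b
  proof (cases "a < p \<and> b < q")
    case True
    then show ?thesis
      using linear_onD(1,2)[OF bform_linear[where F=F and n=p and m=q and x="u a" and y="z b", OF carrier_subspace F]]
        complex_vector.subspace_add[OF carrier_subspace] complex_vector.subspace_scale[OF carrier_subspace]
      unfolding linear_on_def \<phi>_def by simp
  next
    case False
    then have "\<phi> a b = (\<lambda>w. 0)" by (auto simp: \<phi>_def)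
    then show ?thesis by (simp add: linear_on_def)
  qed
  have bound: "cmod (quad r s p q (\<lambda>k l a b. \<phi> a b (y k l)) \<xi> \<eta>) \<le> mnorm X r s y * hs r p \<xi> * hs s q \<eta>"
    if rs: "0 < r" "0 < s" and y: "y \<in> mats r s (carrier X)" for r s y \<xi> \<eta>
  proof -
    have nn: "0 \<le> mnorm X r s y" by (rule operator_spaceD(2)[OF X rs y])
    have "cmod (quad r s p q (\<lambda>k l a b. \<phi> a b (y k l)) \<xi> \<eta>) \<le> mnorm X r s y * (hs r p \<xi> * hs s q \<eta>)"
    \<comment> \<open>\<open>y\<close> is divided by a number above its norm, since the norm itself
      may be 0.\<close>
    proof (rule le_mult_of_gt[OF nn])
      show "0 \<le> hs r p \<xi> * hs s q \<eta>" by (intro mult_nonneg_nonneg L2_set_nonneg)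
      fix c h assume c: "mnorm X r s y < c" and h: "hs r p \<xi> * hs s q \<eta> < h"
      have cpos: "c > 0" using c nn by linarith
      define y' where "y' = inverse c *\<^sub>R\<^sub>C y"
      have y': "y' \<in> mats r s (carrier X)"
        unfolding y'_def by (rule complex_vector.subspace_scale[OF mats_subspace y])
      have "mnorm X r s y' = cmod (complex_of_real (inverse c)) * mnorm X r s y"
        unfolding y'_def by (rule operator_spaceD(4)[OF X rs y])
      also have "\<dots> = inverse c * mnorm X r s y" using cpos unfolding norm_of_real by simp
      also have "\<dots> \<le> 1" using c cpos by (simp add: field_simps)
      finally have "y' \<in> unit_balls X r s" using y' rs by (simp add: unit_balls_def)
      from f2[OF rs this, of \<xi> \<eta>]
      have q1: "cmod (quad r s p q (\<lambda>k l a b. bform F p q (y' k l) (u a) (z b)) \<xi> \<eta>) \<le> hs r p \<xi> * hs s q \<eta>" .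
      have "quad r s p q (\<lambda>k l a b. bform F p q (y' k l) (u a) (z b)) \<xi> \<eta> =
          quad r s p q (\<lambda>k l a b. complex_of_real (inverse c) * \<phi> a b (y k l)) \<xi> \<eta>"
      proof (rule quad_cong)
        fix k l a b assume "k < r" "l < s" "a < p" "b < q"
        then have "y k l \<in> carrier X" using y by (auto simp: mats_def)
        then show "bform F p q (y' k l) (u a) (z b) = complex_of_real (inverse c) * \<phi> a b (y k l)"
          using linear_onD(2)[OF bform_linear[where F=F and n=p and m=q and x="u a" and y="z b", OF carrier_subspace F], of "y k l" "complex_of_real (inverse c)"]
            \<open>a < p\<close> \<open>b < q\<close>
          by (simp add: y'_def \<phi>_def scaleC_fun_def scaleC_complex_def del: of_real_inverse)
      qed
      also have "\<dots> = complex_of_real (inverse c) * quad r s p q (\<lambda>k l a b. \<phi> a b (y k l)) \<xi> \<eta>"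
        unfolding quad_def sum_distrib_left by (intro sum.cong refl) (simp add: mult_ac)
      finally have "inverse c * cmod (quad r s p q (\<lambda>k l a b. \<phi> a b (y k l)) \<xi> \<eta>) \<le> hs r p \<xi> * hs s q \<eta>"
        using q1 cpos by (simp only: norm_mult norm_of_real) simp
      then have "cmod (quad r s p q (\<lambda>k l a b. \<phi> a b (y k l)) \<xi> \<eta>) \<le> c * (hs r p \<xi> * hs s q \<eta>)"
        using cpos by (simp add: field_simps)
      also have "\<dots> \<le> c * h" using h cpos by (intro mult_left_mono) auto
      finally show "cmod (quad r s p q (\<lambda>k l a b. \<phi> a b (y k l)) \<xi> \<eta>) \<le> c * h" .
    qed
    then show ?thesis by (simp only: mult.assoc)
  qed
  have phi: "\<phi> \<in> CBall X p q"
    unfolding CBall_char[OF X]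
  proof (intro conjI allI impI ballI pq lin)
    show "\<phi> i j w = 0" if "w \<notin> carrier X \<or> p \<le> i \<or> q \<le> j" for i j w using that by (auto simp: \<phi>_def)
  qed (rule bound)
  let ?M = "mnorm (A_rho (CBall X)) p q (\<lambda>i j. functional_eval X (x i j))"
  \<comment> \<open>\<open>L x\<close> is the form of the matrix \<phi>(x) at the vectors
    \<open>R\<close> and \<open>S\<close> of norm at most 1, so it is bounded by the norm of the
    evaluation at \<open>x\<close>.\<close>
  have "L x = quad p q p q (\<lambda>a b. functional_eval X (x a b) p q \<phi>) (\<lambda>i a. R a i) (\<lambda>j b. S b j)"
  proof -
    have "L x = (\<Sum>i<p. \<Sum>j<q. F i j (x i j))" using sumL[OF x] ..
    also have "\<dots> = (\<Sum>i<p. \<Sum>j<q. bil p q (functional_eval X (x i j) p q \<phi>) (\<lambda>a. R a i) (\<lambda>b. S b j))"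
    proof (intro sum.cong refl)
      fix i j assume "i \<in> {..<p}" "j \<in> {..<q}"
      then have ij: "i < p" "j < q" and xc: "x i j \<in> carrier X" using x by (auto simp: mats_def)
      show "F i j (x i j) = bil p q (functional_eval X (x i j) p q \<phi>) (\<lambda>a. R a i) (\<lambda>b. S b j)"
        unfolding f1[OF ij xc] functional_eval_entry[OF xc phi] bil_def
        by (intro sum.cong refl) (simp add: \<phi>_def xc mult_ac)
    qed
    finally show ?thesis unfolding quad_rows .
  qed
  then have "cmod (L x) \<le> ?M * hs p p (\<lambda>i a. R a i) * hs q q (\<lambda>j b. S b j)"
    using A_rho_norm_quad[OF cB functional_eval_mats[OF x] pq phi, of "\<lambda>i a. R a i" "\<lambda>j b. S b j"] by simp
  also have "\<dots> \<le> ?M * 1 * 1"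
    unfolding hs_flip[where p=p and n=p and \<xi>=R] hs_flip[where p=q and n=q and \<xi>=S]
    by (intro mult_mono R S order_refl mult_nonneg_nonneg A_rho_norm_nonneg[OF cB pq functional_eval_mats[OF x]]
      L2_set_nonneg zero_le_one)
  finally have "cmod (L x) \<le> ?M" by simp
  moreover have "mnorm X p q x \<le> cmod (L x)"
    using complex_Re_le_cmod[of "L x"] l(3) by (simp add: L_def)
  ultimately show ?thesis by simp
qed

lemma functional_eval_isometric:
  assumes "0 < p" "0 < q" "x \<in> mats p q (carrier X)"
  shows "mnorm (A_rho (CBall X)) p q (\<lambda>i j. functional_eval X (x i j)) = mnorm X p q x"
  using functional_eval_contractive[OF assms] functional_eval_expansive[OF assms] by simp

lemma functional_eval_linear: "linear_on (carrier X) (functional_eval X)"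
proof -
  have "functional_eval X (x + y) = functional_eval X x + functional_eval X y"
    if xy: "x \<in> carrier X" "y \<in> carrier X" for x y
  proof -
    have "x + y \<in> carrier X" by (rule complex_vector.subspace_add[OF carrier_subspace xy])
    moreover have "\<phi> i j (x + y) = \<phi> i j x + \<phi> i j y" if "\<phi> \<in> CBall X n m" for \<phi> n m i j
      using linear_onD(1)[OF CBall_D(3)[OF X that] xy] .
    ultimately show ?thesis using xy by (auto simp: functional_eval_def fun_eq_iff)
  qed
  moreover have "functional_eval X (c *\<^sub>C x) = c *\<^sub>C functional_eval X x" if x: "x \<in> carrier X" for c x
  proof -
    have "c *\<^sub>C x \<in> carrier X" by (rule complex_vector.subspace_scale[OF carrier_subspace x])
    moreover have "\<phi> i j (c *\<^sub>C x) = c * \<phi> i j x" if "\<phi> \<in> CBall X n m" for \<phi> n m i j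
      using linear_onD(2)[OF CBall_D(3)[OF X that] x] by (simp add: scaleC_complex_def)
    ultimately show ?thesis using x
      by (auto simp: functional_eval_def fun_eq_iff scaleC_fun_def scaleC_complex_def)
  qed
  ultimately show ?thesis unfolding linear_on_def by blast
qed

lemma functional_eval_hom: "functional_eval X \<in> op_hom X (A_rho (CBall X))"
  unfolding op_hom_def mem_Collect_eq
proof (intro conjI allI impI ballI)
  show "functional_eval X x = 0" if "x \<notin> carrier X" for x using that by (simp add: functional_eval_def)
  show "functional_eval X x \<in> carrier (A_rho (CBall X))" if "x \<in> carrier X" for x
    by (rule functional_eval_carrier[OF that])
  show "functional_eval X (x + y) = functional_eval X x + functional_eval X y"
    if "x \<in> carrier X" "y \<in> carrier X" for x y
    by (rule linear_onD(1)[OF functional_eval_linear that])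
  show "functional_eval X (c *\<^sub>C x) = c *\<^sub>C functional_eval X x" if "x \<in> carrier X" for c x
    by (rule linear_onD(2)[OF functional_eval_linear that])
qed (rule functional_eval_contractive)

lemma elem_norm_functional_eval:
  assumes x: "x \<in> carrier X"
  shows "elem_norm (A_rho (CBall X)) (functional_eval X x) = elem_norm X x"
proof -
  have sx: "sing x \<in> mats 1 1 (carrier X)" using x by (simp only: sing_mats_iff)
  have "functional_eval X 0 = 0"
    by (rule linear_onD(3)[OF functional_eval_linear complex_vector.subspace_0[OF carrier_subspace]])
  then have "(\<lambda>i j. functional_eval X (sing x i j)) = sing (functional_eval X x)"
    by (auto simp: sing_def fun_eq_iff)
  then show ?thesis
    using functional_eval_isometric[OF zero_less_one zero_less_one sx] by (simp only: elem_norm_sing)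
qed

lemma elem_norm_eq_0:
  assumes x: "x \<in> carrier X" and 0: "elem_norm X x = 0"
  shows "x = 0"
proof -
  have sx: "sing x \<in> mats 1 1 (carrier X)" using x by (simp only: sing_mats_iff)
  have "sing x = 0"
    using operator_spaceD(3)[OF X zero_less_one zero_less_one sx] 0 by (simp only: elem_norm_sing)
  then have "sing x 0 0 = (0 :: 'x matrix) 0 0" by (simp only:)
  then show ?thesis by simp
qed

lemma functional_eval_inj: "inj_on (functional_eval X) (carrier X)"
proof (rule inj_onI)
  fix x y assume xy: "x \<in> carrier X" "y \<in> carrier X" and eq: "functional_eval X x = functional_eval X y"
  have d: "x - y \<in> carrier X" by (rule complex_vector.subspace_diff[OF carrier_subspace xy])
  have "functional_eval X ((x - y) + y) = functional_eval X (x - y) + functional_eval X y"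
    by (rule linear_onD(1)[OF functional_eval_linear d xy(2)])
  then have "functional_eval X (x - y) = 0" using eq by simp
  moreover have "functional_eval X 0 = 0"
    by (rule linear_onD(3)[OF functional_eval_linear complex_vector.subspace_0[OF carrier_subspace]])
  ultimately have "elem_norm X (x - y) = elem_norm X 0"
    using elem_norm_functional_eval[OF d] elem_norm_functional_eval[OF complex_vector.subspace_0[OF carrier_subspace]]
    by simp
  also have "\<dots> = 0"
  proof -
    have sx: "0 \<in> mats 1 1 (carrier X)" by (rule complex_vector.subspace_0[OF mats_subspace])
    show ?thesis unfolding elem_norm_sing sing_zero
      using operator_spaceD(3)[OF X zero_less_one zero_less_one sx] by simp
  qed
  finally show "x = y" using elem_norm_eq_0[OF d] by simp
qed

end

context
  fixes X :: "'x::complex_vector opspace"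
  assumes X: "operator_space X"
begin

text \<open>A basic neighbourhood of 0 in the product topology restricts finitely many coordinates,
  so continuity of \<open>g\<close> at 0 involves only a finite set \<open>S\<close>.\<close>

lemma weak_star_neighbourhood:
  assumes g: "cfun (CBall X) g" and e: "0 < e"
  shows "\<exists>S \<delta>. finite S \<and> 0 < \<delta> \<and>
    (\<forall>\<psi>. sing \<psi> \<in> CBall X 1 1 \<longrightarrow> (\<forall>x\<in>S. cmod (\<psi> x) < \<delta>) \<longrightarrow> cmod (g \<psi>) < e)"
proof -
  note rB = rmconvex_CBall[OF X]
  define Q where "Q = {\<psi>. sing \<psi> \<in> CBall X 1 1}"
  have lin: "linear_on (Esp (CBall X)) g" and gc: "continuous_on (CBall X 1 1) (\<lambda>v. g (v 0 0))"
    using g by (simp_all add: cfun_def)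
  have "continuous_on Q (\<lambda>\<psi>. sing \<psi> :: ('x \<Rightarrow> complex) matrix)"
  proof (rule cont_matrixI)
    fix a b
    show "continuous_on Q (\<lambda>\<psi>. sing \<psi> a b :: 'x \<Rightarrow> complex)"
      by (cases "a = 0 \<and> b = 0") (auto simp: sing_def)
  qed
  then have "continuous_on Q (\<lambda>\<psi>. g (sing \<psi> 0 0))"
    by (rule continuous_on_compose2[OF gc]) (auto simp: Q_def)
  then have cont: "continuous_on Q g" by (simp only: sing_00)
  have Q0: "0 \<in> Q" using zero_in_CBall[OF X, of 1 1] by (simp add: Q_def)
  have g0: "g 0 = 0" by (rule linear_onD(3)[OF lin Esp_zero[OF rB]])
  obtain A where A: "open A" "0 \<in> A" "\<And>\<psi>. \<psi> \<in> Q \<Longrightarrow> \<psi> \<in> A \<Longrightarrow> g \<psi> \<in> ball 0 e"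
    using cont[unfolded continuous_on_topological, rule_format, OF Q0 open_ball, of 0 e] g0 e by auto
  obtain B where B: "finite {a. B a \<noteq> UNIV}" "\<And>a. open (B a)" "0 \<in> Pi\<^sub>E UNIV B" "Pi\<^sub>E UNIV B \<subseteq> A"
    using product_topology_open_contains_basis[of "\<lambda>_. euclidean" UNIV A 0] A(1,2)
    unfolding open_fun_def by auto
  have B0: "0 \<in> B a" for a using B(3) by (auto simp: PiE_iff)
  have "\<forall>a. \<exists>r>0. ball 0 r \<subseteq> B a" using B(2) B0 by (meson openE)
  then obtain r where r: "\<And>a. r a > 0" "\<And>a. ball 0 (r a) \<subseteq> B a" by metis
  define S where "S = {a. B a \<noteq> UNIV}"
  \<comment> \<open>The inserted 1 keeps the minimum defined when \<open>S\<close> is empty.\<close>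
  define \<delta> where "\<delta> = Min (insert 1 (r ` S))"
  have S: "finite S" using B(1) by (simp add: S_def)
  have \<delta>: "\<delta> > 0" "\<And>a. a \<in> S \<Longrightarrow> \<delta> \<le> r a"
    using S r(1) by (auto simp: \<delta>_def intro: Min_le)
  have "cmod (g \<psi>) < e" if psi: "sing \<psi> \<in> CBall X 1 1" and small: "\<forall>x\<in>S. cmod (\<psi> x) < \<delta>" for \<psi>
  proof -
    have "\<psi> a \<in> B a" for a
    proof (cases "a \<in> S")
      case True
      then have "\<psi> a \<in> ball 0 (r a)" using small \<delta>(2)[OF True] by force
      then show ?thesis using r(2) by blast
    qed (simp add: S_def)
    then have "\<psi> \<in> A" using B(4) by (auto simp: PiE_iff)
    then show ?thesis using A(3)[of \<psi>] psi by (simp add: Q_def)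
  qed
  then show ?thesis using S \<delta>(1) by blast
qed

text \<open>The Hahn--Banach theorem is applied to the infimal convolution of \<open>Re g + \<epsilon>\<close> times the norm
  with a multiple of \<open>\<Sum>x\<in>S. |\<psi>(x)|\<close>. A functional below the latter depends on the coordinates
  in \<open>S\<close> only, hence is an evaluation.\<close>

lemma functional_eval_approx:
  assumes g: "cfun (CBall X) g" and e: "0 < e"
  shows "\<exists>x\<in>carrier X. \<forall>\<psi>. sing \<psi> \<in> CBall X 1 1 \<longrightarrow> cmod (g \<psi> - \<psi> x) \<le> e"
proof -
  note rB = rmconvex_CBall[OF X] and subX = carrier_subspace[OF X]
  note subE = Esp_subspace[OF rB]
  obtain S \<delta> where S: "finite S" and \<delta>: "0 < \<delta>"
    and small: "\<And>\<psi>. sing \<psi> \<in> CBall X 1 1 \<Longrightarrow> \<forall>x\<in>S. cmod (\<psi> x) < \<delta> \<Longrightarrow> cmod (g \<psi>) < e"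
    using weak_star_neighbourhood[OF g e] by blast
  have lin: "linear_on (Esp (CBall X)) g" using g by (simp add: cfun_def)
  \<comment> \<open>Scaling \<psi> by \<open>\<delta> / (2 * M)\<close> brings it into the
    neighbourhood, whence \<open>|g \<psi>| < 2 * e * M / \<delta>\<close>; this is the origin of
    \<open>C\<close>.\<close>
  define C where "C = 2 * e / \<delta>"
  have C: "C > 0" using e \<delta> by (simp add: C_def)
  have bound: "cmod (g \<psi>) \<le> e + C * (\<Sum>x\<in>S. cmod (\<psi> x))" if psi: "sing \<psi> \<in> CBall X 1 1" for \<psi>
  proof -
    define M where "M = (\<Sum>x\<in>S. cmod (\<psi> x))"
    have le: "cmod (\<psi> x) \<le> M" if "x \<in> S" for x
      unfolding M_def using S that by (intro member_le_sum) auto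
    have M: "M \<ge> 0" unfolding M_def by (intro sum_nonneg) simp
    show ?thesis
    proof (cases "M < \<delta>")
      case True
      then have "cmod (g \<psi>) < e" using le by (intro small[OF psi]) force
      moreover have "0 \<le> C * M" using C M by simp
      ultimately show ?thesis unfolding M_def by linarith
    next
      case False
      then have Mpos: "M > 0" using \<delta> by linarith
      define s where "s = \<delta> / (2 * M)"
      have s: "0 < s" "s \<le> 1" using False \<delta> Mpos by (simp_all add: s_def)
      have "sing (s *\<^sub>R\<^sub>C \<psi> + 0 *\<^sub>C \<psi>) \<in> CBall X 1 1"
        using s by (intro sing_comb_in_K[OF rB psi psi]) simp
      then have mem: "sing (s *\<^sub>R\<^sub>C \<psi>) \<in> CBall X 1 1" by (simp only: complex_vector.scale_zero_left add_0_right)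
      have "cmod ((s *\<^sub>R\<^sub>C \<psi>) x) < \<delta>" if "x \<in> S" for x
      proof -
        have "cmod ((s *\<^sub>R\<^sub>C \<psi>) x) = s * cmod (\<psi> x)"
          using s by (simp add: scaleC_fun_def scaleC_complex_def norm_mult)
        also have "\<dots> \<le> s * M" using le[OF that] s by (intro mult_left_mono) auto
        also have "\<dots> < \<delta>" using \<delta> Mpos by (simp add: s_def)
        finally show ?thesis .
      qed
      then have "cmod (g (s *\<^sub>R\<^sub>C \<psi>)) < e" by (intro small[OF mem]) blast
      moreover have "g (s *\<^sub>R\<^sub>C \<psi>) = complex_of_real s * g \<psi>"
        using linear_onD(2)[OF lin Esp_sing[OF rB psi]] by (simp add: scaleC_complex_def)
      ultimately have "s * cmod (g \<psi>) < e" using s by (simp add: norm_mult)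
      then have "cmod (g \<psi>) < e / s" using s by (simp add: field_simps)
      also have "e / s = C * M" using Mpos \<delta> by (simp add: s_def C_def field_simps)
      finally show ?thesis using e unfolding M_def by linarith
    qed
  qed
  \<comment> \<open>Pairs of a functional \<rho> and a positive \<tau> that bounds its norm: \<tau>
    stands in for the norm, so that only membership in the ball is used.\<close>
  define J where "J = {(\<rho>, \<tau>). 0 < \<tau> \<and> sing (inverse \<tau> *\<^sub>R\<^sub>C \<rho>) \<in> CBall X 1 1}"
  define f where "f \<kappa> = (\<lambda>(\<rho>, \<tau>). Re (g \<rho>) + e * \<tau> + C * (\<Sum>x\<in>S. cmod (\<kappa> x - \<rho> x)))" for \<kappa>
  define P where "P \<kappa> = (INF i\<in>J. f \<kappa> i)" for \<kappa>
  have JE: "\<rho> \<in> Esp (CBall X)" if "(\<rho>, \<tau>) \<in> J" for \<rho> \<tau>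
    using that unfolding J_def Esp_def by (auto intro!: exI[of _ "inverse \<tau>"])
  have Jbound: "cmod (g \<rho>) \<le> e * \<tau> + C * (\<Sum>x\<in>S. cmod (\<rho> x))" if J: "(\<rho>, \<tau>) \<in> J" for \<rho> \<tau>
  proof -
    have \<tau>: "0 < \<tau>" and mem: "sing (inverse \<tau> *\<^sub>R\<^sub>C \<rho>) \<in> CBall X 1 1" using J by (auto simp: J_def)
    have 1: "g (inverse \<tau> *\<^sub>R\<^sub>C \<rho>) = complex_of_real (inverse \<tau>) * g \<rho>"
      using linear_onD(2)[OF lin JE[OF J]] by (simp only: scaleC_complex_def)
    have 2: "cmod ((inverse \<tau> *\<^sub>R\<^sub>C \<rho>) x) = inverse \<tau> * cmod (\<rho> x)" for x
      unfolding scaleC_fun_def scaleC_complex_def norm_mult norm_of_real using \<tau> by simp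
    have "inverse \<tau> * cmod (g \<rho>) \<le> e + C * (inverse \<tau> * (\<Sum>x\<in>S. cmod (\<rho> x)))"
      using bound[OF mem] \<tau> unfolding 1 2 norm_mult norm_of_real sum_distrib_left[symmetric] by simp
    then show ?thesis using \<tau> by (simp add: field_simps)
  qed
  have zeroJ: "(0, \<tau>) \<in> J" if "0 < \<tau>" for \<tau>
    using that zero_in_CBall[OF X, of 1 1] by (simp add: J_def)
  have ne: "J \<noteq> {}" using zeroJ[of 1] by auto
  have lower: "- (C * (\<Sum>x\<in>S. cmod (\<kappa> x))) \<le> f \<kappa> i" if i: "i \<in> J" for \<kappa> i
  proof -
    obtain \<rho> \<tau> where ieq: "i = (\<rho>, \<tau>)" by (cases i)
    have "(\<Sum>x\<in>S. cmod (\<rho> x)) \<le> (\<Sum>x\<in>S. cmod (\<kappa> x) + cmod (\<kappa> x - \<rho> x))"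
    proof (rule sum_mono)
      fix x show "cmod (\<rho> x) \<le> cmod (\<kappa> x) + cmod (\<kappa> x - \<rho> x)"
        using norm_triangle_ineq4[of "\<kappa> x" "\<kappa> x - \<rho> x"] by simp
    qed
    then have "C * (\<Sum>x\<in>S. cmod (\<rho> x)) \<le> C * (\<Sum>x\<in>S. cmod (\<kappa> x)) + C * (\<Sum>x\<in>S. cmod (\<kappa> x - \<rho> x))"
      using C by (simp add: sum.distrib flip: distrib_left)
    moreover have "- cmod (g \<rho>) \<le> Re (g \<rho>)" using abs_Re_le_cmod[of "g \<rho>"] by linarith
    ultimately show ?thesis using Jbound[of \<rho> \<tau>] i by (simp add: f_def ieq)
  qed
  have le: "P \<kappa> \<le> f \<kappa> i" if "i \<in> J" for \<kappa> i
    unfolding P_def using that lower[of _ \<kappa>] by (intro cINF_lower bdd_belowI2) auto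
  have sub: "sublinear_on UNIV P"
  proof (rule sublinear_onI[OF complex_vector.subspace_UNIV])
    fix \<kappa> \<kappa>'
    show "P (\<kappa> + \<kappa>') \<le> P \<kappa> + P \<kappa>'"
      unfolding P_def[of \<kappa>] P_def[of \<kappa>']
    proof (rule le_cINF_add[OF ne ne])
      fix i j assume ij: "i \<in> J" "j \<in> J"
      obtain \<rho> \<tau> \<rho>' \<tau>' where ieq: "i = (\<rho>, \<tau>)" and jeq: "j = (\<rho>', \<tau>')" by (cases i, cases j)
      have \<tau>: "0 < \<tau>" "0 < \<tau>'" and mem: "sing (inverse \<tau> *\<^sub>R\<^sub>C \<rho>) \<in> CBall X 1 1" "sing (inverse \<tau>' *\<^sub>R\<^sub>C \<rho>') \<in> CBall X 1 1"
        using ij unfolding ieq jeq by (auto simp: J_def)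
      have "\<tau> / (\<tau> + \<tau>') * inverse \<tau> = inverse (\<tau> + \<tau>')" "\<tau>' / (\<tau> + \<tau>') * inverse \<tau>' = inverse (\<tau> + \<tau>')"
        using \<tau> by (simp_all add: field_simps)
      then have c: "complex_of_real (\<tau> / (\<tau> + \<tau>')) * complex_of_real (inverse \<tau>) = complex_of_real (inverse (\<tau> + \<tau>'))"
        "complex_of_real (\<tau>' / (\<tau> + \<tau>')) * complex_of_real (inverse \<tau>') = complex_of_real (inverse (\<tau> + \<tau>'))"
        by (simp_all only: of_real_mult[symmetric])
      have "cmod (complex_of_real (\<tau> / (\<tau> + \<tau>'))) + cmod (complex_of_real (\<tau>' / (\<tau> + \<tau>'))) \<le> 1"
        unfolding norm_of_real using \<tau> by (simp add: field_simps)
      from sing_comb_in_K[OF rB mem this]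
      have "sing (inverse (\<tau> + \<tau>') *\<^sub>R\<^sub>C (\<rho> + \<rho>')) \<in> CBall X 1 1"
        by (simp only: scaleC_scaleC c scaleC_add_right)
      then have "(\<rho> + \<rho>', \<tau> + \<tau>') \<in> J" using \<tau> by (simp add: J_def)
      then have "P (\<kappa> + \<kappa>') \<le> f (\<kappa> + \<kappa>') (\<rho> + \<rho>', \<tau> + \<tau>')" by (rule le)
      also have "\<dots> \<le> f \<kappa> i + f \<kappa>' j"
      proof -
        have "g (\<rho> + \<rho>') = g \<rho> + g \<rho>'"
          using linear_onD(1)[OF lin] JE ij unfolding ieq jeq by blast
        moreover have "(\<Sum>x\<in>S. cmod ((\<kappa> + \<kappa>') x - (\<rho> + \<rho>') x)) \<le> (\<Sum>x\<in>S. cmod (\<kappa> x - \<rho> x) + cmod (\<kappa>' x - \<rho>' x))"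
        proof (rule sum_mono)
          fix x show "cmod ((\<kappa> + \<kappa>') x - (\<rho> + \<rho>') x) \<le> cmod (\<kappa> x - \<rho> x) + cmod (\<kappa>' x - \<rho>' x)"
            using norm_triangle_ineq[of "\<kappa> x - \<rho> x" "\<kappa>' x - \<rho>' x"] by (simp add: algebra_simps)
        qed
        then have "C * (\<Sum>x\<in>S. cmod ((\<kappa> + \<kappa>') x - (\<rho> + \<rho>') x)) \<le> C * (\<Sum>x\<in>S. cmod (\<kappa> x - \<rho> x)) + C * (\<Sum>x\<in>S. cmod (\<kappa>' x - \<rho>' x))"
          unfolding distrib_left[symmetric] sum.distrib[symmetric] using C by (intro mult_left_mono) auto
        ultimately show ?thesis unfolding f_def ieq jeq prod.case by (simp add: distrib_left)
      qed
      finally show "P (\<kappa> + \<kappa>') \<le> f \<kappa> i + f \<kappa>' j" .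
    qed
  next
    fix t :: real and \<kappa> assume t: "0 < t"
    show "P (t *\<^sub>R\<^sub>C \<kappa>) \<le> t * P \<kappa>"
      unfolding P_def[of \<kappa>]
    proof (rule le_cINF_mult[OF ne t])
      fix i assume i: "i \<in> J"
      obtain \<rho> \<tau> where ieq: "i = (\<rho>, \<tau>)" by (cases i)
      have \<tau>: "0 < \<tau>" and mem: "sing (inverse \<tau> *\<^sub>R\<^sub>C \<rho>) \<in> CBall X 1 1" using i unfolding ieq by (auto simp: J_def)
      have "inverse (t * \<tau>) * t = inverse \<tau>" using t by simp
      then have "complex_of_real (inverse (t * \<tau>)) * complex_of_real t = complex_of_real (inverse \<tau>)"
        by (simp only: of_real_mult[symmetric])
      then have eq: "inverse (t * \<tau>) *\<^sub>R\<^sub>C (t *\<^sub>R\<^sub>C \<rho>) = inverse \<tau> *\<^sub>R\<^sub>C \<rho>" by (simp only: scaleC_scaleC)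
      have "(t *\<^sub>R\<^sub>C \<rho>, t * \<tau>) \<in> J" unfolding J_def mem_Collect_eq prod.case eq using t \<tau> mem by simp
      then have "P (t *\<^sub>R\<^sub>C \<kappa>) \<le> f (t *\<^sub>R\<^sub>C \<kappa>) (t *\<^sub>R\<^sub>C \<rho>, t * \<tau>)" by (rule le)
      also have "\<dots> = t * f \<kappa> i"
      proof -
        have 1: "g (t *\<^sub>R\<^sub>C \<rho>) = complex_of_real t * g \<rho>"
          using linear_onD(2)[OF lin JE] i unfolding ieq scaleC_complex_def by blast
        have "cmod ((t *\<^sub>R\<^sub>C \<kappa>) x - (t *\<^sub>R\<^sub>C \<rho>) x) = t * cmod (\<kappa> x - \<rho> x)" for x
        proof -
          have "(t *\<^sub>R\<^sub>C \<kappa>) x - (t *\<^sub>R\<^sub>C \<rho>) x = complex_of_real t * (\<kappa> x - \<rho> x)"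
            by (simp add: scaleC_fun_def scaleC_complex_def algebra_simps)
          then show ?thesis using t by (simp add: norm_mult)
        qed
        then show ?thesis unfolding f_def ieq prod.case 1
          by (simp add: sum_distrib_left algebra_simps)
      qed
      finally show "P (t *\<^sub>R\<^sub>C \<kappa>) \<le> t * f \<kappa> i" .
    qed
  next
    have "P 0 \<le> z" if "0 < z" for z
    proof -
      have "P 0 \<le> f 0 (0, z / e)" using that e by (intro le zeroJ) simp
      also have "\<dots> = z" using e linear_onD(3)[OF lin Esp_zero[OF rB]] by (simp add: f_def)
      finally show ?thesis .
    qed
    then have "P 0 \<le> 0" by (rule dense_ge)
    moreover have "0 \<le> P 0"
      unfolding P_def by (rule cINF_greatest[OF ne]) (use lower[of _ 0] in simp)
    ultimately show "P 0 = 0" by simp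
  qed
  obtain l where l: "real_linear_on UNIV l" "\<And>\<kappa>. l \<kappa> \<le> P \<kappa>"
    using hahn_banach[OF complex_vector.subspace_UNIV sub] by auto
  have lscale: "l (t *\<^sub>R\<^sub>C y) = t * l y" for y t
    using l(1) unfolding real_linear_on_def by blast
  have lneg: "l (- y) = - l y" for y
    using lscale[of "- 1" y] by (simp add: complex_vector.scale_minus_left scaleC_one)
  \<comment> \<open>Taking \<rho> = 0 and letting \<tau> tend to 0 leaves only the sum over
    \<open>S\<close>, so \<open>l\<close> vanishes wherever all coordinates in \<open>S\<close>
    do.\<close>
  have l0: "l \<kappa> = 0" if \<kappa>: "\<forall>x\<in>S. \<kappa> x = 0" for \<kappa>
  proof -
    have le0: "l \<kappa> \<le> 0" if \<kappa>: "\<forall>x\<in>S. \<kappa> x = 0" for \<kappa>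
    proof (rule dense_ge)
      fix z :: real assume "0 < z"
      then have "P \<kappa> \<le> f \<kappa> (0, z / e)" using e by (intro le zeroJ) simp
      also have "\<dots> = z" using e \<kappa> linear_onD(3)[OF lin Esp_zero[OF rB]] by (simp add: f_def)
      finally show "l \<kappa> \<le> z" using l(2)[of \<kappa>] by simp
    qed
    have "l (- \<kappa>) \<le> 0" using \<kappa> by (intro le0) simp
    then show ?thesis using le0[OF \<kappa>] lneg[of \<kappa>] by simp
  qed
  define L where "L \<kappa> = Complex (l \<kappa>) (- l (\<i> *\<^sub>C \<kappa>))" for \<kappa>
  have L: "linear_on UNIV L" unfolding L_def by (rule complexify[OF complex_vector.subspace_UNIV l(1)])
  have L0: "L \<kappa> = 0" if "\<forall>x\<in>S. \<kappa> x = 0" for \<kappa>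
    using that l0[of \<kappa>] l0[of "\<i> *\<^sub>C \<kappa>"] by (simp add: L_def scaleC_fun_def scaleC_complex_def complex_eq_iff)
  define \<delta>' where "\<delta>' x = (\<lambda>y. if y = x then 1 else 0 :: complex)" for x :: 'x
  have Lsum: "L \<kappa> = (\<Sum>x\<in>S. \<kappa> x * L (\<delta>' x))" for \<kappa>
  proof -
    define \<kappa>' where "\<kappa>' = (\<Sum>x\<in>S. \<kappa> x *\<^sub>C \<delta>' x)"
    have "\<kappa>' y = \<kappa> y" if "y \<in> S" for y
    proof -
      have "\<kappa>' y = (\<Sum>x\<in>S. if x = y then \<kappa> y else 0)"
        unfolding \<kappa>'_def sum_fun_apply
        by (intro sum.cong) (auto simp: \<delta>'_def scaleC_fun_def scaleC_complex_def)
      then show ?thesis using S that by simp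
    qed
    then have "L (\<kappa> - \<kappa>') = 0" by (intro L0) simp
    then have "L \<kappa> = L \<kappa>'" using linear_onD(1)[OF L, of "\<kappa> - \<kappa>'" \<kappa>'] by simp
    also have "\<dots> = (\<Sum>x\<in>S. L (\<kappa> x *\<^sub>C \<delta>' x))"
      unfolding \<kappa>'_def by (rule linear_on_sum[OF complex_vector.subspace_UNIV L]) simp
    also have "\<dots> = (\<Sum>x\<in>S. \<kappa> x * L (\<delta>' x))"
      using linear_onD(2)[OF L] by (simp add: scaleC_complex_def)
    finally show ?thesis .
  qed
  define x0 where "x0 = (\<Sum>x\<in>S \<inter> carrier X. L (\<delta>' x) *\<^sub>C x)"
  have x0: "x0 \<in> carrier X"
    unfolding x0_def by (intro complex_vector.subspace_sum[OF subX] complex_vector.subspace_scale[OF subX]) simp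
  have ev: "\<psi> x0 = L \<psi>" if psi: "sing \<psi> \<in> CBall X 1 1" for \<psi>
  proof -
    have plin: "linear_on (carrier X) \<psi>" and p0: "\<And>x. x \<notin> carrier X \<Longrightarrow> \<psi> x = 0"
      using CBall_D(3)[OF X psi, of 0 0] CBall_D(4)[OF X psi, of _ 0 0] by simp_all
    have "\<psi> x0 = (\<Sum>x\<in>S \<inter> carrier X. \<psi> (L (\<delta>' x) *\<^sub>C x))"
      unfolding x0_def by (intro linear_on_sum[OF subX plin] complex_vector.subspace_scale[OF subX]) simp
    also have "\<dots> = (\<Sum>x\<in>S \<inter> carrier X. \<psi> x * L (\<delta>' x))"
      using linear_onD(2)[OF plin] by (intro sum.cong refl) (simp add: scaleC_complex_def)
    also have "\<dots> = (\<Sum>x\<in>S. \<psi> x * L (\<delta>' x))"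
      using S p0 by (intro sum.mono_neutral_left) auto
    finally show ?thesis using Lsum[of \<psi>] by simp
  qed
  have "cmod (g \<psi> - \<psi> x0) \<le> e" if psi: "sing \<psi> \<in> CBall X 1 1" for \<psi>
  proof -
    obtain c where c: "cmod c = 1" "c * (\<psi> x0 - g \<psi>) = complex_of_real (cmod (\<psi> x0 - g \<psi>))"
      by (rule Complex_linear_rotate)
    have "sing (c *\<^sub>C \<psi> + 0 *\<^sub>C \<psi>) \<in> CBall X 1 1"
      using c(1) by (intro sing_comb_in_K[OF rB psi psi]) simp
    then have cpsi: "sing (c *\<^sub>C \<psi>) \<in> CBall X 1 1" by (simp only: complex_vector.scale_zero_left add_0_right)
    \<comment> \<open>At \<rho> = \<kappa> = \<open>c \<psi>\<close> and \<tau> = 1 the sum over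
      \<open>S\<close> vanishes and only the real part of \<open>c * g \<psi>\<close> plus
      \<open>e\<close> remains; the phase \<open>c\<close> was chosen to turn the real part of the
      difference into its modulus.\<close>
    have "(c *\<^sub>C \<psi>, 1) \<in> J" using cpsi by (simp add: J_def scaleC_one)
    then have "l (c *\<^sub>C \<psi>) \<le> f (c *\<^sub>C \<psi>) (c *\<^sub>C \<psi>, 1)" using l(2) le order_trans by blast
    also have "\<dots> = Re (c * g \<psi>) + e"
      using linear_onD(2)[OF lin Esp_sing[OF rB psi]] by (simp add: f_def scaleC_complex_def)
    finally have "Re (L (c *\<^sub>C \<psi>)) \<le> Re (c * g \<psi>) + e" by (simp add: L_def)
    moreover have "L (c *\<^sub>C \<psi>) = c * \<psi> x0"
      using linear_onD(2)[OF L, of \<psi> c] ev[OF psi] by (simp add: scaleC_complex_def)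
    ultimately have "Re (c * (\<psi> x0 - g \<psi>)) \<le> e" by (simp add: right_diff_distrib)
    then show ?thesis unfolding c(2) by (simp add: norm_minus_commute)
  qed
  then show ?thesis using x0 by blast
qed

text \<open>The approximants with error \<open>1 / (k + 1)\<close> form a Cauchy sequence because
  \<open>functional_eval\<close> is isometric. Completeness of \<open>X\<close> supplies the limit,
  which represents \<open>g\<close> on the ball and, by scaling, on its span.\<close>

lemma functional_eval_surj:
  assumes f: "f \<in> carrier (A_rho (CBall X))"
  shows "\<exists>x\<in>carrier X. f = functional_eval X x"
proof -
  note cB = compact_rmconvex_CBall[OF X] and rB = rmconvex_CBall[OF X] and subX = carrier_subspace[OF X]
  obtain g where g: "cfun (CBall X) g" "f = lift (CBall X) g" by (rule A_rho_carrierE[OF cB f])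
  have "\<forall>k. \<exists>x. x \<in> carrier X \<and> (\<forall>\<psi>. sing \<psi> \<in> CBall X 1 1 \<longrightarrow> cmod (g \<psi> - \<psi> x) \<le> inverse (real (Suc k)))"
    using functional_eval_approx[OF g(1)] by (metis inverse_positive_iff_positive of_nat_0_less_iff zero_less_Suc)
  then have "\<exists>s. \<forall>k. s k \<in> carrier X \<and> (\<forall>\<psi>. sing \<psi> \<in> CBall X 1 1 \<longrightarrow> cmod (g \<psi> - \<psi> (s k)) \<le> inverse (real (Suc k)))"
    by (rule choice)
  then obtain s where s: "\<And>k. s k \<in> carrier X"
    and sg: "\<And>k \<psi>. sing \<psi> \<in> CBall X 1 1 \<Longrightarrow> cmod (g \<psi> - \<psi> (s k)) \<le> inverse (real (Suc k))"
    by blast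
  have plin: "\<psi> (x - y) = \<psi> x - \<psi> y" if psi: "sing \<psi> \<in> CBall X 1 1" and xy: "x \<in> carrier X" "y \<in> carrier X" for \<psi> x y
  proof -
    have lin: "linear_on (carrier X) \<psi>" using CBall_D(3)[OF X psi, of 0 0] by simp
    have "\<psi> ((x - y) + y) = \<psi> (x - y) + \<psi> y"
      by (rule linear_onD(1)[OF lin complex_vector.subspace_diff[OF subX xy] xy(2)])
    then show ?thesis by simp
  qed
  have diff: "elem_norm X (s k - s l) \<le> inverse (real (Suc k)) + inverse (real (Suc l))" for k l
  proof -
    have d: "s k - s l \<in> carrier X" by (rule complex_vector.subspace_diff[OF subX s s])
    have "elem_norm (A_rho (CBall X)) (functional_eval X (s k - s l)) \<le> inverse (real (Suc k)) + inverse (real (Suc l))"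
    proof (rule A_rho_elem_le[OF cB])
      fix \<psi> assume psi: "sing \<psi> \<in> CBall X 1 1"
      have "functional_eval X (s k - s l) 1 1 (sing \<psi>) 0 0 = (g \<psi> - \<psi> (s l)) - (g \<psi> - \<psi> (s k))"
        unfolding functional_eval_entry[OF X d psi] sing_00 plin[OF psi s s] by simp
      then show "cmod (functional_eval X (s k - s l) 1 1 (sing \<psi>) 0 0) \<le> inverse (real (Suc k)) + inverse (real (Suc l))"
        using norm_triangle_ineq4[of "g \<psi> - \<psi> (s l)" "g \<psi> - \<psi> (s k)"] sg[OF psi, of k] sg[OF psi, of l]
        by simp
    qed
    then show ?thesis unfolding elem_norm_functional_eval[OF X d] .
  qed
  have "\<exists>x\<in>carrier X. (\<lambda>k. elem_norm X (s k - x)) \<longlonglongrightarrow> 0"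
  proof (rule operator_spaceD(8)[OF X s])
    fix e :: real assume e: "e > 0"
    then obtain N where N: "inverse (real (Suc N)) < e / 2" using reals_Archimedean[of "e / 2"] by auto
    have "elem_norm X (s k - s l) < e" if "k \<ge> N" "l \<ge> N" for k l
    proof -
      have "inverse (real (Suc k)) \<le> inverse (real (Suc N))" "inverse (real (Suc l)) \<le> inverse (real (Suc N))"
        using that by (auto intro!: le_imp_inverse_le)
      then show ?thesis using diff[of k l] N by linarith
    qed
    then show "\<exists>N. \<forall>k\<ge>N. \<forall>l\<ge>N. elem_norm X (s k - s l) < e" by blast
  qed
  then obtain x where x: "x \<in> carrier X" and lim: "(\<lambda>k. elem_norm X (s k - x)) \<longlonglongrightarrow> 0" by blast
  have gx: "g \<psi> = \<psi> x" if psi: "sing \<psi> \<in> CBall X 1 1" for \<psi>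
  proof -
    have "cmod (g \<psi> - \<psi> x) \<le> 0"
    proof (rule LIMSEQ_le_const)
      show "(\<lambda>k. inverse (real (Suc k)) + elem_norm X (s k - x)) \<longlonglongrightarrow> 0"
        using tendsto_add[OF LIMSEQ_inverse_real_of_nat lim] by simp
      have "cmod (g \<psi> - \<psi> x) \<le> inverse (real (Suc k)) + elem_norm X (s k - x)" for k
      proof -
        have d: "s k - x \<in> carrier X" by (rule complex_vector.subspace_diff[OF subX s x])
        have "cmod (\<psi> (s k - x)) \<le> elem_norm X (s k - x)"
          using CBall_bound[OF X psi d, of 0 0] by simp
        then show ?thesis
          using norm_triangle_ineq[of "g \<psi> - \<psi> (s k)" "\<psi> (s k - x)"] sg[OF psi, of k]
          unfolding plin[OF psi s x] by simp
      qed
      then show "\<exists>N. \<forall>k\<ge>N. cmod (g \<psi> - \<psi> x) \<le> inverse (real (Suc k)) + elem_norm X (s k - x)" by blast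
    qed
    then show ?thesis by simp
  qed
  have "f = functional_eval X x"
    unfolding g(2) functional_eval_lift[OF X x]
  proof (rule lift_cong[OF rB])
    fix w assume w: "w \<in> Esp (CBall X)"
    then obtain t where t: "t > 0" "sing (t *\<^sub>R\<^sub>C w) \<in> CBall X 1 1" by (auto simp: Esp_def)
    have "linear_on (Esp (CBall X)) g" using g(1) by (simp add: cfun_def)
    then have "g (t *\<^sub>R\<^sub>C w) = complex_of_real t * g w" using linear_onD(2) w by (metis scaleC_complex_def)
    moreover have "(t *\<^sub>R\<^sub>C w) x = complex_of_real t * w x" by (simp add: scaleC_fun_def scaleC_complex_def)
    ultimately show "g w = w x" using gx[OF t(2)] t(1) by simp
  qed
  then show ?thesis using x by blast
qed

theorem functional_eval_iso: "op_iso X (A_rho (CBall X)) (functional_eval X)"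
  unfolding op_iso_def
proof (intro conjI allI impI ballI)
  show "functional_eval X \<in> op_hom X (A_rho (CBall X))" by (rule functional_eval_hom[OF X])
  show "bij_betw (functional_eval X) (carrier X) (carrier (A_rho (CBall X)))"
    unfolding bij_betw_def using functional_eval_inj[OF X] functional_eval_carrier[OF X] functional_eval_surj by blast
qed (rule functional_eval_isometric[OF X])

end

section \<open>The two functors\<close>

lemma op_homD:
  assumes "\<phi> \<in> op_hom X Y"
  shows "x \<notin> carrier X \<Longrightarrow> \<phi> x = 0" "x \<in> carrier X \<Longrightarrow> \<phi> x \<in> carrier Y" "linear_on (carrier X) \<phi>"
    and "0 < p \<Longrightarrow> 0 < q \<Longrightarrow> y \<in> mats p q (carrier X) \<Longrightarrow> mnorm Y p q (\<lambda>i j. \<phi> (y i j)) \<le> mnorm X p q y"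
  using assms unfolding op_hom_def linear_on_def mem_Collect_eq by (elim conjE; blast)+

lemma op_hom_mats:
  assumes X: "operator_space X" and phi: "\<phi> \<in> op_hom X Y" and x: "x \<in> mats p q (carrier X)"
  shows "(\<lambda>i j. \<phi> (x i j)) \<in> mats p q (carrier Y)"
  using x op_homD(2)[OF phi] linear_onD(3)[OF op_homD(3)[OF phi] complex_vector.subspace_0[OF carrier_subspace[OF X]]]
  by (simp add: mats_def)

lemma op_hom_comp:
  assumes X: "operator_space X" and phi: "\<phi> \<in> op_hom X Y" and psi: "\<psi> \<in> op_hom Y Z" and Y: "operator_space Y"
  shows "\<psi> \<circ> \<phi> \<in> op_hom X Z"
  unfolding op_hom_def mem_Collect_eq o_def
proof (intro conjI allI impI ballI)
  note f = op_homD[OF phi] and g = op_homD[OF psi]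
  have g0: "\<psi> 0 = 0" by (rule linear_onD(3)[OF g(3) complex_vector.subspace_0[OF carrier_subspace[OF Y]]])
  show "\<psi> (\<phi> x) = 0" if "x \<notin> carrier X" for x using f(1)[OF that] g0 by simp
  show "\<psi> (\<phi> x) \<in> carrier Z" if "x \<in> carrier X" for x using f(2) g(2) that by blast
  show "\<psi> (\<phi> (x + y)) = \<psi> (\<phi> x) + \<psi> (\<phi> y)" if "x \<in> carrier X" "y \<in> carrier X" for x y
    using linear_onD(1)[OF f(3) that] linear_onD(1)[OF g(3) f(2)[OF that(1)] f(2)[OF that(2)]] by simp
  show "\<psi> (\<phi> (c *\<^sub>C x)) = c *\<^sub>C \<psi> (\<phi> x)" if "x \<in> carrier X" for c x
    using linear_onD(2)[OF f(3) that] linear_onD(2)[OF g(3) f(2)[OF that]] by simp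
  show "mnorm Z p q (\<lambda>i j. \<psi> (\<phi> (x i j))) \<le> mnorm X p q x"
    if "0 < p" "0 < q" "x \<in> mats p q (carrier X)" for p q x
    using g(4)[OF that(1,2) op_hom_mats[OF X phi that(3)]] f(4)[OF that] by simp
qed

lemma op_id_hom:
  assumes X: "operator_space X"
  shows "op_id X \<in> op_hom X X"
  unfolding op_hom_def mem_Collect_eq op_id_def
proof (intro conjI allI impI ballI)
  note sub = carrier_subspace[OF X]
  show "mnorm X p q (\<lambda>i j. if x i j \<in> carrier X then x i j else 0) \<le> mnorm X p q x"
    if x: "x \<in> mats p q (carrier X)" for p q x
  proof -
    have "(\<lambda>i j. if x i j \<in> carrier X then x i j else 0) = x"
      using x by (auto simp: mats_def fun_eq_iff) (metis not_less)
    then show ?thesis by simp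
  qed
qed (use complex_vector.subspace_add[OF carrier_subspace[OF X]] complex_vector.subspace_scale[OF carrier_subspace[OF X]] in auto)

definition op_inverse :: "'a::complex_vector opspace \<Rightarrow> 'b::complex_vector opspace \<Rightarrow> ('a \<Rightarrow> 'b) \<Rightarrow> 'b \<Rightarrow> 'a" where
  "op_inverse X Y \<phi> = (\<lambda>y. if y \<in> carrier Y then inv_into (carrier X) \<phi> y else 0)"

lemma op_inverse:
  assumes X: "operator_space X" and Y: "operator_space Y" and iso: "op_iso X Y \<phi>"
  shows "op_inverse X Y \<phi> \<in> op_hom Y X"
    and "x \<in> carrier X \<Longrightarrow> op_inverse X Y \<phi> (\<phi> x) = x"
    and "y \<in> carrier Y \<Longrightarrow> \<phi> (op_inverse X Y \<phi> y) = y"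
proof -
  note subX = carrier_subspace[OF X] and subY = carrier_subspace[OF Y]
  have phi: "\<phi> \<in> op_hom X Y" and bij: "bij_betw \<phi> (carrier X) (carrier Y)"
    and isom: "\<And>p q x. 0 < p \<Longrightarrow> 0 < q \<Longrightarrow> x \<in> mats p q (carrier X) \<Longrightarrow> mnorm Y p q (\<lambda>i j. \<phi> (x i j)) = mnorm X p q x"
    using iso by (auto simp: op_iso_def)
  let ?i = "op_inverse X Y \<phi>"
  show left: "?i (\<phi> x) = x" if "x \<in> carrier X" for x
    using bij_betw_inv_into_left[OF bij that] op_homD(2)[OF phi that] by (simp add: op_inverse_def)
  show right: "\<phi> (?i y) = y" if "y \<in> carrier Y" for y
    using bij_betw_inv_into_right[OF bij that] that by (simp add: op_inverse_def)
  have mem: "?i y \<in> carrier X" if "y \<in> carrier Y" for y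
    using bij_betwE[OF bij_betw_inv_into[OF bij]] that by (simp add: op_inverse_def)
  show "?i \<in> op_hom Y X"
    unfolding op_hom_def mem_Collect_eq
  proof (intro conjI allI impI ballI)
    show "?i y = 0" if "y \<notin> carrier Y" for y using that by (simp add: op_inverse_def)
    show "?i y \<in> carrier X" if "y \<in> carrier Y" for y by (rule mem[OF that])
    show "?i (y + y') = ?i y + ?i y'" if yy: "y \<in> carrier Y" "y' \<in> carrier Y" for y y'
    proof -
      have s: "?i y + ?i y' \<in> carrier X" by (rule complex_vector.subspace_add[OF subX mem[OF yy(1)] mem[OF yy(2)]])
      have "\<phi> (?i y + ?i y') = y + y'"
        using linear_onD(1)[OF op_homD(3)[OF phi] mem[OF yy(1)] mem[OF yy(2)]] right yy by simp
      then show ?thesis using left[OF s] by simp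
    qed
    show "?i (c *\<^sub>C y) = c *\<^sub>C ?i y" if y: "y \<in> carrier Y" for c y
    proof -
      have s: "c *\<^sub>C ?i y \<in> carrier X" by (rule complex_vector.subspace_scale[OF subX mem[OF y]])
      have "\<phi> (c *\<^sub>C ?i y) = c *\<^sub>C y"
        using linear_onD(2)[OF op_homD(3)[OF phi] mem[OF y]] right[OF y] by simp
      then show ?thesis using left[OF s] by simp
    qed
    show "mnorm X p q (\<lambda>i j. ?i (y i j)) \<le> mnorm Y p q y"
      if pq: "0 < p" "0 < q" and y: "y \<in> mats p q (carrier Y)" for p q y
    proof -
      have yc: "y i j \<in> carrier Y" for i j
        using y complex_vector.subspace_0[OF subY] by (cases "i < p \<and> j < q") (auto simp: mats_def not_less)
      have "\<phi> 0 = 0" by (rule linear_onD(3)[OF op_homD(3)[OF phi] complex_vector.subspace_0[OF subX]])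
      then have "?i 0 = 0" using left[OF complex_vector.subspace_0[OF subX]] by simp
      then have "(\<lambda>i j. ?i (y i j)) \<in> mats p q (carrier X)"
        using y mem by (simp add: mats_def)
      from isom[OF pq this] show ?thesis using right[OF yc] by simp
    qed
  qed
qed

lemma rm_hom_rep:
  assumes K: "compact_rmconvex K" and T: "rmconvex T" and th: "\<theta> \<in> rm_hom K T"
  shows "\<exists>h. linear_on (Esp K) h \<and> \<theta> = lift K h"
proof -
  have "rm_affine K T \<theta>" using th by (simp add: rm_hom_def)
  moreover have "\<forall>n m. T n m \<subseteq> mats n m UNIV" using rmconvexD(1)[OF T] by blast
  ultimately show ?thesis by (intro rm_affine_rep[OF compact_rmconvexD(1)[OF K]])
qed

lemma rm_homD:
  assumes "\<theta> \<in> rm_hom K T"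
  shows "v \<in> K n m \<Longrightarrow> \<theta> n m v \<in> T n m" "v \<notin> K n m \<Longrightarrow> \<theta> n m v = 0"
    and "continuous_on (K n m) (\<theta> n m)" "rm_affine K T \<theta>"
proof -
  show a: "rm_affine K T \<theta>" and "continuous_on (K n m) (\<theta> n m)" using assms by (auto simp: rm_hom_def)
  show "v \<in> K n m \<Longrightarrow> \<theta> n m v \<in> T n m" "v \<notin> K n m \<Longrightarrow> \<theta> n m v = 0"
    using rm_affineD[OF a] by blast+
qed

section \<open>Functoriality of \<open>CBall\<close>\<close>

lemma CBall_map_mem:
  fixes X :: "'x::complex_vector opspace" and Y :: "'y::complex_vector opspace"
  assumes X: "operator_space X" and Y: "operator_space Y" and phi: "\<phi> \<in> op_hom X Y" and psi: "\<psi> \<in> CBall Y n m"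
  shows "(\<lambda>i j x. \<psi> i j (\<phi> x)) \<in> CBall X n m"
  unfolding CBall_char[OF X]
proof (intro conjI allI impI ballI)
  note f = op_homD[OF phi]
  have lin: "linear_on (carrier Y) (\<psi> i j)" for i j by (rule CBall_D(3)[OF Y psi])
  show "0 < n" "0 < m" using CBall_D(1,2)[OF Y psi] .
  show "linear_on (carrier X) (\<lambda>x. \<psi> i j (\<phi> x))" for i j
    unfolding linear_on_def using linear_onD(1,2)[OF f(3)] linear_onD(1,2)[OF lin] f(2) by simp
  show "\<psi> i j (\<phi> x) = 0" if "x \<notin> carrier X \<or> n \<le> i \<or> m \<le> j" for i j x
  proof (cases "x \<in> carrier X")
    case True
    then show ?thesis using that CBall_D(4)[OF Y psi] by blast
  next
    case False
    then show ?thesis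
      using f(1) linear_onD(3)[OF lin complex_vector.subspace_0[OF carrier_subspace[OF Y]]] by simp
  qed
  show "cmod (quad p q n m (\<lambda>a b i j. \<psi> i j (\<phi> (x a b))) \<xi> \<eta>) \<le> mnorm X p q x * hs p n \<xi> * hs q m \<eta>"
    if pq: "0 < p" "0 < q" and x: "x \<in> mats p q (carrier X)" for p q x \<xi> \<eta>
  proof -
    have "cmod (quad p q n m (\<lambda>a b i j. \<psi> i j (\<phi> (x a b))) \<xi> \<eta>) \<le> mnorm Y p q (\<lambda>i j. \<phi> (x i j)) * hs p n \<xi> * hs q m \<eta>"
      by (rule CBall_D(5)[OF Y psi pq op_hom_mats[OF X phi x]])
    also have "\<dots> \<le> mnorm X p q x * hs p n \<xi> * hs q m \<eta>"
      by (intro mult_right_mono f(4)[OF pq x] L2_set_nonneg)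
    finally show ?thesis .
  qed
qed

lemma CBall_map_hom:
  fixes X :: "'x::complex_vector opspace" and Y :: "'y::complex_vector opspace"
  assumes X: "operator_space X" and Y: "operator_space Y" and phi: "\<phi> \<in> op_hom X Y"
  shows "CBall_map Y \<phi> \<in> rm_hom (CBall Y) (CBall X)"
proof -
  have eq: "CBall_map Y \<phi> = lift (CBall Y) (\<lambda>\<psi> x. \<psi> (\<phi> x))"
    by (auto simp: CBall_map_def lift_def fun_eq_iff)
  have "rm_affine (CBall Y) (CBall X) (lift (CBall Y) (\<lambda>\<psi> x. \<psi> (\<phi> x)))"
  proof (rule rm_affine_lift[OF rmconvex_CBall[OF Y]])
    show "linear_on (Esp (CBall Y)) (\<lambda>\<psi> x. \<psi> (\<phi> x))"
      by (simp add: linear_on_def scaleC_fun_def fun_eq_iff)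
    show "\<forall>n m. \<forall>\<psi>\<in>CBall Y n m. (\<lambda>i j x. \<psi> i j (\<phi> x)) \<in> CBall X n m"
      using CBall_map_mem[OF X Y phi] by blast
  qed
  moreover have "continuous_on (CBall Y n m) (CBall_map Y \<phi> n m)" for n m
  proof -
    have "continuous_on (CBall Y n m) (\<lambda>\<psi> i j x. \<psi> i j (\<phi> x))"
      by (intro cont_matrixI continuous_on_coordinatewise_then_product cont_eval3[OF Y])
    then show ?thesis by (rule continuous_on_eq) (simp add: CBall_map_def)
  qed
  ultimately show ?thesis unfolding rm_hom_def mem_Collect_eq eq[symmetric] by blast
qed

lemma CBall_map_id:
  assumes X: "operator_space X"
  shows "CBall_map X (op_id X) = rm_id (CBall X)"
proof (intro ext)
  fix n m \<psi> i j x
  show "CBall_map X (op_id X) n m \<psi> i j x = rm_id (CBall X) n m \<psi> i j x"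
  proof (cases "\<psi> \<in> CBall X n m")
    case True
    have "\<psi> i j (op_id X x) = \<psi> i j x"
      using CBall_D(4)[OF X True, of x i j] linear_onD(3)[OF CBall_D(3)[OF X True] complex_vector.subspace_0[OF carrier_subspace[OF X]]]
      by (simp add: op_id_def)
    then show ?thesis using True by (simp add: CBall_map_def rm_id_def)
  qed (simp add: CBall_map_def rm_id_def)
qed

lemma CBall_map_comp:
  assumes X: "operator_space X" and Y: "operator_space Y" and Z: "operator_space Z"
    and phi: "\<phi> \<in> op_hom X Y" and psi: "\<psi> \<in> op_hom Y Z"
  shows "CBall_map Z (\<psi> \<circ> \<phi>) = rm_comp (CBall_map Y \<phi>) (CBall_map Z \<psi>)"
proof (intro ext)
  fix n m \<kappa> i j x
  show "CBall_map Z (\<psi> \<circ> \<phi>) n m \<kappa> i j x = rm_comp (CBall_map Y \<phi>) (CBall_map Z \<psi>) n m \<kappa> i j x"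
    using CBall_map_mem[OF Y Z psi, of \<kappa> n m] by (simp add: CBall_map_def rm_comp_def)
qed

section \<open>Functoriality of \<open>A_rho\<close>\<close>

lemma A_rho_map_lift:
  fixes K :: "'k::complex_lctvs matrix_family" and T :: "'t::complex_lctvs matrix_family"
  assumes K: "compact_rmconvex K" and T: "compact_rmconvex T" and th: "\<theta> \<in> rm_hom K T" and f: "f \<in> carrier (A_rho T)"
  shows "A_rho_map K T \<theta> f \<in> carrier (A_rho K)"
proof -
  note rK = compact_rmconvexD(1)[OF K] and rT = compact_rmconvexD(1)[OF T]
  obtain h where h: "linear_on (Esp K) h" "\<theta> = lift K h" using rm_hom_rep[OF K rT th] by blast
  obtain g where g: "cfun T g" "f = lift T g" by (rule A_rho_carrierE[OF T f])
  have glin: "linear_on (Esp T) g" and gc: "continuous_on (T 1 1) (\<lambda>v. g (v 0 0))"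
    using g(1) by (simp_all add: cfun_def)
  \<comment> \<open>\<open>g\<close> is linear on \<open>Esp T\<close> only, so \<open>h\<close> has
    to map \<open>Esp K\<close> into it; this is seen by scaling into level (1, 1).\<close>
  have hE: "h w \<in> Esp T" if w: "w \<in> Esp K" for w
  proof -
    obtain t where t: "t > 0" "sing (t *\<^sub>R\<^sub>C w) \<in> K 1 1" using w unfolding Esp_def by blast
    have "\<theta> 1 1 (sing (t *\<^sub>R\<^sub>C w)) \<in> T 1 1" by (rule rm_homD(1)[OF th t(2)])
    moreover have "\<theta> 1 1 (sing (t *\<^sub>R\<^sub>C w)) = sing (t *\<^sub>R\<^sub>C h w)"
    proof -
      have "h (sing (t *\<^sub>R\<^sub>C w) i j) = sing (t *\<^sub>R\<^sub>C h w) i j" for i j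
        using linear_onD(2)[OF h(1) w] linear_onD(3)[OF h(1) w] by (simp add: sing_def)
      then show ?thesis using t(2) by (simp only: h(2) lift_def if_True)
    qed
    ultimately show ?thesis using t(1) unfolding Esp_def by auto
  qed
  have "linear_on (Esp K) (\<lambda>w. g (h w))"
    unfolding linear_on_def using linear_onD(1,2)[OF h(1)] linear_onD(1,2)[OF glin] hE by simp
  moreover have "continuous_on (K 1 1) (\<lambda>v. g (h (v 0 0)))"
  proof -
    have "continuous_on (K 1 1) (\<lambda>v. g (\<theta> 1 1 v 0 0))"
      using rm_homD(1)[OF th, of _ 1 1] by (intro continuous_on_compose2[OF gc rm_homD(3)[OF th]]) blast
    then show ?thesis by (rule continuous_on_eq) (simp add: h(2) lift_def)
  qed
  ultimately have "cfun K (\<lambda>w. g (h w))" by (simp add: cfun_def)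
  moreover have "A_rho_map K T \<theta> f = lift K (\<lambda>w. g (h w))"
  proof (intro ext)
    fix n m v i j
    show "A_rho_map K T \<theta> f n m v i j = lift K (\<lambda>w. g (h w)) n m v i j"
    proof (cases "v \<in> K n m")
      case True
      have "\<theta> n m v \<in> T n m" by (rule rm_homD(1)[OF th True])
      then have "f n m (\<theta> n m v) i j = g (\<theta> n m v i j)" by (simp add: g(2) lift_def)
      also have "\<theta> n m v i j = h (v i j)" using True by (simp add: h(2) lift_def)
      finally show ?thesis using True f by (simp add: A_rho_map_def lift_def)
    qed (use f in \<open>simp add: A_rho_map_def lift_def\<close>)
  qed
  ultimately show ?thesis unfolding A_rho_carrier[OF K] by blast
qed

lemma A_rho_map_hom:
  fixes K :: "'k::complex_lctvs matrix_family" and T :: "'t::complex_lctvs matrix_family"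
  assumes K: "compact_rmconvex K" and T: "compact_rmconvex T" and th: "\<theta> \<in> rm_hom K T"
  shows "A_rho_map K T \<theta> \<in> op_hom (A_rho T) (A_rho K)"
  unfolding op_hom_def mem_Collect_eq
proof (intro conjI allI impI ballI)
  note subT = A_rho_subspace[OF T]
  show "A_rho_map K T \<theta> f = 0" if "f \<notin> carrier (A_rho T)" for f using that by (simp add: A_rho_map_def)
  show "A_rho_map K T \<theta> f \<in> carrier (A_rho K)" if "f \<in> carrier (A_rho T)" for f
    by (rule A_rho_map_lift[OF K T th that])
  show "A_rho_map K T \<theta> (f + f') = A_rho_map K T \<theta> f + A_rho_map K T \<theta> f'"
    if ff: "f \<in> carrier (A_rho T)" "f' \<in> carrier (A_rho T)" for f f'
    using complex_vector.subspace_add[OF subT ff] ff by (auto simp: A_rho_map_def fun_eq_iff)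
  show "A_rho_map K T \<theta> (c *\<^sub>C f) = c *\<^sub>C A_rho_map K T \<theta> f" if f: "f \<in> carrier (A_rho T)" for c f
  proof (intro ext)
    fix n m v i j
    have "c *\<^sub>C f \<in> carrier (A_rho T)" by (rule complex_vector.subspace_scale[OF subT f])
    then have "A_rho_map K T \<theta> (c *\<^sub>C f) n m v i j = (if v \<in> K n m then (c *\<^sub>C f) n m (\<theta> n m v) i j else 0)"
      by (simp add: A_rho_map_def)
    then show "A_rho_map K T \<theta> (c *\<^sub>C f) n m v i j = (c *\<^sub>C A_rho_map K T \<theta> f) n m v i j"
      using f by (simp add: A_rho_map_def scaleC_fun_def)
  qed
  show "mnorm (A_rho K) p q (\<lambda>i j. A_rho_map K T \<theta> (F i j)) \<le> mnorm (A_rho T) p q F"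
    if pq: "0 < p" "0 < q" and F: "F \<in> mats p q (carrier (A_rho T))" for p q F
  proof (rule A_rho_norm_le[OF K pq])
    fix v assume v: "v \<in> K p q"
    have "opnorm (p * p) (q * q) (flatten p q (\<lambda>a b. A_rho_map K T \<theta> (F a b) p q v)) =
        opnorm (p * p) (q * q) (flatten p q (\<lambda>a b. F a b p q (\<theta> p q v)))"
      using F v by (intro opnorm_flatten_cong) (simp add: A_rho_map_def mats_def)
    also have "\<dots> \<le> mnorm (A_rho T) p q F"
      by (rule A_rho_norm_upper[OF T F rm_homD(1)[OF th v]])
    finally show "opnorm (p * p) (q * q) (flatten p q (\<lambda>a b. A_rho_map K T \<theta> (F a b) p q v)) \<le> mnorm (A_rho T) p q F" .
  qed
qed

lemma A_rho_map_id:
  fixes K :: "'k::complex_lctvs matrix_family"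
  assumes K: "compact_rmconvex K"
  shows "A_rho_map K K (rm_id K) = op_id (A_rho K)"
proof (intro ext)
  fix f n m v i j
  show "A_rho_map K K (rm_id K) f n m v i j = op_id (A_rho K) f n m v i j"
  proof (cases "f \<in> carrier (A_rho K)")
    case True
    then obtain g where "f = lift K g" by (rule A_rho_carrierE[OF K])
    then show ?thesis using True by (simp add: A_rho_map_def op_id_def rm_id_def lift_def)
  qed (simp add: A_rho_map_def op_id_def)
qed

lemma A_rho_map_comp:
  fixes K :: "'k::complex_lctvs matrix_family" and T :: "'t::complex_lctvs matrix_family"
    and S :: "'s::complex_lctvs matrix_family"
  assumes K: "compact_rmconvex K" and T: "compact_rmconvex T" and S: "compact_rmconvex S"
    and th: "\<theta> \<in> rm_hom K T" and eta: "\<eta> \<in> rm_hom T S"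
  shows "A_rho_map K S (rm_comp \<eta> \<theta>) = A_rho_map K T \<theta> \<circ> A_rho_map T S \<eta>"
proof (intro ext)
  fix f n m v i j
  have 0: "0 \<in> carrier (A_rho T)" by (rule zero_in_A_rho[OF T])
  show "A_rho_map K S (rm_comp \<eta> \<theta>) f n m v i j = (A_rho_map K T \<theta> \<circ> A_rho_map T S \<eta>) f n m v i j"
  proof (cases "f \<in> carrier (A_rho S)")
    case True
    then have "A_rho_map T S \<eta> f \<in> carrier (A_rho T)" by (rule A_rho_map_lift[OF T S eta])
    then have "(A_rho_map K T \<theta> \<circ> A_rho_map T S \<eta>) f n m v i j =
        (if v \<in> K n m then A_rho_map T S \<eta> f n m (\<theta> n m v) i j else 0)"
      by (simp add: A_rho_map_def[of K T])
    then show ?thesis using True rm_homD(1)[OF th, of v n m] by (simp add: A_rho_map_def rm_comp_def)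
  next
    case False
    then show ?thesis using 0 by (simp add: A_rho_map_def)
  qed
qed

section \<open>Naturality of the evaluations\<close>

lemma point_eval_natural:
  fixes K :: "'k::complex_lctvs matrix_family" and T :: "'t::complex_lctvs matrix_family"
  assumes K: "compact_rmconvex K" and T: "compact_rmconvex T" and th: "\<theta> \<in> rm_hom K T"
  shows "rm_comp (CBall_map (A_rho K) (A_rho_map K T \<theta>)) (point_eval K) = rm_comp (point_eval T) \<theta>"
proof (intro ext)
  fix n m v i j f
  show "rm_comp (CBall_map (A_rho K) (A_rho_map K T \<theta>)) (point_eval K) n m v i j f = rm_comp (point_eval T) \<theta> n m v i j f"
  proof (cases "v \<in> K n m")
    case True
    have pe: "point_eval K n m v \<in> CBall (A_rho K) n m" by (rule point_eval_in_CBall[OF K True])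
    have thv: "\<theta> n m v \<in> T n m" by (rule rm_homD(1)[OF th True])
    have "rm_comp (CBall_map (A_rho K) (A_rho_map K T \<theta>)) (point_eval K) n m v i j f =
        point_eval K n m v i j (A_rho_map K T \<theta> f)"
      using pe by (simp add: rm_comp_def CBall_map_def)
    also have "\<dots> = (if f \<in> carrier (A_rho T) then f n m (\<theta> n m v) i j else 0)"
    proof (cases "f \<in> carrier (A_rho T)")
      case f: True
      then show ?thesis
        using True A_rho_map_lift[OF K T th f] by (simp add: point_eval_def A_rho_map_def[of K T \<theta> f])
    next
      case False
      then show ?thesis using True by (simp add: point_eval_def A_rho_map_def)
    qed
    finally show ?thesis using thv by (simp add: rm_comp_def point_eval_def)
  next
    case False
    \<comment> \<open>For \<open>v\<close> outside \<open>K\<close> the map \<theta> takes the value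
      0, which may be a point of \<open>T\<close>; the evaluation there vanishes because elements of
      \<open>A_rho T\<close> are linear.\<close>
    have "point_eval T n m 0 i j f = 0"
    proof (cases "0 \<in> T n m \<and> f \<in> carrier (A_rho T)")
      case True
      then obtain g where g: "cfun T g" "f = lift T g" using A_rho_carrierE[OF T] by blast
      have "g 0 = 0"
        using linear_onD(3)[OF _ Esp_zero[OF compact_rmconvexD(1)[OF T]], of g] g(1) by (simp add: cfun_def)
      then show ?thesis using True by (simp add: point_eval_def g(2) lift_def)
    qed (auto simp: point_eval_def)
    then have "rm_comp (point_eval T) \<theta> n m v i j f = 0" using rm_homD(2)[OF th False] by (simp add: rm_comp_def)
    moreover have "rm_comp (CBall_map (A_rho K) (A_rho_map K T \<theta>)) (point_eval K) n m v i j f = 0"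
      using False by (simp add: rm_comp_def point_eval_def CBall_map_def)
    ultimately show ?thesis by simp
  qed
qed

lemma functional_eval_natural:
  fixes X :: "'x::complex_vector opspace" and Y :: "'y::complex_vector opspace"
  assumes X: "operator_space X" and Y: "operator_space Y" and phi: "\<phi> \<in> op_hom X Y"
  shows "A_rho_map (CBall Y) (CBall X) (CBall_map Y \<phi>) \<circ> functional_eval X = functional_eval Y \<circ> \<phi>"
proof (intro ext)
  fix x n m \<psi> i j
  note f = op_homD[OF phi]
  show "(A_rho_map (CBall Y) (CBall X) (CBall_map Y \<phi>) \<circ> functional_eval X) x n m \<psi> i j = (functional_eval Y \<circ> \<phi>) x n m \<psi> i j"
  proof (cases "x \<in> carrier X")
    case True
    then show ?thesis
      using functional_eval_carrier[OF X True] f(2)[OF True] CBall_map_mem[OF X Y phi, of \<psi> n m]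
      by (simp add: A_rho_map_def functional_eval_entry[OF X True] CBall_map_def functional_eval_def[of Y])
  next
    case False
    have "functional_eval Y 0 = 0"
      by (rule linear_onD(3)[OF functional_eval_linear[OF Y] complex_vector.subspace_0[OF carrier_subspace[OF Y]]])
    then show ?thesis
      using False f(1)[OF False] by (simp add: functional_eval_def[of X] A_rho_map_def)
  qed
qed

text \<open>Faithful: by naturality \<open>CBall_map Y \<phi>\<close> determines \<phi> after
  \<open>functional_eval Y\<close>, which is injective. Full: \<open>A_rho_map\<close> of \<theta>,
  transported along the evaluation isomorphisms, is a preimage.\<close>

lemma CBall_map_bij:
  fixes X :: "'x::complex_vector opspace" and Y :: "'y::complex_vector opspace"
  assumes X: "operator_space X" and Y: "operator_space Y"
  shows "bij_betw (CBall_map Y) (op_hom X Y) (rm_hom (CBall Y) (CBall X))"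
  unfolding bij_betw_def
proof (intro conjI inj_onI subset_antisym subsetI)
  fix \<phi> \<phi>' assume phi: "\<phi> \<in> op_hom X Y" "\<phi>' \<in> op_hom X Y" and eq: "CBall_map Y \<phi> = CBall_map Y \<phi>'"
  show "\<phi> = \<phi>'"
  proof
    fix x
    show "\<phi> x = \<phi>' x"
    proof (cases "x \<in> carrier X")
      case True
      have "functional_eval Y (\<phi> x) = functional_eval Y (\<phi>' x)"
        using functional_eval_natural[OF X Y phi(1)] functional_eval_natural[OF X Y phi(2)] eq
        by (metis o_apply)
      then show ?thesis
        using inj_onD[OF functional_eval_inj[OF Y]] op_homD(2)[OF phi(1) True] op_homD(2)[OF phi(2) True] by blast
    qed (use op_homD(1)[OF phi(1)] op_homD(1)[OF phi(2)] in simp)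
  qed
next
  fix \<theta> assume "\<theta> \<in> CBall_map Y ` op_hom X Y"
  then show "\<theta> \<in> rm_hom (CBall Y) (CBall X)" using CBall_map_hom[OF X Y] by blast
next
  fix \<theta> assume th: "\<theta> \<in> rm_hom (CBall Y) (CBall X)"
  note cX = compact_rmconvex_CBall[OF X] and cY = compact_rmconvex_CBall[OF Y]
  note oX = operator_space_A_rho[OF cX] and oY = operator_space_A_rho[OF cY]
  define A where "A = A_rho_map (CBall Y) (CBall X) \<theta>"
  define J where "J = op_inverse Y (A_rho (CBall Y)) (functional_eval Y)"
  note inv = op_inverse[OF Y oY functional_eval_iso[OF Y], folded J_def]
  have A: "A \<in> op_hom (A_rho (CBall X)) (A_rho (CBall Y))"
    unfolding A_def by (rule A_rho_map_hom[OF cY cX th])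
  have phi: "J \<circ> (A \<circ> functional_eval X) \<in> op_hom X Y"
    by (intro op_hom_comp[OF X _ inv(1) oY] op_hom_comp[OF X functional_eval_hom[OF X] A oX])
  have "CBall_map Y (J \<circ> (A \<circ> functional_eval X)) = \<theta>"
  proof (intro ext)
    fix n m \<psi> i j x
    show "CBall_map Y (J \<circ> (A \<circ> functional_eval X)) n m \<psi> i j x = \<theta> n m \<psi> i j x"
    proof (cases "\<psi> \<in> CBall Y n m")
      case psi: True
      have th': "\<theta> n m \<psi> \<in> CBall X n m" by (rule rm_homD(1)[OF th psi])
      show ?thesis
      proof (cases "x \<in> carrier X")
        case True
        let ?y = "J (A (functional_eval X x))"
        have fx: "functional_eval X x \<in> carrier (A_rho (CBall X))" by (rule functional_eval_carrier[OF X True])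
        have "A (functional_eval X x) \<in> carrier (A_rho (CBall Y))" by (rule op_homD(2)[OF A fx])
        then have yc: "?y \<in> carrier Y" and ye: "functional_eval Y ?y = A (functional_eval X x)"
          using op_homD(2)[OF inv(1)] inv(3) by blast+
        have "\<psi> i j ?y = functional_eval Y ?y n m \<psi> i j" by (simp only: functional_eval_entry[OF Y yc psi])
        also have "\<dots> = functional_eval X x n m (\<theta> n m \<psi>) i j"
          unfolding ye using fx psi by (simp add: A_def A_rho_map_def)
        also have "\<dots> = \<theta> n m \<psi> i j x" by (simp only: functional_eval_entry[OF X True th'])
        finally show ?thesis using psi by (simp add: CBall_map_def)
      next
        case False
        have "\<psi> i j 0 = 0"
          by (rule linear_onD(3)[OF CBall_D(3)[OF Y psi] complex_vector.subspace_0[OF carrier_subspace[OF Y]]])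
        then show ?thesis
          using psi op_homD(1)[OF phi False] CBall_D(4)[OF X th', of x i j] False by (simp add: CBall_map_def)
      qed
    qed (use rm_homD(2)[OF th] in \<open>simp add: CBall_map_def\<close>)
  qed
  then show "\<theta> \<in> CBall_map Y ` op_hom X Y" using phi by (metis imageI)
qed

text \<open>Maps are extended by 0, so a composite evaluated outside its domain passes through the
  value of the second map at 0.\<close>

lemma rm_hom_zero:
  assumes K: "compact_rmconvex K" and T: "rmconvex T" and th: "\<theta> \<in> rm_hom K T"
  shows "\<theta> n m 0 = 0"
proof -
  obtain h where h: "linear_on (Esp K) h" "\<theta> = lift K h" using rm_hom_rep[OF K T th] by blast
  have "h 0 = 0" by (rule linear_onD(3)[OF h(1) Esp_zero[OF compact_rmconvexD(1)[OF K]]])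
  then show ?thesis by (simp add: h(2) lift_def fun_eq_iff)
qed

section \<open>Isomorphisms and their inverses in the two categories\<close>

lemma rm_homeo_imp_hom: "rm_homeo K T \<theta> \<Longrightarrow> \<theta> \<in> rm_hom K T"
  unfolding rm_homeo_def rm_hom_def by (blast dest: homeomorphism_cont1)

text \<open>The levelwise inverses are affine, since \<theta> maps the combination of the preimages
  to the given combination and is injective on \<open>K\<close>.\<close>

lemma rm_homeo_inverse:
  fixes K :: "'k::complex_lctvs matrix_family" and T :: "'t::complex_lctvs matrix_family"
  assumes K: "compact_rmconvex K" and T: "compact_rmconvex T" and homeo: "rm_homeo K T \<theta>"
  shows "\<exists>\<eta>\<in>rm_hom T K. rm_comp \<eta> \<theta> = rm_id K \<and> rm_comp \<theta> \<eta> = rm_id T"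
proof -
  note rK = compact_rmconvexD(1)[OF K] and rT = compact_rmconvexD(1)[OF T]
  note th = rm_homeo_imp_hom[OF homeo]
  have aff: "rm_affine K T \<theta>" using homeo by (simp add: rm_homeo_def)
  define g where "g n m = (SOME g. homeomorphism (K n m) (T n m) (\<theta> n m) g)" for n m
  have hom: "homeomorphism (K n m) (T n m) (\<theta> n m) (g n m)" for n m
  proof -
    have "\<exists>g. homeomorphism (K n m) (T n m) (\<theta> n m) g" using homeo by (simp add: rm_homeo_def)
    then show ?thesis unfolding g_def by (rule someI_ex)
  qed
  have g1: "g n m (\<theta> n m v) = v" if "v \<in> K n m" for n m v by (rule homeomorphism_apply1[OF hom that])
  have g2: "\<theta> n m (g n m w) = w" if "w \<in> T n m" for n m w by (rule homeomorphism_apply2[OF hom that])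
  have gK: "g n m w \<in> K n m" if "w \<in> T n m" for n m w using homeomorphism_image2[OF hom] that by blast
  have thT: "\<theta> n m v \<in> T n m" if "v \<in> K n m" for n m v by (rule rm_affineD(2)[OF aff that])
  define \<eta> where "\<eta> = (\<lambda>n m w. if w \<in> T n m then g n m w else 0)"
  have "rm_affine T K \<eta>"
    unfolding rm_affine_def
  proof (intro conjI allI impI ballI)
    show "\<eta> n m w = 0" if "w \<notin> T n m" for n m w using that by (simp add: \<eta>_def)
    show "\<eta> n m w \<in> K n m" if "w \<in> T n m" for n m w using that gK by (simp add: \<eta>_def)
    fix l n m N M \<alpha> \<beta> w
    assume A: "0 < (l::nat) \<and> 0 < n \<and> 0 < m \<and>
      (\<forall>i<l. \<alpha> i \<in> cmats (N i) n \<and> \<beta> i \<in> cmats (M i) m \<and> w i \<in> T (N i) (M i)) \<and>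
      (\<Sum>i<l. gram (N i) (\<alpha> i)) = id_mat n \<and> (\<Sum>i<l. gram (M i) (\<beta> i)) = id_mat m"
    define v where "v i = \<eta> (N i) (M i) (w i)" for i
    have v: "v i \<in> K (N i) (M i)" "\<theta> (N i) (M i) (v i) = w i" if "i < l" for i
      using A that gK g2 by (auto simp: v_def \<eta>_def)
    let ?s = "\<Sum>i<l. sandwich (N i) (M i) (adj (\<alpha> i)) (v i) (\<beta> i)"
    have mem: "\<alpha> i \<in> cmats (N i) n \<and> \<beta> i \<in> cmats (M i) m \<and> v i \<in> K (N i) (M i)" if "i < l" for i
      using A v(1) that by blast
    have sK: "?s \<in> K n m"
    proof (rule rmconvexD(3)[OF rK])
      show "opnorm n n (\<Sum>i<l. gram (N i) (\<alpha> i)) * opnorm m m (\<Sum>i<l. gram (M i) (\<beta> i)) \<le> 1"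
        using A mult_mono[OF opnorm_id_mat[of n] opnorm_id_mat[of m]] by simp
    qed (use A mem in blast)+
    have "\<theta> n m ?s = (\<Sum>i<l. sandwich (N i) (M i) (adj (\<alpha> i)) (\<theta> (N i) (M i) (v i)) (\<beta> i))"
      by (rule rm_affine_comb[OF aff _ _ _ mem]) (use A in blast)+
    also have "\<dots> = (\<Sum>i<l. sandwich (N i) (M i) (adj (\<alpha> i)) (w i) (\<beta> i))"
      by (intro sum.cong refl) (simp add: v(2))
    finally have eq: "\<theta> n m ?s = (\<Sum>i<l. sandwich (N i) (M i) (adj (\<alpha> i)) (w i) (\<beta> i))" .
    have "\<eta> n m (\<theta> n m ?s) = ?s" using thT[OF sK] g1[OF sK] by (simp add: \<eta>_def)
    then show "\<eta> n m (\<Sum>i<l. sandwich (N i) (M i) (adj (\<alpha> i)) (w i) (\<beta> i)) =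
        (\<Sum>i<l. sandwich (N i) (M i) (adj (\<alpha> i)) (\<eta> (N i) (M i) (w i)) (\<beta> i))"
      unfolding eq unfolding v_def .
  qed
  moreover have "continuous_on (T n m) (\<eta> n m)" for n m
    by (rule continuous_on_eq[OF homeomorphism_cont2[OF hom]]) (simp add: \<eta>_def)
  ultimately have eta: "\<eta> \<in> rm_hom T K" by (simp add: rm_hom_def)
  have "rm_comp \<eta> \<theta> n m v = rm_id K n m v" for n m v
  proof (cases "v \<in> K n m")
    case True
    then show ?thesis using thT[OF True] g1[OF True] by (simp add: rm_comp_def rm_id_def \<eta>_def)
  next
    case False
    then show ?thesis
      using rm_affineD(1)[OF aff False] rm_hom_zero[OF T rK eta, of n m] by (simp add: rm_comp_def rm_id_def)
  qed
  moreover have "rm_comp \<theta> \<eta> n m w = rm_id T n m w" for n m w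
    using g2[of w n m] rm_hom_zero[OF K rT th, of n m]
    by (cases "w \<in> T n m") (simp_all add: rm_comp_def rm_id_def \<eta>_def)
  ultimately show ?thesis using eta by (intro bexI[of _ \<eta>] conjI ext) simp_all
qed

lemma rm_homeo_of_inverse:
  assumes th: "\<theta> \<in> rm_hom K T" and eta: "\<eta> \<in> rm_hom T K"
    and left: "rm_comp \<eta> \<theta> = rm_id K" and right: "rm_comp \<theta> \<eta> = rm_id T"
  shows "rm_homeo K T \<theta>"
proof -
  have 1: "\<eta> n m (\<theta> n m v) = v" if "v \<in> K n m" for n m v
    using fun_cong[OF fun_cong[OF fun_cong[OF left, of n], of m], of v] that by (simp add: rm_comp_def rm_id_def)
  have 2: "\<theta> n m (\<eta> n m w) = w" if "w \<in> T n m" for n m w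
    using fun_cong[OF fun_cong[OF fun_cong[OF right, of n], of m], of w] that by (simp add: rm_comp_def rm_id_def)
  have "homeomorphism (K n m) (T n m) (\<theta> n m) (\<eta> n m)" for n m
    by (rule homeomorphismI) (use rm_homD(1,3)[OF th] rm_homD(1,3)[OF eta] 1 2 in auto)
  then show ?thesis using rm_homD(4)[OF th] unfolding rm_homeo_def by blast
qed

text \<open>Contractivity of both maps on all levels forces equality of norms.\<close>

lemma op_iso_of_inverse:
  assumes X: "operator_space X" and Y: "operator_space Y"
    and phi: "\<phi> \<in> op_hom X Y" and psi: "\<psi> \<in> op_hom Y X"
    and left: "\<psi> \<circ> \<phi> = op_id X" and right: "\<phi> \<circ> \<psi> = op_id Y"
  shows "op_iso X Y \<phi>"
proof -
  have 1: "\<psi> (\<phi> x) = x" if "x \<in> carrier X" for x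
    using fun_cong[OF left, of x] that by (simp add: op_id_def)
  have 2: "\<phi> (\<psi> y) = y" if "y \<in> carrier Y" for y
    using fun_cong[OF right, of y] that by (simp add: op_id_def)
  have "bij_betw \<phi> (carrier X) (carrier Y)"
    by (rule bij_betwI[where g=\<psi>]) (use op_homD(2)[OF phi] op_homD(2)[OF psi] 1 2 in auto)
  moreover have "mnorm Y p q (\<lambda>i j. \<phi> (x i j)) = mnorm X p q x"
    if pq: "0 < p" "0 < q" and x: "x \<in> mats p q (carrier X)" for p q x
  proof (rule antisym)
    show "mnorm Y p q (\<lambda>i j. \<phi> (x i j)) \<le> mnorm X p q x" by (rule op_homD(4)[OF phi pq x])
    have xc: "x i j \<in> carrier X" for i j
      using x complex_vector.subspace_0[OF carrier_subspace[OF X]] by (cases "i < p \<and> j < q") (auto simp: mats_def not_less)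
    from op_homD(4)[OF psi pq op_hom_mats[OF X phi x]]
    show "mnorm X p q x \<le> mnorm Y p q (\<lambda>i j. \<phi> (x i j))" by (simp add: 1[OF xc])
  qed
  ultimately show ?thesis using phi by (simp add: op_iso_def)
qed

text \<open>\<open>CBall\<close> reverses arrows, so the homeomorphism comes from the inverse of
  \<phi>. Conversely, fullness provides preimages of \<theta> and of its inverse, and faithfulness
  makes them mutually inverse.\<close>

lemma op_iso_iff_rm_homeo:
  fixes X :: "'x::complex_vector opspace" and Y :: "'y::complex_vector opspace"
  assumes X: "operator_space X" and Y: "operator_space Y"
  shows "(\<exists>\<phi>. op_iso X Y \<phi>) \<longleftrightarrow> (\<exists>\<theta>. rm_homeo (CBall X) (CBall Y) \<theta>)"
proof
  note rX = rmconvex_CBall[OF X]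
  assume "\<exists>\<phi>. op_iso X Y \<phi>"
  then obtain \<phi> where iso: "op_iso X Y \<phi>" by blast
  note inv = op_inverse[OF X Y iso]
  let ?\<psi> = "op_inverse X Y \<phi>"
  have phi: "\<phi> \<in> op_hom X Y" using iso by (simp add: op_iso_def)
  have psi0: "?\<psi> 0 = 0" and phi0: "\<phi> 0 = 0"
    using linear_onD(3)[OF op_homD(3)[OF inv(1)] complex_vector.subspace_0[OF carrier_subspace[OF Y]]]
      linear_onD(3)[OF op_homD(3)[OF phi] complex_vector.subspace_0[OF carrier_subspace[OF X]]] by simp_all
  have "?\<psi> \<circ> \<phi> = op_id X"
    using inv(2) op_homD(1)[OF phi] psi0 by (auto simp: op_id_def fun_eq_iff)
  then have l: "rm_comp (CBall_map Y \<phi>) (CBall_map X ?\<psi>) = rm_id (CBall X)"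
    using CBall_map_comp[OF X Y X phi inv(1)] CBall_map_id[OF X] by simp
  have "\<phi> \<circ> ?\<psi> = op_id Y"
    using inv(3) op_homD(1)[OF inv(1)] phi0 by (auto simp: op_id_def fun_eq_iff)
  then have r: "rm_comp (CBall_map X ?\<psi>) (CBall_map Y \<phi>) = rm_id (CBall Y)"
    using CBall_map_comp[OF Y X Y inv(1) phi] CBall_map_id[OF Y] by simp
  show "\<exists>\<theta>. rm_homeo (CBall X) (CBall Y) \<theta>"
    using rm_homeo_of_inverse[OF CBall_map_hom[OF Y X inv(1)] CBall_map_hom[OF X Y phi] l r] by blast
next
  note cX = compact_rmconvex_CBall[OF X] and cY = compact_rmconvex_CBall[OF Y]
  assume "\<exists>\<theta>. rm_homeo (CBall X) (CBall Y) \<theta>"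
  then obtain \<theta> where homeo: "rm_homeo (CBall X) (CBall Y) \<theta>" by blast
  obtain \<eta> where eta: "\<eta> \<in> rm_hom (CBall Y) (CBall X)"
      and comp: "rm_comp \<eta> \<theta> = rm_id (CBall X)" "rm_comp \<theta> \<eta> = rm_id (CBall Y)"
    using rm_homeo_inverse[OF cX cY homeo] by blast
  obtain \<psi> where psi: "\<psi> \<in> op_hom Y X" "\<theta> = CBall_map X \<psi>"
    using CBall_map_bij[OF Y X] rm_homeo_imp_hom[OF homeo] unfolding bij_betw_def by blast
  obtain \<phi> where phi: "\<phi> \<in> op_hom X Y" "\<eta> = CBall_map Y \<phi>"
    using CBall_map_bij[OF X Y] eta unfolding bij_betw_def by blast
  have "CBall_map X (\<psi> \<circ> \<phi>) = CBall_map X (op_id X)"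
    using CBall_map_comp[OF X Y X phi(1) psi(1)] comp(1) CBall_map_id[OF X] phi(2) psi(2) by simp
  then have l: "\<psi> \<circ> \<phi> = op_id X"
    by (rule inj_onD[OF bij_betw_imp_inj_on[OF CBall_map_bij[OF X X]] _ op_hom_comp[OF X phi(1) psi(1) Y] op_id_hom[OF X]])
  have "CBall_map Y (\<phi> \<circ> \<psi>) = CBall_map Y (op_id Y)"
    using CBall_map_comp[OF Y X Y psi(1) phi(1)] comp(2) CBall_map_id[OF Y] phi(2) psi(2) by simp
  then have r: "\<phi> \<circ> \<psi> = op_id Y"
    by (rule inj_onD[OF bij_betw_imp_inj_on[OF CBall_map_bij[OF Y Y]] _ op_hom_comp[OF Y psi(1) phi(1) X] op_id_hom[OF Y]])
  show "\<exists>\<phi>. op_iso X Y \<phi>" using op_iso_of_inverse[OF X Y phi(1) psi(1) l r] by blast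
qed

theorem mainTheorem4:
  fixes K :: "'k::complex_lctvs matrix_family"
    and T :: "'t::complex_lctvs matrix_family"
    and S :: "'s::complex_lctvs matrix_family"
    and X :: "'x::complex_vector opspace"
    and Y :: "'y::complex_vector opspace"
    and Z :: "'z::complex_vector opspace"
  assumes K: "compact_rmconvex K" and T: "compact_rmconvex T" and S: "compact_rmconvex S"
    and X: "operator_space X" and Y: "operator_space Y" and Z: "operator_space Z"
  shows
    \<comment> \<open>(a)\<close>
    "(operator_space (A_rho K) \<and> compact_rmconvex (CBall (A_rho K)) \<and>
      rm_homeo K (CBall (A_rho K)) (point_eval K))
    \<and>
    \<comment> \<open>(b), one-to-one correspondence up to isomorphism\<close>
    (compact_rmconvex (CBall X) \<and>
      ((\<exists>\<phi>. op_iso X Y \<phi>) \<longleftrightarrow> (\<exists>\<theta>. rm_homeo (CBall X) (CBall Y) \<theta>)) \<and>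
      (\<exists>W :: ('k, complex) family_map opspace.
         operator_space W \<and> (\<exists>\<theta>. rm_homeo K (CBall W) \<theta>)))
    \<and>
    \<comment> \<open>(b), equivalence of categories: \<open>CBall\<close> is a contravariant functor, which is fully faithful\<close>
    ((\<forall>\<phi>\<in>op_hom X Y. CBall_map Y \<phi> \<in> rm_hom (CBall Y) (CBall X)) \<and>
      CBall_map X (op_id X) = rm_id (CBall X) \<and>
      (\<forall>\<phi>\<in>op_hom X Y. \<forall>\<psi>\<in>op_hom Y Z.
         CBall_map Z (\<psi> \<circ> \<phi>) = rm_comp (CBall_map Y \<phi>) (CBall_map Z \<psi>)) \<and>
      bij_betw (CBall_map Y) (op_hom X Y) (rm_hom (CBall Y) (CBall X)))
    \<and>
    \<comment> \<open>\<open>A\<^sub>\<rho>\<close> is a contravariant functor in the opposite direction\<close>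
    ((\<forall>\<theta>\<in>rm_hom K T. A_rho_map K T \<theta> \<in> op_hom (A_rho T) (A_rho K)) \<and>
      A_rho_map K K (rm_id K) = op_id (A_rho K) \<and>
      (\<forall>\<theta>\<in>rm_hom K T. \<forall>\<eta>\<in>rm_hom T S.
         A_rho_map K S (rm_comp \<eta> \<theta>) = A_rho_map K T \<theta> \<circ> A_rho_map T S \<eta>))
    \<and>
    \<comment> \<open>evaluations are natural isomorphisms from the identity functors to both composites\<close>
    (rm_homeo K (CBall (A_rho K)) (point_eval K) \<and>
      (\<forall>\<theta>\<in>rm_hom K T.
         rm_comp (CBall_map (A_rho K) (A_rho_map K T \<theta>)) (point_eval K) =
           rm_comp (point_eval T) \<theta>) \<and>
      op_iso X (A_rho (CBall X)) (functional_eval X) \<and>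
      (\<forall>\<phi>\<in>op_hom X Y.
         A_rho_map (CBall Y) (CBall X) (CBall_map Y \<phi>) \<circ> functional_eval X =
           functional_eval Y \<circ> \<phi>))"
proof (intro conjI ballI)
  note cX = compact_rmconvex_CBall[OF X] and oK = operator_space_A_rho[OF K]
  show oK': "operator_space (A_rho K)" by (rule oK)
  show "compact_rmconvex (CBall (A_rho K))" by (rule compact_rmconvex_CBall[OF oK])
  show homeo: "rm_homeo K (CBall (A_rho K)) (point_eval K)" by (rule point_eval_homeo[OF K])
  show "rm_homeo K (CBall (A_rho K)) (point_eval K)" by (rule homeo)
  show "compact_rmconvex (CBall X)" by (rule cX)
  show "(\<exists>\<phi>. op_iso X Y \<phi>) \<longleftrightarrow> (\<exists>\<theta>. rm_homeo (CBall X) (CBall Y) \<theta>)"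
    by (rule op_iso_iff_rm_homeo[OF X Y])
  show "\<exists>W :: ('k, complex) family_map opspace. operator_space W \<and> (\<exists>\<theta>. rm_homeo K (CBall W) \<theta>)"
    using oK homeo by blast
  show "CBall_map Y \<phi> \<in> rm_hom (CBall Y) (CBall X)" if "\<phi> \<in> op_hom X Y" for \<phi>
    by (rule CBall_map_hom[OF X Y that])
  show "CBall_map X (op_id X) = rm_id (CBall X)" by (rule CBall_map_id[OF X])
  show "CBall_map Z (\<psi> \<circ> \<phi>) = rm_comp (CBall_map Y \<phi>) (CBall_map Z \<psi>)"
    if "\<phi> \<in> op_hom X Y" "\<psi> \<in> op_hom Y Z" for \<phi> \<psi>
    by (rule CBall_map_comp[OF X Y Z that])
  show "bij_betw (CBall_map Y) (op_hom X Y) (rm_hom (CBall Y) (CBall X))"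
    by (rule CBall_map_bij[OF X Y])
  show "A_rho_map K T \<theta> \<in> op_hom (A_rho T) (A_rho K)" if "\<theta> \<in> rm_hom K T" for \<theta>
    by (rule A_rho_map_hom[OF K T that])
  show "A_rho_map K K (rm_id K) = op_id (A_rho K)" by (rule A_rho_map_id[OF K])
  show "A_rho_map K S (rm_comp \<eta> \<theta>) = A_rho_map K T \<theta> \<circ> A_rho_map T S \<eta>"
    if "\<theta> \<in> rm_hom K T" "\<eta> \<in> rm_hom T S" for \<theta> \<eta>
    by (rule A_rho_map_comp[OF K T S that])
  show "rm_comp (CBall_map (A_rho K) (A_rho_map K T \<theta>)) (point_eval K) = rm_comp (point_eval T) \<theta>"
    if "\<theta> \<in> rm_hom K T" for \<theta>
    by (rule point_eval_natural[OF K T that])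
  show "op_iso X (A_rho (CBall X)) (functional_eval X)" by (rule functional_eval_iso[OF X])
  show "A_rho_map (CBall Y) (CBall X) (CBall_map Y \<phi>) \<circ> functional_eval X = functional_eval Y \<circ> \<phi>"
    if "\<phi> \<in> op_hom X Y" for \<phi>
    by (rule functional_eval_natural[OF X Y that])
qed

end
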